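(* For any class $\mathscr{C}$ of graphs of bounded clique-width, the problem $\mathrm{MC}(\mathrm{MSO}_1[{<}\text{-inv}],\mathscr{C})$ is fixed-parameter tractable.
   Context: $\mathrm{MSO}_1$ is monadic second-order logic on graphs (signature $\{E\}$) with quantification over vertices and sets of vertices only. Clique-width: for $k\in\mathbb{N}$, $k$-coloured graphs are built using the operations: create a single vertex with colour $i\in\{1,\dots,k\}$; disjoint union; for colours $i,j$, add all edges between vertices of colour $i$ and vertices of colour $j$; for colours $i,j$, recolour all vertices of colour $i$ to colour $j$. The clique-width of a graph $G$ is the least $k$ such that $G$ (with colours forgotten) can be built by such an expression using $k$ colours. A formula $\phi$ over $\{E,<\}$ is order-invariant if for every graph $G$ and all linear orders $<_1,<_2$ of $V(G)$, $(G,<_1)\models\phi$ iff $(G,<_2)\models\phi$; write $G\models_{\mathrm{ord\text{-}inv}}\phi$ if $(G,<)\models\phi$ for some (equivalently every) linear order $<$. The parameterised problem $\mathrm{MC}(\mathrm{MSO}_1[{<}\text{-inv}],\mathscr{C})$ has as input $G\in\mathscr{C}$ and an order-invariant $\mathrm{MSO}_1$ sentence $\phi$ over $\{E,<\}$, parameter $|\phi|$, and asks whether $G\models_{\mathrm{ord\text{-}inv}}\phi$. Fixed-parameter tractable means decidable in time $f(|\phi|)\cdot\|G\|^{O(1)}$ for some function $f$. *)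

theory Defs
  imports "Graph_Theory.Pair_Digraph" "HOL-Library.Extended_Nat"
begin

text \<open>
  Graphs are finite, simple and undirected: the locale \<^locale>\<open>pair_graph\<close>, in which an undirected
  edge is a pair of opposite arcs. The binary relation \<open>E\<close> of the signature is \<^const>\<open>parcs\<close>.
\<close>

section \<open>Clique-width\<close>

text \<open>
  \<open>cw_built k G c\<close>: some expression with colours from \<open>{1..k}\<close> builds the graph \<open>G\<close> with colouring
  \<open>c\<close>, a map whose domain is the vertex set. As usual, edges are only added between two different
  colours (otherwise loops would arise).
\<close>

inductive cw_built :: "nat \<Rightarrow> 'v pair_pre_digraph \<Rightarrow> ('v \<rightharpoonup> nat) \<Rightarrow> bool" for k :: nat where
  vertex: "i \<in> {1..k} \<Longrightarrow> cw_built k \<lparr>pverts = {v}, parcs = {}\<rparr> [v \<mapsto> i]"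
| disjoint_union:
    "\<lbrakk>cw_built k G c; cw_built k H d; pverts G \<inter> pverts H = {}\<rbrakk>
     \<Longrightarrow> cw_built k \<lparr>pverts = pverts G \<union> pverts H, parcs = parcs G \<union> parcs H\<rparr> (c ++ d)"
| add_edges:
    "\<lbrakk>cw_built k G c; i \<in> {1..k}; j \<in> {1..k}; i \<noteq> j\<rbrakk>
     \<Longrightarrow> cw_built k
          \<lparr>pverts = pverts G,
           parcs = parcs G \<union> {(u, v). c u = Some i \<and> c v = Some j \<or> c u = Some j \<and> c v = Some i}\<rparr> c"
| recolour:
    "\<lbrakk>cw_built k G c; i \<in> {1..k}; j \<in> {1..k}\<rbrakk>
     \<Longrightarrow> cw_built k G (\<lambda>v. map_option (\<lambda>a. if a = i then j else a) (c v))"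

text \<open>
  The infimum over an empty set is \<open>\<infinity>\<close>. Every nonempty graph has finite clique-width; the empty
  graph is built by no expression, so it has clique-width \<open>\<infinity>\<close> (structures are nonempty).
\<close>

definition clique_width :: "'v pair_pre_digraph \<Rightarrow> enat" where
  "clique_width G = Inf {enat k | k. \<exists>c. cw_built k G c}"

definition bounded_clique_width :: "'v pair_pre_digraph set \<Rightarrow> bool" where
  "bounded_clique_width C \<longleftrightarrow> (\<exists>k::nat. \<forall>G\<in>C. clique_width G \<le> enat k)"


section \<open>Monadic second-order logic over the signature \<open>{E, <}\<close>\<close>

text \<open>Vertex variables and set variables are both named by numbers, in separate name spaces.\<close>

datatype mso =
    Edge nat nat
  | Less nat nat
  | Equal nat nat
  | Member nat nat
  | Neg mso
  | Conj mso mso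
  | Disj mso mso
  | ExV nat mso
  | AllV nat mso
  | ExS nat mso
  | AllS nat mso

primrec free_vvars :: "mso \<Rightarrow> nat set" where
  "free_vvars (Edge x y) = {x, y}"
| "free_vvars (Less x y) = {x, y}"
| "free_vvars (Equal x y) = {x, y}"
| "free_vvars (Member x X) = {x}"
| "free_vvars (Neg p) = free_vvars p"
| "free_vvars (Conj p q) = free_vvars p \<union> free_vvars q"
| "free_vvars (Disj p q) = free_vvars p \<union> free_vvars q"
| "free_vvars (ExV x p) = free_vvars p - {x}"
| "free_vvars (AllV x p) = free_vvars p - {x}"
| "free_vvars (ExS X p) = free_vvars p"
| "free_vvars (AllS X p) = free_vvars p"

primrec free_svars :: "mso \<Rightarrow> nat set" where
  "free_svars (Edge x y) = {}"
| "free_svars (Less x y) = {}"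
| "free_svars (Equal x y) = {}"
| "free_svars (Member x X) = {X}"
| "free_svars (Neg p) = free_svars p"
| "free_svars (Conj p q) = free_svars p \<union> free_svars q"
| "free_svars (Disj p q) = free_svars p \<union> free_svars q"
| "free_svars (ExV x p) = free_svars p"
| "free_svars (AllV x p) = free_svars p"
| "free_svars (ExS X p) = free_svars p - {X}"
| "free_svars (AllS X p) = free_svars p - {X}"

definition sentence :: "mso \<Rightarrow> bool" where
  "sentence p \<longleftrightarrow> free_vvars p = {} \<and> free_svars p = {}"

primrec sat :: "'v pair_pre_digraph \<Rightarrow> 'v rel \<Rightarrow> (nat \<Rightarrow> 'v) \<Rightarrow> (nat \<Rightarrow> 'v set) \<Rightarrow> mso \<Rightarrow> bool" where
  "sat G r a A (Edge x y) \<longleftrightarrow> (a x, a y) \<in> parcs G"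
| "sat G r a A (Less x y) \<longleftrightarrow> (a x, a y) \<in> r"
| "sat G r a A (Equal x y) \<longleftrightarrow> a x = a y"
| "sat G r a A (Member x X) \<longleftrightarrow> a x \<in> A X"
| "sat G r a A (Neg p) \<longleftrightarrow> \<not> sat G r a A p"
| "sat G r a A (Conj p q) \<longleftrightarrow> sat G r a A p \<and> sat G r a A q"
| "sat G r a A (Disj p q) \<longleftrightarrow> sat G r a A p \<or> sat G r a A q"
| "sat G r a A (ExV x p) \<longleftrightarrow> (\<exists>v\<in>pverts G. sat G r (a(x := v)) A p)"
| "sat G r a A (AllV x p) \<longleftrightarrow> (\<forall>v\<in>pverts G. sat G r (a(x := v)) A p)"
| "sat G r a A (ExS X p) \<longleftrightarrow> (\<exists>S. S \<subseteq> pverts G \<and> sat G r a (A(X := S)) p)"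
| "sat G r a A (AllS X p) \<longleftrightarrow> (\<forall>S. S \<subseteq> pverts G \<longrightarrow> sat G r a (A(X := S)) p)"

text \<open>Only meant for sentences, whose truth value does not depend on the assignments.\<close>

definition models :: "'v pair_pre_digraph \<Rightarrow> 'v rel \<Rightarrow> mso \<Rightarrow> bool" where
  "models G r p \<longleftrightarrow> sat G r (\<lambda>_. undefined) (\<lambda>_. {}) p"

text \<open>The library predicate \<^const>\<open>strict_linear_order_on\<close> does not confine \<open>r\<close> to the vertices.\<close>

definition linear_order_of :: "'v pair_pre_digraph \<Rightarrow> 'v rel \<Rightarrow> bool" where
  "linear_order_of G r \<longleftrightarrow> r \<subseteq> pverts G \<times> pverts G \<and> strict_linear_order_on (pverts G) r"

text \<open>Up to isomorphism, every finite graph has its vertices among the natural numbers.\<close>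

definition order_invariant :: "mso \<Rightarrow> bool" where
  "order_invariant p \<longleftrightarrow>
     (\<forall>(G :: nat pair_pre_digraph) r1 r2.
        pair_graph G \<and> linear_order_of G r1 \<and> linear_order_of G r2
        \<longrightarrow> (models G r1 p \<longleftrightarrow> models G r2 p))"

definition models_ord_inv :: "'v pair_pre_digraph \<Rightarrow> mso \<Rightarrow> bool" where
  "models_ord_inv G p \<longleftrightarrow> (\<exists>r. linear_order_of G r \<and> models G r p)"


section \<open>Random access machines\<close>

text \<open>
  The uniform-cost RAM with addition and (truncated) subtraction, which is polynomially equivalent
  to Turing machines. \<open>Read d a\<close> copies to register \<open>d\<close> the input symbol at the position held in
  register \<open>a\<close>; \<open>Load\<close> and \<open>Store\<close> are the indirect memory accesses.
\<close>

datatype instr =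
    Const nat nat
  | Add nat nat nat
  | Sub nat nat nat
  | Load nat nat
  | Store nat nat
  | Read nat nat
  | JumpZero nat nat

type_synonym config = "nat \<times> (nat \<Rightarrow> nat)"

fun exec :: "nat list \<Rightarrow> instr \<Rightarrow> config \<Rightarrow> config" where
  "exec w (Const d n) (pc, R) = (Suc pc, R(d := n))"
| "exec w (Add d a b) (pc, R) = (Suc pc, R(d := R a + R b))"
| "exec w (Sub d a b) (pc, R) = (Suc pc, R(d := R a - R b))"
| "exec w (Load d a) (pc, R) = (Suc pc, R(d := R (R a)))"
| "exec w (Store a b) (pc, R) = (Suc pc, R(R a := R b))"
| "exec w (Read d a) (pc, R) = (Suc pc, R(d := if R a < length w then w ! R a else 0))"
| "exec w (JumpZero a l) (pc, R) = (if R a = 0 then l else Suc pc, R)"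

text \<open>A machine has halted when the program counter is outside the program.\<close>

definition step :: "instr list \<Rightarrow> nat list \<Rightarrow> config \<Rightarrow> config" where
  "step P w s = (if fst s < length P then exec w (P ! fst s) s else s)"

text \<open>Register 0 initially holds the length of the input, and finally the answer.\<close>

definition config_after :: "instr list \<Rightarrow> nat list \<Rightarrow> nat \<Rightarrow> config" where
  "config_after P w t = (step P w ^^ t) (0, (\<lambda>_. 0)(0 := length w))"

definition halts_within :: "instr list \<Rightarrow> nat list \<Rightarrow> nat \<Rightarrow> bool" where
  "halts_within P w t \<longleftrightarrow> length P \<le> fst (config_after P w t)"

definition accepts_within :: "instr list \<Rightarrow> nat list \<Rightarrow> nat \<Rightarrow> bool" where
  "accepts_within P w t \<longleftrightarrow> halts_within P w t \<and> snd (config_after P w t) 0 \<noteq> 0"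


section \<open>Fixed-parameter tractability\<close>

text \<open>
  An instance may have several encodings as an input word (a graph can be presented with its
  vertices in any order); an algorithm has to be correct for each of them. Nothing is required
  on words that encode no instance.
\<close>

record 'i param_problem =
  instances :: "'i set"
  encodings :: "'i \<Rightarrow> nat list set"
  yes :: "'i \<Rightarrow> bool"
  parameter :: "'i \<Rightarrow> nat"
  input_size :: "'i \<Rightarrow> nat"

definition fpt :: "'i param_problem \<Rightarrow> bool" where
  "fpt Q \<longleftrightarrow>
     (\<exists>(P :: instr list) (f :: nat \<Rightarrow> nat) (d :: nat).
        \<forall>x \<in> instances Q. \<forall>w \<in> encodings Q x.
          let t = f (parameter Q x) * input_size Q x ^ d
          in halts_within P w t \<and> (accepts_within P w t \<longleftrightarrow> yes Q x))"


section \<open>The model-checking problem\<close>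

text \<open>
  All words are over the alphabet \<open>{0..12}\<close>: a graph is given by its number of vertices in unary
  and its adjacency matrix, row by row; a formula is given in prefix notation with variable names
  in unary.
\<close>

definition unary :: "nat \<Rightarrow> nat list" where
  "unary n = replicate n 1 @ [0]"

definition graph_word :: "'v pair_pre_digraph \<Rightarrow> 'v list \<Rightarrow> nat list" where
  "graph_word G vs =
     unary (length vs)
     @ concat (map (\<lambda>u. map (\<lambda>v. if (u, v) \<in> parcs G then 1 else 0) vs) vs)"

primrec formula_word :: "mso \<Rightarrow> nat list" where
  "formula_word (Edge x y) = 2 # unary x @ unary y"
| "formula_word (Less x y) = 3 # unary x @ unary y"
| "formula_word (Equal x y) = 4 # unary x @ unary y"
| "formula_word (Member x X) = 5 # unary x @ unary X"
| "formula_word (Neg p) = 6 # formula_word p"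
| "formula_word (Conj p q) = 7 # formula_word p @ formula_word q"
| "formula_word (Disj p q) = 8 # formula_word p @ formula_word q"
| "formula_word (ExV x p) = 9 # unary x @ formula_word p"
| "formula_word (AllV x p) = 10 # unary x @ formula_word p"
| "formula_word (ExS X p) = 11 # unary X @ formula_word p"
| "formula_word (AllS X p) = 12 # unary X @ formula_word p"

definition formula_size :: "mso \<Rightarrow> nat" where
  "formula_size p = length (formula_word p)"

text \<open>Vertices plus edges; every edge consists of two arcs.\<close>

definition graph_size :: "'v pair_pre_digraph \<Rightarrow> nat" where
  "graph_size G = card (pverts G) + card (parcs G) div 2"

definition MC_mso1_ord_inv ::
  "'v pair_pre_digraph set \<Rightarrow> ('v pair_pre_digraph \<times> mso) param_problem" where
  "MC_mso1_ord_inv C =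
     \<lparr>instances = {(G, p). G \<in> C \<and> sentence p \<and> order_invariant p},
      encodings = (\<lambda>(G, p). {graph_word G vs @ formula_word p | vs. distinct vs \<and> set vs = pverts G}),
      yes = (\<lambda>(G, p). models_ord_inv G p),
      parameter = (\<lambda>(G, p). formula_size p),
      input_size = (\<lambda>(G, p). graph_size G)\<rparr>"

end

theory Submission
  imports Defs "HOL-Library.Nat_Bijection"
begin

text \<open>
  Since the formula is order-invariant, it suffices to evaluate it for one linear order, which the
  algorithm may choose itself. It decomposes the graph without knowing an expression of width \<open>k\<close>.
  In a graph of clique-width at most \<open>k\<close>, every set \<open>B\<close> of at least two vertices whose cut rank over the
  field with two elements is at most \<open>6 k + 1\<close> splits into two nonempty sets whose cut rank is again
  at most \<open>6 k + 1\<close>. If the rank of \<open>B\<close> is smaller, remove a single vertex. Otherwise the expression has a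
  subexpression with vertex set \<open>W\<close> such that the rows of \<open>B \<inter> W\<close> have rank between \<open>2 k\<close> and \<open>4 k\<close>;
  then both \<open>B \<inter> W\<close> and \<open>B - W\<close> carry rank at least \<open>2 k\<close>, while \<open>W\<close> is joined to the rest through at
  most \<open>k\<close> classes. The set \<open>W\<close> is unknown, but the closure of a bounded number of its vertices under
  a rule that involves a bounded number of vertices outside of \<open>W\<close> can replace it. So a split
  can be found by trying all tuples of bounded length.

  Splitting down to single vertices gives a tree. The adjacency of a vertex of a set of cut rank at
  most \<open>m\<close> to the vertices outside is determined by its adjacency to \<open>m\<close> of them, so \<open>2 ^ m\<close> labels are
  enough for merging along the tree. Order the vertices such that one half of every split precedes the
  other. Then the monadic type of a set follows from the types of its halves and the description of
  the merge, and only finitely many types occur. The tables of this composition are computed from the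
  formula alone, for all possible merges, so that their cost does not depend on the graph.
\<close>

section \<open>A total loop language and its compilation\<close>

text \<open>Order invariance is what makes a decomposition usable at all: with an order imposed from
  outside, such as that of the input, \<open><\<close> between the two halves of a split could be
  arbitrarily complicated, and no bounded set of labels would describe it. Here every set of the
  tree becomes an interval of the chosen order, and \<open><\<close> between two halves carries no
  information. Cut rank takes the place of clique-width because it is submodular and because a bound
  on it can be verified by exhaustive search for boundedly many generating rows; the price, a number
  of labels exponential in the bound, is still a constant. Ranks occur as sizes of row spaces, so
  sums of ranks appear as products. Tractability asks for a single machine for all formulas, with a
  step count. Therefore the formula is data: its tables are addressed by positions in the formula
  word. The algorithm is written in a language whose loops are bounded when they start, so that
  results and running times are total functions defined by recursion on the program.\<close>

type_synonym env = "nat \<Rightarrow> nat"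
type_synonym mem = "nat \<Rightarrow> nat \<Rightarrow> nat"

text \<open>The number of iterations of a loop is evaluated before the loop starts, so every program
  terminates. Locals are bound by loops only and are read-only otherwise; the state that commands
  change consists of arrays.\<close>

datatype exp =
    Lit nat
  | Var nat
  | Arr nat exp
  | Inp exp
  | Plus exp exp
  | Minus exp exp
  | Ite exp exp exp
  | Fold nat nat exp exp exp

datatype com =
    Asg nat exp exp
  | Seq com com
  | For nat exp com

primrec eval :: "nat list \<Rightarrow> exp \<Rightarrow> env \<Rightarrow> mem \<Rightarrow> nat" where
  "eval w (Lit n) r s = n"
| "eval w (Var x) r s = r x"
| "eval w (Arr a e) r s = s a (eval w e r s)"
| "eval w (Inp e) r s = (if eval w e r s < length w then w ! eval w e r s else 0)"
| "eval w (Plus e f) r s = eval w e r s + eval w f r s"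
| "eval w (Minus e f) r s = eval w e r s - eval w f r s"
| "eval w (Ite e f g) r s = (if eval w e r s = 0 then eval w g r s else eval w f r s)"
| "eval w (Fold x y e i b) r s =
     fold (\<lambda>j acc. eval w b (r(x := j, y := acc)) s) [0..<eval w e r s] (eval w i r s)"

primrec run :: "nat list \<Rightarrow> com \<Rightarrow> env \<Rightarrow> mem \<Rightarrow> mem" where
  "run w (Asg a i e) r s = s(a := (s a)(eval w i r s := eval w e r s))"
| "run w (Seq c d) r s = run w d r (run w c r s)"
| "run w (For x e c) r s = fold (\<lambda>j s. run w c (r(x := j)) s) [0..<eval w e r s] s"

text \<open>\<open>cost K\<close> counts the steps of the compiled code exactly; \<open>K\<close> is the stride of the memory layout.\<close>

primrec cost :: "nat \<Rightarrow> nat list \<Rightarrow> exp \<Rightarrow> env \<Rightarrow> mem \<Rightarrow> nat" where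
  "cost K w (Lit n) r s = 1"
| "cost K w (Var x) r s = 2"
| "cost K w (Arr a e) r s = cost K w e r s + (K + 2)"
| "cost K w (Inp e) r s = cost K w e r s + 1"
| "cost K w (Plus e f) r s = cost K w e r s + cost K w f r s + 1"
| "cost K w (Minus e f) r s = cost K w e r s + cost K w f r s + 1"
| "cost K w (Ite e f g) r s =
     cost K w e r s + 1 + (if eval w e r s = 0 then cost K w g r s else cost K w f r s + 2)"
| "cost K w (Fold x y e i b) r s =
     cost K w e r s + cost K w i r s + 7
     + (\<Sum>j<eval w e r s. cost K w b (r(x := j, y :=
          fold (\<lambda>j acc. eval w b (r(x := j, y := acc)) s) [0..<j] (eval w i r s))) s + 8)
     + 6"

primrec ccost :: "nat \<Rightarrow> nat list \<Rightarrow> com \<Rightarrow> env \<Rightarrow> mem \<Rightarrow> nat" where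
  "ccost K w (Asg a i e) r s = cost K w i r s + cost K w e r s + (K + 2)"
| "ccost K w (Seq c d) r s = ccost K w c r s + ccost K w d r (run w c r s)"
| "ccost K w (For x e c) r s =
     cost K w e r s + 3
     + (\<Sum>j<eval w e r s.
          ccost K w c (r(x := j)) (fold (\<lambda>j s. run w c (r(x := j)) s) [0..<j] s) + 6)
     + 3"

primrec arrs :: "exp \<Rightarrow> nat set" where
  "arrs (Lit n) = {}"
| "arrs (Var x) = {}"
| "arrs (Arr a e) = insert a (arrs e)"
| "arrs (Inp e) = arrs e"
| "arrs (Plus e f) = arrs e \<union> arrs f"
| "arrs (Minus e f) = arrs e \<union> arrs f"
| "arrs (Ite e f g) = arrs e \<union> arrs f \<union> arrs g"
| "arrs (Fold x y e i b) = arrs e \<union> arrs i \<union> arrs b"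

primrec carrs :: "com \<Rightarrow> nat set" where
  "carrs (Asg a i e) = insert a (arrs i \<union> arrs e)"
| "carrs (Seq c d) = carrs c \<union> carrs d"
| "carrs (For x e c) = arrs e \<union> carrs c"

lemma finite_arrs: "finite (arrs e)" "finite (carrs c)"
proof -
  show *: "finite (arrs e)" for e by (induction e) auto
  show "finite (carrs c)" by (induction c) (auto simp: *)
qed

text \<open>Jump targets are absolute. Code is therefore compiled for the address at which it will
  stand, and its correctness is stated for every program that contains it at this address.\<close>

primrec code_at :: "instr list \<Rightarrow> nat \<Rightarrow> instr list \<Rightarrow> bool" where
  "code_at P pc [] = True"
| "code_at P pc (i # c) = (pc < length P \<and> P ! pc = i \<and> code_at P (Suc pc) c)"

lemma code_at_append: "code_at P pc (c @ d) \<longleftrightarrow> code_at P pc c \<and> code_at P (pc + length c) d"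
  by (induction c arbitrary: pc) auto

lemma code_at_mid: "code_at (xs @ c @ ys) (length xs) c"
proof (induction c arbitrary: xs)
  case (Cons i c)
  from Cons[of "xs @ [i]"] show ?case by (auto simp: nth_append)
qed auto

section \<open>Execution of machine code\<close>

abbreviation steps :: "instr list \<Rightarrow> nat list \<Rightarrow> nat \<Rightarrow> config \<Rightarrow> config" where
  "steps P w t c \<equiv> (step P w ^^ t) c"

lemma steps_add: "steps P w (m + n) c = steps P w n (steps P w m c)"
  by (subst add.commute) (simp add: funpow_add)

lemma steps_Suc: "steps P w (Suc n) c = steps P w n (step P w c)"
  by (simp only: funpow_Suc_right comp_apply)

lemma step_at:
  "code_at P pc (i # c) \<Longrightarrow> step P w (pc, R) = exec w i (pc, R)"
  by (simp add: step_def)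

text \<open>Meant for jump-free code: the program counter 0 is a dummy, since no other instruction
  lets its effect on the registers depend on it.\<close>

primrec exl :: "nat list \<Rightarrow> instr list \<Rightarrow> (nat \<Rightarrow> nat) \<Rightarrow> (nat \<Rightarrow> nat)" where
  "exl w [] R = R"
| "exl w (i # c) R = exl w c (snd (exec w i (0, R)))"

fun straight :: "instr \<Rightarrow> bool" where
  "straight (JumpZero a l) = False"
| "straight i = True"

lemma steps_straight:
  assumes "code_at P pc c" "list_all straight c"
  shows "steps P w (length c) (pc, R) = (pc + length c, exl w c R)"
  using assms
proof (induction c arbitrary: pc R)
  case (Cons i c)
  have "step P w (pc, R) = exec w i (pc, R)"
    using Cons.prems by (subst step_at) auto
  also have "\<dots> = (Suc pc, snd (exec w i (0, R)))"
    using Cons.prems by (cases i) auto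
  finally show ?case
    using Cons by (simp only: list.size steps_Suc add_Suc_right) simp
qed simp

lemma steps_straight':
  assumes "code_at P pc c" "list_all straight c" "length c = n"
  shows "steps P w n (pc, R) = (pc + n, exl w c R)"
  using steps_straight[OF assms(1,2)] assms(3) by simp

section \<open>Compilation of expressions and commands\<close>

locale layout =
  fixes K :: nat
  assumes K2: "2 \<le> K"
begin

text \<open>The registers for intermediate values, for locals and for the arrays are interleaved.\<close>

definition sc :: "nat \<Rightarrow> nat" where "sc t = K * t"
definition lc :: "nat \<Rightarrow> nat" where "lc x = K * x + 1"
definition ar :: "nat \<Rightarrow> nat \<Rightarrow> nat" where "ar a i = K * i + a + 2"

lemma lin_inj: "a < K \<Longrightarrow> b < K \<Longrightarrow> K * i + a = K * j + b \<longleftrightarrow> i = j \<and> a = (b::nat)"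
proof
  assume ab: "a < K" "b < K" and eq: "K * i + a = K * j + b"
  have "(K * i + a) div K = i" "(K * j + b) div K = j" using ab by auto
  with eq have "i = j" by metis
  with eq show "i = j \<and> a = b" by simp
qed auto

lemma sc_inj [simp]: "sc t = sc u \<longleftrightarrow> t = u"
  using K2 by (simp add: sc_def)
lemma lc_inj [simp]: "lc t = lc u \<longleftrightarrow> t = u"
  using K2 by (simp add: lc_def)
lemma sc_lc [simp]: "sc t \<noteq> lc u" "lc u \<noteq> sc t"
  using lin_inj[of 0 1 t u] K2 by (auto simp: sc_def lc_def)
lemma sc_ar [simp]: "a + 2 < K \<Longrightarrow> sc t \<noteq> ar a i" "a + 2 < K \<Longrightarrow> ar a i \<noteq> sc t"
  using lin_inj[of 0 "a + 2" t i] by (auto simp: sc_def ar_def)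
lemma lc_ar [simp]: "a + 2 < K \<Longrightarrow> lc x \<noteq> ar a i" "a + 2 < K \<Longrightarrow> ar a i \<noteq> lc x"
  using lin_inj[of 1 "a + 2" x i] by (auto simp: lc_def ar_def)
lemma ar_inj [simp]: "a + 2 < K \<Longrightarrow> b + 2 < K \<Longrightarrow> ar a i = ar b j \<longleftrightarrow> a = b \<and> i = j"
  using lin_inj[of "a + 2" "b + 2" i j] by (auto simp: ar_def)

text \<open>Nothing is said about the registers for intermediate values, which code may overwrite,
  nor about arrays that are too large for the stride and have no registers of their own.\<close>

definition rep :: "env \<Rightarrow> mem \<Rightarrow> (nat \<Rightarrow> nat) \<Rightarrow> bool" where
  "rep r s R \<longleftrightarrow> (\<forall>x. R (lc x) = r x) \<and> (\<forall>a i. a + 2 < K \<longrightarrow> R (ar a i) = s a i)"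

lemma rep_lc: "rep r s R \<Longrightarrow> R (lc x) = r x"
  and rep_ar: "rep r s R \<Longrightarrow> a + 2 < K \<Longrightarrow> R (ar a i) = s a i"
  by (auto simp: rep_def)

lemma rep_sc [simp]: "rep r s (R(sc t := n)) \<longleftrightarrow> rep r s R"
  by (auto simp: rep_def)

text \<open>The machine cannot multiply, so \<open>K\<close> additions compute the address
  \<open>ar a i\<close> from the index \<open>i\<close>. The stride is fixed with the program, hence
  this takes constant time.\<close>

definition addr :: "nat \<Rightarrow> nat \<Rightarrow> nat \<Rightarrow> instr list" where
  "addr u t a = Const (sc u) (a + 2) # replicate K (Add (sc u) (sc u) (sc t))"

lemma steps_replicate_add:
  assumes "code_at P pc (replicate n (Add d d x))" "d \<noteq> x"
  shows "steps P w n (pc, R) = (pc + n, R(d := R d + n * R x))"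
  using assms
proof (induction n arbitrary: pc R)
  case (Suc n)
  have "step P w (pc, R) = (Suc pc, R(d := R d + R x))"
    using Suc.prems by (subst step_at) auto
  with Suc show ?case
    by (simp only: steps_Suc) (simp add: algebra_simps fun_eq_iff)
qed simp

lemma steps_addr:
  assumes "code_at P pc (addr u t a)" "u \<noteq> t"
  shows "steps P w (Suc K) (pc, R) = (pc + Suc K, R(sc u := ar a (R (sc t))))"
proof -
  have "step P w (pc, R) = (Suc pc, R(sc u := a + 2))"
    using assms by (subst step_at) (auto simp: addr_def)
  moreover have "steps P w K (Suc pc, R(sc u := a + 2))
      = (Suc pc + K, (R(sc u := a + 2))(sc u := (R(sc u := a + 2)) (sc u) + K * (R(sc u := a + 2)) (sc t)))"
    using assms by (intro steps_replicate_add) (auto simp: addr_def)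
  ultimately show ?thesis
    using assms(2) by (simp only: steps_Suc) (simp add: ar_def algebra_simps)
qed

text \<open>\<open>pc\<close> is the address of the code and \<open>t\<close> the height of the
  stack: the value is delivered in \<open>sc t\<close>, and the entries below \<open>t\<close> are
  preserved. In a \<open>Fold\<close>, the entries from \<open>t\<close> on hold the remaining
  number of iterations, the initial accumulator, the saved locals \<open>x\<close> and
  \<open>y\<close>, the value of the body, and the constant 1. Jumps on a register that has just
  been set to 0 are unconditional.\<close>

primrec cexp :: "nat \<Rightarrow> nat \<Rightarrow> exp \<Rightarrow> instr list" where
  "cexp pc t (Lit n) = [Const (sc t) n]"
| "cexp pc t (Var x) = [Const (sc t) 0, Add (sc t) (sc t) (lc x)]"
| "cexp pc t (Arr a e) = cexp pc t e @ addr (Suc t) t a @ [Load (sc t) (sc (Suc t))]"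
| "cexp pc t (Inp e) = cexp pc t e @ [Read (sc t) (sc t)]"
| "cexp pc t (Plus e f) =
     (let c = cexp pc t e in c @ cexp (pc + length c) (Suc t) f @ [Add (sc t) (sc t) (sc (Suc t))])"
| "cexp pc t (Minus e f) =
     (let c = cexp pc t e in c @ cexp (pc + length c) (Suc t) f @ [Sub (sc t) (sc t) (sc (Suc t))])"
| "cexp pc t (Ite e f g) =
     (let ce = cexp pc t e; cf = cexp (pc + length ce + 1) t f; q = pc + length ce + 1 + length cf + 2;
          cg = cexp q t g
      in ce @ [JumpZero (sc t) q] @ cf @ [Const (sc (Suc t)) 0, JumpZero (sc (Suc t)) (q + length cg)] @ cg)"
| "cexp pc t (Fold x y e i b) =
     (let ce = cexp pc t e; ci = cexp (pc + length ce) (t + 1) i; q = pc + length ce + length ci + 7;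
          cb = cexp (q + 1) (t + 4) b
      in ce @ ci
         @ [Const (sc (t + 2)) 0, Add (sc (t + 2)) (sc (t + 2)) (lc x),
            Const (sc (t + 3)) 0, Add (sc (t + 3)) (sc (t + 3)) (lc y),
            Const (lc x) 0, Const (lc y) 0, Add (lc y) (lc y) (sc (t + 1))]
         @ [JumpZero (sc t) (q + 1 + length cb + 7)] @ cb
         @ [Const (sc (t + 5)) 1, Add (lc x) (lc x) (sc (t + 5)), Sub (sc t) (sc t) (sc (t + 5)),
            Const (lc y) 0, Add (lc y) (lc y) (sc (t + 4)), Const (sc (t + 4)) 0] @ [JumpZero (sc (t + 4)) q]
         @ [Add (sc t) (sc t) (lc y), Const (lc x) 0, Add (lc x) (lc x) (sc (t + 2)),
            Const (lc y) 0, Add (lc y) (lc y) (sc (t + 3))])"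

definition good :: "nat \<Rightarrow> env \<Rightarrow> mem \<Rightarrow> nat \<Rightarrow> (nat \<Rightarrow> nat) \<Rightarrow> (nat \<Rightarrow> nat) \<Rightarrow> bool" where
  "good t r s v R R' \<longleftrightarrow> rep r s R' \<and> R' (sc t) = v \<and> (\<forall>u<t. R' (sc u) = R (sc u))"

lemma steps_loop:
  assumes body: "\<And>j R. j < n \<Longrightarrow> I j R \<Longrightarrow> \<exists>R'. steps P w (c j) (q, R) = (q, R') \<and> I (Suc j) R'"
    and "I 0 R"
  shows "\<exists>R'. steps P w (\<Sum>j<n. c j) (q, R) = (q, R') \<and> I n R'"
  using body
proof (induction n)
  case 0
  then show ?case using assms(2) by auto
next
  case (Suc n)
  then obtain R1 where R1: "steps P w (\<Sum>j<n. c j) (q, R) = (q, R1)" "I n R1"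
    by (metis less_SucI)
  obtain R2 where R2: "steps P w (c n) (q, R1) = (q, R2)" "I (Suc n) R2"
    using Suc.prems[OF lessI R1(2)] by auto
  have "steps P w (\<Sum>j<Suc n. c j) (q, R) = (q, R2)"
    using R1 R2 by (simp add: steps_add)
  with R2 show ?case by auto
qed

text \<open>The number of steps is exact, so the machine can be forgotten afterwards: bounds on the
  running time become bounds on \<open>cost\<close>.\<close>

lemma cexp_correct:
  assumes "code_at P pc (cexp pc t e)" "rep r s R" "\<forall>a\<in>arrs e. a + 2 < K"
  shows "\<exists>R'. steps P w (cost K w e r s) (pc, R) = (pc + length (cexp pc t e), R')
           \<and> good t r s (eval w e r s) R R'"
  using assms
proof (induction e arbitrary: pc t r s R)
  case (Lit n)
  then show ?case
    using steps_straight[of P pc "cexp pc t (Lit n)" w R] by (auto simp: good_def)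
next
  case (Var x)
  then have "rep r s (exl w (cexp pc t (Var x)) R) \<and> exl w (cexp pc t (Var x)) R (sc t) = r x
      \<and> (\<forall>u<t. exl w (cexp pc t (Var x)) R (sc u) = R (sc u))"
    by (auto simp: rep_lc)
  with Var show ?case
    using steps_straight[of P pc "cexp pc t (Var x)" w R] by (auto simp: good_def numeral_2_eq_2)
next
  case (Arr a e)
  let ?c = "cexp pc t e"
  obtain R1 where R1: "steps P w (cost K w e r s) (pc, R) = (pc + length ?c, R1)"
      "good t r s (eval w e r s) R R1"
    using Arr by (force simp: code_at_append)
  have c: "code_at P (pc + length ?c) (addr (Suc t) t a)"
    "code_at P (pc + length ?c + Suc K) [Load (sc t) (sc (Suc t))]"
    using Arr.prems by (auto simp: code_at_append addr_def)
  let ?R2 = "R1(sc (Suc t) := ar a (R1 (sc t)))"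
  define R3 where "R3 = ?R2(sc t := ?R2 (?R2 (sc (Suc t))))"
  have 2: "steps P w (Suc K) (pc + length ?c, R1) = (pc + length ?c + Suc K, ?R2)"
    using steps_addr[OF c(1)] by simp
  have 3: "steps P w (Suc 0) (pc + length ?c + Suc K, ?R2)
      = (pc + length ?c + Suc K + 1, R3)"
    using steps_straight[OF c(2), of w ?R2] by (simp add: R3_def)
  have "steps P w (cost K w e r s + (Suc K + Suc 0)) (pc, R)
      = (pc + length ?c + Suc K + 1, R3)"
    using R1(1) 2 3 by (simp only: steps_add)
  moreover have "good t r s (eval w (Arr a e) r s) R R3"
    using R1(2) Arr.prems by (auto simp: good_def rep_ar R3_def)
  ultimately show ?case
    by (intro exI[of _ R3]) (simp add: addr_def)
next
  case (Inp e)
  let ?c = "cexp pc t e"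
  obtain R1 where R1: "steps P w (cost K w e r s) (pc, R) = (pc + length ?c, R1)"
      "good t r s (eval w e r s) R R1"
    using Inp by (force simp: code_at_append)
  define R2 where "R2 = exl w [Read (sc t) (sc t)] R1"
  have "steps P w (Suc 0) (pc + length ?c, R1) = (Suc (pc + length ?c), R2)"
    using steps_straight[of P "pc + length ?c" "[Read (sc t) (sc t)]" w R1] Inp.prems
    by (auto simp: code_at_append R2_def)
  with R1 have "steps P w (cost K w e r s + Suc 0) (pc, R)
      = (Suc (pc + length ?c), R2)"
    by (simp only: steps_add)
  moreover have "good t r s (eval w (Inp e) r s) R R2"
    using R1(2) by (auto simp: good_def R2_def)
  ultimately show ?case
    by (intro exI[of _ R2]) simp
next
  case (Plus e f)
  let ?c = "cexp pc t e" and ?i = "[Add (sc t) (sc t) (sc (Suc t))]"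
  let ?d = "cexp (pc + length ?c) (Suc t) f"
  obtain R1 where R1: "steps P w (cost K w e r s) (pc, R) = (pc + length ?c, R1)"
      "good t r s (eval w e r s) R R1"
    using Plus by (force simp: code_at_append Let_def)
  obtain R2 where R2: "steps P w (cost K w f r s) (pc + length ?c, R1) = (pc + length ?c + length ?d, R2)"
      "good (Suc t) r s (eval w f r s) R1 R2"
    using Plus.IH(2)[of "pc + length ?c" "Suc t" r s R1] Plus.prems R1(2)
    by (auto simp: code_at_append Let_def good_def)
  define R3 where "R3 = exl w ?i R2"
  have 3: "steps P w (Suc 0) (pc + length ?c + length ?d, R2)
      = (Suc (pc + length ?c + length ?d), R3)"
    using steps_straight[of P "pc + length ?c + length ?d" ?i w R2] Plus.prems
    by (auto simp: R3_def code_at_append Let_def)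
  have "steps P w (cost K w e r s + (cost K w f r s + Suc 0)) (pc, R)
      = (Suc (pc + length ?c + length ?d), R3)"
    using R1(1) R2(1) 3 by (simp only: steps_add)
  moreover have "good t r s (eval w (Plus e f) r s) R R3"
    using R1(2) R2(2) by (auto simp: good_def R3_def)
  ultimately show ?case
    by (intro exI[of _ R3]) (simp add: Let_def)
next
  case (Minus e f)
  let ?c = "cexp pc t e" and ?i = "[Sub (sc t) (sc t) (sc (Suc t))]"
  let ?d = "cexp (pc + length ?c) (Suc t) f"
  obtain R1 where R1: "steps P w (cost K w e r s) (pc, R) = (pc + length ?c, R1)"
      "good t r s (eval w e r s) R R1"
    using Minus by (force simp: code_at_append Let_def)
  obtain R2 where R2: "steps P w (cost K w f r s) (pc + length ?c, R1) = (pc + length ?c + length ?d, R2)"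
      "good (Suc t) r s (eval w f r s) R1 R2"
    using Minus.IH(2)[of "pc + length ?c" "Suc t" r s R1] Minus.prems R1(2)
    by (auto simp: code_at_append Let_def good_def)
  define R3 where "R3 = exl w ?i R2"
  have 3: "steps P w (Suc 0) (pc + length ?c + length ?d, R2)
      = (Suc (pc + length ?c + length ?d), R3)"
    using steps_straight[of P "pc + length ?c + length ?d" ?i w R2] Minus.prems
    by (auto simp: R3_def code_at_append Let_def)
  have "steps P w (cost K w e r s + (cost K w f r s + Suc 0)) (pc, R)
      = (Suc (pc + length ?c + length ?d), R3)"
    using R1(1) R2(1) 3 by (simp only: steps_add)
  moreover have "good t r s (eval w (Minus e f) r s) R R3"
    using R1(2) R2(2) by (auto simp: good_def R3_def)
  ultimately show ?case
    by (intro exI[of _ R3]) (simp add: Let_def)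
next
  case (Ite e f g)
  let ?c = "cexp pc t e"
  let ?p = "pc + length ?c"
  let ?d = "cexp (?p + 1) t f"
  let ?q = "?p + 1 + length ?d + 2"
  let ?g = "cexp ?q t g"
  let ?end = "?q + length ?g"
  have len: "pc + length (cexp pc t (Ite e f g)) = ?end"
    by (simp add: Let_def)
  have cd: "code_at P pc ?c" "code_at P ?p [JumpZero (sc t) ?q]" "code_at P (?p + 1) ?d"
    "code_at P (?p + 1 + length ?d) [Const (sc (Suc t)) 0]"
    "code_at P (?p + 1 + length ?d + 1) [JumpZero (sc (Suc t)) ?end]" "code_at P ?q ?g"
    using Ite.prems(1) by (simp_all add: Let_def code_at_append add.assoc)
  obtain R1 where R1: "steps P w (cost K w e r s) (pc, R) = (?p, R1)" "good t r s (eval w e r s) R R1"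
    using Ite.IH(1)[of pc t r s R] Ite.prems cd by auto
  show ?case
  proof (cases "eval w e r s = 0")
    case True
    have j: "steps P w 1 (?p, R1) = (?q, R1)"
      using step_at[OF cd(2), of w R1] R1(2) True by (simp add: good_def)
    obtain R2 where R2: "steps P w (cost K w g r s) (?q, R1) = (?end, R2)" "good t r s (eval w g r s) R1 R2"
      using Ite.IH(3)[of ?q t r s R1] Ite.prems cd R1(2) by (auto simp: good_def)
    have "steps P w (cost K w e r s + (1 + cost K w g r s)) (pc, R) = (?end, R2)"
      using R1(1) j R2(1) by (simp only: steps_add)
    moreover have "good t r s (eval w (Ite e f g) r s) R R2"
      using R1(2) R2(2) True by (auto simp: good_def)
    ultimately show ?thesis
      unfolding len using True by (auto intro!: exI[of _ R2])
  next
    case False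
    have j: "steps P w 1 (?p, R1) = (?p + 1, R1)"
      using step_at[OF cd(2), of w R1] R1(2) False by (simp add: good_def)
    obtain R2 where R2: "steps P w (cost K w f r s) (?p + 1, R1) = (?p + 1 + length ?d, R2)"
        "good t r s (eval w f r s) R1 R2"
      using Ite.IH(2)[of "?p + 1" t r s R1] Ite.prems cd R1(2) by (auto simp: good_def)
    have k: "steps P w 1 (?p + 1 + length ?d, R2) = (?p + 1 + length ?d + 1, R2(sc (Suc t) := 0))"
      using step_at[OF cd(4), of w R2] by simp
    have l: "steps P w 1 (?p + 1 + length ?d + 1, R2(sc (Suc t) := 0)) = (?end, R2(sc (Suc t) := 0))"
      using step_at[OF cd(5), of w "R2(sc (Suc t) := 0)"] by simp
    have "steps P w (cost K w e r s + (1 + (cost K w f r s + (1 + 1)))) (pc, R) = (?end, R2(sc (Suc t) := 0))"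
      using R1(1) j R2(1) k l by (simp only: steps_add)
    moreover have "good t r s (eval w (Ite e f g) r s) R (R2(sc (Suc t) := 0))"
      using R1(2) R2(2) False by (auto simp: good_def)
    ultimately show ?thesis
      unfolding len using False by (auto intro!: exI[of _ "R2(sc (Suc t) := 0)"] simp: numeral_2_eq_2)
  qed
next
  case (Fold x y e i b)
  let ?ce = "cexp pc t e"
  let ?p = "pc + length ?ce"
  let ?ci = "cexp ?p (t + 1) i"
  let ?p1 = "?p + length ?ci"
  let ?q = "?p1 + 7"
  let ?cb = "cexp (?q + 1) (t + 4) b"
  let ?p2 = "?q + 1 + length ?cb"
  let ?p3 = "?p2 + 7"
  let ?B1 = "[Const (sc (t + 2)) 0, Add (sc (t + 2)) (sc (t + 2)) (lc x),
            Const (sc (t + 3)) 0, Add (sc (t + 3)) (sc (t + 3)) (lc y),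
            Const (lc x) 0, Const (lc y) 0, Add (lc y) (lc y) (sc (t + 1))]"
  let ?B2 = "[Const (sc (t + 5)) 1, Add (lc x) (lc x) (sc (t + 5)), Sub (sc t) (sc t) (sc (t + 5)),
            Const (lc y) 0, Add (lc y) (lc y) (sc (t + 4)), Const (sc (t + 4)) 0]"
  let ?B3 = "[Add (sc t) (sc t) (lc y), Const (lc x) 0, Add (lc x) (lc x) (sc (t + 2)),
            Const (lc y) 0, Add (lc y) (lc y) (sc (t + 3))]"
  have len: "pc + length (cexp pc t (Fold x y e i b)) = ?p3 + 5"
    by (simp add: Let_def)
  have cd: "code_at P pc ?ce" "code_at P ?p ?ci" "code_at P ?p1 ?B1" "code_at P ?q [JumpZero (sc t) ?p3]"
    "code_at P (?q + 1) ?cb" "code_at P ?p2 ?B2" "code_at P (?p2 + 6) [JumpZero (sc (t + 4)) ?q]"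
    "code_at P ?p3 ?B3"
    using Fold.prems(1) by (simp_all add: Let_def code_at_append add.assoc eval_nat_numeral)
  define n where "n = eval w e r s"
  define acc where "acc j = fold (\<lambda>j acc. eval w b (r(x := j, y := acc)) s) [0..<j] (eval w i r s)" for j
  obtain R1 where R1: "steps P w (cost K w e r s) (pc, R) = (?p, R1)" "good t r s n R R1"
    using Fold.IH(1)[of pc t r s R] Fold.prems cd by (auto simp: n_def)
  obtain R2 where R2: "steps P w (cost K w i r s) (?p, R1) = (?p1, R2)" "good (t + 1) r s (acc 0) R1 R2"
    using Fold.IH(2)[of ?p "t + 1" r s R1] Fold.prems cd R1(2) by (auto simp: good_def acc_def)
  define R3 where "R3 = exl w ?B1 R2"
  have s3: "steps P w 7 (?p1, R2) = (?q, R3)"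
    unfolding R3_def by (rule steps_straight'[OF cd(3)]) simp_all
  \<comment> \<open>The counter in \<open>sc t\<close> runs down while the local \<open>x\<close>
    runs up. On exit \<open>sc t\<close> is 0, so that adding the accumulator to it delivers the
    value.\<close>
  define I where "I j R' \<longleftrightarrow> rep (r(x := j, y := acc j)) s R' \<and> R' (sc t) = n - j \<and> R' (sc (t + 2)) = r x
      \<and> R' (sc (t + 3)) = r y \<and> (\<forall>u<t. R' (sc u) = R (sc u))" for j R'
  have I0: "I 0 R3"
    using R1(2) R2(2) unfolding I_def R3_def good_def by (auto simp: rep_def)
  have body: "\<exists>R''. steps P w (cost K w b (r(x := j, y := acc j)) s + 8) (?q, R') = (?q, R'') \<and> I (Suc j) R''"
    if jn: "j < n" "I j R'" for j R'
  proof -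
    have j1: "steps P w 1 (?q, R') = (?q + 1, R')"
      using step_at[OF cd(4), of w R'] jn by (simp add: I_def)
    obtain R4 where R4: "steps P w (cost K w b (r(x := j, y := acc j)) s) (?q + 1, R') = (?p2, R4)"
        "good (t + 4) (r(x := j, y := acc j)) s (eval w b (r(x := j, y := acc j)) s) R' R4"
    proof -
      have "rep (r(x := j, y := acc j)) s R'" "\<forall>a\<in>arrs b. a + 2 < K"
        using jn(2) Fold.prems(3) by (auto simp: I_def)
      from Fold.IH(3)[OF cd(5) this] show thesis
        using that by blast
    qed
    define R5 where "R5 = exl w ?B2 R4"
    have s5: "steps P w 6 (?p2, R4) = (?p2 + 6, R5)"
      unfolding R5_def by (rule steps_straight'[OF cd(6)]) simp_all
    have j2: "steps P w 1 (?p2 + 6, R5) = (?q, R5)"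
      using step_at[OF cd(7), of w R5] by (simp add: R5_def)
    have "steps P w (1 + (cost K w b (r(x := j, y := acc j)) s + (6 + 1))) (?q, R') = (?q, R5)"
      using j1 R4(1) s5 j2 by (simp only: steps_add)
    then have "steps P w (cost K w b (r(x := j, y := acc j)) s + 8) (?q, R') = (?q, R5)"
      by (simp add: add.commute add.left_commute)
    moreover have "eval w b (r(x := j, y := acc j)) s = acc (Suc j)"
      by (simp add: acc_def)
    then have "I (Suc j) R5"
      using R4(2) jn unfolding I_def R5_def good_def by (auto simp: rep_def)
    ultimately show ?thesis by auto
  qed
  obtain R6 where R6: "steps P w (\<Sum>j<n. cost K w b (r(x := j, y := acc j)) s + 8) (?q, R3) = (?q, R6)" "I n R6"
    using steps_loop[where n = n and I = I and c = "\<lambda>j. cost K w b (r(x := j, y := acc j)) s + 8" and q = ?q and R = R3, OF body I0] by blast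
  have j3: "steps P w 1 (?q, R6) = (?p3, R6)"
    using step_at[OF cd(4), of w R6] R6(2) by (simp add: I_def)
  define R7 where "R7 = exl w ?B3 R6"
  have s7: "steps P w 5 (?p3, R6) = (?p3 + 5, R7)"
    unfolding R7_def by (rule steps_straight'[OF cd(8)]) simp_all
  have "steps P w (cost K w e r s + (cost K w i r s + (7
      + ((\<Sum>j<n. cost K w b (r(x := j, y := acc j)) s + 8) + (1 + 5))))) (pc, R) = (?p3 + 5, R7)"
    using R1(1) R2(1) s3 R6(1) j3 s7 by (simp only: steps_add)
  then have "steps P w (cost K w (Fold x y e i b) r s) (pc, R) = (?p3 + 5, R7)"
    by (simp add: n_def acc_def add.assoc)
  moreover have "good t r s (eval w (Fold x y e i b) r s) R R7"
  proof -
    have "eval w (Fold x y e i b) r s = acc n" by (simp add: acc_def n_def)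
    then show ?thesis
      using R6(2) unfolding good_def R7_def I_def by (auto simp: rep_def)
  qed
  ultimately show ?case unfolding len by blast
qed

primrec ccom :: "nat \<Rightarrow> nat \<Rightarrow> com \<Rightarrow> instr list" where
  "ccom pc t (Asg a i e) =
     (let ci = cexp pc t i; ce = cexp (pc + length ci) (t + 1) e
      in ci @ ce @ addr (t + 2) t a @ [Store (sc (t + 2)) (sc (t + 1))])"
| "ccom pc t (Seq c d) = (let cc = ccom pc t c in cc @ ccom (pc + length cc) t d)"
| "ccom pc t (For x e c) =
     (let ce = cexp pc t e; q = pc + length ce + 3; cc = ccom (q + 1) (t + 2) c
      in ce @ [Const (sc (t + 1)) 0, Add (sc (t + 1)) (sc (t + 1)) (lc x), Const (lc x) 0]
         @ [JumpZero (sc t) (q + 1 + length cc + 5)] @ cc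
         @ [Const (sc (t + 2)) 1, Add (lc x) (lc x) (sc (t + 2)), Sub (sc t) (sc t) (sc (t + 2)),
            Const (sc (t + 2)) 0] @ [JumpZero (sc (t + 2)) q]
         @ [Const (lc x) 0, Add (lc x) (lc x) (sc (t + 1))])"

lemma ccom_correct:
  assumes "code_at P pc (ccom pc t c)" "rep r s R" "\<forall>a\<in>carrs c. a + 2 < K"
  shows "\<exists>R'. steps P w (ccost K w c r s) (pc, R) = (pc + length (ccom pc t c), R')
           \<and> rep r (run w c r s) R' \<and> (\<forall>u<t. R' (sc u) = R (sc u))"
  using assms
proof (induction c arbitrary: pc t r s R)
  case (Asg a i e)
  let ?ci = "cexp pc t i"
  let ?p = "pc + length ?ci"
  let ?ce = "cexp ?p (t + 1) e"
  let ?p1 = "?p + length ?ce"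
  have cd: "code_at P pc ?ci" "code_at P ?p ?ce" "code_at P ?p1 (addr (t + 2) t a)"
     "code_at P (?p1 + Suc K) [Store (sc (t + 2)) (sc (t + 1))]"
    using Asg.prems(1) by (simp_all add: Let_def code_at_append add.assoc addr_def)
  have len: "pc + length (ccom pc t (Asg a i e)) = ?p1 + Suc K + 1"
    by (simp add: Let_def addr_def)
  obtain R1 where R1: "steps P w (cost K w i r s) (pc, R) = (?p, R1)" "good t r s (eval w i r s) R R1"
    using cexp_correct[OF cd(1) Asg.prems(2), of w] Asg.prems(3) by auto
  obtain R2 where R2: "steps P w (cost K w e r s) (?p, R1) = (?p1, R2)" "good (t + 1) r s (eval w e r s) R1 R2"
    using cexp_correct[OF cd(2), of r s R1 w] R1(2) Asg.prems(3) by (auto simp: good_def)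
  define R3 where "R3 = R2(sc (t + 2) := ar a (R2 (sc t)))"
  have s3: "steps P w (Suc K) (?p1, R2) = (?p1 + Suc K, R3)"
    using steps_addr[OF cd(3), of w R2] by (simp add: R3_def)
  define R4 where "R4 = R3(R3 (sc (t + 2)) := R3 (sc (t + 1)))"
  have s4: "steps P w 1 (?p1 + Suc K, R3) = (?p1 + Suc K + 1, R4)"
    using step_at[OF cd(4), of w R3] by (simp add: R4_def)
  have "steps P w (cost K w i r s + (cost K w e r s + (Suc K + 1))) (pc, R) = (?p1 + Suc K + 1, R4)"
    using R1(1) R2(1) s3 s4 by (simp only: steps_add)
  then have "steps P w (ccost K w (Asg a i e) r s) (pc, R) = (?p1 + Suc K + 1, R4)"
    by (simp add: add.assoc)
  moreover have "rep r (run w (Asg a i e) r s) R4" "\<forall>u<t. R4 (sc u) = R (sc u)"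
    using R1(2) R2(2) Asg.prems(3) unfolding R4_def R3_def good_def by (auto simp: rep_def)
  ultimately show ?case unfolding len by blast
next
  case (Seq c d)
  let ?c = "ccom pc t c"
  obtain R1 where R1: "steps P w (ccost K w c r s) (pc, R) = (pc + length ?c, R1)"
      "rep r (run w c r s) R1" "\<forall>u<t. R1 (sc u) = R (sc u)"
    using Seq.IH(1)[of pc t r s R] Seq.prems by (auto simp: Let_def code_at_append)
  obtain R2 where R2: "steps P w (ccost K w d r (run w c r s)) (pc + length ?c, R1)
        = (pc + length ?c + length (ccom (pc + length ?c) t d), R2)"
      "rep r (run w d r (run w c r s)) R2" "\<forall>u<t. R2 (sc u) = R1 (sc u)"
    using Seq.IH(2)[of "pc + length ?c" t r "run w c r s" R1] Seq.prems R1 by (auto simp: Let_def code_at_append)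
  have "steps P w (ccost K w (Seq c d) r s) (pc, R) = (pc + length ?c + length (ccom (pc + length ?c) t d), R2)"
    using R1(1) R2(1) by (simp only: ccost.simps steps_add)
  with R1 R2 show ?case by (intro exI[of _ R2]) (auto simp: Let_def)
next
  case (For x e c)
  let ?ce = "cexp pc t e"
  let ?p = "pc + length ?ce"
  let ?q = "?p + 3"
  let ?cc = "ccom (?q + 1) (t + 2) c"
  let ?p2 = "?q + 1 + length ?cc"
  let ?p3 = "?p2 + 5"
  let ?B1 = "[Const (sc (t + 1)) 0, Add (sc (t + 1)) (sc (t + 1)) (lc x), Const (lc x) 0]"
  let ?B2 = "[Const (sc (t + 2)) 1, Add (lc x) (lc x) (sc (t + 2)), Sub (sc t) (sc t) (sc (t + 2)),
            Const (sc (t + 2)) 0]"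
  let ?B3 = "[Const (lc x) 0, Add (lc x) (lc x) (sc (t + 1))]"
  have len: "pc + length (ccom pc t (For x e c)) = ?p3 + 2"
    by (simp add: Let_def)
  have cd: "code_at P pc ?ce" "code_at P ?p ?B1" "code_at P ?q [JumpZero (sc t) ?p3]"
    "code_at P (?q + 1) ?cc" "code_at P ?p2 ?B2" "code_at P (?p2 + 4) [JumpZero (sc (t + 2)) ?q]"
    "code_at P ?p3 ?B3"
    using For.prems(1) by (simp_all add: Let_def code_at_append add.assoc eval_nat_numeral)
  define n where "n = eval w e r s"
  define st where "st j = fold (\<lambda>j s. run w c (r(x := j)) s) [0..<j] s" for j
  obtain R1 where R1: "steps P w (cost K w e r s) (pc, R) = (?p, R1)" "good t r s n R R1"
    using cexp_correct[OF cd(1) For.prems(2), of w] For.prems(3) by (auto simp: n_def)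
  define R3 where "R3 = exl w ?B1 R1"
  have s3: "steps P w 3 (?p, R1) = (?q, R3)"
    unfolding R3_def by (rule steps_straight'[OF cd(2)]) simp_all
  define I where "I j R' \<longleftrightarrow> rep (r(x := j)) (st j) R' \<and> R' (sc t) = n - j \<and> R' (sc (t + 1)) = r x
      \<and> (\<forall>u<t. R' (sc u) = R (sc u))" for j R'
  have I0: "I 0 R3"
    using R1(2) unfolding I_def R3_def good_def by (auto simp: rep_def st_def)
  have body: "\<exists>R''. steps P w (ccost K w c (r(x := j)) (st j) + 6) (?q, R') = (?q, R'') \<and> I (Suc j) R''"
    if jn: "j < n" "I j R'" for j R'
  proof -
    have j1: "steps P w 1 (?q, R') = (?q + 1, R')"
      using step_at[OF cd(3), of w R'] jn by (simp add: I_def)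
    have st': "run w c (r(x := j)) (st j) = st (Suc j)"
      by (simp add: st_def)
    obtain R4 where R4: "steps P w (ccost K w c (r(x := j)) (st j)) (?q + 1, R') = (?p2, R4)"
        "rep (r(x := j)) (st (Suc j)) R4" "\<forall>u<t + 2. R4 (sc u) = R' (sc u)"
    proof -
      have "rep (r(x := j)) (st j) R'" "\<forall>a\<in>carrs c. a + 2 < K"
        using jn(2) For.prems(3) by (auto simp: I_def)
      from For.IH[OF cd(4) this] show thesis
        using that unfolding st' by blast
    qed
    define R5 where "R5 = exl w ?B2 R4"
    have s5: "steps P w 4 (?p2, R4) = (?p2 + 4, R5)"
      unfolding R5_def by (rule steps_straight'[OF cd(5)]) simp_all
    have j2: "steps P w 1 (?p2 + 4, R5) = (?q, R5)"
      using step_at[OF cd(6), of w R5] by (simp add: R5_def)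
    have "steps P w (1 + (ccost K w c (r(x := j)) (st j) + (4 + 1))) (?q, R') = (?q, R5)"
      using j1 R4(1) s5 j2 by (simp only: steps_add)
    then have "steps P w (ccost K w c (r(x := j)) (st j) + 6) (?q, R') = (?q, R5)"
      by (simp add: add.commute add.left_commute)
    moreover have "I (Suc j) R5"
      using R4(2,3) jn unfolding I_def R5_def by (auto simp: rep_def)
    ultimately show ?thesis by auto
  qed
  obtain R6 where R6: "steps P w (\<Sum>j<n. ccost K w c (r(x := j)) (st j) + 6) (?q, R3) = (?q, R6)" "I n R6"
    using steps_loop[where n = n and I = I and c = "\<lambda>j. ccost K w c (r(x := j)) (st j) + 6" and q = ?q and R = R3, OF body I0] by blast
  have j3: "steps P w 1 (?q, R6) = (?p3, R6)"
    using step_at[OF cd(3), of w R6] R6(2) by (simp add: I_def)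
  define R7 where "R7 = exl w ?B3 R6"
  have s7: "steps P w 2 (?p3, R6) = (?p3 + 2, R7)"
    unfolding R7_def by (rule steps_straight'[OF cd(7)]) simp_all
  have "steps P w (cost K w e r s + (3
      + ((\<Sum>j<n. ccost K w c (r(x := j)) (st j) + 6) + (1 + 2)))) (pc, R) = (?p3 + 2, R7)"
    using R1(1) s3 R6(1) j3 s7 by (simp only: steps_add)
  then have "steps P w (ccost K w (For x e c) r s) (pc, R) = (?p3 + 2, R7)"
    by (simp add: n_def st_def add.assoc)
  moreover have "rep r (run w (For x e c) r s) R7" "\<forall>u<t. R7 (sc u) = R (sc u)"
  proof -
    have "run w (For x e c) r s = st n" by (simp add: st_def n_def)
    then show "rep r (run w (For x e c) r s) R7" "\<forall>u<t. R7 (sc u) = R (sc u)"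
      using R6(2) unfolding R7_def I_def by (auto simp: rep_def)
  qed
  ultimately show ?case unfolding len by blast
qed

end

text \<open>One residue class for each array up to the largest one that is mentioned, and two for
  intermediate values and locals. Array 0 is always included, since it holds the length of the
  input.\<close>

definition stride :: "com \<Rightarrow> exp \<Rightarrow> nat" where
  "stride c e = Suc (Max (insert 0 (carrs c \<union> arrs e)) + 2)"

theorem program_correct:
  "\<exists>P. \<forall>w t. let s = run w c (\<lambda>_. 0) (\<lambda>a i. if a = 0 \<and> i = 0 then length w else 0) in
     Suc (ccost (stride c e) w c (\<lambda>_. 0) (\<lambda>a i. if a = 0 \<and> i = 0 then length w else 0))
       + cost (stride c e) w e (\<lambda>_. 0) s \<le> t
     \<longrightarrow> halts_within P w t \<and> (accepts_within P w t \<longleftrightarrow> eval w e (\<lambda>_. 0) s \<noteq> 0)"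
proof -
  define K where "K = stride c e"
  interpret layout K by unfold_locales (simp add: K_def stride_def)
  have fin: "finite (insert 0 (carrs c \<union> arrs e))"
    by (simp add: finite_arrs)
  have aK: "a + 2 < K" if "a \<in> insert 0 (carrs c \<union> arrs e)" for a
    using Max_ge[OF fin that] by (simp add: K_def stride_def)
  define cc where "cc = ccom 1 0 c"
  define ce where "ce = cexp (1 + length cc) 0 e"
  \<comment> \<open>The length of the input arrives in register 0, the bottom of the stack, but
    belongs into entry 0 of array 0, which is register 2. Register 1 is still 0, so the addition is
    a copy.\<close>
  define P where "P = Add 2 0 1 # cc @ ce"
  define s0 :: "nat list \<Rightarrow> mem" where "s0 w = (\<lambda>a i. if a = 0 \<and> i = 0 then length w else 0)" for w
  have main: "halts_within P w t \<and> (accepts_within P w t \<longleftrightarrow> eval w e (\<lambda>_. 0) (run w c (\<lambda>_. 0) (s0 w)) \<noteq> 0)"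
    if t: "Suc (ccost K w c (\<lambda>_. 0) (s0 w)) + cost K w e (\<lambda>_. 0) (run w c (\<lambda>_. 0) (s0 w)) \<le> t" for w t
  proof -
    define s where "s = run w c (\<lambda>_. 0) (s0 w)"
    define R0 :: "nat \<Rightarrow> nat" where "R0 = (\<lambda>_. 0)(0 := length w)"
    have "code_at ([] @ P @ []) (length ([] :: instr list)) P" by (rule code_at_mid)
    then have cd: "code_at P 0 [Add 2 0 1]" "code_at P 1 cc" "code_at P (1 + length cc) ce"
      by (simp_all add: P_def code_at_append)
    define R1 where "R1 = R0(2 := length w)"
    have s1: "steps P w 1 (0, R0) = (1, R1)"
      using step_at[OF cd(1), of w R0] by (simp add: R1_def R0_def)
    have ar00: "ar a i = 2 \<longleftrightarrow> a = 0 \<and> i = 0" if "a + 2 < K" for a i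
      using ar_inj[of a 0 i 0] that aK[of 0] by (simp add: ar_def)
    have arn0: "ar a i \<noteq> 0" for a i by (simp add: ar_def)
    have lc2: "lc x \<noteq> 2" "lc x \<noteq> 0" for x using lc_ar(1)[of 0 x 0] aK[of 0] by (simp_all add: ar_def lc_def)
    have rep1: "rep (\<lambda>_. 0) (s0 w) R1"
      unfolding rep_def R1_def R0_def s0_def using ar00 arn0 lc2
      by (auto simp del: neq0_conv)
    obtain R2 where R2: "steps P w (ccost K w c (\<lambda>_. 0) (s0 w)) (1, R1) = (1 + length cc, R2)"
        "rep (\<lambda>_. 0) s R2"
      using ccom_correct[OF cd(2)[unfolded cc_def] rep1, of w] aK by (auto simp: cc_def s_def)
    obtain R3 where R3: "steps P w (cost K w e (\<lambda>_. 0) s) (1 + length cc, R2) = (1 + length cc + length ce, R3)"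
        "good 0 (\<lambda>_. 0) s (eval w e (\<lambda>_. 0) s) R2 R3"
      using cexp_correct[OF cd(3)[unfolded ce_def] R2(2), of w] aK by (auto simp: ce_def)
    have *: "steps P w (1 + (ccost K w c (\<lambda>_. 0) (s0 w) + cost K w e (\<lambda>_. 0) s)) (0, R0) = (length P, R3)"
      using s1 R2(1) R3(1) by (simp only: steps_add) (simp add: P_def)
    obtain d where d: "t = (1 + (ccost K w c (\<lambda>_. 0) (s0 w) + cost K w e (\<lambda>_. 0) s)) + d"
      using le_Suc_ex[OF t] by (auto simp: s_def)
    \<comment> \<open>A halted machine does not move any more, so every upper bound on the number of
      steps will do.\<close>
    have stay: "steps P w d (length P, R3) = (length P, R3)"
      by (induction d) (simp_all add: step_def)
    have "config_after P w t = (length P, R3)"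
      unfolding config_after_def d R0_def[symmetric] by (subst steps_add) (simp only: * stay)
    moreover have "R3 0 = eval w e (\<lambda>_. 0) s" using R3(2) by (simp add: good_def sc_def)
    ultimately show ?thesis
      by (simp add: halts_within_def accepts_within_def s_def)
  qed
  then show ?thesis
    by (intro exI[of _ P]) (simp add: Let_def K_def s0_def)
qed

subsection \<open>Input-free code depends only on the arrays that it mentions\<close>

primrec inp_free :: "exp \<Rightarrow> bool" where
  "inp_free (Lit n) = True"
| "inp_free (Var x) = True"
| "inp_free (Arr a e) = inp_free e"
| "inp_free (Inp e) = False"
| "inp_free (Plus e f) = (inp_free e \<and> inp_free f)"
| "inp_free (Minus e f) = (inp_free e \<and> inp_free f)"
| "inp_free (Ite e f g) = (inp_free e \<and> inp_free f \<and> inp_free g)"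
| "inp_free (Fold x y e i b) = (inp_free e \<and> inp_free i \<and> inp_free b)"

primrec cinp_free :: "com \<Rightarrow> bool" where
  "cinp_free (Asg a i e) = (inp_free i \<and> inp_free e)"
| "cinp_free (Seq c d) = (cinp_free c \<and> cinp_free d)"
| "cinp_free (For x e c) = (inp_free e \<and> cinp_free c)"

lemma inp_free_eval:
  assumes "inp_free e" "\<And>a. a \<in> arrs e \<Longrightarrow> s a = s' a"
  shows "eval w e r s = eval w' e r s'"
  using assms by (induction e arbitrary: r) auto

lemma inp_free_cost:
  assumes "inp_free e" "\<And>a. a \<in> arrs e \<Longrightarrow> s a = s' a"
  shows "cost K w e r s = cost K w' e r s'"
  using assms
proof (induction e arbitrary: r)
  case (Fold x y e i b)
  have "eval w e r s = eval w' e r s'" "eval w i r s = eval w' i r s'"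
    "\<And>r. eval w b r s = eval w' b r s'"
    using Fold.prems by (auto intro!: inp_free_eval)
  then show ?case using Fold by auto
next
  case (Ite e f g)
  have "eval w e r s = eval w' e r s'"
    using Ite.prems by (auto intro!: inp_free_eval)
  then show ?case using Ite by auto
qed auto

text \<open>Meant for the tables of types: their computation on the actual input takes the same time
  as on the empty word with a memory that contains just the formula. So its cost is a function of
  the formula.\<close>

lemma cinp_free_run:
  assumes "cinp_free c" "carrs c \<subseteq> A" "\<And>a. a \<in> A \<Longrightarrow> s a = s' a"
  shows "a \<in> A \<Longrightarrow> run w c r s a = run w' c r s' a"
    and "ccost K w c r s = ccost K w' c r s'"
proof -
  have "(\<forall>a\<in>A. run w c r s a = run w' c r s' a) \<and> ccost K w c r s = ccost K w' c r s'"
    using assms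
  proof (induction c arbitrary: r s s')
    case (Asg b i e)
    have "eval w i r s = eval w' i r s'" "eval w e r s = eval w' e r s'"
      "cost K w i r s = cost K w' i r s'" "cost K w e r s = cost K w' e r s'"
      using Asg by (auto intro!: inp_free_eval inp_free_cost)
    then show ?case using Asg by auto
  next
    case (Seq c d)
    from Seq.IH(1)[of s s' r] Seq.prems
    have 1: "\<forall>a\<in>A. run w c r s a = run w' c r s' a" "ccost K w c r s = ccost K w' c r s'" by auto
    from Seq.IH(2)[of "run w c r s" "run w' c r s'" r] Seq.prems 1
    show ?case by auto
  next
    case (For x e c)
    have e: "eval w e r s = eval w' e r s'" "cost K w e r s = cost K w' e r s'"
      using For by (auto intro!: inp_free_eval inp_free_cost)
    define f where "f = (\<lambda>j s. run w c (r(x := j)) s)"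
    define f' where "f' = (\<lambda>j s. run w' c (r(x := j)) s)"
    have *: "\<forall>a\<in>A. fold f [0..<n] s a = fold f' [0..<n] s' a" for n
    proof (induction n)
      case (Suc n)
      then show ?case
        using For.IH[of "fold f [0..<n] s" "fold f' [0..<n] s'" "r(x := n)"] For.prems
        by (auto simp: f_def f'_def simp del: fun_upd_apply)
    qed (use For.prems in auto)
    have "ccost K w c (r(x := j)) (fold f [0..<j] s) = ccost K w' c (r(x := j)) (fold f' [0..<j] s')" for j
      using For.IH[of "fold f [0..<j] s" "fold f' [0..<j] s'" "r(x := j)"] For.prems * by (auto simp del: fun_upd_apply)
    then show ?case using e * by (simp add: f_def f'_def)
  qed
  then show "a \<in> A \<Longrightarrow> run w c r s a = run w' c r s' a" "ccost K w c r s = ccost K w' c r s'"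
    by auto
qed

primrec writes :: "com \<Rightarrow> nat set" where
  "writes (Asg a i e) = {a}"
| "writes (Seq c d) = writes c \<union> writes d"
| "writes (For x e c) = writes c"

lemma run_frame: "a \<notin> writes c \<Longrightarrow> run w c r s a = s a"
proof (induction c arbitrary: r s)
  case (For x e c)
  have "fold (\<lambda>j s. run w c (r(x := j)) s) [0..<n] s a = s a" for n
    using For by (induction n) auto
  then show ?case by simp
qed auto

subsection \<open>Polynomial cost\<close>

text \<open>In \<open>bexp L e\<close> all loop bounds are constants or scalars (entries 0) of arrays in \<open>L\<close>, or smaller.\<close>

fun bd :: "nat set \<Rightarrow> exp \<Rightarrow> bool" where
  "bd L (Lit n) = True"
| "bd L (Arr a e) = (a \<in> L \<and> e = Lit 0)"
| "bd L (Minus e f) = bd L e"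
| "bd L _ = False"

primrec bexp :: "nat set \<Rightarrow> exp \<Rightarrow> bool" where
  "bexp L (Lit n) = True"
| "bexp L (Var x) = True"
| "bexp L (Arr a e) = bexp L e"
| "bexp L (Inp e) = bexp L e"
| "bexp L (Plus e f) = (bexp L e \<and> bexp L f)"
| "bexp L (Minus e f) = (bexp L e \<and> bexp L f)"
| "bexp L (Ite e f g) = (bexp L e \<and> bexp L f \<and> bexp L g)"
| "bexp L (Fold x y e i b) = (bd L e \<and> bexp L e \<and> bexp L i \<and> bexp L b)"

text \<open>Arrays in \<open>L\<close> must not be assigned to. A bound on their scalars that holds
  before the run thus bounds all loops during the run.\<close>

primrec bcom :: "nat set \<Rightarrow> com \<Rightarrow> bool" where
  "bcom L (Asg a i e) = (a \<notin> L \<and> bexp L i \<and> bexp L e)"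
| "bcom L (Seq c d) = (bcom L c \<and> bcom L d)"
| "bcom L (For x e c) = (bd L e \<and> bexp L e \<and> bcom L c)"

lemma bcom_writes: "bcom L c \<Longrightarrow> a \<in> L \<Longrightarrow> a \<notin> writes c"
  by (induction c) auto

text \<open>With \<open>M\<close> at least 1, powers of \<open>M\<close> grow with the exponent and
  dominate constants, so bounds of different degrees can be added.\<close>

definition scalars_le :: "nat set \<Rightarrow> nat \<Rightarrow> mem \<Rightarrow> bool" where
  "scalars_le L M s \<longleftrightarrow> 1 \<le> M \<and> (\<forall>a\<in>L. s a 0 \<le> M)"

definition polyb :: "nat set \<Rightarrow> (nat list \<Rightarrow> env \<Rightarrow> mem \<Rightarrow> nat) \<Rightarrow> bool" where
  "polyb L f \<longleftrightarrow> (\<exists>C d. \<forall>w r s M. scalars_le L M s \<longrightarrow> f w r s \<le> C * M ^ d)"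

lemma polyb_const: "polyb L (\<lambda>_ _ _. c)"
  unfolding polyb_def by (rule exI[of _ c], rule exI[of _ 0]) simp

lemma polyb_mono: "polyb L g \<Longrightarrow> (\<And>w r s. f w r s \<le> g w r s) \<Longrightarrow> polyb L f"
  unfolding polyb_def by (meson le_trans)

lemma polyb_add:
  assumes "polyb L f" "polyb L g"
  shows "polyb L (\<lambda>w r s. f w r s + g w r s)"
proof -
  from assms obtain C d D e where
    f: "\<And>w r s M. scalars_le L M s \<Longrightarrow> f w r s \<le> C * M ^ d"
    and g: "\<And>w r s M. scalars_le L M s \<Longrightarrow> g w r s \<le> D * M ^ e"
    unfolding polyb_def by metis
  have "f w r s + g w r s \<le> (C + D) * M ^ (d + e)" if "scalars_le L M s" for w r s M
  proof -
    have "1 \<le> M" using that by (simp add: scalars_le_def)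
    then have "M ^ d \<le> M ^ (d + e)" "M ^ e \<le> M ^ (d + e)" by (simp_all add: power_increasing)
    then have "C * M ^ d + D * M ^ e \<le> (C + D) * M ^ (d + e)"
      by (simp add: add_mult_distrib add_mono)
    with f[OF that, of w r] g[OF that, of w r] show ?thesis by linarith
  qed
  then show ?thesis unfolding polyb_def by (intro exI[of _ "C + D"] exI[of _ "d + e"]) auto
qed

lemma polyb_bd: "bd L e \<Longrightarrow> \<exists>C. \<forall>w r s M. scalars_le L M s \<longrightarrow> eval w e r s \<le> C * M"
proof (induction L e rule: bd.induct)
  case (1 L n)
  have "n \<le> n * M" if "scalars_le L M s" for M s
    using that by (simp add: scalars_le_def)
  then show ?case by (auto intro!: exI[of _ n])
next
  case (2 L a e)
  then show ?case by (auto intro!: exI[of _ 1] simp: scalars_le_def)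
next
  case (3 L e f)
  then obtain C where "\<forall>w r s M. scalars_le L M s \<longrightarrow> eval w e r s \<le> C * M" by auto
  then show ?case by (auto intro!: exI[of _ C] intro: le_trans[OF diff_le_self])
qed auto

text \<open>The environments and the memories of the iterations enter through \<open>R\<close> and \<open>S\<close>.\<close>

lemma polyb_sum:
  assumes "bd L e" "polyb L f"
    "\<And>w r s M j. scalars_le L M s \<Longrightarrow> scalars_le L M (S w r s j)"
  shows "polyb L (\<lambda>w r s. \<Sum>j<eval w e r s. f w (R w r s j) (S w r s j))"
proof -
  obtain C where C: "\<And>w r s M. scalars_le L M s \<Longrightarrow> eval w e r s \<le> C * M"
    using polyb_bd[OF assms(1)] by auto
  obtain D d where f: "\<And>w r s M. scalars_le L M s \<Longrightarrow> f w r s \<le> D * M ^ d"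
    using assms(2) unfolding polyb_def by auto
  have "(\<Sum>j<eval w e r s. f w (R w r s j) (S w r s j)) \<le> (C * D) * M ^ Suc d" if "scalars_le L M s" for w r s M
  proof -
    have "(\<Sum>j<eval w e r s. f w (R w r s j) (S w r s j)) \<le> (\<Sum>j<eval w e r s. D * M ^ d)"
      by (intro sum_mono f assms(3) that)
    also have "\<dots> = eval w e r s * (D * M ^ d)" by simp
    also have "\<dots> \<le> (C * M) * (D * M ^ d)" using C[OF that] by (intro mult_right_mono) auto
    finally show ?thesis by (simp add: algebra_simps)
  qed
  then show ?thesis unfolding polyb_def by (intro exI[of _ "C * D"] exI[of _ "Suc d"]) auto
qed

lemma polyb_cost: "bexp L e \<Longrightarrow> polyb L (\<lambda>w r s. cost K w e r s)"
proof (induction e)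
  case (Ite e f g)
  have "polyb L (\<lambda>w r s. cost K w e r s + (cost K w f r s + (cost K w g r s + 3)))"
    using Ite by (intro polyb_add polyb_const) auto
  then show ?case by (rule polyb_mono) auto
next
  case (Fold x y e i b)
  have "polyb L (\<lambda>w r s. cost K w b r s + 8)"
    using Fold by (intro polyb_add polyb_const) auto
  then have "polyb L (\<lambda>w r s. \<Sum>j<eval w e r s. cost K w b (r(x := j, y :=
          fold (\<lambda>j acc. eval w b (r(x := j, y := acc)) s) [0..<j] (eval w i r s))) s + 8)"
    using Fold polyb_sum[where f = "\<lambda>w r s. cost K w b r s + 8" and S = "\<lambda>w r s j. s" and R = "\<lambda>w r s j. r(x := j, y :=
          fold (\<lambda>j acc. eval w b (r(x := j, y := acc)) s) [0..<j] (eval w i r s))" and L = L and e = e]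
    by auto
  then have "polyb L (\<lambda>w r s. cost K w e r s + (cost K w i r s + (14 +
     (\<Sum>j<eval w e r s. cost K w b (r(x := j, y :=
          fold (\<lambda>j acc. eval w b (r(x := j, y := acc)) s) [0..<j] (eval w i r s))) s + 8))))"
    using Fold by (intro polyb_add polyb_const) auto
  then show ?case by (rule polyb_mono) auto
next
  case (Plus e f)
  have "polyb L (\<lambda>w r s. cost K w e r s + (cost K w f r s + 1))"
    using Plus by (intro polyb_add polyb_const) auto
  then show ?case by (rule polyb_mono) auto
next
  case (Minus e f)
  have "polyb L (\<lambda>w r s. cost K w e r s + (cost K w f r s + 1))"
    using Minus by (intro polyb_add polyb_const) auto
  then show ?case by (rule polyb_mono) auto
next
  case (Arr a e)
  have "polyb L (\<lambda>w r s. cost K w e r s + (K + 2))"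
    using Arr by (intro polyb_add polyb_const) auto
  then show ?case by (rule polyb_mono) auto
next
  case (Inp e)
  have "polyb L (\<lambda>w r s. cost K w e r s + 1)"
    using Inp by (intro polyb_add polyb_const) auto
  then show ?case by (rule polyb_mono) auto
next
  case (Lit n)
  show ?case using polyb_mono[OF polyb_const[of L 1]] by simp
next
  case (Var x)
  show ?case using polyb_mono[OF polyb_const[of L 2]] by simp
qed

lemma scalars_le_run: "bcom L c \<Longrightarrow> scalars_le L M s \<Longrightarrow> scalars_le L M (run w c r s)"
  using bcom_writes[of L c] run_frame[of _ c] by (auto simp: scalars_le_def)

lemma polyb_compose:
  assumes "polyb L f" "\<And>w r s M. scalars_le L M s \<Longrightarrow> scalars_le L M (S w r s)"
  shows "polyb L (\<lambda>w r s. f w r (S w r s))"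
  using assms unfolding polyb_def by meson

lemma polyb_ccost: "bcom L c \<Longrightarrow> polyb L (\<lambda>w r s. ccost K w c r s)"
proof (induction c)
  case (Asg a i e)
  have "polyb L (\<lambda>w r s. cost K w i r s + (cost K w e r s + (K + 2)))"
    using Asg by (intro polyb_add polyb_const polyb_cost) auto
  then show ?case by (rule polyb_mono) auto
next
  case (Seq c d)
  then have "polyb L (\<lambda>w r s. ccost K w c r s + ccost K w d r (run w c r s))"
    using polyb_compose[where f = "\<lambda>w r s. ccost K w d r s" and S = "\<lambda>w r s. run w c r s"]
    by (intro polyb_add) (auto intro: scalars_le_run)
  then show ?case by (rule polyb_mono) auto
next
  case (For x e c)
  have S: "scalars_le L M (fold (\<lambda>j s. run w c (r(x := j)) s) [0..<j] s)" if "scalars_le L M s" for w r s M j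
    using that For.prems by (induction j) (auto intro: scalars_le_run)
  have "polyb L (\<lambda>w r s. ccost K w c r s + 6)"
    using For by (intro polyb_add polyb_const) auto
  then have "polyb L (\<lambda>w r s. \<Sum>j<eval w e r s. ccost K w c (r(x := j))
         (fold (\<lambda>j s. run w c (r(x := j)) s) [0..<j] s) + 6)"
    using For.prems S polyb_sum[where f = "\<lambda>w r s. ccost K w c r s + 6" and L = L and e = e
        and R = "\<lambda>w r s j. r(x := j)" and S = "\<lambda>w r s j. fold (\<lambda>j s. run w c (r(x := j)) s) [0..<j] s"]
    by auto
  then have "polyb L (\<lambda>w r s. cost K w e r s + (6 +
      (\<Sum>j<eval w e r s. ccost K w c (r(x := j))
         (fold (\<lambda>j s. run w c (r(x := j)) s) [0..<j] s) + 6)))"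
    using For.prems by (intro polyb_add polyb_const polyb_cost) auto
  then show ?case by (rule polyb_mono) auto
qed

section \<open>Splitting vertex sets of small cut rank\<close>

text \<open>Addition of vectors over the field with two elements, a vector being the set of its
  nonzero coordinates.\<close>

definition sdiff :: "'a set \<Rightarrow> 'a set \<Rightarrow> 'a set" where
  "sdiff X Y = (X - Y) \<union> (Y - X)"

lemma in_sdiff [simp]: "x \<in> sdiff X Y \<longleftrightarrow> (x \<in> X) \<noteq> (x \<in> Y)"
  by (auto simp: sdiff_def)

lemma odd_card_sdiff:
  assumes "finite X" "finite Y"
  shows "odd (card (sdiff X Y)) \<longleftrightarrow> odd (card X) \<noteq> odd (card Y)"
proof -
  have "card (sdiff X Y) = card (X - Y) + card (Y - X)"
    unfolding sdiff_def using assms by (intro card_Un_disjoint) auto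
  moreover have "card X = card (X - Y) + card (X \<inter> Y)" "card Y = card (Y - X) + card (X \<inter> Y)"
    using assms by (metis card_Int_Diff add.commute inf_commute)+
  ultimately show ?thesis by auto
qed

section \<open>Row spaces over the field with two elements\<close>

locale igraph =
  fixes V :: "'a set" and A :: "'a \<Rightarrow> 'a \<Rightarrow> bool"
  assumes finV: "finite V"
    and A_sym: "A u v \<longleftrightarrow> A v u"
begin

text \<open>\<open>sp Y X\<close> is the row space over the field with two elements of the adjacency matrix with
  rows \<open>X\<close> and columns \<open>Y\<close>, and \<open>R X\<close> is 2 to the cut rank of \<open>X\<close>.\<close>

definition sm :: "'a set \<Rightarrow> 'a set \<Rightarrow> 'a set" where
  "sm Y S = {y \<in> Y. odd (card {u \<in> S. A u y})}"

definition sp :: "'a set \<Rightarrow> 'a set \<Rightarrow> 'a set set" where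
  "sp Y X = sm Y ` Pow X"

definition R :: "'a set \<Rightarrow> nat" where
  "R X = card (sp X (V - X))"

lemma sm_sdiff:
  assumes "finite S" "finite T"
  shows "sm Y (sdiff S T) = sdiff (sm Y S) (sm Y T)"
proof -
  have "{u \<in> sdiff S T. A u y} = sdiff {u \<in> S. A u y} {u \<in> T. A u y}" for y by auto
  then show ?thesis
    using assms by (auto simp: sm_def odd_card_sdiff)
qed

lemma sm_empty [simp]: "sm Y {} = {}" "sm {} S = {}"
  by (auto simp: sm_def)

lemma sm_Int: "Y \<subseteq> Y' \<Longrightarrow> sm Y S = sm Y' S \<inter> Y"
  by (auto simp: sm_def)

lemma sm_subset: "sm Y S \<subseteq> Y"
  by (auto simp: sm_def)

lemma finite_sp [simp]: "finite X \<Longrightarrow> finite (sp Y X)"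
  by (simp add: sp_def)

lemma sp_subset_Pow: "sp Y X \<subseteq> Pow Y"
  by (auto simp: sp_def sm_def)

lemma sp_sdiff:
  assumes "finite X" "a \<in> sp Y X" "b \<in> sp Y X"
  shows "sdiff a b \<in> sp Y X"
proof -
  obtain S T where ST: "S \<subseteq> X" "T \<subseteq> X" "a = sm Y S" "b = sm Y T"
    using assms by (auto simp: sp_def)
  then have "sdiff a b = sm Y (sdiff S T)"
    using assms(1) by (simp add: sm_sdiff finite_subset)
  moreover have "sdiff S T \<subseteq> X" using ST by (auto simp: sdiff_def)
  ultimately show ?thesis by (auto simp: sp_def)
qed

lemma empty_in_sp: "{} \<in> sp Y X"
  by (force simp: sp_def)

lemma sp_empty: "sp {} X = {{}}"
  by (auto simp: sp_def image_iff)

lemma card_sp_rows: "finite X \<Longrightarrow> card (sp Y X) \<le> 2 ^ card X"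
  unfolding sp_def by (metis card_Pow card_image_le finite_Pow_iff)

lemma card_sp_columns: "finite Y \<Longrightarrow> card (sp Y X) \<le> 2 ^ card Y"
  by (metis card_Pow card_mono finite_Pow_iff sp_subset_Pow)

lemma sp_mono_rows: "X \<subseteq> X' \<Longrightarrow> sp Y X \<subseteq> sp Y X'"
  by (auto simp: sp_def)

lemma sp_restrict: "Y \<subseteq> Y' \<Longrightarrow> sp Y X = (\<lambda>a. a \<inter> Y) ` sp Y' X"
  unfolding sp_def image_image by (simp add: sm_Int cong: image_cong)

lemma card_sp_mono:
  assumes "Y \<subseteq> Y'" "X \<subseteq> X'" "finite X'"
  shows "card (sp Y X) \<le> card (sp Y' X')"
proof -
  have "card (sp Y X) \<le> card (sp Y X')"
    using assms by (intro card_mono sp_mono_rows) auto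
  also have "\<dots> \<le> card (sp Y' X')"
    using assms by (simp add: sp_restrict[OF assms(1)] card_image_le)
  finally show ?thesis .
qed

text \<open>Subadditivity of the rank in the columns, in multiplicative form: a vector on
  \<open>Y \<union> Y'\<close> is determined by its two restrictions.\<close>

lemma card_sp_Un_columns:
  assumes "finite X"
  shows "card (sp (Y \<union> Y') X) \<le> card (sp Y X) * card (sp Y' X)"
proof -
  have "inj_on (\<lambda>a. (a \<inter> Y, a \<inter> Y')) (sp (Y \<union> Y') X)"
  proof (rule inj_onI)
    fix a b assume "a \<in> sp (Y \<union> Y') X" "b \<in> sp (Y \<union> Y') X" and eq: "(a \<inter> Y, a \<inter> Y') = (b \<inter> Y, b \<inter> Y')"
    then have "a \<subseteq> Y \<union> Y'" "b \<subseteq> Y \<union> Y'" using sp_subset_Pow by auto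
    with eq show "a = b" by blast
  qed
  moreover have "(\<lambda>a. (a \<inter> Y, a \<inter> Y')) ` sp (Y \<union> Y') X \<subseteq> sp Y X \<times> sp Y' X"
    using sp_restrict[of Y "Y \<union> Y'" X] sp_restrict[of Y' "Y \<union> Y'" X] by auto
  ultimately have "card (sp (Y \<union> Y') X) \<le> card (sp Y X \<times> sp Y' X)"
    using assms by (intro card_inj_on_le) auto
  then show ?thesis by (simp add: card_cartesian_product)
qed

lemma card_sp_Un_rows:
  assumes "finite X" "finite X'"
  shows "card (sp Y (X \<union> X')) \<le> card (sp Y X) * card (sp Y X')"
proof -
  have "sp Y (X \<union> X') \<subseteq> (\<lambda>(a, b). sdiff a b) ` (sp Y X \<times> sp Y X')"
  proof
    fix a assume "a \<in> sp Y (X \<union> X')"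
    then obtain S where S: "S \<subseteq> X \<union> X'" "a = sm Y S" by (auto simp: sp_def)
    have "finite S" using S assms finite_subset by blast
    moreover have "S = sdiff (S \<inter> X) (S - X)" by auto
    ultimately have "a = sdiff (sm Y (S \<inter> X)) (sm Y (S - X))"
      using S(2) by (metis finite_Diff finite_Int sm_sdiff)
    moreover have "sm Y (S \<inter> X) \<in> sp Y X" "sm Y (S - X) \<in> sp Y X'"
      using S by (auto simp: sp_def)
    ultimately show "a \<in> (\<lambda>(a, b). sdiff a b) ` (sp Y X \<times> sp Y X')" by auto
  qed
  then have "card (sp Y (X \<union> X')) \<le> card (sp Y X \<times> sp Y X')"
    using assms by (meson card_image_le card_mono finite_SigmaI finite_imageI finite_sp le_trans)
  then show ?thesis by (simp add: card_cartesian_product)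
qed

text \<open>Row spaces are closed under addition, so it is enough to generate the single
  rows.\<close>

lemma sp_trans:
  assumes "finite Q" "finite X" "\<And>u. u \<in> X \<Longrightarrow> sm Y {u} \<in> sp Y Q"
  shows "sp Y X \<subseteq> sp Y Q"
proof
  fix a assume "a \<in> sp Y X"
  then obtain S where S: "S \<subseteq> X" "a = sm Y S" by (auto simp: sp_def)
  have "finite S" using S assms(2) finite_subset by blast
  then have "S \<subseteq> X \<Longrightarrow> sm Y S \<in> sp Y Q"
  proof (induction S)
    case (insert u S)
    have "insert u S = sdiff {u} S" using insert by auto
    then have "sm Y (insert u S) = sdiff (sm Y {u}) (sm Y S)"
      using insert by (metis finite.emptyI finite.insertI sm_sdiff)
    then show ?case using insert assms by (auto intro: sp_sdiff)
  qed (simp add: empty_in_sp)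
  with S show "a \<in> sp Y Q" by simp
qed

text \<open>What remains of a subexpression with vertex set \<open>W\<close>: the later operations
  treat vertices of one colour alike, so these have the same neighbours outside of
  \<open>W\<close>.\<close>

definition classes :: "nat \<Rightarrow> 'a set \<Rightarrow> bool" where
  "classes k W \<longleftrightarrow> (\<exists>col. (\<forall>u\<in>W. col u \<in> {1..k}) \<and>
     (\<forall>u\<in>W. \<forall>u'\<in>W. col u = col u' \<longrightarrow> (\<forall>v\<in>V - W. A u v \<longleftrightarrow> A u' v)))"

lemma classes_reps:
  assumes "classes k W" "W \<subseteq> V"
  obtains Q where "Q \<subseteq> W" "card Q \<le> k" "\<And>u. u \<in> W \<Longrightarrow> \<exists>x\<in>Q. \<forall>v\<in>V - W. A u v \<longleftrightarrow> A x v"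
proof -
  obtain col where c: "\<forall>u\<in>W. col u \<in> {1..k}"
    "\<forall>u\<in>W. \<forall>u'\<in>W. col u = col u' \<longrightarrow> (\<forall>v\<in>V - W. A u v \<longleftrightarrow> A u' v)"
    using assms by (auto simp: classes_def)
  define rp where "rp i = (SOME u. u \<in> W \<and> col u = i)" for i
  have rp: "rp (col u) \<in> W \<and> col (rp (col u)) = col u" if "u \<in> W" for u
    unfolding rp_def by (rule someI[of _ u]) (simp add: that)
  show thesis
  proof (rule that)
    show "rp ` (col ` W) \<subseteq> W" using rp by auto
    have "card (rp ` (col ` W)) \<le> card (col ` W)"
      using assms(2) finV finite_subset by (blast intro: card_image_le)
    also have "\<dots> \<le> card {1..k}" using c(1) by (intro card_mono) auto
    finally show "card (rp ` (col ` W)) \<le> k" by simp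
  next
    fix u assume u: "u \<in> W"
    have "col u = col (rp (col u)) \<longrightarrow> (\<forall>v\<in>V - W. A u v \<longleftrightarrow> A (rp (col u)) v)"
      using c(2) u rp[OF u] by blast
    then have "\<forall>v\<in>V - W. A u v \<longleftrightarrow> A (rp (col u)) v" using rp[OF u] by simp
    then show "\<exists>x\<in>rp ` col ` W. \<forall>v\<in>V - W. A u v \<longleftrightarrow> A x v" using u by auto
  qed
qed

text \<open>At most \<open>k\<close> different rows occur, and their representatives generate the
  row space.\<close>

lemma card_sp_classes_rows:
  assumes "classes k W" "W \<subseteq> V"
  shows "card (sp (V - W) W) \<le> 2 ^ k"
proof -
  obtain Q where Q: "Q \<subseteq> W" "card Q \<le> k" "\<And>u. u \<in> W \<Longrightarrow> \<exists>x\<in>Q. \<forall>v\<in>V - W. A u v \<longleftrightarrow> A x v"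
    using classes_reps[OF assms] by blast
  have fin: "finite W" "finite Q" using assms(2) Q(1) finV by (meson finite_subset)+
  have "sp (V - W) W \<subseteq> sp (V - W) Q"
  proof (rule sp_trans[OF fin(2,1)])
    fix u assume "u \<in> W"
    then obtain x where x: "x \<in> Q" "\<forall>v\<in>V - W. A u v \<longleftrightarrow> A x v" using Q(3) by blast
    have "{w. w = z \<and> A w y} = (if A z y then {z} else {})" for z y by auto
    then have "sm (V - W) {z} = {y \<in> V - W. A z y}" for z by (auto simp: sm_def split: if_splits)
    with x have "sm (V - W) {u} = sm (V - W) {x}" by auto
    then show "sm (V - W) {u} \<in> sp (V - W) Q" using x(1) by (auto simp: sp_def)
  qed
  then have "card (sp (V - W) W) \<le> card (sp (V - W) Q)" using fin by (intro card_mono) auto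
  also have "\<dots> \<le> 2 ^ card Q" using fin by (rule_tac card_sp_rows)
  also have "\<dots> \<le> 2 ^ k" using Q(2) by simp
  finally show ?thesis .
qed

text \<open>The vectors counted by \<open>R W\<close> are subsets of \<open>W\<close> that are
  unions of colour classes.\<close>

lemma card_sp_classes_columns:
  assumes "classes k W" "W \<subseteq> V"
  shows "R W \<le> 2 ^ k"
proof -
  obtain col where c: "\<forall>u\<in>W. col u \<in> {1..k}"
    "\<forall>u\<in>W. \<forall>u'\<in>W. col u = col u' \<longrightarrow> (\<forall>v\<in>V - W. A u v \<longleftrightarrow> A u' v)"
    using assms by (auto simp: classes_def)
  have *: "a = {x \<in> W. col x \<in> col ` a}" if aW: "a \<in> sp W (V - W)" for a
  proof -
    obtain S where S: "S \<subseteq> V - W" "a = sm W S" using aW by (auto simp: sp_def)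
    have "x \<in> a" if "x \<in> W" "y \<in> a" "col x = col y" for x y
    proof -
      have "y \<in> W" using that S by (auto simp: sm_def)
      then have "{u \<in> S. A u x} = {u \<in> S. A u y}" using c(2) that S A_sym by blast
      then show ?thesis using that S by (auto simp: sm_def)
    qed
    moreover have "a \<subseteq> W" using S sm_subset by auto
    ultimately show ?thesis by auto
  qed
  have "inj_on (\<lambda>a. col ` a) (sp W (V - W))"
  proof (rule inj_onI)
    fix a b assume "a \<in> sp W (V - W)" "b \<in> sp W (V - W)" and e: "col ` a = col ` b"
    then have "a = {x \<in> W. col x \<in> col ` a}" "b = {x \<in> W. col x \<in> col ` b}" using * by blast+
    with e show "a = b" by simp
  qed
  moreover have "(\<lambda>a. col ` a) ` sp W (V - W) \<subseteq> Pow {1..k}"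
    using c(1) sp_subset_Pow[of W "V - W"] by fastforce
  ultimately have "card (sp W (V - W)) \<le> card (Pow {1..k})"
    by (intro card_inj_on_le) auto
  then show ?thesis by (simp add: card_Pow R_def)
qed

text \<open>Submodularity of the cut rank. The linear map \<open>\<phi>\<close> sends pairs of
  vectors, one for \<open>X\<close> and one for \<open>Y\<close>, onto the space of
  \<open>X \<inter> Y\<close>. Its kernel contains a copy of the space of
  \<open>X \<union> Y\<close>, embedded by restricting a vector to \<open>X\<close> and to
  \<open>Y\<close>. So there are at least as many pairs as the product of the two sizes.\<close>

lemma R_submodular:
  assumes "X \<subseteq> V" "Y \<subseteq> V"
  shows "R (X \<inter> Y) * R (X \<union> Y) \<le> R X * R Y"
proof -
  define P Q where "P = V - X" and "Q = V - Y"
  have fin: "finite P" "finite Q" "finite (P \<inter> Q)" "finite (P \<union> Q)" using finV by (auto simp: P_def Q_def)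
  have PQ: "V - (X \<inter> Y) = P \<union> Q" "V - (X \<union> Y) = P \<inter> Q" by (auto simp: P_def Q_def)
  let ?H = "sp X P \<times> sp Y Q" and ?I = "sp (X \<inter> Y) (P \<union> Q)" and ?K = "sp (X \<union> Y) (P \<inter> Q)"
  define \<phi> where "\<phi> = (\<lambda>(a, b). sdiff (a \<inter> Y) (b \<inter> X))"
  have "\<exists>h\<in>?H. \<phi> h = i" if "i \<in> ?I" for i
  proof -
    obtain S where S: "S \<subseteq> P \<union> Q" "i = sm (X \<inter> Y) S" using \<open>i \<in> ?I\<close> by (auto simp: sp_def)
    have fS: "finite S" using S fin finite_subset by blast
    have "S = sdiff (S \<inter> P) (S - P)" by auto
    then have "i = sdiff (sm (X \<inter> Y) (S \<inter> P)) (sm (X \<inter> Y) (S - P))"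
      using S(2) fS by (metis finite_Diff finite_Int sm_sdiff)
    also have "\<dots> = \<phi> (sm X (S \<inter> P), sm Y (S - P))"
      using sm_Int[of "X \<inter> Y" X] sm_Int[of "X \<inter> Y" Y] sm_subset
      by (auto simp: \<phi>_def sm_def)
    finally have "\<phi> (sm X (S \<inter> P), sm Y (S - P)) = i" by simp
    moreover have "(sm X (S \<inter> P), sm Y (S - P)) \<in> ?H" using S by (auto simp: sp_def)
    ultimately show ?thesis by blast
  qed
  then obtain g where g: "\<And>i. i \<in> ?I \<Longrightarrow> g i \<in> ?H \<and> \<phi> (g i) = i" by metis
  \<comment> \<open>A preimage of \<open>i\<close> under \<open>\<phi>\<close>, shifted by the
    kernel element that comes from \<open>c\<close>. Applying \<open>\<phi>\<close> recovers
    \<open>i\<close>, and the shift then reveals \<open>c\<close>.\<close>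
  define \<theta> where "\<theta> = (\<lambda>(i, c). (sdiff (fst (g i)) (c \<inter> X), sdiff (snd (g i)) (c \<inter> Y)))"
  have cX: "c \<inter> X \<in> sp X P" "c \<inter> Y \<in> sp Y Q" if "c \<in> ?K" for c
    using that sp_restrict[of X "X \<union> Y" "P \<inter> Q"] sp_restrict[of Y "X \<union> Y" "P \<inter> Q"]
      sp_mono_rows[of "P \<inter> Q" P X] sp_mono_rows[of "P \<inter> Q" Q Y] by auto
  have sub: "fst (g i) \<subseteq> X" "snd (g i) \<subseteq> Y" if "i \<in> ?I" for i
    using g[OF that] sp_subset_Pow[of X P] sp_subset_Pow[of Y Q] by (auto simp: mem_Times_iff)
  have "inj_on \<theta> (?I \<times> ?K)"
  proof (rule inj_onI, clarify)
    fix i c j d assume ij: "i \<in> ?I" "j \<in> ?I" and cd: "c \<in> ?K" "d \<in> ?K" and eq: "\<theta> (i, c) = \<theta> (j, d)"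
    have \<phi>\<theta>: "\<phi> (\<theta> (l, e)) = \<phi> (g l)" for l e
      by (auto simp: \<phi>_def \<theta>_def split: prod.splits)
    have "i = j" using g[OF ij(1)] g[OF ij(2)] \<phi>\<theta>[of i c] \<phi>\<theta>[of j d] eq by simp
    have "c \<inter> X = d \<inter> X" "c \<inter> Y = d \<inter> Y"
      using eq unfolding \<open>i = j\<close> \<theta>_def by (auto simp: set_eq_iff)
    moreover have "c \<subseteq> X \<union> Y" "d \<subseteq> X \<union> Y" using cd sp_subset_Pow by auto
    ultimately have "c = d" by blast
    with \<open>i = j\<close> show "i = j \<and> c = d" by simp
  qed
  moreover have "\<theta> ` (?I \<times> ?K) \<subseteq> ?H"
    using g cX fin by (auto simp: \<theta>_def mem_Times_iff intro!: sp_sdiff)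
  ultimately have "card (?I \<times> ?K) \<le> card ?H"
    using fin by (intro card_inj_on_le) auto
  then show ?thesis
    unfolding R_def PQ by (simp add: card_cartesian_product P_def Q_def)
qed

text \<open>Each further row lies in the span of the earlier ones or doubles it; the rows of the
  second kind form a basis.\<close>

lemma basis_exists:
  assumes "finite P"
  shows "\<exists>G\<subseteq>P. sp X G = sp X P \<and> 2 ^ card G = card (sp X P)"
  using assms
proof (induction P)
  case empty
  then show ?case by (simp add: sp_def)
next
  case (insert u P)
  then obtain G where G: "G \<subseteq> P" "sp X G = sp X P" "2 ^ card G = card (sp X P)" by auto
  have fG: "finite G" "u \<notin> G" using G insert finite_subset by auto
  show ?case
  proof (cases "sm X {u} \<in> sp X P")
    case True
    have "sm X {v} \<in> sp X P" if "v \<in> insert u P" for v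
      using that True by (auto simp: sp_def)
    then have "sp X (insert u P) = sp X P"
      using sp_trans[of P "insert u P" X] insert sp_mono_rows[of P "insert u P" X] by auto
    with G show ?thesis by (metis subset_insertI2)
  next
    case False
    have sp_insert: "sp X (insert u Q) = sp X Q \<union> sdiff (sm X {u}) ` sp X Q" if "finite Q" "u \<notin> Q" for Q
    proof -
      have "sm X (insert u S) = sdiff (sm X {u}) (sm X S)" if "S \<subseteq> Q" for S
      proof -
        have "insert u S = sdiff {u} S" using that \<open>u \<notin> Q\<close> by auto
        then show ?thesis using that \<open>finite Q\<close> by (metis finite.emptyI finite.insertI finite_subset sm_sdiff)
      qed
      then have "sm X ` insert u ` Pow Q = sdiff (sm X {u}) ` sm X ` Pow Q"
        unfolding image_image by (rule image_cong[OF refl]) simp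
      then show ?thesis by (simp add: sp_def Pow_insert image_Un)
    qed
    have "sp X (insert u G) = sp X (insert u P)"
      using sp_insert[of G] sp_insert[of P] fG insert G by simp
    moreover have "card (sp X (insert u P)) = 2 * card (sp X P)"
    proof -
      have "sdiff (sm X {u}) a \<noteq> b" if "a \<in> sp X P" "b \<in> sp X P" for a b
      proof
        assume "sdiff (sm X {u}) a = b"
        then have "sm X {u} = sdiff a b" by auto
        then show False using False sp_sdiff[of P a X b] that insert by simp
      qed
      then have "sp X P \<inter> sdiff (sm X {u}) ` sp X P = {}" by blast
      moreover have "inj (sdiff (sm X {u}))"
        by (rule injI) (metis (no_types, lifting) in_sdiff set_eqI)
      then have "card (sdiff (sm X {u}) ` sp X P) = card (sp X P)"
        by (meson card_image inj_on_subset subset_UNIV)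
      ultimately show ?thesis
        using insert by (simp add: sp_insert card_Un_disjoint)
    qed
    ultimately show ?thesis
      using G fG by (intro exI[of _ "insert u G"]) auto
  qed
qed

text \<open>As long as two vectors agree on the columns in \<open>S\<close>, a column on which they
  differ separates at least one more vector. A logarithmic number of columns would be possible, but
  any constant is good enough here.\<close>

lemma seeds_exist:
  assumes "finite Q" "j \<le> card (sp W Q)"
  shows "\<exists>S\<subseteq>W. finite S \<and> card S \<le> j \<and> j \<le> card (sp S Q)"
  using assms(2)
proof (induction j)
  case 0
  then show ?case by auto
next
  case (Suc j)
  then obtain S where S: "S \<subseteq> W" "finite S" "card S \<le> j" "j \<le> card (sp S Q)" by auto
  show ?case
  proof (cases "Suc j \<le> card (sp S Q)")
    case True
    with S show ?thesis by (auto intro!: exI[of _ S])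
  next
    case False
    have "\<not> inj_on (\<lambda>a. a \<inter> S) (sp W Q)"
    proof
      assume "inj_on (\<lambda>a. a \<inter> S) (sp W Q)"
      then have "card (sp S Q) = card (sp W Q)"
        using S(1) by (simp add: sp_restrict[of S W] card_image)
      with False Suc.prems show False by simp
    qed
    then obtain a b where ab: "a \<in> sp W Q" "b \<in> sp W Q" "a \<inter> S = b \<inter> S" "a \<noteq> b"
      by (auto simp: inj_on_def)
    then obtain y where y: "(y \<in> a) \<noteq> (y \<in> b)" by blast
    then have yW: "y \<in> W" using ab sp_subset_Pow by blast
    let ?T = "insert y S"
    have TW: "?T \<subseteq> W" using S yW by auto
    have "a \<inter> ?T \<in> sp ?T Q" "b \<inter> ?T \<in> sp ?T Q" using ab sp_restrict[OF TW] by auto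
    moreover have "a \<inter> ?T \<noteq> b \<inter> ?T" using y by blast
    moreover have "(a \<inter> ?T) \<inter> S = (b \<inter> ?T) \<inter> S" using ab by blast
    ultimately have "\<not> inj_on (\<lambda>a. a \<inter> S) (sp ?T Q)" by (meson inj_onD)
    then have "card ((\<lambda>a. a \<inter> S) ` sp ?T Q) \<noteq> card (sp ?T Q)"
      using assms(1) by (metis eq_card_imp_inj_on finite_sp)
    moreover have "card ((\<lambda>a. a \<inter> S) ` sp ?T Q) \<le> card (sp ?T Q)"
      using assms(1) by (simp add: card_image_le)
    moreover have "(\<lambda>a. a \<inter> S) ` sp ?T Q = sp S Q"
      using sp_restrict[of S ?T Q] by auto
    ultimately have "Suc j \<le> card (sp ?T Q)" using S(4) by simp
    moreover have "card ?T \<le> Suc j" using S by (simp add: card_insert_if)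
    ultimately show ?thesis using TW S(2) by blast
  qed
qed

text \<open>A vertex that agrees with a representative \<open>x\<close> on all test vertices forces every vertex on
  which it differs from \<open>x\<close> into the closure.\<close>

definition bad :: "'a set \<Rightarrow> 'a set \<Rightarrow> ('a \<times> 'a) set" where
  "bad Q T = {(u, v). u \<in> V \<and> v \<in> V \<and> (\<exists>x\<in>Q. (\<forall>c\<in>T. A u c \<longleftrightarrow> A x c) \<and> A u v \<noteq> A x v)}"

definition clos :: "'a set \<Rightarrow> 'a set \<Rightarrow> 'a set" where
  "clos Q T = (bad Q T)\<^sup>* `` Q"

text \<open>The only representative is \<open>v\<close> itself, and \<open>v\<close> differs from
  itself nowhere.\<close>

lemma clos_singleton: "clos {v} T = {v}"
proof -
  have "(bad {v} T)\<^sup>* `` {v} = {v}"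
    by (rule Image_closed_trancl) (auto simp: bad_def)
  then show ?thesis by (simp add: clos_def)
qed

lemma clos_subset: "Q \<subseteq> W \<Longrightarrow> bad Q T `` W \<subseteq> W \<Longrightarrow> clos Q T \<subseteq> W"
  unfolding clos_def by (metis Image_closed_trancl Image_mono order_refl)

lemma clos_bad: "u \<in> clos Q T \<Longrightarrow> (u, v) \<in> bad Q T \<Longrightarrow> v \<in> clos Q T"
  unfolding clos_def by (meson Image_iff rtrancl.rtrancl_into_rtrancl)

text \<open>All that the search for splits has to know about a clique-width expression. The measure
  \<open>f\<close> is quantified because the one to be used depends on the set that is to be
  split.\<close>

definition balanced :: "nat \<Rightarrow> bool" where
  "balanced k \<longleftrightarrow> (\<forall>f th. 2 \<le> th \<longrightarrow> (\<forall>X Y. f (X \<union> Y) \<le> f X * f Y) \<longrightarrow> (\<forall>v. f {v} \<le> (2 :: nat)) \<longrightarrow> th \<le> f V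
     \<longrightarrow> (\<exists>W\<subseteq>V. th \<le> f W \<and> f W \<le> th\<^sup>2 \<and> classes k W))"

text \<open>For each of the \<open>k * k\<close> pairs of colours, one vertex outside of
  \<open>W\<close> on which some vertices of these colours differ, if there is any; the choice of
  the vertices within the colours does not matter.\<close>

lemma tests_exist:
  assumes "classes k W" "W \<subseteq> V"
  obtains T where "T \<subseteq> V - W" "card T \<le> k * k"
    "\<And>x y. x \<in> W \<Longrightarrow> y \<in> W \<Longrightarrow> (\<forall>c\<in>T. A x c \<longleftrightarrow> A y c) \<Longrightarrow> (\<forall>c\<in>V - W. A x c \<longleftrightarrow> A y c)"
proof -
  obtain col where c: "\<forall>u\<in>W. col u \<in> {1..k}"
    "\<forall>u\<in>W. \<forall>u'\<in>W. col u = col u' \<longrightarrow> (\<forall>v\<in>V - W. A u v \<longleftrightarrow> A u' v)"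
    using assms by (auto simp: classes_def)
  define D where "D i j c \<longleftrightarrow> c \<in> V - W \<and> (\<exists>x\<in>W. \<exists>y\<in>W. col x = i \<and> col y = j \<and> A x c \<noteq> A y c)" for i j c
  define g where "g = (\<lambda>(i, j). SOME c. D i j c)"
  define T where "T = g ` {(i, j) \<in> {1..k} \<times> {1..k}. \<exists>c. D i j c}"
  have g: "D i j (g (i, j))" if "D i j c" for i j c
    unfolding g_def using someI[of "D i j", OF that] by simp
  show thesis
  proof (rule that)
    show "T \<subseteq> V - W" unfolding T_def using g by (fastforce simp: D_def)
    have "card T \<le> card ({1..k} \<times> {1..k})"
      unfolding T_def by (rule order_trans[OF card_image_le card_mono])
        (auto intro: finite_subset[of _ "{1..k} \<times> {1..k}"])
    then show "card T \<le> k * k" by simp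
  next
    fix x y assume xy: "x \<in> W" "y \<in> W" "\<forall>c\<in>T. A x c \<longleftrightarrow> A y c"
    show "\<forall>c\<in>V - W. A x c \<longleftrightarrow> A y c"
    proof (rule ccontr)
      assume "\<not> ?thesis"
      then obtain c0 where "D (col x) (col y) c0" using xy by (auto simp: D_def)
      from g[OF this] have Dg: "D (col x) (col y) (g (col x, col y))" .
      then have "g (col x, col y) \<in> T" unfolding T_def using c(1) xy by auto
      then have e: "A x (g (col x, col y)) \<longleftrightarrow> A y (g (col x, col y))" using xy by auto
      from Dg obtain x' y' where "x' \<in> W" "y' \<in> W" "col x' = col x" "col y' = col y"
        "A x' (g (col x, col y)) \<noteq> A y' (g (col x, col y))" "g (col x, col y) \<in> V - W"
        by (auto simp: D_def)
      then show False using c(2) xy e by metis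
    qed
  qed
qed

text \<open>Origin of the constants: applying submodularity with a set of cut rank at most
  \<open>k\<close> costs a factor \<open>2 ^ k\<close>, and comparing \<open>f\<close> with the rank
  of a union costs another one. Both parts must therefore carry at least
  \<open>th = 2 ^ (2 * k)\<close>. A balanced piece carries at most \<open>th\<^sup>2\<close>, which
  leaves \<open>th\<close> for the rest as soon as \<open>R B\<close> exceeds
  \<open>th ^ 3 = 2 ^ (6 * k)\<close>. The additional 1 in the exponent pays for the removal of a
  single vertex, which at most doubles \<open>R B\<close>.\<close>

theorem split_exists:
  assumes k: "1 \<le> k" "balanced k" and B: "B \<subseteq> V" "2 \<le> card B" "R B \<le> 2 ^ (6 * k + 1)"
  shows "\<exists>Q T. Q \<subseteq> V \<and> T \<subseteq> V \<and> Q \<noteq> {} \<and> T \<noteq> {} \<and> card Q \<le> k + 2 ^ (2 * k) \<and> card T \<le> k * k + 1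
     \<and> B \<inter> clos Q T \<noteq> {} \<and> B - clos Q T \<noteq> {}
     \<and> R (B \<inter> clos Q T) \<le> 2 ^ (6 * k + 1) \<and> R (B - clos Q T) \<le> 2 ^ (6 * k + 1)"
proof (cases "2 * R B \<le> 2 ^ (6 * k + 1)")
  case True
  obtain v where v: "v \<in> B" using B(2) by fastforce
  have finB: "finite B" using B(1) finV finite_subset by blast
  have "B - {v} \<noteq> {}"
  proof
    assume "B - {v} = {}"
    then have "B \<subseteq> {v}" by auto
    then have "card B \<le> card {v}" by (intro card_mono) auto
    then show False using B(2) by simp
  qed
  moreover have "R (B \<inter> {v}) \<le> 2 ^ (6 * k + 1)"
  proof -
    have "R (B \<inter> {v}) \<le> 2 ^ card (B \<inter> {v})" unfolding R_def by (rule card_sp_columns) (use finB in simp)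
    also have "\<dots> \<le> 2 ^ 1" using v by (simp add: Int_absorb1)
    also have "\<dots> \<le> 2 ^ (6 * k + 1)" by (rule power_increasing) auto
    finally show ?thesis .
  qed
  moreover have "R (B - {v}) \<le> 2 ^ (6 * k + 1)"
  proof -
    have "V - (B - {v}) = (V - B) \<union> {v}" using v B(1) by auto
    then have "R (B - {v}) \<le> card (sp (B - {v}) (V - B)) * card (sp (B - {v}) {v})"
      unfolding R_def using card_sp_Un_rows[of "V - B" "{v}"] finV by auto
    also have "\<dots> \<le> R B * 2"
      using card_sp_mono[of "B - {v}" B "V - B" "V - B"] card_sp_rows[of "{v}" "B - {v}"] finV
      by (intro mult_mono) (auto simp: R_def)
    finally show ?thesis using True by simp
  qed
  moreover have "1 \<le> k + 2 ^ (2 * k)" using k by simp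
  ultimately show ?thesis
    using v B(1) clos_singleton[of v "{v}"] by (intro exI[of _ "{v}"]) auto
next
  case False
  define th :: nat where "th = 2 ^ (2 * k)"
  have th3: "th ^ 3 < R B"
  proof -
    have "th ^ 3 = 2 ^ (6 * k)" by (simp add: th_def flip: power_mult)
    then show ?thesis using False by simp
  qed
  have th2: "2 \<le> th" using k power_increasing[of 1 "2 * k" "2 :: nat"] by (simp add: th_def)
  define f where "f X = card (sp (B \<inter> X) (V - B))" for X
  have finVB: "finite (V - B)" using finV by simp
  have fmono: "f X \<le> f Y" if "X \<subseteq> Y" for X Y
    unfolding f_def using that finV by (intro card_sp_mono) auto
  have fV: "f V = R B" using B(1) by (simp add: f_def R_def Int_absorb2)
  have fUn: "f (X \<union> Y) \<le> f X * f Y" for X Y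
    unfolding f_def Int_Un_distrib using finVB by (rule card_sp_Un_columns)
  have f1: "f {v} \<le> 2" for v
  proof -
    have "f {v} \<le> 2 ^ card (B \<inter> {v})" unfolding f_def by (rule card_sp_columns) simp
    also have "\<dots> \<le> 2 ^ 1" by (rule power_increasing) (auto simp: card_le_Suc0_iff_eq)
    finally show ?thesis by simp
  qed
  have f0: "f {} = 1" by (simp add: f_def sp_empty)
  have "th \<le> f V"
    unfolding fV using th3 th2 self_le_power[of th 3] by linarith
  with k(2) th2 f1 fUn have "\<exists>W\<subseteq>V. th \<le> f W \<and> f W \<le> th\<^sup>2 \<and> classes k W"
    unfolding balanced_def by simp
  then obtain W where W: "W \<subseteq> V" "th \<le> f W" "f W \<le> th\<^sup>2" "classes k W"
    by blast
  have fVW: "th \<le> f (V - W)"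
  proof (rule ccontr)
    assume "\<not> th \<le> f (V - W)"
    then have "f W * f (V - W) \<le> th\<^sup>2 * th" using W(3) by (intro mult_mono) auto
    moreover have "f V \<le> f W * f (V - W)" using fUn[of W "V - W"] W(1) by (simp add: Un_absorb1)
    ultimately show False using fV th3 by (simp add: power2_eq_square power3_eq_cube)
  qed
  obtain T where T: "T \<subseteq> V - W" "card T \<le> k * k"
    "\<And>x y. x \<in> W \<Longrightarrow> y \<in> W \<Longrightarrow> (\<forall>c\<in>T. A x c \<longleftrightarrow> A y c) \<Longrightarrow> (\<forall>c\<in>V - W. A x c \<longleftrightarrow> A y c)"
    using tests_exist[OF W(4,1)] by blast
  have "V - W \<noteq> {}"
  proof
    assume "V - W = {}"
    then have "th \<le> f {}" using fVW by metis
    with f0 th2 show False by simp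
  qed
  then obtain t where t: "t \<in> V - W" by blast
  \<comment> \<open>\<open>T\<close> may be empty, but only a nonempty set can be listed by a tuple
    of fixed length. A further test vertex outside of \<open>W\<close> does no harm.\<close>
  define T' where "T' = insert t T"
  have T': "T' \<subseteq> V - W" "T' \<noteq> {}" "card T' \<le> k * k + 1"
    "\<And>x y. x \<in> W \<Longrightarrow> y \<in> W \<Longrightarrow> (\<forall>c\<in>T'. A x c \<longleftrightarrow> A y c) \<Longrightarrow> (\<forall>c\<in>V - W. A x c \<longleftrightarrow> A y c)"
  proof -
    have "finite T" using T(1) finV finite_subset by blast
    then show "card T' \<le> k * k + 1" using T(2) by (simp add: T'_def card_insert_if)
    show "(\<forall>c\<in>V - W. A x c \<longleftrightarrow> A y c)" if "x \<in> W" "y \<in> W" "(\<forall>c\<in>T'. A x c \<longleftrightarrow> A y c)" for x y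
      using T(3)[OF that(1,2)] that(3) by (simp add: T'_def)
  qed (use T t in \<open>auto simp: T'_def\<close>)
  obtain Q where Q: "Q \<subseteq> W" "card Q \<le> k" "\<And>u. u \<in> W \<Longrightarrow> \<exists>x\<in>Q. \<forall>v\<in>V - W. A u v \<longleftrightarrow> A x v"
    using classes_reps[OF W(4,1)] by blast
  \<comment> \<open>The closure will contain these seeds, so \<open>f\<close> is at least
    \<open>th\<close> on it even if it is much smaller than \<open>W\<close>.\<close>
  obtain S where S: "S \<subseteq> B \<inter> W" "finite S" "card S \<le> th" "th \<le> card (sp S (V - B))"
    using seeds_exist[of "V - B" th "B \<inter> W"] W(2) finVB by (auto simp: f_def)
  define Q' where "Q' = Q \<union> S"
  have Q': "Q' \<subseteq> W" "card Q' \<le> k + th" "Q' \<noteq> {}"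
  proof -
    show "Q' \<subseteq> W" using Q S by (auto simp: Q'_def)
    show "card Q' \<le> k + th" using card_Un_le[of Q S] Q S by (simp add: Q'_def)
    have "S \<noteq> {}"
    proof
      assume "S = {}"
      then have "card (sp S (V - B)) = 1" by (simp add: sp_empty)
      then show False using S(4) th2 by simp
    qed
    then show "Q' \<noteq> {}" by (simp add: Q'_def)
  qed
  define Z where "Z = clos Q' T'"
  \<comment> \<open>A vertex of \<open>W\<close> that agrees with a representative on the tests
    agrees with it everywhere outside of \<open>W\<close>. So the vertices that it forces into the
    closure belong to \<open>W\<close>.\<close>
  have ZW: "Z \<subseteq> W"
    unfolding Z_def
  proof (rule clos_subset[OF Q'(1)], clarify)
    fix u v assume u: "u \<in> W" and "(u, v) \<in> bad Q' T'"
    then obtain x where x: "x \<in> Q'" "\<forall>c\<in>T'. A u c \<longleftrightarrow> A x c" "A u v \<noteq> A x v" "v \<in> V"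
      by (auto simp: bad_def)
    then have "\<forall>c\<in>V - W. A u c \<longleftrightarrow> A x c" using T'(4)[of u x] u Q'(1) by blast
    with x show "v \<in> W" by blast
  qed
  have Q'Z: "Q' \<subseteq> Z" by (auto simp: Z_def clos_def)
  have ZV: "Z \<subseteq> V" using ZW W(1) by blast
  \<comment> \<open>Two vertices of \<open>Z\<close> with the same colour in \<open>W\<close> share
    a representative. A vertex outside of \<open>Z\<close> on which one of them differed from it
    would have been forced into \<open>Z\<close>.\<close>
  have clZ: "classes k Z"
  proof -
    obtain col where c: "\<forall>u\<in>W. col u \<in> {1..k}"
      "\<forall>u\<in>W. \<forall>u'\<in>W. col u = col u' \<longrightarrow> (\<forall>v\<in>V - W. A u v \<longleftrightarrow> A u' v)"
      using W(4) by (auto simp: classes_def)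
    have step: "A u v \<longleftrightarrow> A x v" if "u \<in> Z" "x \<in> Q'" "\<forall>v\<in>V - W. A u v \<longleftrightarrow> A x v" "v \<in> V - Z" for u x v
    proof (rule ccontr)
      assume "A u v \<noteq> A x v"
      then have "(u, v) \<in> bad Q' T'" using that T'(1) ZV unfolding bad_def by blast
      then show False using clos_bad[of u Q' T' v] that by (simp add: Z_def)
    qed
    have "A u v \<longleftrightarrow> A u' v" if u: "u \<in> Z" "u' \<in> Z" "col u = col u'" "v \<in> V - Z" for u u' v
    proof -
      obtain x where x: "x \<in> Q'" "\<forall>v\<in>V - W. A u v \<longleftrightarrow> A x v" using Q(3)[of u] u(1) ZW unfolding Q'_def by blast
      have "\<forall>v\<in>V - W. A u v \<longleftrightarrow> A u' v" using c(2) u ZW by blast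
      then have "\<forall>v\<in>V - W. A u' v \<longleftrightarrow> A x v" using x(2) by simp
      then show ?thesis using step[of u x v] step[of u' x v] x u by simp
    qed
    then show ?thesis using c(1) ZW unfolding classes_def by blast
  qed
  have RZ: "R Z \<le> 2 ^ k" using card_sp_classes_columns[OF clZ ZV] .
  have RVZ: "card (sp (V - Z) Z) \<le> 2 ^ k" using card_sp_classes_rows[OF clZ ZV] .
  then have RVZ': "R (V - Z) \<le> 2 ^ k" using ZV by (simp add: R_def double_diff)
  have fZ: "th \<le> f Z"
  proof -
    have "B \<inter> S = S" using S(1) by auto
    then have "th \<le> f S" using S(4) by (simp add: f_def)
    also have "\<dots> \<le> f Z" using Q'Z by (intro fmono) (auto simp: Q'_def)
    finally show ?thesis .
  qed
  have fVZ: "th \<le> f (V - Z)" using fVW fmono[of "V - W" "V - Z"] ZW by (meson Diff_mono le_trans order_refl)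
  have finZ: "finite Z" using ZV finV finite_subset by blast
  have thk: "th = 2 ^ k * 2 ^ k" by (simp add: th_def flip: power_add)
  \<comment> \<open>\<open>x\<close> is the part whose rank is to be bounded and \<open>y\<close>
    the union in the submodular inequality; the two factors \<open>2 ^ k\<close> make up
    \<open>th\<close> and cancel.\<close>
  have cancel: "x \<le> R B" if "x * y \<le> R B * 2 ^ k" "th \<le> y * 2 ^ k" for x y :: nat
  proof -
    have "x * th \<le> x * y * 2 ^ k" using that(2) by (simp add: mult.assoc)
    also have "\<dots> \<le> R B * 2 ^ k * 2 ^ k" using that(1) by (intro mult_right_mono) auto
    finally have "x * th \<le> R B * th" by (simp add: thk mult.assoc)
    then show ?thesis using th2 by simp
  qed
  have "R (B \<inter> Z) \<le> R B"
  proof (rule cancel)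
    show "R (B \<inter> Z) * R (B \<union> Z) \<le> R B * 2 ^ k"
      using R_submodular[OF B(1) ZV] RZ by (meson le_trans mult_le_mono2)
    \<comment> \<open>Among the rows outside of \<open>B\<close>, those in \<open>Z - B\<close>
      contribute at most the factor \<open>2 ^ k\<close>, because \<open>Z\<close> has
      \<open>k\<close> classes. The others lie outside of \<open>B \<union> Z\<close> and are
      accounted for by \<open>R (B \<union> Z)\<close>.\<close>
    have "f (V - Z) = card (sp (B - Z) ((V - (B \<union> Z)) \<union> (Z - B)))"
    proof -
      have "B \<inter> (V - Z) = B - Z" "V - B = (V - (B \<union> Z)) \<union> (Z - B)" using B(1) ZV by auto
      then show ?thesis by (simp add: f_def)
    qed
    also have "\<dots> \<le> card (sp (B - Z) (V - (B \<union> Z))) * card (sp (B - Z) (Z - B))"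
      using finV finZ by (intro card_sp_Un_rows) auto
    also have "\<dots> \<le> R (B \<union> Z) * 2 ^ k"
    proof (intro mult_mono)
      show "card (sp (B - Z) (V - (B \<union> Z))) \<le> R (B \<union> Z)"
        unfolding R_def using finV by (intro card_sp_mono) auto
      have "card (sp (B - Z) (Z - B)) \<le> card (sp (V - Z) Z)"
        using finZ B(1) by (intro card_sp_mono) auto
      with RVZ show "card (sp (B - Z) (Z - B)) \<le> 2 ^ k" by simp
    qed auto
    finally show "th \<le> R (B \<union> Z) * 2 ^ k" using fVZ by simp
  qed
  moreover have "R (B - Z) \<le> R B"
  proof (rule cancel)
    have "B \<inter> (V - Z) = B - Z" using B(1) by auto
    then show "R (B - Z) * R (B \<union> (V - Z)) \<le> R B * 2 ^ k"
      using R_submodular[OF B(1), of "V - Z"] RVZ' by (metis Diff_subset le_trans mult_le_mono2)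
    have "f Z = card (sp (B \<inter> Z) ((Z - B) \<union> (V - (B \<union> Z))))"
    proof -
      have "V - B = (Z - B) \<union> (V - (B \<union> Z))" using ZV by auto
      then show ?thesis by (simp add: f_def)
    qed
    also have "\<dots> \<le> card (sp (B \<inter> Z) (Z - B)) * card (sp (B \<inter> Z) (V - (B \<union> Z)))"
      using finV finZ by (intro card_sp_Un_rows) auto
    also have "\<dots> \<le> R (B \<union> (V - Z)) * 2 ^ k"
    proof (intro mult_mono)
      show "card (sp (B \<inter> Z) (Z - B)) \<le> R (B \<union> (V - Z))"
        unfolding R_def using finV ZV by (intro card_sp_mono) auto
      have "card (sp (B \<inter> Z) (V - (B \<union> Z))) \<le> R Z"
        unfolding R_def using finV by (intro card_sp_mono) auto
      with RZ show "card (sp (B \<inter> Z) (V - (B \<union> Z))) \<le> 2 ^ k" by simp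
    qed auto
    finally show "th \<le> R (B \<union> (V - Z)) * 2 ^ k" using fZ by simp
  qed
  moreover have "B \<inter> Z \<noteq> {}"
  proof
    assume "B \<inter> Z = {}"
    then have "f Z = f {}" by (simp add: f_def)
    with fZ f0 th2 show False by simp
  qed
  moreover have "B - Z \<noteq> {}"
  proof
    assume "B - Z = {}"
    then have "f (V - Z) = f {}" unfolding f_def by (metis Diff_disjoint Diff_eq_empty_iff Int_Diff Int_commute Int_empty_right inf.absorb_iff2)
    with fVZ f0 th2 show False by simp
  qed
  ultimately show ?thesis
    using B(3) Q' T' W(1) th_def unfolding Z_def
    by (intro exI[of _ Q'] exI[of _ T']) auto
qed

end

subsection \<open>Balanced pieces of a clique-width expression\<close>

text \<open>Descent into the expression until a union with measure at most \<open>th\<^sup>2\<close>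
  or a single vertex is reached: at a union of larger measure, one of the parts still has measure at
  least \<open>th\<close>, since \<open>f\<close> is submultiplicative. \<open>D\<close> records the
  adjacencies that the operations above the current subexpression add, as a relation on its current
  colours.\<close>

lemma cw_built_balanced:
  fixes f :: "'v set \<Rightarrow> nat"
  assumes "cw_built k H c" and th: "2 \<le> th" and fUn: "\<And>X Y. f (X \<union> Y) \<le> f X * f Y" and f1: "\<And>v. f {v} \<le> 2"
    and "th \<le> f (pverts H)" "pverts H \<subseteq> V"
    and "\<And>u v. u \<in> pverts H \<Longrightarrow> v \<in> pverts H \<Longrightarrow> A u v \<longleftrightarrow> (u, v) \<in> parcs H \<or> D (the (c u)) (the (c v))"
    and "\<And>u u' v. u \<in> pverts H \<Longrightarrow> u' \<in> pverts H \<Longrightarrow> c u = c u' \<Longrightarrow> v \<in> V - pverts H \<Longrightarrow> A u v \<longleftrightarrow> A u' v"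
  shows "\<exists>W\<subseteq>V. th \<le> f W \<and> f W \<le> th\<^sup>2 \<and> (\<exists>col. (\<forall>u\<in>W. col u \<in> {1..k}) \<and>
     (\<forall>u\<in>W. \<forall>u'\<in>W. col u = col u' \<longrightarrow> (\<forall>v\<in>V - W. A u v \<longleftrightarrow> A u' v)))"
proof -
  have dom: "dom c = pverts H \<and> ran c \<subseteq> {1..k} \<and> parcs H \<subseteq> pverts H \<times> pverts H" if "cw_built k H c" for H c
    using that
  proof induction
    case (disjoint_union G c H d)
    have "ran (c ++ d) \<subseteq> ran c \<union> ran d" by (auto simp: ran_def map_add_Some_iff)
    with disjoint_union show ?case by auto
  next
    case (add_edges G c i j)
    then show ?case by auto
  next
    case (recolour G c i j)
    then show ?case by (auto simp: ran_def dom_def split: if_splits)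
  next
    case (vertex i v)
    then show ?case by (auto simp: ran_def split: if_splits)
  qed
  show ?thesis
    using assms(1,5-)
  proof (induction arbitrary: D)
    case (vertex i v)
    have "f {v} \<le> th\<^sup>2" using f1[of v] th by (meson le_trans self_le_power zero_less_numeral le_numeral_extra(4) one_le_numeral)
    then show ?case using vertex
      by (intro exI[of _ "{v}"]) (auto intro!: exI[of _ "\<lambda>_. i"])
  next
    case (disjoint_union G c1 H d)
    let ?U = "pverts G \<union> pverts H"
    have dG: "dom c1 = pverts G" "dom d = pverts H" "parcs G \<subseteq> pverts G \<times> pverts G" "parcs H \<subseteq> pverts H \<times> pverts H"
      "ran c1 \<subseteq> {1..k}" "ran d \<subseteq> {1..k}"
      using dom disjoint_union.hyps by blast+
    have cG: "(c1 ++ d) u = c1 u" if "u \<in> pverts G" for u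
      using that dG disjoint_union.hyps(3) by (simp add: map_add_dom_app_simps(3) disjoint_iff)
    have cH: "(c1 ++ d) u = d u" if "u \<in> pverts H" for u
      using that dG by (simp add: map_add_dom_app_simps(1))
    have rk: "the ((c1 ++ d) u) \<in> {1..k}" if "u \<in> ?U" for u
    proof (cases "u \<in> pverts G")
      case True
      then obtain a where "c1 u = Some a" using dG(1) by blast
      then show ?thesis using cG[OF True] dG(5) by (auto simp: ran_def)
    next
      case False
      then have u: "u \<in> pverts H" using that by blast
      then obtain a where "d u = Some a" using dG(2) by blast
      then show ?thesis using cH[OF u] dG(6) by (auto simp: ran_def)
    qed
    have Ad: "A u v \<longleftrightarrow> ((u, v) \<in> parcs G \<union> parcs H) \<or> D (the ((c1 ++ d) u)) (the ((c1 ++ d) v))"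
      if "u \<in> ?U" "v \<in> ?U" for u v
      using disjoint_union.prems(3)[of u v] that by simp
    have Ao: "A u v \<longleftrightarrow> A u' v" if "u \<in> ?U" "u' \<in> ?U" "(c1 ++ d) u = (c1 ++ d) u'" "v \<in> V - ?U" for u u' v
      using disjoint_union.prems(4)[of u u' v] that by simp
    show ?case
    proof (cases "f ?U \<le> th\<^sup>2")
      case True
      have nn: "(c1 ++ d) u \<noteq> None" if "u \<in> ?U" for u
      proof
        assume "(c1 ++ d) u = None"
        then have "u \<notin> dom c1" "u \<notin> dom d" by auto
        with that dG(1,2) show False by simp
      qed
      have eqc: "the ((c1 ++ d) u) = the ((c1 ++ d) u') \<Longrightarrow> (c1 ++ d) u = (c1 ++ d) u'" if U: "u \<in> ?U" "u' \<in> ?U" for u u'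
      proof -
        have *: "the x = the y \<Longrightarrow> x = y" if "x \<noteq> None" "y \<noteq> None" for x y :: "nat option"
          using that by auto
        show "the ((c1 ++ d) u) = the ((c1 ++ d) u') \<Longrightarrow> (c1 ++ d) u = (c1 ++ d) u'"
          by (rule *[OF nn[OF U(1)] nn[OF U(2)]])
      qed
      let ?col = "\<lambda>u. the ((c1 ++ d) u)"
      have "\<forall>u\<in>?U. \<forall>u'\<in>?U. ?col u = ?col u' \<longrightarrow> (\<forall>v\<in>V - ?U. A u v \<longleftrightarrow> A u' v)"
      proof (intro ballI impI)
        fix u u' v assume "u \<in> ?U" "u' \<in> ?U" "?col u = ?col u'" "v \<in> V - ?U"
        with eqc[of u u'] Ao[of u u' v] show "A u v \<longleftrightarrow> A u' v" by simp
      qed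
      moreover have "\<forall>u\<in>?U. ?col u \<in> {1..k}" using rk by (rule ballI)
      moreover have "th \<le> f ?U" "?U \<subseteq> V" using disjoint_union.prems(1,2) by simp_all
      ultimately show ?thesis using True
        by (intro exI[of _ ?U] conjI exI[of _ ?col])
    next
      case False
      have "th \<le> f (pverts G) \<or> th \<le> f (pverts H)"
      proof (rule ccontr)
        assume "\<not> ?thesis"
        then have "f (pverts G) * f (pverts H) \<le> th * th" by (intro mult_mono) auto
        with fUn[of "pverts G" "pverts H"] False show False by (simp add: power2_eq_square)
      qed
      then show ?thesis
      proof
        assume th: "th \<le> f (pverts G)"
        show ?thesis
        proof (rule disjoint_union.IH(1)[of D, OF th])
          show "pverts G \<subseteq> V" using disjoint_union.prems(2) by simp
          fix u v assume uv: "u \<in> pverts G" "v \<in> pverts G"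
          then have "(u, v) \<notin> parcs H" using dG(3,4) disjoint_union.hyps(3) by auto
          with uv show "A u v \<longleftrightarrow> (u, v) \<in> parcs G \<or> D (the (c1 u)) (the (c1 v))" using Ad[of u v] cG by simp
        next
          fix u u' v assume uv: "u \<in> pverts G" "u' \<in> pverts G" "c1 u = c1 u'" "v \<in> V - pverts G"
          show "A u v \<longleftrightarrow> A u' v"
          \<comment> \<open>There are no arcs between the two parts yet. Adjacency to the other part
            thus comes from \<open>D\<close> alone and depends on colours only.\<close>
          proof (cases "v \<in> pverts H")
            case True
            then have "(x, v) \<notin> parcs G \<union> parcs H" if "x \<in> pverts G" for x
              using that dG(3,4) disjoint_union.hyps(3) by auto
            then show ?thesis using Ad[of u v] Ad[of u' v] uv True cG cH by simp
          next
            case False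
            then show ?thesis using Ao[of u u' v] uv cG by simp
          qed
        qed
      next
        assume th: "th \<le> f (pverts H)"
        show ?thesis
        proof (rule disjoint_union.IH(2)[of D, OF th])
          show "pverts H \<subseteq> V" using disjoint_union.prems(2) by simp
          fix u v assume uv: "u \<in> pverts H" "v \<in> pverts H"
          then have "(u, v) \<notin> parcs G" using dG(3,4) disjoint_union.hyps(3) by auto
          with uv show "A u v \<longleftrightarrow> (u, v) \<in> parcs H \<or> D (the (d u)) (the (d v))" using Ad[of u v] cH by simp
        next
          fix u u' v assume uv: "u \<in> pverts H" "u' \<in> pverts H" "d u = d u'" "v \<in> V - pverts H"
          show "A u v \<longleftrightarrow> A u' v"
          proof (cases "v \<in> pverts G")
            case True
            then have "(x, v) \<notin> parcs G \<union> parcs H" if "x \<in> pverts H" for x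
              using that dG(3,4) disjoint_union.hyps(3) by auto
            then show ?thesis using Ad[of u v] Ad[of u' v] uv True cG cH by simp
          next
            case False
            then show ?thesis using Ao[of u u' v] uv cH by simp
          qed
        qed
      qed
    qed
  next
    case (add_edges G c i j)
    have dG: "dom c = pverts G" using dom add_edges.hyps by blast
    show ?case
    \<comment> \<open>On the way down, the edges of this operation move from the graph into the
      relation on colours.\<close>
    proof (rule add_edges.IH[of "\<lambda>a b. D a b \<or> a = i \<and> b = j \<or> a = j \<and> b = i"])
      fix u v assume uv: "u \<in> pverts G" "v \<in> pverts G"
      then obtain a b where "c u = Some a" "c v = Some b" using dG by blast
      with add_edges.prems(3)[of u v] uv
      show "A u v \<longleftrightarrow> (u, v) \<in> parcs G \<or> D (the (c u)) (the (c v)) \<or> the (c u) = i \<and> the (c v) = j \<or> the (c u) = j \<and> the (c v) = i"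
        by auto
    next
      fix u u' v assume "u \<in> pverts G" "u' \<in> pverts G" "c u = c u'" "v \<in> V - pverts G"
      then show "A u v \<longleftrightarrow> A u' v" using add_edges.prems(4)[of u u' v] by simp
    qed (use add_edges.prems(1,2) in simp_all)
  next
    case (recolour G c i j)
    have dG: "dom c = pverts G" using dom recolour.hyps by blast
    define g where "g a = (if a = i then j else a)" for a
    show ?case
    \<comment> \<open>The colours below are the old ones, so the relation is pulled back along the
      recolouring.\<close>
    proof (rule recolour.IH[of "\<lambda>a b. D (g a) (g b)"])
      fix u v assume uv: "u \<in> pverts G" "v \<in> pverts G"
      then obtain a b where "c u = Some a" "c v = Some b" using dG by blast
      with recolour.prems(3)[of u v] uv
      show "A u v \<longleftrightarrow> (u, v) \<in> parcs G \<or> D (g (the (c u))) (g (the (c v)))"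
        by (simp add: g_def)
    next
      fix u u' v assume "u \<in> pverts G" "u' \<in> pverts G" "c u = c u'" "v \<in> V - pverts G"
      then show "A u v \<longleftrightarrow> A u' v" using recolour.prems(4)[of u u' v] by simp
    qed (use recolour.prems(1,2) in simp_all)
  qed
qed

section \<open>Composing monadic second-order types\<close>

text \<open>Vertex and set variables become set variables \<open>2 x\<close> and \<open>2 X + 1\<close>; the first component of
  \<open>Atm\<close>, \<open>Bin\<close> and \<open>Qn\<close> is the letter of the connective in \<^const>\<open>formula_word\<close>.\<close>

datatype fm = Atm nat nat nat | Ng fm | Bin nat fm fm | Qn nat nat fm

primrec conv :: "mso \<Rightarrow> fm" where
  "conv (Edge x y) = Atm 2 (2 * x) (2 * y)"
| "conv (Less x y) = Atm 3 (2 * x) (2 * y)"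
| "conv (Equal x y) = Atm 4 (2 * x) (2 * y)"
| "conv (Member x X) = Atm 5 (2 * x) (2 * X + 1)"
| "conv (Neg p) = Ng (conv p)"
| "conv (Conj p q) = Bin 7 (conv p) (conv q)"
| "conv (Disj p q) = Bin 8 (conv p) (conv q)"
| "conv (ExV x p) = Qn 9 (2 * x) (conv p)"
| "conv (AllV x p) = Qn 10 (2 * x) (conv p)"
| "conv (ExS X p) = Qn 11 (2 * X + 1) (conv p)"
| "conv (AllS X p) = Qn 12 (2 * X + 1) (conv p)"

text \<open>Membership needs no relation of its own: a vertex variable denotes a singleton, so both
  equality and membership say that the two sets have a common element.\<close>

definition rel :: "('v \<Rightarrow> 'v \<Rightarrow> bool) \<Rightarrow> 'v rel \<Rightarrow> nat \<Rightarrow> 'v \<Rightarrow> 'v \<Rightarrow> bool" where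
  "rel A r c u v \<longleftrightarrow> (if c = 2 then A u v else if c = 3 then (u, v) \<in> r else u = v)"

primrec satf :: "'v set \<Rightarrow> ('v \<Rightarrow> 'v \<Rightarrow> bool) \<Rightarrow> 'v rel \<Rightarrow> (nat \<Rightarrow> 'v set) \<Rightarrow> fm \<Rightarrow> bool" where
  "satf V A r \<sigma> (Atm c X Y) \<longleftrightarrow> (\<exists>u\<in>\<sigma> X. \<exists>v\<in>\<sigma> Y. rel A r c u v)"
| "satf V A r \<sigma> (Ng p) \<longleftrightarrow> \<not> satf V A r \<sigma> p"
| "satf V A r \<sigma> (Bin c p q) \<longleftrightarrow>
     (if c = 7 then satf V A r \<sigma> p \<and> satf V A r \<sigma> q else satf V A r \<sigma> p \<or> satf V A r \<sigma> q)"
| "satf V A r \<sigma> (Qn c v p) \<longleftrightarrow>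
     (if c = 9 then \<exists>S\<subseteq>V. card S = 1 \<and> satf V A r (\<sigma>(v := S)) p
      else if c = 10 then \<forall>S\<subseteq>V. card S = 1 \<longrightarrow> satf V A r (\<sigma>(v := S)) p
      else if c = 11 then \<exists>S\<subseteq>V. satf V A r (\<sigma>(v := S)) p
      else \<forall>S\<subseteq>V. satf V A r (\<sigma>(v := S)) p)"

lemma ex_card_1: "(\<exists>S\<subseteq>V. card S = 1 \<and> P S) \<longleftrightarrow> (\<exists>v\<in>V. P {v})"
  and all_card_1: "(\<forall>S\<subseteq>V. card S = 1 \<longrightarrow> P S) \<longleftrightarrow> (\<forall>v\<in>V. P {v})"
  by (auto simp: card_1_singleton_iff)

lemma odd_neq_even: "Suc (2 * m) \<noteq> 2 * n" "2 * n \<noteq> Suc (2 * m)" for m n :: nat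
  by presburger+

lemma sat_satf:
  assumes "\<And>x. x \<in> free_vvars \<phi> \<Longrightarrow> \<sigma> (2 * x) = {a x}" "\<And>X. X \<in> free_svars \<phi> \<Longrightarrow> \<sigma> (2 * X + 1) = AA X"
  shows "sat G r a AA \<phi> \<longleftrightarrow> satf (pverts G) (\<lambda>u v. (u, v) \<in> parcs G) r \<sigma> (conv \<phi>)"
  using assms
proof (induction \<phi> arbitrary: \<sigma> a AA)
  case (ExV x p)
  have "sat G r (a(x := v)) AA p = satf (pverts G) (\<lambda>u v. (u, v) \<in> parcs G) r (\<sigma>(2 * x := {v})) (conv p)" for v
    using ExV.prems by (intro ExV.IH) (auto simp: odd_neq_even)
  then show ?case by (simp add: ex_card_1[simplified])
next
  case (AllV x p)
  have "sat G r (a(x := v)) AA p = satf (pverts G) (\<lambda>u v. (u, v) \<in> parcs G) r (\<sigma>(2 * x := {v})) (conv p)" for v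
    using AllV.prems by (intro AllV.IH) (auto simp: odd_neq_even)
  then show ?case by (simp add: all_card_1[simplified])
next
  case (ExS X p)
  have "sat G r a (AA(X := S)) p = satf (pverts G) (\<lambda>u v. (u, v) \<in> parcs G) r (\<sigma>(2 * X + 1 := S)) (conv p)" for S
    using ExS.prems by (intro ExS.IH) (auto simp: odd_neq_even)
  then show ?case by simp
next
  case (AllS X p)
  have "sat G r a (AA(X := S)) p = satf (pverts G) (\<lambda>u v. (u, v) \<in> parcs G) r (\<sigma>(2 * X + 1 := S)) (conv p)" for S
    using AllS.prems by (intro AllS.IH) (auto simp: odd_neq_even)
  then show ?case by simp
next
  case (Conj p q)
  have "sat G r a AA p = satf (pverts G) (\<lambda>u v. (u, v) \<in> parcs G) r \<sigma> (conv p)"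
    "sat G r a AA q = satf (pverts G) (\<lambda>u v. (u, v) \<in> parcs G) r \<sigma> (conv q)"
    using Conj.prems by (intro Conj.IH; simp)+
  then show ?case by simp
next
  case (Disj p q)
  have "sat G r a AA p = satf (pverts G) (\<lambda>u v. (u, v) \<in> parcs G) r \<sigma> (conv p)"
    "sat G r a AA q = satf (pverts G) (\<lambda>u v. (u, v) \<in> parcs G) r \<sigma> (conv q)"
    using Disj.prems by (intro Disj.IH; simp)+
  then show ?case by simp
next
  case (Neg p)
  have "sat G r a AA p = satf (pverts G) (\<lambda>u v. (u, v) \<in> parcs G) r \<sigma> (conv p)"
    using Neg.prems by (intro Neg.IH; simp)
  then show ?case by simp
qed (auto simp: rel_def)

text \<open>The type of an atom records the labels of the values of its two variables, and with \<open>Done\<close>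
  whether the atom already holds. \<open>Star\<close> is always present, so that in a combination of two pieces
  the tokens of either piece also survive on their own.\<close>

datatype tk = Star | Done | XT nat | YT nat

primrec tcode :: "tk \<Rightarrow> nat" where
  "tcode Star = 0"
| "tcode Done = 1"
| "tcode (XT a) = 2 + 2 * a"
| "tcode (YT a) = 3 + 2 * a"

definition tdec :: "nat \<Rightarrow> tk" where
  "tdec n = (if n = 0 then Star else if n = 1 then Done else if even n then XT ((n - 2) div 2) else YT ((n - 3) div 2))"

lemma tdec_tcode [simp]: "tdec (tcode t) = t"
  by (cases t) (auto simp: tdec_def)

lemma one_in_tcode: "Suc 0 \<in> tcode ` T \<longleftrightarrow> Done \<in> T"
proof -
  have "Suc 0 = tcode t \<longleftrightarrow> t = Done" for t by (cases t) auto
  then show ?thesis by (simp add: image_iff)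
qed

definition toks :: "('v \<Rightarrow> 'v \<Rightarrow> bool) \<Rightarrow> 'v rel \<Rightarrow> ('v \<Rightarrow> nat) \<Rightarrow> nat \<Rightarrow> 'v set \<Rightarrow> 'v set \<Rightarrow> tk set" where
  "toks A r lab c S T = {Star} \<union> {t. t = Done \<and> (\<exists>u\<in>S. \<exists>v\<in>T. rel A r c u v)}
     \<union> (\<lambda>u. XT (lab u)) ` S \<union> (\<lambda>u. YT (lab u)) ` T"

text \<open>The complete tree of choices for the quantifiers; no connective is evaluated before the
  root. Sizes are cut off at 2, which still identifies singletons and is compatible with disjoint
  unions. Types are numbers in order to serve as table entries and table arguments.\<close>

primrec st :: "('v \<Rightarrow> 'v \<Rightarrow> bool) \<Rightarrow> 'v rel \<Rightarrow> ('v \<Rightarrow> nat) \<Rightarrow> 'v set \<Rightarrow> (nat \<Rightarrow> 'v set) \<Rightarrow> fm \<Rightarrow> nat" where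
  "st A r lab B \<sigma> (Atm c X Y) = set_encode (tcode ` toks A r lab c (\<sigma> X \<inter> B) (\<sigma> Y \<inter> B))"
| "st A r lab B \<sigma> (Ng p) = st A r lab B \<sigma> p"
| "st A r lab B \<sigma> (Bin c p q) = prod_encode (st A r lab B \<sigma> p, st A r lab B \<sigma> q)"
| "st A r lab B \<sigma> (Qn c v p) =
     set_encode ((\<lambda>S. prod_encode (st A r lab B (\<sigma>(v := S)) p, min 2 (card S))) ` Pow B)"

text \<open>Relabellings of the first and of the second half, and the pairs of labels that are
  adjacent across.\<close>

type_synonym merge = "(nat \<Rightarrow> nat) \<times> (nat \<Rightarrow> nat) \<times> (nat \<Rightarrow> nat \<Rightarrow> bool)"

primrec relab :: "(nat \<Rightarrow> nat) \<Rightarrow> tk \<Rightarrow> tk" where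
  "relab f Star = Star"
| "relab f Done = Done"
| "relab f (XT a) = XT (f a)"
| "relab f (YT a) = YT (f a)"

text \<open>Across the halves an atom becomes true by an edge, in either direction, or as
  \<open><\<close> if its first variable is in the first half, all of which precedes the second.
  Equality never holds across, the halves being disjoint. Combinations without information yield
  \<open>Star\<close>, which is present anyway.\<close>

fun comb :: "nat \<Rightarrow> merge \<Rightarrow> tk \<Rightarrow> tk \<Rightarrow> tk" where
  "comb c (f, g, J) t Star = relab f t"
| "comb c (f, g, J) Star t = relab g t"
| "comb c (f, g, J) (XT a) (YT b) = (if c = 2 \<and> J a b \<or> c = 3 then Done else Star)"
| "comb c (f, g, J) (YT a) (XT b) = (if c = 2 \<and> J a b then Done else Star)"
| "comb c m _ _ = Star"

abbreviation pfst :: "nat \<Rightarrow> nat" where "pfst z \<equiv> fst (prod_decode z)"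
abbreviation psnd :: "nat \<Rightarrow> nat" where "psnd z \<equiv> snd (prod_decode z)"

primrec opn :: "merge \<Rightarrow> fm \<Rightarrow> nat \<Rightarrow> nat \<Rightarrow> nat" where
  "opn m (Atm c X Y) x y =
     set_encode ((\<lambda>(e, f). tcode (comb c m (tdec e) (tdec f))) ` (set_decode x \<times> set_decode y))"
| "opn m (Ng p) x y = opn m p x y"
| "opn m (Bin c p q) x y = prod_encode (opn m p (pfst x) (pfst y), opn m q (psnd x) (psnd y))"
| "opn m (Qn c v p) x y =
     set_encode ((\<lambda>(e, f). prod_encode (opn m p (pfst e) (pfst f), min 2 (psnd e + psnd f)))
       ` (set_decode x \<times> set_decode y))"

text \<open>\<open>M\<close> is the set of variables whose value contains the vertex. The vertex has
  label 0, and 2 and 3 are the codes of \<open>XT 0\<close> and \<open>YT 0\<close>. Edge and order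
  atoms do not hold within one vertex.\<close>

primrec leafn :: "nat set \<Rightarrow> fm \<Rightarrow> nat" where
  "leafn M (Atm c X Y) = set_encode ({0} \<union> (if X \<in> M \<and> Y \<in> M \<and> c \<noteq> 2 \<and> c \<noteq> 3 then {1} else {})
     \<union> (if X \<in> M then {2} else {}) \<union> (if Y \<in> M then {3} else {}))"
| "leafn M (Ng p) = leafn M p"
| "leafn M (Bin c p q) = prod_encode (leafn M p, leafn M q)"
| "leafn M (Qn c v p) = set_encode {prod_encode (leafn (M - {v}) p, 0), prod_encode (leafn (insert v M) p, 1)}"

primrec accn :: "fm \<Rightarrow> nat \<Rightarrow> bool" where
  "accn (Atm c X Y) x \<longleftrightarrow> 1 \<in> set_decode x"
| "accn (Ng p) x \<longleftrightarrow> \<not> accn p x"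
| "accn (Bin c p q) x \<longleftrightarrow>
     (if c = 7 then accn p (pfst x) \<and> accn q (psnd x) else accn p (pfst x) \<or> accn q (psnd x))"
| "accn (Qn c v p) x \<longleftrightarrow>
     (if c = 9 then \<exists>e\<in>set_decode x. psnd e = 1 \<and> accn p (pfst e)
      else if c = 10 then \<forall>e\<in>set_decode x. psnd e = 1 \<longrightarrow> accn p (pfst e)
      else if c = 11 then \<exists>e\<in>set_decode x. accn p (pfst e)
      else \<forall>e\<in>set_decode x. accn p (pfst e))"

lemma st_cong:
  assumes "\<And>X. \<sigma> X \<inter> B = \<sigma>' X \<inter> B"
  shows "st A r lab B \<sigma> p = st A r lab B \<sigma>' p"
  using assms
proof (induction p arbitrary: \<sigma> \<sigma>')
  case (Bin c p q)
  show ?case using Bin.IH(1)[OF Bin.prems] Bin.IH(2)[OF Bin.prems] by simp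
next
  case (Qn c v p)
  have "st A r lab B (\<sigma>(v := S)) p = st A r lab B (\<sigma>'(v := S)) p" for S
  proof (rule Qn.IH)
    fix X show "(\<sigma>(v := S)) X \<inter> B = (\<sigma>'(v := S)) X \<inter> B" using Qn.prems[of X] by simp
  qed
  then show ?case by simp
next
  case (Atm c X Y)
  show ?case using Atm[of X] Atm[of Y] by simp
next
  case (Ng p)
  show ?case using Ng.IH[OF Ng.prems] by simp
qed

lemma finite_toks [simp]: "finite S \<Longrightarrow> finite T \<Longrightarrow> finite (toks A r lab c S T)"
  by (auto simp: toks_def intro: finite_subset[of _ "{Done}"])

definition merge_ok :: "('v \<Rightarrow> 'v \<Rightarrow> bool) \<Rightarrow> 'v rel \<Rightarrow> 'v rel \<Rightarrow> 'v rel \<Rightarrow> ('v \<Rightarrow> nat) \<Rightarrow> ('v \<Rightarrow> nat) \<Rightarrow> ('v \<Rightarrow> nat)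
    \<Rightarrow> 'v set \<Rightarrow> 'v set \<Rightarrow> merge \<Rightarrow> bool" where
  "merge_ok A r r1 r2 lab lab1 lab2 B1 B2 m \<longleftrightarrow> (case m of (f, g, J) \<Rightarrow>
     finite B1 \<and> finite B2 \<and> B1 \<inter> B2 = {}
     \<and> (\<forall>u v. A u v \<longleftrightarrow> A v u)
     \<and> (\<forall>u\<in>B1. lab u = f (lab1 u)) \<and> (\<forall>u\<in>B2. lab u = g (lab2 u))
     \<and> (\<forall>u\<in>B1. \<forall>v\<in>B2. A u v \<longleftrightarrow> J (lab1 u) (lab2 v))
     \<and> (\<forall>u\<in>B1. \<forall>v\<in>B1. (u, v) \<in> r \<longleftrightarrow> (u, v) \<in> r1) \<and> (\<forall>u\<in>B2. \<forall>v\<in>B2. (u, v) \<in> r \<longleftrightarrow> (u, v) \<in> r2)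
     \<and> (\<forall>u\<in>B1. \<forall>v\<in>B2. (u, v) \<in> r \<and> (v, u) \<notin> r))"

lemma toks_merge:
  assumes m: "merge_ok A r r1 r2 lab lab1 lab2 B1 B2 m"
    and S: "S \<subseteq> B1 \<union> B2" "T \<subseteq> B1 \<union> B2"
  shows "toks A r lab c S T = (\<lambda>(t, u). comb c m t u) `
    (toks A r1 lab1 c (S \<inter> B1) (T \<inter> B1) \<times> toks A r2 lab2 c (S \<inter> B2) (T \<inter> B2))" (is "?L = ?f ` (?P \<times> ?Q)")
proof -
  obtain f g J where mm: "m = (f, g, J)" by (cases m)
  note ok = m[unfolded merge_ok_def mm, simplified]
  have image: "t \<in> ?f ` (?P \<times> ?Q)" if "comb c m x y = t" "x \<in> ?P" "y \<in> ?Q" for t x y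
    using that by force
  have StarP: "Star \<in> ?P" "Star \<in> ?Q" by (auto simp: toks_def)
  show ?thesis
  proof (intro equalityI subsetI)
    fix t assume "t \<in> ?L"
    then consider "t = Star" | u v where "t = Done" "u \<in> S" "v \<in> T" "rel A r c u v"
      | u where "t = XT (lab u)" "u \<in> S" | u where "t = YT (lab u)" "u \<in> T"
      by (auto simp: toks_def)
    then show "t \<in> ?f ` (?P \<times> ?Q)"
    proof cases
      case 1
      show ?thesis by (rule image[OF _ StarP]) (simp add: 1 mm)
    next
      case (2 u v)
      have "u \<in> B1 \<union> B2" "v \<in> B1 \<union> B2" using 2 S by auto
      then consider "u \<in> B1" "v \<in> B1" | "u \<in> B2" "v \<in> B2" | "u \<in> B1" "v \<in> B2" | "u \<in> B2" "v \<in> B1" by auto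
      then show ?thesis
      proof cases
        case 1
        then have "rel A r1 c u v" using 2(4) ok by (auto simp: rel_def split: if_splits)
        then have "Done \<in> ?P" using 1 2 by (auto simp: toks_def)
        then show ?thesis by (rule image[OF _ _ StarP(2), rotated]) (simp add: 2 mm)
      next
        case c2: 2
        then have "rel A r2 c u v" using 2(4) ok by (auto simp: rel_def split: if_splits)
        then have "Done \<in> ?Q" using c2 2 by (auto simp: toks_def)
        then show ?thesis by (rule image[OF _ StarP(1), rotated]) (simp add: 2 mm)
      next
        case 3
        have "XT (lab1 u) \<in> ?P" "YT (lab2 v) \<in> ?Q" using 2 3 by (auto simp: toks_def)
        moreover have "c = 2 \<and> J (lab1 u) (lab2 v) \<or> c = 3"
          using 2(4) 3 ok by (auto simp: rel_def split: if_splits)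
        ultimately show ?thesis by (intro image) (auto simp: 2 mm)
      next
        case 4
        have "YT (lab1 v) \<in> ?P" "XT (lab2 u) \<in> ?Q" using 2 4 by (auto simp: toks_def)
        moreover have "c = 2 \<and> J (lab1 v) (lab2 u)"
          using 2(4) 4 ok by (auto simp: rel_def split: if_splits)
        ultimately show ?thesis by (intro image) (auto simp: 2 mm)
      qed
    next
      case (3 u)
      have "u \<in> B1 \<or> u \<in> B2" using 3 S by auto
      then show ?thesis
      proof
        assume u: "u \<in> B1"
        then have "XT (lab1 u) \<in> ?P" using 3 by (auto simp: toks_def)
        then show ?thesis by (rule image[OF _ _ StarP(2), rotated]) (use u ok in \<open>simp add: 3 mm\<close>)
      next
        assume u: "u \<in> B2"
        then have "XT (lab2 u) \<in> ?Q" using 3 by (auto simp: toks_def)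
        then show ?thesis by (rule image[OF _ StarP(1), rotated]) (use u ok in \<open>simp add: 3 mm\<close>)
      qed
    next
      case (4 u)
      have "u \<in> B1 \<or> u \<in> B2" using 4 S by auto
      then show ?thesis
      proof
        assume u: "u \<in> B1"
        then have "YT (lab1 u) \<in> ?P" using 4 by (auto simp: toks_def)
        then show ?thesis by (rule image[OF _ _ StarP(2), rotated]) (use u ok in \<open>simp add: 4 mm\<close>)
      next
        assume u: "u \<in> B2"
        then have "YT (lab2 u) \<in> ?Q" using 4 by (auto simp: toks_def)
        then show ?thesis by (rule image[OF _ StarP(1), rotated]) (use u ok in \<open>simp add: 4 mm\<close>)
      qed
    qed
  next
    fix t assume "t \<in> ?f ` (?P \<times> ?Q)"
    then obtain x y where t: "t = comb c m x y" and x: "x \<in> ?P" and y: "y \<in> ?Q" by auto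
    have StarL: "Star \<in> ?L" by (simp add: toks_def)
    have left: "relab f x \<in> ?L"
    proof -
      from x consider "x = Star" | u v where "x = Done" "u \<in> S \<inter> B1" "v \<in> T \<inter> B1" "rel A r1 c u v"
        | u where "x = XT (lab1 u)" "u \<in> S \<inter> B1" | u where "x = YT (lab1 u)" "u \<in> T \<inter> B1"
        by (auto simp: toks_def)
      then show ?thesis
      proof cases
        case (2 u v)
        then have "rel A r c u v" using ok by (auto simp: rel_def split: if_splits)
        with 2 show ?thesis by (auto simp: toks_def)
      next
        case (3 u)
        then have "relab f x = XT (lab u)" "u \<in> S" using ok by simp_all
        then show ?thesis by (simp add: toks_def)
      next
        case (4 u)
        then have "relab f x = YT (lab u)" "u \<in> T" using ok by simp_all
        then show ?thesis by (simp add: toks_def)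
      qed (simp add: toks_def)
    qed
    have right: "relab g y \<in> ?L"
    proof -
      from y consider "y = Star" | u v where "y = Done" "u \<in> S \<inter> B2" "v \<in> T \<inter> B2" "rel A r2 c u v"
        | u where "y = XT (lab2 u)" "u \<in> S \<inter> B2" | u where "y = YT (lab2 u)" "u \<in> T \<inter> B2"
        by (auto simp: toks_def)
      then show ?thesis
      proof cases
        case (2 u v)
        then have "rel A r c u v" using ok by (auto simp: rel_def split: if_splits)
        with 2 show ?thesis by (auto simp: toks_def)
      next
        case (3 u)
        then have "relab g y = XT (lab u)" "u \<in> S" using ok by simp_all
        then show ?thesis by (simp add: toks_def)
      next
        case (4 u)
        then have "relab g y = YT (lab u)" "u \<in> T" using ok by simp_all
        then show ?thesis by (simp add: toks_def)
      qed (simp add: toks_def)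
    qed
    have xy: "Done \<in> ?L" if h: "x = XT a" "y = YT b" "c = 2 \<and> J a b \<or> c = 3" for a b
    proof -
      obtain u v where uv: "u \<in> S \<inter> B1" "a = lab1 u" "v \<in> T \<inter> B2" "b = lab2 v"
        using x y h(1,2) by (auto simp: toks_def)
      then have "rel A r c u v" using h(3) ok by (auto simp: rel_def)
      with uv show ?thesis by (auto simp: toks_def)
    qed
    have yx: "Done \<in> ?L" if h: "x = YT a" "y = XT b" "c = 2 \<and> J a b" for a b
    proof -
      obtain u v where uv: "u \<in> T \<inter> B1" "a = lab1 u" "v \<in> S \<inter> B2" "b = lab2 v"
        using x y h(1,2) by (auto simp: toks_def)
      then have "A u v" using h(3) ok by auto
      then have "A v u" using ok by blast
      then have "rel A r c v u" using h(3) by (simp add: rel_def)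
      with uv show ?thesis by (auto simp: toks_def)
    qed
    show "t \<in> ?L"
      unfolding t mm using left right xy yx StarL by (cases x; cases y) auto
  qed
qed

text \<open>The composition theorem. A subset of \<open>B1 \<union> B2\<close> is an arbitrary pair
  of subsets of the halves, so the choices for a set variable combine without restriction.\<close>

theorem opn_st:
  assumes m: "merge_ok A r r1 r2 lab lab1 lab2 B1 B2 m"
  shows "st A r lab (B1 \<union> B2) \<sigma> p = opn m p (st A r1 lab1 B1 \<sigma> p) (st A r2 lab2 B2 \<sigma> p)"
proof (induction p arbitrary: \<sigma>)
  case (Atm c X Y)
  have fin: "finite B1" "finite B2" using m by (auto simp: merge_ok_def split: prod.splits)
  let ?P = "toks A r1 lab1 c (\<sigma> X \<inter> B1) (\<sigma> Y \<inter> B1)" and ?Q = "toks A r2 lab2 c (\<sigma> X \<inter> B2) (\<sigma> Y \<inter> B2)"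
  have "toks A r lab c (\<sigma> X \<inter> (B1 \<union> B2)) (\<sigma> Y \<inter> (B1 \<union> B2)) = (\<lambda>(t, u). comb c m t u) ` (?P \<times> ?Q)"
  proof -
    have "Z \<inter> (B1 \<union> B2) \<inter> B1 = Z \<inter> B1" "Z \<inter> (B1 \<union> B2) \<inter> B2 = Z \<inter> B2" for Z by auto
    then show ?thesis
      using toks_merge[OF m, of "\<sigma> X \<inter> (B1 \<union> B2)" "\<sigma> Y \<inter> (B1 \<union> B2)" c] by simp
  qed
  moreover have "set_decode (set_encode (tcode ` ?P)) = tcode ` ?P" "set_decode (set_encode (tcode ` ?Q)) = tcode ` ?Q"
    using fin by (auto intro!: set_encode_inverse)
  moreover have "(\<lambda>(e, f). tcode (comb c m (tdec e) (tdec f))) ` (tcode ` ?P \<times> tcode ` ?Q)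
      = tcode ` (\<lambda>(t, u). comb c m t u) ` (?P \<times> ?Q)"
    by (force simp: image_iff)
  ultimately show ?case by simp
next
  case (Qn c v p)
  have fin: "finite B1" "finite B2" and dj: "B1 \<inter> B2 = {}" using m by (auto simp: merge_ok_def split: prod.splits)
  let ?F1 = "\<lambda>S. prod_encode (st A r1 lab1 B1 (\<sigma>(v := S)) p, min 2 (card S))"
  let ?F2 = "\<lambda>S. prod_encode (st A r2 lab2 B2 (\<sigma>(v := S)) p, min 2 (card S))"
  let ?F = "\<lambda>S. prod_encode (st A r lab (B1 \<union> B2) (\<sigma>(v := S)) p, min 2 (card S))"
  let ?G = "\<lambda>(e, f). prod_encode (opn m p (pfst e) (pfst f), min 2 (psnd e + psnd f))"
  have *: "?G (?F1 S1, ?F2 S2) = ?F (S1 \<union> S2)" if "S1 \<subseteq> B1" "S2 \<subseteq> B2" for S1 S2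
  proof -
    have "st A r1 lab1 B1 (\<sigma>(v := S1)) p = st A r1 lab1 B1 (\<sigma>(v := S1 \<union> S2)) p"
      "st A r2 lab2 B2 (\<sigma>(v := S2)) p = st A r2 lab2 B2 (\<sigma>(v := S1 \<union> S2)) p"
      by (rule st_cong, use that dj in \<open>auto\<close>)+
    moreover have "card (S1 \<union> S2) = card S1 + card S2"
      using that dj fin by (intro card_Un_disjoint) (auto intro: finite_subset)
    moreover have "min 2 (min 2 a + min 2 b) = min 2 (a + b)" for a b :: nat by (simp add: min_def)
    ultimately show ?thesis by (simp add: Qn.IH[of "\<sigma>(v := S1 \<union> S2)"] del: fun_upd_apply)
  qed
  have "?F ` Pow (B1 \<union> B2) = ?G ` (?F1 ` Pow B1 \<times> ?F2 ` Pow B2)"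
  proof (intro equalityI subsetI)
    fix z assume "z \<in> ?F ` Pow (B1 \<union> B2)"
    then obtain S where S: "S \<subseteq> B1 \<union> B2" "z = ?F S" by auto
    then have "S = (S \<inter> B1) \<union> (S \<inter> B2)" by auto
    then have "z = ?G (?F1 (S \<inter> B1), ?F2 (S \<inter> B2))" using S(2) *[of "S \<inter> B1" "S \<inter> B2"] by simp
    then show "z \<in> ?G ` (?F1 ` Pow B1 \<times> ?F2 ` Pow B2)" by blast
  next
    fix z assume "z \<in> ?G ` (?F1 ` Pow B1 \<times> ?F2 ` Pow B2)"
    then obtain S1 S2 where S: "S1 \<subseteq> B1" "S2 \<subseteq> B2" "z = ?G (?F1 S1, ?F2 S2)" by blast
    have "z = ?F (S1 \<union> S2)" unfolding S(3) by (rule *[OF S(1,2)])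
    moreover have "S1 \<union> S2 \<in> Pow (B1 \<union> B2)" using S by auto
    ultimately show "z \<in> ?F ` Pow (B1 \<union> B2)" by blast
  qed
  moreover have "set_decode (set_encode (?F1 ` Pow B1)) = ?F1 ` Pow B1"
    "set_decode (set_encode (?F2 ` Pow B2)) = ?F2 ` Pow B2"
    using fin by (auto intro!: set_encode_inverse)
  ultimately show ?case by (simp only: st.simps opn.simps)
qed simp_all

theorem leafn_st:
  assumes "lab u = 0" "\<not> A u u" "(u, u) \<notin> r"
  shows "st A r lab {u} \<sigma> p = leafn {X. u \<in> \<sigma> X} p"
proof (induction p arbitrary: \<sigma>)
  case (Atm c X Y)
  have "\<sigma> Z \<inter> {u} = (if u \<in> \<sigma> Z then {u} else {})" for Z by auto
  then have "tcode ` toks A r lab c (\<sigma> X \<inter> {u}) (\<sigma> Y \<inter> {u})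
     = {0} \<union> (if u \<in> \<sigma> X \<and> u \<in> \<sigma> Y \<and> c \<noteq> 2 \<and> c \<noteq> 3 then {1} else {})
     \<union> (if u \<in> \<sigma> X then {2} else {}) \<union> (if u \<in> \<sigma> Y then {3} else {})"
    using assms by (auto simp: toks_def rel_def image_iff)
  then show ?case by simp
next
  case (Qn c v p)
  have "{X. u \<in> (\<sigma>(v := S)) X} = (if u \<in> S then insert v {X. u \<in> \<sigma> X} else {X. u \<in> \<sigma> X} - {v})" for S by auto
  then show ?case by (simp add: Qn.IH Pow_insert insert_commute)
qed auto

theorem accn_st:
  assumes "finite V" "\<And>X. \<sigma> X \<subseteq> V"
  shows "accn p (st A r lab V \<sigma> p) \<longleftrightarrow> satf V A r \<sigma> p"
  using assms(2)
proof (induction p arbitrary: \<sigma>)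
  case (Atm c X Y)
  have "finite (\<sigma> X)" "finite (\<sigma> Y)" "\<sigma> X \<inter> V = \<sigma> X" "\<sigma> Y \<inter> V = \<sigma> Y"
    using Atm assms(1) finite_subset by blast+
  then have "set_decode (st A r lab V \<sigma> (Atm c X Y)) = tcode ` toks A r lab c (\<sigma> X) (\<sigma> Y)"
    by simp
  then show ?case by (simp only: accn.simps satf.simps one_in_tcode One_nat_def) (auto simp: toks_def)
next
  case (Qn c v p)
  let ?F = "\<lambda>S. prod_encode (st A r lab V (\<sigma>(v := S)) p, min 2 (card S))"
  have D: "set_decode (st A r lab V \<sigma> (Qn c v p)) = ?F ` Pow V"
    using assms(1) by (simp add: set_encode_inverse)
  have IH: "accn p (st A r lab V (\<sigma>(v := S)) p) \<longleftrightarrow> satf V A r (\<sigma>(v := S)) p" if "S \<subseteq> V" for S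
    using Qn.prems that by (intro Qn.IH) auto
  have c1: "min 2 (card S) = 1 \<longleftrightarrow> card S = 1" for S :: "'a set" by auto
  have ex: "(\<exists>e\<in>?F ` Pow V. Q e) \<longleftrightarrow> (\<exists>S\<subseteq>V. Q (?F S))" and all: "(\<forall>e\<in>?F ` Pow V. Q e) \<longleftrightarrow> (\<forall>S\<subseteq>V. Q (?F S))" for Q
    by blast+
  show ?case
    unfolding accn.simps satf.simps D ex all using IH c1 by (simp cong: conj_cong)
qed auto

subsection \<open>Bounds on types\<close>

text \<open>\<open>vs L p\<close> contains the types of pieces with labels below \<open>L\<close>.\<close>

primrec vs :: "nat \<Rightarrow> fm \<Rightarrow> nat set" where
  "vs L (Atm c X Y) = {..<2 ^ (2 + 2 * L)}"
| "vs L (Ng p) = vs L p"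
| "vs L (Bin c p q) = prod_encode ` (vs L p \<times> vs L q)"
| "vs L (Qn c v p) = set_encode ` Pow (prod_encode ` (vs L p \<times> {..2}))"

primrec ht :: "fm \<Rightarrow> nat" where
  "ht (Atm c X Y) = 0"
| "ht (Ng p) = Suc (ht p)"
| "ht (Bin c p q) = Suc (max (ht p) (ht q))"
| "ht (Qn c v p) = Suc (ht p)"

text \<open>A tower of exponentials in the height: below a quantifier, a type is a set of pairs,
  coded as a subset of an initial segment. One recursion covers all connectives, so the program
  obtains the bound by iteration without looking at the formula.\<close>

primrec bnd :: "nat \<Rightarrow> nat \<Rightarrow> nat" where
  "bnd L 0 = 2 ^ (2 + 2 * L)"
| "bnd L (Suc i) = 2 ^ prod_encode (bnd L i, bnd L i)"

lemma triangle_mono: "m \<le> n \<Longrightarrow> triangle m \<le> triangle n"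
  by (induction n) (auto simp: le_Suc_eq)

lemma prod_encode_less: "a < n \<Longrightarrow> b \<le> n \<Longrightarrow> prod_encode (a, b) < prod_encode (n, n)"
  using triangle_mono[of "a + b" "n + n"] by (simp add: prod_encode_def)

lemma le_triangle: "n \<le> triangle n"
  by (induction n) auto

lemma bnd_mono_Suc: "bnd L i < bnd L (Suc i)"
proof -
  have "bnd L i \<le> prod_encode (bnd L i, bnd L i)" using le_triangle by (simp add: prod_encode_def)
  also have "\<dots> < 2 ^ prod_encode (bnd L i, bnd L i)" by (rule less_exp)
  finally show ?thesis by simp
qed

lemma bnd_mono: "i \<le> j \<Longrightarrow> bnd L i \<le> bnd L j"
  using lift_Suc_mono_le[of "bnd L"] bnd_mono_Suc by (simp add: less_imp_le)

lemma bnd_ge: "4 \<le> bnd L i"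
proof -
  have "(2 :: nat) ^ 2 \<le> bnd L 0" unfolding bnd.simps by (rule power_increasing) auto
  also have "\<dots> \<le> bnd L i" by (rule bnd_mono) simp
  finally show ?thesis by simp
qed

lemma in_set_decode_less: "e \<in> set_decode x \<Longrightarrow> e < x"
proof -
  assume "e \<in> set_decode x"
  then have "odd (x div 2 ^ e)" by (simp add: set_decode_def)
  then have "2 ^ e \<le> x" by (metis div_less even_zero not_le)
  with less_exp[of e] show "e < x" by (rule less_le_trans)
qed

lemma in_set_decode_less_exp:
  assumes "e \<in> set_decode x" "x < 2 ^ k"
  shows "e < k"
proof -
  from assms(1) have "odd (x div 2 ^ e)" by (simp add: set_decode_def)
  then have "2 ^ e \<le> x" by (metis div_less even_zero not_le)
  then have "(2 :: nat) ^ e < 2 ^ k" using assms(2) by (rule le_less_trans)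
  then show ?thesis by simp
qed

lemma set_encode_less_exp:
  assumes "E \<subseteq> {..<k}"
  shows "set_encode E < 2 ^ k"
proof -
  have "set_encode E \<le> set_encode {..<k}"
    unfolding set_encode_def using assms by (intro sum_mono2) auto
  also have "set_encode {..<k} = 2 ^ k - 1"
    by (induction k) (simp_all add: lessThan_Suc)
  finally show ?thesis by (metis diff_less le_less_trans pos2 zero_less_one zero_less_power)
qed

lemma vs_bound: "x \<in> vs L p \<Longrightarrow> x < bnd L (ht p)"
proof (induction p arbitrary: x)
  case (Ng p)
  have "x < bnd L (ht p)" using Ng by simp
  then show ?case using bnd_mono_Suc[of L "ht p"] by (simp only: ht.simps less_trans)
next
  case (Bin c p q)
  then obtain a b where ab: "x = prod_encode (a, b)" "a \<in> vs L p" "b \<in> vs L q" by auto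
  let ?N = "bnd L (max (ht p) (ht q))"
  have "a < ?N" "b < ?N"
    using Bin.IH ab bnd_mono[of "ht p" "max (ht p) (ht q)" L] bnd_mono[of "ht q" "max (ht p) (ht q)" L]
    by (auto intro: less_le_trans)
  then have "x < prod_encode (?N, ?N)" unfolding ab by (intro prod_encode_less) auto
  also have "\<dots> < 2 ^ prod_encode (?N, ?N)" by simp
  finally show ?case by simp
next
  case (Qn c v p)
  then obtain E where E: "x = set_encode E" "E \<subseteq> prod_encode ` (vs L p \<times> {..2})" by auto
  have "E \<subseteq> {..<prod_encode (bnd L (ht p), bnd L (ht p))}"
  proof
    fix e assume "e \<in> E"
    then obtain a b where ab: "e = prod_encode (a, b)" "a \<in> vs L p" "b \<le> 2" using E(2) by auto
    then show "e \<in> {..<prod_encode (bnd L (ht p), bnd L (ht p))}"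
      using Qn.IH[of a] bnd_ge[of L "ht p"] prod_encode_less[of a "bnd L (ht p)" b] by simp
  qed
  then show ?case using set_encode_less_exp E(1) by simp
qed simp

lemma finite_vs: "finite (vs L p)"
  using vs_bound by (meson finite_lessThan finite_subset lessThan_iff subsetI)

lemma opn_vs:
  assumes "m = (f, g, J)" "\<And>a. a < L \<Longrightarrow> f a < L" "\<And>a. a < L \<Longrightarrow> g a < L" "x \<in> vs L p" "y \<in> vs L p"
  shows "opn m p x y \<in> vs L p"
  using assms(4,5)
proof (induction p arbitrary: x y)
  case (Atm c X Y)
  have r: "tcode (relab h t) < 2 + 2 * L" if "tcode t < 2 + 2 * L" "\<And>a. a < L \<Longrightarrow> h a < L" for h t
  proof (cases t)
    case (XT a)
    then show ?thesis using that(1) that(2)[of a] by simp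
  next
    case (YT a)
    then show ?thesis using that(1) that(2)[of a] by simp
  qed simp_all
  have td: "tcode (tdec e) = e" for e
  proof -
    have "e \<ge> 3" if "odd e" "e \<noteq> 1" using that by presburger
    then show ?thesis by (auto simp: tdec_def)
  qed
  have "tcode (comb c m t u) < 2 + 2 * L" if "tcode t < 2 + 2 * L" "tcode u < 2 + 2 * L" for t u
    using r[of t f, OF that(1) assms(2)] r[of u g, OF that(2) assms(3)] unfolding assms(1) by (cases t; cases u) simp_all
  moreover have "e < 2 + 2 * L" if "e \<in> set_decode x \<or> e \<in> set_decode y" for e
    using that Atm by (auto intro: in_set_decode_less_exp)
  ultimately have "(\<lambda>(e, f). tcode (comb c m (tdec e) (tdec f))) ` (set_decode x \<times> set_decode y) \<subseteq> {..<2 + 2 * L}"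
    by (auto simp: td)
  then show ?case unfolding opn.simps vs.simps lessThan_iff by (rule set_encode_less_exp)
next
  case (Bin c p q)
  then show ?case by auto
next
  case (Qn c v p)
  obtain E F where E: "x = set_encode E" "E \<subseteq> prod_encode ` (vs L p \<times> {..2})"
    and F: "y = set_encode F" "F \<subseteq> prod_encode ` (vs L p \<times> {..2})" using Qn.prems by auto
  have "finite (prod_encode ` (vs L p \<times> {..2}))" using finite_vs by simp
  then have EF: "set_decode x = E" "set_decode y = F" using E F finite_subset by (metis set_encode_inverse)+
  have "(\<lambda>(e, f). prod_encode (opn m p (pfst e) (pfst f), min 2 (psnd e + psnd f))) ` (E \<times> F)
      \<subseteq> prod_encode ` (vs L p \<times> {..2})"
  proof clarify
    fix e f assume "e \<in> E" "f \<in> F"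
    then obtain a b a' b' where "e = prod_encode (a, b)" "a \<in> vs L p" "f = prod_encode (a', b')" "a' \<in> vs L p"
      using E(2) F(2) by blast
    then show "prod_encode (opn m p (pfst e) (pfst f), min 2 (psnd e + psnd f)) \<in> prod_encode ` (vs L p \<times> {..2})"
      using Qn.IH by simp
  qed
  then show ?case by (simp add: EF)
qed simp

lemma leafn_vs: "1 \<le> L \<Longrightarrow> leafn M p \<in> vs L p"
proof (induction p arbitrary: M)
  case (Atm c X Y)
  then show ?case
    unfolding leafn.simps vs.simps lessThan_iff by (intro set_encode_less_exp) auto
next
  case (Qn c v p)
  then show ?case
    unfolding leafn.simps vs.simps by (intro imageI) simp
qed auto

section \<open>Derived expressions\<close>

definition notE :: "exp \<Rightarrow> exp" where "notE a = Ite a (Lit 0) (Lit 1)"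
definition andE :: "exp \<Rightarrow> exp \<Rightarrow> exp" where "andE a b = Ite a (Ite b (Lit 1) (Lit 0)) (Lit 0)"
definition orE :: "exp \<Rightarrow> exp \<Rightarrow> exp" where "orE a b = Ite a (Lit 1) (Ite b (Lit 1) (Lit 0))"
definition eqE :: "exp \<Rightarrow> exp \<Rightarrow> exp" where "eqE a b = notE (Plus (Minus a b) (Minus b a))"
definition ltE :: "exp \<Rightarrow> exp \<Rightarrow> exp" where "ltE a b = Ite (Minus b a) (Lit 1) (Lit 0)"

lemma eval_bool [simp]:
  "eval w (notE a) r s = of_bool (eval w a r s = 0)"
  "eval w (andE a b) r s = of_bool (eval w a r s \<noteq> 0 \<and> eval w b r s \<noteq> 0)"
  "eval w (orE a b) r s = of_bool (eval w a r s \<noteq> 0 \<or> eval w b r s \<noteq> 0)"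
  "eval w (eqE a b) r s = of_bool (eval w a r s = eval w b r s)"
  "eval w (ltE a b) r s = of_bool (eval w a r s < eval w b r s)"
  by (auto simp: notE_def andE_def orE_def eqE_def ltE_def)

text \<open>The loops below bind the local \<open>x\<close> and use \<open>Suc x\<close> as accumulator; their bodies are only
  relevant while the accumulator is 0.\<close>

definition exE :: "nat \<Rightarrow> exp \<Rightarrow> exp \<Rightarrow> exp" where
  "exE x n b = Fold x (Suc x) n (Lit 0) (orE (Var (Suc x)) b)"

definition allE' :: "nat \<Rightarrow> exp \<Rightarrow> exp \<Rightarrow> exp" where
  "allE' x n b = notE (exE x n (notE b))"

definition selE :: "nat \<Rightarrow> exp \<Rightarrow> exp \<Rightarrow> exp" where
  "selE x n b = Fold x (Suc x) n (Lit 0)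
     (Ite (Var (Suc x)) (Var (Suc x)) (Ite b (Plus (Var x) (Lit 1)) (Lit 0)))"

definition sumE :: "nat \<Rightarrow> exp \<Rightarrow> exp \<Rightarrow> exp" where
  "sumE x n b = Fold x (Suc x) n (Lit 0) (Plus (Var (Suc x)) b)"

lemma eval_exE [simp]:
  "eval w (exE x n b) r s = of_bool (\<exists>i<eval w n r s. eval w b (r(x := i, Suc x := 0)) s \<noteq> 0)"
proof -
  have "fold (\<lambda>j acc. eval w (orE (Var (Suc x)) b) (r(x := j, Suc x := acc)) s) [0..<k] 0
      = of_bool (\<exists>i<k. eval w b (r(x := i, Suc x := 0)) s \<noteq> 0)" for k
  proof (induction k)
    case (Suc k)
    show ?case
    proof (cases "\<exists>i<k. eval w b (r(x := i, Suc x := 0)) s \<noteq> 0")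
      case True
      then have *: "fold (\<lambda>j acc. eval w (orE (Var (Suc x)) b) (r(x := j, Suc x := acc)) s) [0..<k] 0 = 1"
        using Suc by (simp del: fun_upd_apply eval_bool)
      show ?thesis unfolding upt_Suc_append[OF le0] fold_append comp_apply * using True
        by (auto simp add: less_Suc_eq fun_upd_same simp del: fun_upd_apply)
    next
      case False
      then have *: "fold (\<lambda>j acc. eval w (orE (Var (Suc x)) b) (r(x := j, Suc x := acc)) s) [0..<k] 0 = 0"
        using Suc by (simp del: fun_upd_apply eval_bool)
      show ?thesis unfolding upt_Suc_append[OF le0] fold_append comp_apply * using False
        by (auto simp add: less_Suc_eq fun_upd_same simp del: fun_upd_apply)
    qed
  qed simp
  then show ?thesis by (simp add: exE_def)
qed

lemma eval_allE [simp]: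
  "eval w (allE' x n b) r s = of_bool (\<forall>i<eval w n r s. eval w b (r(x := i, Suc x := 0)) s \<noteq> 0)"
  by (auto simp: allE'_def)

text \<open>Shifted by one so that 0 can report failure; this also fits \<open>selE\<close>, whose
  accumulator is 0 as long as nothing has been found.\<close>

definition first :: "nat \<Rightarrow> (nat \<Rightarrow> bool) \<Rightarrow> nat" where
  "first n P = (if \<exists>i<n. P i then Suc (LEAST i. P i) else 0)"

lemma first_cases:
  obtains "first n P = 0" "\<forall>i<n. \<not> P i" | i where "first n P = Suc i" "i < n" "P i"
proof (cases "\<exists>i<n. P i")
  case True
  then have "P (LEAST i. P i)" "(LEAST i. P i) < n"
    by (auto intro: LeastI le_less_trans[OF Least_le])
  with True that(2) show thesis by (simp add: first_def)
next
  case False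
  with that(1) show thesis by (simp add: first_def)
qed

lemma eval_selE [simp]:
  "eval w (selE x n b) r s = first (eval w n r s) (\<lambda>i. eval w b (r(x := i, Suc x := 0)) s \<noteq> 0)"
proof -
  let ?P = "\<lambda>i. eval w b (r(x := i, Suc x := 0)) s \<noteq> 0"
  have "fold (\<lambda>j acc. eval w (Ite (Var (Suc x)) (Var (Suc x)) (Ite b (Plus (Var x) (Lit 1)) (Lit 0)))
      (r(x := j, Suc x := acc)) s) [0..<k] 0 = first k ?P" for k
  proof (induction k)
    case (Suc k)
    have "first (Suc k) ?P = (if first k ?P = 0 then if ?P k then Suc k else 0 else first k ?P)"
    proof (cases "\<exists>i<k. ?P i")
      case True
      then show ?thesis by (auto simp: first_def less_Suc_eq)
    next
      case False
      then have "?P k \<Longrightarrow> (LEAST i. ?P i) = k" by (intro Least_equality) (auto intro: leI)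
      with False show ?thesis by (auto simp: first_def less_Suc_eq)
    qed
    note step = this
    show ?case unfolding upt_Suc_append[OF le0] fold_append comp_apply Suc.IH step
      by (cases "first k ?P = 0") simp_all
  qed (simp add: first_def)
  then show ?thesis by (simp add: selE_def)
qed

text \<open>The hypothesis says that the body ignores the running sum, which is in its scope as
  local \<open>Suc x\<close>.\<close>

lemma eval_sumE:
  assumes "\<And>i a. i < eval w n r s \<Longrightarrow> eval w b (r(x := i, Suc x := a)) s = h i"
  shows "eval w (sumE x n b) r s = (\<Sum>i<eval w n r s. h i)"
proof -
  have "k \<le> eval w n r s \<Longrightarrow> fold (\<lambda>j acc. eval w (Plus (Var (Suc x)) b) (r(x := j, Suc x := acc)) s) [0..<k] 0 = (\<Sum>i<k. h i)" for k
    using assms by (induction k) auto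
  then show ?thesis by (simp add: sumE_def)
qed

text \<open>These use the locals 0 to 3 internally, outside of the scope of their arguments.\<close>

definition powE :: "exp \<Rightarrow> exp" where
  "powE e = Fold 0 1 e (Lit 1) (Plus (Var 1) (Var 1))"

definition triE :: "exp \<Rightarrow> exp" where
  "triE e = Fold 0 1 e (Lit 0) (Plus (Var 1) (Plus (Var 0) (Lit 1)))"

definition prE :: "exp \<Rightarrow> exp \<Rightarrow> exp" where
  "prE a b = Plus (triE (Plus a b)) a"

text \<open>With the initial value 0, replacing the accumulator \<open>a\<close> in round
  \<open>j\<close> by \<open>j - a\<close> produces 0, 0, 1, 1, 2, 2 and so on: half of the number
  of rounds.\<close>

definition halfE :: "exp \<Rightarrow> exp" where
  "halfE e = Fold 0 1 e (Lit 0) (Minus (Var 0) (Var 1))"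

definition oddE :: "exp \<Rightarrow> exp" where
  "oddE e = Fold 0 1 e (Lit 0) (Minus (Lit 1) (Var 1))"

definition memE :: "exp \<Rightarrow> exp \<Rightarrow> exp" where
  "memE e x = oddE (Fold 2 3 e x (halfE (Var 3)))"

lemma eval_powE [simp]: "eval w (powE e) r s = 2 ^ eval w e r s"
proof -
  have "fold (\<lambda>j acc. eval w (Plus (Var 1) (Var 1)) (r(0 := j, 1 := acc)) s) [0..<k] 1 = 2 ^ k" for k
    by (induction k) auto
  then show ?thesis by (simp add: powE_def)
qed

lemma eval_triE [simp]: "eval w (triE e) r s = triangle (eval w e r s)"
proof -
  have "fold (\<lambda>j acc. eval w (Plus (Var 1) (Plus (Var 0) (Lit 1))) (r(0 := j, 1 := acc)) s) [0..<k] 0 = triangle k" for k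
    by (induction k) auto
  then show ?thesis by (simp add: triE_def)
qed

lemma eval_prE [simp]: "eval w (prE a b) r s = prod_encode (eval w a r s, eval w b r s)"
  by (simp add: prE_def prod_encode_def)

lemma eval_halfE [simp]: "eval w (halfE e) r s = eval w e r s div 2"
proof -
  have "fold (\<lambda>j acc. eval w (Minus (Var 0) (Var 1)) (r(0 := j, 1 := acc)) s) [0..<k] 0 = k div 2" for k
    by (induction k) auto
  then show ?thesis by (simp add: halfE_def)
qed

lemma eval_oddE [simp]: "eval w (oddE e) r s = of_bool (odd (eval w e r s))"
proof -
  have "fold (\<lambda>j acc. eval w (Minus (Lit 1) (Var 1)) (r(0 := j, 1 := acc)) s) [0..<k] 0 = of_bool (odd k)" for k
    by (induction k) auto
  then show ?thesis by (simp add: oddE_def)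
qed

lemma eval_memE [simp]: "eval w (memE e x) r s = of_bool (eval w e r s \<in> set_decode (eval w x r s))"
proof -
  have "fold (\<lambda>j acc. eval w (halfE (Var 3)) (r(2 := j, 3 := acc)) s) [0..<k] a = a div 2 ^ k" for k a
    by (induction k) (simp_all add: mult.commute flip: div_mult2_eq)
  then show ?thesis by (simp add: memE_def set_decode_def)
qed

text \<open>The arguments of the projections must be locals from 6 on.\<close>

definition pfstE :: "nat \<Rightarrow> exp" where
  "pfstE j = Minus (selE 4 (Plus (Var j) (Lit 1)) (exE 2 (Plus (Var j) (Lit 1)) (eqE (prE (Var 4) (Var 2)) (Var j)))) (Lit 1)"

definition psndE :: "nat \<Rightarrow> exp" where
  "psndE j = Minus (selE 4 (Plus (Var j) (Lit 1)) (exE 2 (Plus (Var j) (Lit 1)) (eqE (prE (Var 2) (Var 4)) (Var j)))) (Lit 1)"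

lemma first_unique: "P a \<Longrightarrow> a < n \<Longrightarrow> (\<And>i. P i \<Longrightarrow> i = a) \<Longrightarrow> first n P = Suc a"
  unfolding first_def by (metis LeastI)

lemma first_cong: "(\<And>i. P i \<longleftrightarrow> Q i) \<Longrightarrow> first n P = first n Q"
proof -
  assume "\<And>i. P i \<longleftrightarrow> Q i"
  then have "P = Q" by blast
  then show "first n P = first n Q" by simp
qed

lemma eval_pfstE [simp]: "6 \<le> j \<Longrightarrow> eval w (pfstE j) r s = pfst (r j)"
proof -
  assume j: "6 \<le> j"
  obtain a b where ab: "r j = prod_encode (a, b)" by (metis prod_decode_inverse surj_pair)
  have "first (Suc (r j)) (\<lambda>i. \<exists>i'<Suc (r j). prod_encode (i, i') = r j) = Suc a"
    by (rule first_unique) (auto simp: ab le_prod_encode_1 le_prod_encode_2 less_Suc_eq_le)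
  then show ?thesis using j by (simp add: pfstE_def ab)
qed

lemma eval_psndE [simp]: "6 \<le> j \<Longrightarrow> eval w (psndE j) r s = psnd (r j)"
proof -
  assume j: "6 \<le> j"
  obtain a b where ab: "r j = prod_encode (a, b)" by (metis prod_decode_inverse surj_pair)
  have "first (Suc (r j)) (\<lambda>i. \<exists>i'<Suc (r j). prod_encode (i', i) = r j) = Suc b"
    by (rule first_unique) (auto simp: ab le_prod_encode_1 le_prod_encode_2 less_Suc_eq_le)
  then show ?thesis using j by (simp add: psndE_def ab)
qed

text \<open>A function on finitely many arguments that is known when the program is written, such as
  a merge, becomes a case distinction.\<close>

primrec tabE :: "(nat \<Rightarrow> exp) \<Rightarrow> nat \<Rightarrow> exp \<Rightarrow> exp" where
  "tabE F 0 e = Lit 0"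
| "tabE F (Suc n) e = Ite (eqE e (Lit n)) (F n) (tabE F n e)"

lemma eval_tabE: "eval w e r s < n \<Longrightarrow> eval w (tabE F n e) r s = eval w (F (eval w e r s)) r s"
  by (induction n) (auto simp: less_Suc_eq)

section \<open>The tables of types\<close>

text \<open>Array 1 contains the length of the formula word, array 2 the formula word, array 3 a bound \<open>T\<close>
  on all types, and array 4 all tables: the entry for position \<open>p\<close> of the formula word, kind \<open>k\<close> and
  arguments \<open>x\<close>, \<open>y\<close> is stored at \<open>(p, (k, (x, y)))\<close>. The kinds below \<open>NP\<close> are the operations
  \<open>opn\<close>, followed by \<open>leafn\<close>, \<open>accn\<close>, the end and the value of a unary number, and the end
  of a formula.\<close>

abbreviation cell :: "nat \<Rightarrow> nat \<Rightarrow> nat \<Rightarrow> nat \<Rightarrow> nat" where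
  "cell p k x y \<equiv> prod_encode (p, prod_encode (k, prod_encode (x, y)))"

abbreviation "LFE \<equiv> Arr 1 (Lit 0)"
abbreviation "TE \<equiv> Arr 3 (Lit 0)"
text \<open>Local 20 counts up while the positions are treated from the last to the first.\<close>

definition pE :: exp where "pE = Minus (Minus LFE (Lit 1)) (Var 20)"

text \<open>The guard permits only positions strictly to the right of the current one, whatever the
  value of \<open>q\<close>. So an entry is independent of those that are filled later, without any
  assumption on the formula word.\<close>

definition rdE :: "exp \<Rightarrow> exp \<Rightarrow> exp \<Rightarrow> exp \<Rightarrow> exp" where
  "rdE q k x y = Ite (ltE pE q) (Arr 4 (prE q (prE k (prE x y)))) (Lit 0)"

locale tables =
  fixes L :: nat and ms :: "merge list"
begin

definition NP :: nat where "NP = length ms"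

definition ueE :: "exp \<Rightarrow> exp" where "ueE q = rdE q (Lit (NP + 2)) (Lit 0) (Lit 0)"
definition uvE :: "exp \<Rightarrow> exp" where "uvE q = rdE q (Lit (NP + 3)) (Lit 0) (Lit 0)"
definition enE :: "exp \<Rightarrow> exp" where "enE q = rdE q (Lit (NP + 4)) (Lit 0) (Lit 0)"

abbreviation "p1E \<equiv> Plus pE (Lit 1)"
abbreviation "cE \<equiv> Arr 2 pE"

text \<open>The alternatives are for atoms, negations, binary connectives and quantifiers, according
  to the letter in \<open>formula_word\<close>.\<close>

definition byc :: "exp \<Rightarrow> exp \<Rightarrow> exp \<Rightarrow> exp \<Rightarrow> exp" where
  "byc a b c d = Ite (ltE cE (Lit 6)) a (Ite (ltE cE (Lit 7)) b (Ite (ltE cE (Lit 9)) c d))"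

text \<open>These are the numbers of variables as in \<open>conv\<close>: twice the unary number,
  plus one for set variables, which occur in atoms with letter 5 and after the letters 11 and
  12.\<close>

definition v1E :: exp where "v1E = Plus (uvE p1E) (uvE p1E)"
definition v2E :: exp where "v2E = Plus (Plus (uvE (ueE p1E)) (uvE (ueE p1E))) (eqE cE (Lit 5))"
definition vqE :: exp where "vqE = Plus v1E (ltE (Lit 10) cE)"

definition combE :: exp where
  "combE = tabE (\<lambda>i. tabE (\<lambda>c. tabE (\<lambda>e. tabE (\<lambda>f. Lit (tcode (comb c (ms ! i) (tdec e) (tdec f))))
     (2 + 2 * L) (Var 12)) (2 + 2 * L) (Var 10)) 6 cE) NP (Var 24)"

text \<open>A set is assembled as a sum of powers of two over the members found by exhaustive
  search; this is affordable because \<open>TE\<close> depends on the formula only.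
  \<open>2 - (2 - x)\<close> is the minimum of 2 and \<open>x\<close>.\<close>

definition opE :: exp where
  "opE = byc
    (sumE 14 (Lit (2 + 2 * L)) (Ite (exE 10 (Lit (2 + 2 * L)) (exE 12 (Lit (2 + 2 * L))
       (andE (andE (memE (Var 10) (Var 26)) (memE (Var 12) (Var 28))) (eqE combE (Var 14))))) (powE (Var 14)) (Lit 0)))
    (rdE p1E (Var 24) (Var 26) (Var 28))
    (prE (rdE p1E (Var 24) (pfstE 26) (pfstE 28)) (rdE (enE p1E) (Var 24) (psndE 26) (psndE 28)))
    (sumE 14 TE (Ite (exE 10 TE (exE 12 TE
       (andE (andE (memE (Var 10) (Var 26)) (memE (Var 12) (Var 28)))
         (eqE (prE (rdE (ueE p1E) (Var 24) (pfstE 10) (pfstE 12))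
            (Minus (Lit 2) (Minus (Lit 2) (Plus (psndE 10) (psndE 12))))) (Var 14))))) (powE (Var 14)) (Lit 0)))"

text \<open>Local 26 codes the set of variables that contain the vertex; a quantifier removes or
  adds one variable by subtracting or adding a power of two. For atoms, 1, 2, 4 and 8 are the bits
  of the tokens with codes 0 to 3.\<close>

definition leafE :: exp where
  "leafE = (let lf = (\<lambda>q m. rdE q (Lit NP) m (Lit 0)) in byc
    (Plus (Plus (Lit 1) (Ite (andE (andE (memE v1E (Var 26)) (memE v2E (Var 26))) (ltE (Lit 3) cE)) (Lit 2) (Lit 0)))
      (Plus (Ite (memE v1E (Var 26)) (Lit 4) (Lit 0)) (Ite (memE v2E (Var 26)) (Lit 8) (Lit 0))))
    (lf p1E (Var 26))
    (prE (lf p1E (Var 26)) (lf (enE p1E) (Var 26)))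
    (Plus (powE (prE (lf (ueE p1E) (Ite (memE vqE (Var 26)) (Minus (Var 26) (powE vqE)) (Var 26))) (Lit 0)))
      (powE (prE (lf (ueE p1E) (Ite (memE vqE (Var 26)) (Var 26) (Plus (Var 26) (powE vqE)))) (Lit 1)))))"

definition accE :: exp where
  "accE = (let ac = (\<lambda>q x. rdE q (Lit (NP + 1)) x (Lit 0)) in byc
    (memE (Lit 1) (Var 26))
    (notE (ac p1E (Var 26)))
    (Ite (eqE cE (Lit 7)) (andE (ac p1E (pfstE 26)) (ac (enE p1E) (psndE 26)))
       (orE (ac p1E (pfstE 26)) (ac (enE p1E) (psndE 26))))
    (Ite (eqE cE (Lit 9)) (exE 10 TE (andE (memE (Var 10) (Var 26)) (andE (eqE (psndE 10) (Lit 1)) (ac (ueE p1E) (pfstE 10)))))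
      (Ite (eqE cE (Lit 10)) (allE' 10 TE (orE (notE (andE (memE (Var 10) (Var 26)) (eqE (psndE 10) (Lit 1)))) (ac (ueE p1E) (pfstE 10))))
        (Ite (eqE cE (Lit 11)) (exE 10 TE (andE (memE (Var 10) (Var 26)) (ac (ueE p1E) (pfstE 10))))
          (allE' 10 TE (orE (notE (memE (Var 10) (Var 26))) (ac (ueE p1E) (pfstE 10))))))))"

definition ue'E :: exp where "ue'E = Ite (eqE cE (Lit 1)) (ueE p1E) p1E"
definition uv'E :: exp where "uv'E = Ite (eqE cE (Lit 1)) (Plus (uvE p1E) (Lit 1)) (Lit 0)"
definition en'E :: exp where
  "en'E = byc (ueE (ueE p1E)) (enE p1E) (enE (enE p1E)) (enE (ueE p1E))"

definition allkE :: exp where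
  "allkE = Ite (ltE (Var 24) (Lit NP)) opE (Ite (eqE (Var 24) (Lit NP)) leafE
     (Ite (eqE (Var 24) (Lit (NP + 1))) accE (Ite (eqE (Var 24) (Lit (NP + 2))) ue'E
     (Ite (eqE (Var 24) (Lit (NP + 3))) uv'E en'E))))"

definition fill_p :: com where
  "fill_p = For 24 (Lit (NP + 5)) (For 26 TE (For 28 TE
     (Asg 4 (prE pE (prE (Var 24) (prE (Var 26) (Var 28)))) allkE)))"

definition fill_tab :: com where
  "fill_tab = For 20 LFE fill_p"

text \<open>Two memories that agree on everything that the entries for position \<open>p\<close> depend on.\<close>

definition agree :: "nat \<Rightarrow> mem \<Rightarrow> mem \<Rightarrow> bool" where
  "agree p s s' \<longleftrightarrow> (\<forall>a. a \<noteq> 4 \<longrightarrow> s a = s' a) \<and> (\<forall>q z. p < q \<longrightarrow> s 4 (prod_encode (q, z)) = s' 4 (prod_encode (q, z)))"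

text \<open>Stability under changes of the tables at the current position and to its left. The
  position is recovered from local 20 as in \<open>pE\<close>.\<close>

definition sf :: "exp \<Rightarrow> bool" where
  "sf e \<longleftrightarrow> (\<forall>w r s s'. agree (s 1 0 - 1 - r 20) s s' \<longrightarrow> eval w e r s = eval w e r s')"

lemma sf_basic:
  "sf (Lit n)" "sf (Var x)" "a \<noteq> 4 \<Longrightarrow> sf e \<Longrightarrow> sf (Arr a e)"
  "sf e \<Longrightarrow> sf f \<Longrightarrow> sf (Plus e f)" "sf e \<Longrightarrow> sf f \<Longrightarrow> sf (Minus e f)"
proof -
  show "sf (Lit n)" "sf (Var x)" by (simp_all add: sf_def)
  assume e: "sf e"
  {
    assume "a \<noteq> 4"
    then have "agree p s s' \<Longrightarrow> s a = s' a" for p s s' by (simp add: agree_def)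
    with e show "sf (Arr a e)" unfolding sf_def eval.simps by metis
  }
  assume "sf f"
  with e show "sf (Plus e f)" "sf (Minus e f)" unfolding sf_def eval.simps by metis+
qed

lemma sf_Ite: "sf e \<Longrightarrow> sf f \<Longrightarrow> sf g \<Longrightarrow> sf (Ite e f g)"
  unfolding sf_def eval.simps by metis

lemma sf_Fold:
  assumes "sf e" "sf i" "sf b" "x \<noteq> 20" "y \<noteq> 20"
  shows "sf (Fold x y e i b)"
  unfolding sf_def
proof (intro allI impI)
  fix w and r :: env and s s' assume ag: "agree (s 1 0 - 1 - r 20) s s'"
  then have "eval w e r s = eval w e r s'" "eval w i r s = eval w i r s'"
    using assms unfolding sf_def by blast+
  moreover have "eval w b (r(x := j, y := a)) s = eval w b (r(x := j, y := a)) s'" for j a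
    using assms ag unfolding sf_def by simp
  ultimately show "eval w (Fold x y e i b) r s = eval w (Fold x y e i b) r s'"
    by simp
qed

lemma sf_pE: "sf pE"
  unfolding pE_def by (intro sf_basic) auto

lemma sf_rdE:
  assumes "sf q" "sf k" "sf x" "sf y"
  shows "sf (rdE q k x y)"
  unfolding sf_def
proof (intro allI impI)
  fix w and r :: env and s s' assume ag: "agree (s 1 0 - 1 - r 20) s s'"
  then have "eval w q r s = eval w q r s'" "eval w k r s = eval w k r s'" "eval w x r s = eval w x r s'"
    "eval w y r s = eval w y r s'" "eval w pE r s = eval w pE r s'"
    using assms sf_pE unfolding sf_def by blast+
  then show "eval w (rdE q k x y) r s = eval w (rdE q k x y) r s'"
    using ag by (auto simp: rdE_def agree_def pE_def)
qed

lemma sf_derived: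
  "sf a \<Longrightarrow> sf (notE a)" "sf a \<Longrightarrow> sf b \<Longrightarrow> sf (andE a b)" "sf a \<Longrightarrow> sf b \<Longrightarrow> sf (orE a b)"
  "sf a \<Longrightarrow> sf b \<Longrightarrow> sf (eqE a b)" "sf a \<Longrightarrow> sf b \<Longrightarrow> sf (ltE a b)"
  "sf n \<Longrightarrow> sf b \<Longrightarrow> x \<noteq> 20 \<Longrightarrow> Suc x \<noteq> 20 \<Longrightarrow> sf (exE x n b)"
  "sf n \<Longrightarrow> sf b \<Longrightarrow> x \<noteq> 20 \<Longrightarrow> Suc x \<noteq> 20 \<Longrightarrow> sf (allE' x n b)"
  "sf n \<Longrightarrow> sf b \<Longrightarrow> x \<noteq> 20 \<Longrightarrow> Suc x \<noteq> 20 \<Longrightarrow> sf (selE x n b)"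
  "sf n \<Longrightarrow> sf b \<Longrightarrow> x \<noteq> 20 \<Longrightarrow> Suc x \<noteq> 20 \<Longrightarrow> sf (sumE x n b)"
  unfolding notE_def andE_def orE_def eqE_def ltE_def exE_def allE'_def selE_def sumE_def
  by (intro sf_basic sf_Ite sf_Fold; assumption)+

lemma sf_arith:
  "sf a \<Longrightarrow> sf (powE a)" "sf a \<Longrightarrow> sf b \<Longrightarrow> sf (prE a b)" "sf a \<Longrightarrow> sf b \<Longrightarrow> sf (memE a b)"
  "sf (pfstE j)" "sf (psndE j)"
  unfolding powE_def prE_def triE_def memE_def oddE_def halfE_def pfstE_def psndE_def
  by (intro sf_basic sf_Ite sf_Fold sf_derived; (assumption | simp))+

lemma sf_tabE: "sf e \<Longrightarrow> (\<And>i. sf (F i)) \<Longrightarrow> sf (tabE F n e)"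
  by (induction n) (auto intro: sf_basic sf_Ite sf_derived)

lemma sf_allkE: "sf allkE"
  unfolding allkE_def opE_def leafE_def accE_def ue'E_def uv'E_def en'E_def byc_def combE_def v1E_def v2E_def vqE_def
    ueE_def uvE_def enE_def Let_def
  by (intro sf_basic sf_Ite sf_derived sf_arith sf_tabE sf_rdE sf_pE; simp)

text \<open>A rule for loops that only make progress with respect to a preorder on memories: what
  the body establishes for one index survives the remaining iterations.\<close>

lemma run_For_inv:
  fixes r :: env
  assumes trans: "\<And>a b c. le a b \<Longrightarrow> le b c \<Longrightarrow> le a (c :: mem)" and refl: "\<And>a. le a a"
    and n: "eval w e r s = n"
    and body: "\<And>j t. j < n \<Longrightarrow> le s0 t \<Longrightarrow> le t (run w c (r(x := j)) t) \<and> Q j (run w c (r(x := j)) t)"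
    and Q: "\<And>j t t'. j < n \<Longrightarrow> Q j t \<Longrightarrow> le t t' \<Longrightarrow> Q j t'"
    and s: "le s0 s"
  shows "le s (run w (For x e c) r s) \<and> (\<forall>j<n. Q j (run w (For x e c) r s))"
proof -
  let ?f = "\<lambda>k. fold (\<lambda>j s. run w c (r(x := j)) s) [0..<k] s"
  have "k \<le> n \<Longrightarrow> le s (?f k) \<and> (\<forall>j<k. Q j (?f k))" for k
  proof (induction k)
    case (Suc k)
    have f: "le s (?f k)" "\<forall>j<k. Q j (?f k)" using Suc.IH Suc.prems by (simp_all del: fun_upd_apply)
    then have "le s0 (?f k)" using s trans by blast
    then have b: "le (?f k) (run w c (r(x := k)) (?f k))" "Q k (run w c (r(x := k)) (?f k))"
      using body[of k] Suc.prems by auto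
    have "le s (?f (Suc k))" using f(1) b(1) trans by simp
    moreover have "Q j (?f (Suc k))" if "j < Suc k" for j
    proof (cases "j = k")
      case False
      then have "Q j (?f k)" using f(2) that by simp
      then show ?thesis using Q[OF _ _ b(1)] that Suc.prems by simp
    qed (use b in simp)
    ultimately show ?case by blast
  qed (use refl in simp)
  from this[of n] show ?thesis using n by simp
qed

definition env :: "env \<Rightarrow> nat \<Rightarrow> nat \<Rightarrow> nat \<Rightarrow> nat \<Rightarrow> env" where
  "env r i k x y = r(20 := i, 24 := k, 26 := x, 28 := y)"

lemma run_fill_p:
  fixes s0 :: mem and w :: "nat list" and r :: env
  assumes r: "r 20 = i"
  defines "p \<equiv> s0 1 0 - 1 - i" and "s1 \<equiv> run w fill_p r s0"
  shows "(\<forall>a. a \<noteq> 4 \<longrightarrow> s1 a = s0 a) \<and> (\<forall>q z. q \<noteq> p \<longrightarrow> s1 4 (prod_encode (q, z)) = s0 4 (prod_encode (q, z)))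
    \<and> (\<forall>k<NP + 5. \<forall>x<s0 3 0. \<forall>y<s0 3 0. s1 4 (cell p k x y) = eval w allkE (env r i k x y) s0)"
proof -
  define val where "val z = eval w allkE (env r i (pfst z) (pfst (psnd z)) (psnd (psnd z))) s0" for z
  \<comment> \<open>A cell of the current position is either untouched or holds its final value.
    This value can be computed from \<open>s0\<close>, since no entry reads cells of its own
    position.\<close>
  define le where "le s t \<longleftrightarrow> (\<forall>a. a \<noteq> 4 \<longrightarrow> t a = s a) \<and> (\<forall>q z. q \<noteq> p \<longrightarrow> t 4 (prod_encode (q, z)) = s 4 (prod_encode (q, z)))
     \<and> (\<forall>z. t 4 (prod_encode (p, z)) = s 4 (prod_encode (p, z)) \<or> t 4 (prod_encode (p, z)) = val z)" for s t :: mem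
  have le_trans: "le a c" if "le a b" "le b c" for a b c
    unfolding le_def
  proof (intro conjI allI impI)
    fix z show "c 4 (prod_encode (p, z)) = a 4 (prod_encode (p, z)) \<or> c 4 (prod_encode (p, z)) = val z"
      using that unfolding le_def by metis
  qed (use that in \<open>simp_all add: le_def\<close>)
  have le_refl: "le a a" for a by (simp add: le_def)
  define asg where "asg = Asg 4 (prE pE (prE (Var 24) (prE (Var 26) (Var 28)))) allkE"
  have fp: "fill_p = For 24 (Lit (NP + 5)) (For 26 TE (For 28 TE asg))" by (simp add: fill_p_def asg_def)
  have asg: "le t (run w asg (env r i k x y) t) \<and> run w asg (env r i k x y) t 4 (cell p k x y) = val (prod_encode (k, prod_encode (x, y)))"
    if "le s0 t" for k x y t
  proof -
    have t: "t 1 0 = s0 1 0" using that by (simp add: le_def)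
    have e: "env r i k x y 20 = i" by (simp add: env_def)
    have "agree p s0 t" using that by (auto simp: agree_def le_def)
    then have "eval w allkE (env r i k x y) s0 = eval w allkE (env r i k x y) t"
      using sf_allkE e unfolding sf_def p_def by metis
    moreover have "eval w (prE pE (prE (Var 24) (prE (Var 26) (Var 28)))) (env r i k x y) t = cell p k x y"
      by (simp add: pE_def env_def t[unfolded One_nat_def] p_def)
    ultimately show ?thesis
      by (auto simp: asg_def le_def val_def)
  qed
  have Qmono: "t' 4 (cell p k x y) = val (prod_encode (k, prod_encode (x, y)))"
    if "t 4 (cell p k x y) = val (prod_encode (k, prod_encode (x, y)))" "le t t'" for t t' k x y
    using that unfolding le_def by metis
  have T: "t 3 0 = s0 3 0" if "le s0 t" for t using that by (simp add: le_def)
  let ?r1 = "\<lambda>k. r(24 := k)"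
  let ?r2 = "\<lambda>k x. r(24 := k, 26 := x)"
  have envr: "(?r2 k x)(28 := y) = env r i k x y" for k x y
    using r by (auto simp: env_def fun_eq_iff)
  have 3: "le t (run w (For 28 TE asg) (?r2 k x) t) \<and>
     (\<forall>y<s0 3 0. run w (For 28 TE asg) (?r2 k x) t 4 (cell p k x y) = val (prod_encode (k, prod_encode (x, y))))"
    if t: "le s0 t" for k x t
  proof (rule run_For_inv[where le = le and ?s0.0 = s0])
    show "le a b \<Longrightarrow> le b c \<Longrightarrow> le a c" for a b c by (rule le_trans)
    show "le a a" for a by (rule le_refl)
    show "le s0 t" by (rule t)
    show "eval w TE (?r2 k x) t = s0 3 0" using T[OF t] by simp
    show "le u (run w asg ((?r2 k x)(28 := y)) u) \<and>
      run w asg ((?r2 k x)(28 := y)) u 4 (cell p k x y) = val (prod_encode (k, prod_encode (x, y)))"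
      if "le s0 u" for y u
      unfolding envr by (rule asg[OF that])
  qed (rule Qmono)
  have 2: "le t (run w (For 26 TE (For 28 TE asg)) (?r1 k) t) \<and>
     (\<forall>x<s0 3 0. \<forall>y<s0 3 0. run w (For 26 TE (For 28 TE asg)) (?r1 k) t 4 (cell p k x y) = val (prod_encode (k, prod_encode (x, y))))"
    if t: "le s0 t" for k t
  proof (rule run_For_inv[where le = le and ?s0.0 = s0])
    show "le a b \<Longrightarrow> le b c \<Longrightarrow> le a c" for a b c by (rule le_trans)
    show "le a a" for a by (rule le_refl)
    show "le s0 t" by (rule t)
    show "eval w TE (?r1 k) t = s0 3 0" using T[OF t] by simp
    show "le u (run w (For 28 TE asg) ((?r1 k)(26 := x)) u) \<and>
      (\<forall>y<s0 3 0. run w (For 28 TE asg) ((?r1 k)(26 := x)) u 4 (cell p k x y) = val (prod_encode (k, prod_encode (x, y))))"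
      if "le s0 u" for x u
      by (rule 3[OF that])
  qed (use Qmono in blast)
  have "le s0 (run w fill_p r s0) \<and>
     (\<forall>k<NP + 5. \<forall>x<s0 3 0. \<forall>y<s0 3 0. run w fill_p r s0 4 (cell p k x y) = val (prod_encode (k, prod_encode (x, y))))"
    unfolding fp
  proof (rule run_For_inv[where le = le and ?s0.0 = s0])
    show "le a b \<Longrightarrow> le b c \<Longrightarrow> le a c" for a b c by (rule le_trans)
    show "le a a" for a by (rule le_refl)
    show "le s0 s0" by (rule le_refl)
    show "eval w (Lit (NP + 5)) r s0 = NP + 5" by simp
    show "le u (run w (For 26 TE (For 28 TE asg)) (?r1 k) u) \<and>
      (\<forall>x<s0 3 0. \<forall>y<s0 3 0. run w (For 26 TE (For 28 TE asg)) (?r1 k) u 4 (cell p k x y) = val (prod_encode (k, prod_encode (x, y))))"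
      if "le s0 u" for k u
      by (rule 2[OF that])
  qed (use Qmono in blast)
  then show ?thesis unfolding s1_def by (auto simp: le_def val_def)
qed

text \<open>The positions are filled from right to left and an entry only refers to positions to its right,
  so that the equations still hold in the final memory.\<close>

theorem run_fill_tab:
  fixes s0 :: mem and w :: "nat list" and r :: env
  defines "s1 \<equiv> run w fill_tab r s0"
  shows "(\<forall>a. a \<noteq> 4 \<longrightarrow> s1 a = s0 a) \<and>
    (\<forall>p<s0 1 0. \<forall>k<NP + 5. \<forall>x<s0 3 0. \<forall>y<s0 3 0.
       s1 4 (cell p k x y) = eval w allkE (env r (s0 1 0 - 1 - p) k x y) s1)"
proof -
  define n where "n = s0 1 0"
  define f where "f i = fold (\<lambda>j s. run w fill_p (r(20 := j)) s) [0..<i] s0" for i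
  have "i \<le> n \<Longrightarrow> (\<forall>a. a \<noteq> 4 \<longrightarrow> f i a = s0 a) \<and>
    (\<forall>p<n. n \<le> p + i \<longrightarrow> (\<forall>k<NP + 5. \<forall>x<s0 3 0. \<forall>y<s0 3 0.
       f i 4 (cell p k x y) = eval w allkE (env r (n - 1 - p) k x y) (f i)))" for i
  proof (induction i)
    case 0
    then show ?case by (auto simp: f_def)
  next
    case (Suc i)
    then have IH1: "\<And>a. a \<noteq> 4 \<Longrightarrow> f i a = s0 a" and IH2: "\<And>p k x y. p < n \<Longrightarrow> n \<le> p + i \<Longrightarrow> k < NP + 5 \<Longrightarrow> x < s0 3 0 \<Longrightarrow> y < s0 3 0 \<Longrightarrow>
       f i 4 (cell p k x y) = eval w allkE (env r (n - 1 - p) k x y) (f i)" by auto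
    have fS: "f (Suc i) = run w fill_p (r(20 := i)) (f i)" by (simp add: f_def)
    have e: "f i 1 0 = n" "f i 3 0 = s0 3 0" using IH1 by (auto simp: n_def)
    define p0 where "p0 = n - 1 - i"
    note F = run_fill_p[of "r(20 := i)" i w "f i", folded fS, unfolded e, folded p0_def]
    have F1: "\<And>a. a \<noteq> 4 \<Longrightarrow> f (Suc i) a = f i a" and F2: "\<And>q z. q \<noteq> p0 \<Longrightarrow> f (Suc i) 4 (prod_encode (q, z)) = f i 4 (prod_encode (q, z))"
      and F3: "\<And>k x y. k < NP + 5 \<Longrightarrow> x < s0 3 0 \<Longrightarrow> y < s0 3 0 \<Longrightarrow> f (Suc i) 4 (cell p0 k x y) = eval w allkE (env (r(20 := i)) i k x y) (f i)"
      using F by auto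
    have env': "env (r(20 := i)) i k x y = env r i k x y" for k x y by (simp add: env_def)
    have stable: "eval w allkE (env r (n - 1 - p) k x y) (f i) = eval w allkE (env r (n - 1 - p) k x y) (f (Suc i))"
      if "p < n" "p0 \<le> p" for p k x y
    proof -
      have "agree p (f i) (f (Suc i))" using F1 F2 that by (auto simp: agree_def)
      moreover have "f i 1 0 - 1 - env r (n - 1 - p) k x y 20 = p" using that e by (simp add: env_def)
      ultimately show ?thesis using sf_allkE unfolding sf_def by metis
    qed
    show ?case
    proof (intro conjI allI impI)
      fix a :: nat assume "a \<noteq> 4" then show "f (Suc i) a = s0 a" using F1 IH1 by simp
    next
      fix p k x y assume p: "p < n" "n \<le> p + Suc i" and b: "k < NP + 5" "x < s0 3 0" "y < s0 3 0"
      show "f (Suc i) 4 (cell p k x y) = eval w allkE (env r (n - 1 - p) k x y) (f (Suc i))"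
      proof (cases "p = p0")
        case True
        then have "n - 1 - p = i" using Suc.prems p by (simp add: p0_def)
        then show ?thesis using F3[OF b] stable[OF p(1), of k x y] True env' by simp
      next
        case False
        then have "n \<le> p + i" "p0 \<le> p" using p Suc.prems by (auto simp: p0_def)
        then show ?thesis using IH2[OF p(1) _ b] F2[OF False] stable[OF p(1)] by simp
      qed
    qed
  qed
  from this[of n] show ?thesis
    by (auto simp: s1_def fill_tab_def f_def n_def)
qed

end

subsection \<open>Correctness of the tables\<close>

definition un :: "(nat \<Rightarrow> nat) \<Rightarrow> nat \<Rightarrow> nat \<Rightarrow> bool" where
  "un F q x \<longleftrightarrow> (\<forall>i<x. F (q + i) = 1) \<and> F (q + x) = 0"

text \<open>\<open>pos n F p f q\<close>: the word \<open>F\<close> of length \<open>n\<close> has the formula \<open>f\<close> at the positions from \<open>p\<close> to \<open>q\<close>.\<close>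

primrec pos :: "nat \<Rightarrow> (nat \<Rightarrow> nat) \<Rightarrow> nat \<Rightarrow> fm \<Rightarrow> nat \<Rightarrow> bool" where
  "pos n F p (Atm c X Y) q \<longleftrightarrow> F p = c \<and> c \<in> {2..5} \<and> (\<exists>x y. un F (p + 1) x \<and> un F (p + 2 + x) y \<and>
     X = 2 * x \<and> Y = 2 * y + of_bool (c = 5) \<and> q = p + 3 + x + y \<and> q \<le> n)"
| "pos n F p (Ng f) q \<longleftrightarrow> F p = 6 \<and> pos n F (p + 1) f q"
| "pos n F p (Bin c f g) q \<longleftrightarrow> F p = c \<and> c \<in> {7..8} \<and> (\<exists>u. pos n F (p + 1) f u \<and> pos n F u g q)"
| "pos n F p (Qn c v f) q \<longleftrightarrow> F p = c \<and> c \<in> {9..12} \<and> (\<exists>x. un F (p + 1) x \<and>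
     v = 2 * x + of_bool (10 < c) \<and> pos n F (p + 2 + x) f q)"

primrec occ :: "(nat \<Rightarrow> nat) \<Rightarrow> nat \<Rightarrow> nat list \<Rightarrow> bool" where
  "occ F p [] = True"
| "occ F p (x # xs) = (F p = x \<and> occ F (Suc p) xs)"

lemma occ_append: "occ F p (xs @ ys) \<longleftrightarrow> occ F p xs \<and> occ F (p + length xs) ys"
  by (induction xs arbitrary: p) auto

lemma occ_unary: "occ F p (unary x) \<Longrightarrow> un F p x"
proof -
  have "occ F p (replicate x 1) \<Longrightarrow> \<forall>i<x. F (p + i) = 1" for p
  proof (induction x arbitrary: p)
    case (Suc x)
    then show ?case using Suc.IH[of "Suc p"] by (auto simp: less_Suc_eq_0_disj)
  qed simp
  then show "occ F p (unary x) \<Longrightarrow> un F p x" by (auto simp: unary_def occ_append un_def)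
qed

lemma length_unary [simp]: "length (unary x) = Suc x"
  by (simp add: unary_def)

lemma occ_pos:
  "occ F p (formula_word \<phi>) \<Longrightarrow> p + length (formula_word \<phi>) \<le> n \<Longrightarrow> pos n F p (conv \<phi>) (p + length (formula_word \<phi>))"
proof (induction \<phi> arbitrary: p)
  case (Conj a b)
  then show ?case using Conj.IH(1)[of "Suc p"] Conj.IH(2)[of "Suc p + length (formula_word a)"]
    by (auto simp: occ_append algebra_simps)
next
  case (Disj a b)
  then show ?case using Disj.IH(1)[of "Suc p"] Disj.IH(2)[of "Suc p + length (formula_word a)"]
    by (auto simp: occ_append algebra_simps)
next
  case (Neg a)
  then show ?case using Neg.IH[of "Suc p"] by simp
next
  case (ExV x a)
  then show ?case using ExV.IH[of "p + 2 + x"]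
    by (auto simp: occ_append algebra_simps intro!: occ_unary exI[of _ x])
next
  case (AllV x a)
  then show ?case using AllV.IH[of "p + 2 + x"]
    by (auto simp: occ_append algebra_simps intro!: occ_unary exI[of _ x])
next
  case (ExS x a)
  then show ?case using ExS.IH[of "p + 2 + x"]
    by (auto simp: occ_append algebra_simps intro!: occ_unary exI[of _ x])
next
  case (AllS x a)
  then show ?case using AllS.IH[of "p + 2 + x"]
    by (auto simp: occ_append algebra_simps intro!: occ_unary exI[of _ x])
next
  case (Edge x y)
  then have "F p = 2" "un F (p + 1) x" "un F (p + 2 + x) y" by (auto simp: occ_append algebra_simps dest!: occ_unary)
  then show ?case using Edge.prems(2) by (auto intro!: exI[of _ x] exI[of _ y])
next
  case (Less x y)
  then have "F p = 3" "un F (p + 1) x" "un F (p + 2 + x) y" by (auto simp: occ_append algebra_simps dest!: occ_unary)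
  then show ?case using Less.prems(2) by (auto intro!: exI[of _ x] exI[of _ y])
next
  case (Equal x y)
  then have "F p = 4" "un F (p + 1) x" "un F (p + 2 + x) y" by (auto simp: occ_append algebra_simps dest!: occ_unary)
  then show ?case using Equal.prems(2) by (auto intro!: exI[of _ x] exI[of _ y])
next
  case (Member x y)
  then have "F p = 5" "un F (p + 1) x" "un F (p + 2 + x) y" by (auto simp: occ_append algebra_simps dest!: occ_unary)
  then show ?case using Member.prems(2) by (auto intro!: exI[of _ x] exI[of _ y])
qed

text \<open>Every connective takes at least one letter. The height of a formula is thus below its
  length, which turns the bound on types by height into one by length.\<close>

lemma pos_le: "pos n F p f q \<Longrightarrow> p + ht f < q \<and> q \<le> n"
proof (induction f arbitrary: p q)
  case (Bin c f g)
  then show ?case by fastforce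
next
  case (Qn c v f)
  then show ?case by fastforce
qed fastforce+

lemma sum_set_encode: "(\<Sum>z<n. if P z then 2 ^ z else 0) = set_encode {z. z < n \<and> P z}"
proof -
  have "(\<Sum>z<n. if P z then 2 ^ z else 0) = sum ((^) 2) {z \<in> {..<n}. P z}"
    by (rule sum.inter_filter[symmetric]) simp
  then show ?thesis by (simp add: set_encode_def)
qed

lemma image_bounded_eq:
  assumes "\<And>e. e \<in> X \<or> e \<in> Y \<Longrightarrow> e < (n :: nat)" "(\<lambda>(e, f). g e f) ` (X \<times> Y) \<subseteq> {..<n}"
  shows "{z. z < n \<and> (\<exists>e<n. \<exists>f<n. (e \<in> X \<and> f \<in> Y) \<and> g e f = z)} = (\<lambda>(e, f). g e f) ` (X \<times> Y)"
  using assms by (auto simp: image_iff)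

lemma vs_Qn_decode:
  assumes "x \<in> vs L (Qn c v f)" "e \<in> set_decode x"
  shows "pfst e \<in> vs L f"
proof -
  obtain E where E: "x = set_encode E" "E \<subseteq> prod_encode ` (vs L f \<times> {..2})" using assms(1) by auto
  have "finite (prod_encode ` (vs L f \<times> {..2}))" using finite_vs by simp
  then have "finite E" using E(2) finite_subset by blast
  then have "e \<in> E" using E(1) assms(2) by simp
  then show ?thesis using E(2) by auto
qed

text \<open>\<open>T\<close> has to exceed the types and also the codes of sets of variables, since
  both occur as arguments of the tables. Variables of the formula have numbers below
  \<open>2 * n + 2\<close>, their unary names being part of the word.\<close>

locale tables_sem = tables +
  fixes M :: mem and w :: "nat list" and r :: env and n T :: nat
  assumes n: "M 1 0 = n" and T: "M 3 0 = T"
    and L1: "1 \<le> L"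
    and ms: "\<And>m. m \<in> set ms \<Longrightarrow> \<exists>f g J. m = (f, g, J) \<and> (\<forall>a<L. f a < L \<and> g a < L)"
    and T1: "bnd L n \<le> T" and T2: "2 ^ (2 * n + 2) \<le> T"
    and fix_tab: "\<And>p k x y. p < n \<Longrightarrow> k < NP + 5 \<Longrightarrow> x < T \<Longrightarrow> y < T \<Longrightarrow>
       M 4 (cell p k x y) = eval w allkE (env r (n - 1 - p) k x y) M"
begin

abbreviation "G p k x y \<equiv> M 4 (cell p k x y)"
abbreviation "F \<equiv> M 2"

lemma T0: "2 < T"
proof -
  have "(2 :: nat) ^ 2 \<le> 2 ^ (2 * n + 2)" by (rule power_increasing) auto
  then have "(2 :: nat) ^ 2 \<le> T" using T2 by (rule order_trans)
  then show ?thesis by simp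
qed

lemma eval_pE [simp]: "eval w pE r' M = n - 1 - r' 20"
  using n by (simp add: pE_def)

lemma eval_rdE [simp]:
  "eval w (rdE q k x y) r' M = (if n - 1 - r' 20 < eval w q r' M
     then G (eval w q r' M) (eval w k r' M) (eval w x r' M) (eval w y r' M) else 0)"
  by (simp add: rdE_def)

lemma eval_byc [simp]:
  "eval w (byc a b c d) r' M = (let v = F (n - 1 - r' 20) in
     if v < 6 then eval w a r' M else if v < 7 then eval w b r' M else if v < 9 then eval w c r' M else eval w d r' M)"
  by (simp add: byc_def Let_def)

lemma env_simps [simp]:
  "env r i k x y 20 = i" "env r i k x y 24 = k" "env r i k x y 26 = x" "env r i k x y 28 = y"
  by (simp_all add: env_def)

lemma G_unary:
  assumes "p < n"
  shows "G p (NP + 2) 0 0 = (if F p = 1 then G (p + 1) (NP + 2) 0 0 else p + 1)"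
    and "G p (NP + 3) 0 0 = (if F p = 1 then G (p + 1) (NP + 3) 0 0 + 1 else 0)"
  using assms T0 fix_tab[of p "NP + 2" 0 0] fix_tab[of p "NP + 3" 0 0]
  by (simp_all add: allkE_def ue'E_def uv'E_def ueE_def uvE_def)

lemma un_sem: "un F q x \<Longrightarrow> q + x < n \<Longrightarrow> G q (NP + 2) 0 0 = q + x + 1 \<and> G q (NP + 3) 0 0 = x"
proof (induction x arbitrary: q)
  case 0
  then show ?case using G_unary[of q] by (simp add: un_def)
next
  case (Suc x)
  then have "un F (Suc q) x" "F q = 1" by (auto simp: un_def)
  then show ?case using Suc G_unary[of q] by simp
qed

lemma pos_end: "pos n F p f q \<Longrightarrow> G p (NP + 4) 0 0 = q"
proof (induction f arbitrary: p q)
  case (Atm c X Y)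
  then obtain x y where u: "F p = c" "c \<in> {2..5}" "un F (p + 1) x" "un F (p + 2 + x) y" "q = p + 3 + x + y" "q \<le> n"
    by auto
  then show ?case using T0 fix_tab[of p "NP + 4" 0 0] un_sem[of "p + 1" x] un_sem[of "p + 2 + x" y]
    by (simp add: allkE_def en'E_def ueE_def)
next
  case (Ng f)
  then show ?case using pos_le[of n F "p + 1" f q] T0 fix_tab[of p "NP + 4" 0 0] Ng.IH[of "p + 1" q]
    by (simp add: allkE_def en'E_def enE_def)
next
  case (Bin c f g)
  then obtain u where u: "F p = c" "c \<in> {7..8}" "pos n F (p + 1) f u" "pos n F u g q" by auto
  then show ?case using pos_le[of n F "p + 1" f u] pos_le[of n F u g q] T0 fix_tab[of p "NP + 4" 0 0]
      Bin.IH(1)[of "p + 1" u] Bin.IH(2)[of u q]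
    by (simp add: allkE_def en'E_def enE_def)
next
  case (Qn c v f)
  then obtain x where u: "F p = c" "c \<in> {9..12}" "un F (p + 1) x" "pos n F (p + 2 + x) f q" by auto
  then show ?case using pos_le[of n F "p + 2 + x" f q] T0 fix_tab[of p "NP + 4" 0 0]
      Qn.IH[of "p + 2 + x" q] un_sem[of "p + 1" x]
    by (simp add: allkE_def en'E_def enE_def ueE_def)
qed

lemma vs_T: "pos n F p f q \<Longrightarrow> x \<in> vs L f \<Longrightarrow> x < T"
  using vs_bound[of x L f] pos_le[of n F p f q] bnd_mono[of "ht f" n L] T1 by linarith

lemma eval_combE:
  assumes "r' 24 < NP" "F (n - 1 - r' 20) < 6" "r' 10 < 2 + 2 * L" "r' 12 < 2 + 2 * L"
  shows "eval w combE r' M = tcode (comb (F (n - 1 - r' 20)) (ms ! r' 24) (tdec (r' 10)) (tdec (r' 12)))"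
  using assms by (simp add: combE_def eval_tabE)

lemma ms_nth:
  assumes "i < NP"
  obtains f g J where "ms ! i = (f, g, J)" "\<And>a. a < L \<Longrightarrow> f a < L" "\<And>a. a < L \<Longrightarrow> g a < L"
proof -
  have "ms ! i \<in> set ms" using assms by (simp add: NP_def)
  from ms[OF this] that show thesis by blast
qed

text \<open>The tables are right only on arguments that are types. At a quantifier the search runs
  over all numbers below \<open>T\<close>, but the membership tests let only types pass.\<close>

theorem G_op:
  assumes "pos n F p f q" "i < NP" "x \<in> vs L f" "y \<in> vs L f"
  shows "G p i x y = opn (ms ! i) f x y"
  using assms(1,3,4)
proof (induction f arbitrary: p q x y)
  case (Atm c X Y)
  obtain f g J where m: "ms ! i = (f, g, J)" "\<And>a. a < L \<Longrightarrow> f a < L" "\<And>a. a < L \<Longrightarrow> g a < L"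
    using ms_nth[OF assms(2)] by blast
  have c: "F p = c" "c \<in> {2..5}" "p < n" using Atm.prems(1) by auto
  let ?D = "2 + 2 * L"
  let ?g = "\<lambda>e f. tcode (comb c (ms ! i) (tdec e) (tdec f))"
  have xy: "x < T" "y < T" using vs_T[OF Atm.prems(1)] Atm.prems by auto
  have "G p i x y = eval w opE (env r (n - 1 - p) i x y) M"
    using fix_tab[of p i x y] xy c assms(2) by (simp add: allkE_def)
  also have "\<dots> = (\<Sum>z<?D. if \<exists>e<?D. \<exists>f<?D. (e \<in> set_decode x \<and> f \<in> set_decode y) \<and> ?g e f = z then 2 ^ z else 0)"
  proof -
    have "eval w (sumE 14 (Lit ?D) (Ite (exE 10 (Lit ?D) (exE 12 (Lit ?D)
       (andE (andE (memE (Var 10) (Var 26)) (memE (Var 12) (Var 28))) (eqE combE (Var 14))))) (powE (Var 14)) (Lit 0)))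
        (env r (n - 1 - p) i x y) M
      = (\<Sum>z<eval w (Lit ?D) (env r (n - 1 - p) i x y) M. if \<exists>e<?D. \<exists>f<?D. (e \<in> set_decode x \<and> f \<in> set_decode y) \<and> ?g e f = z then 2 ^ z else 0)"
      by (rule eval_sumE) (use c assms(2) in \<open>simp add: eval_combE cong: conj_cong\<close>)
    then show ?thesis using c by (simp add: opE_def)
  qed
  also have "\<dots> = set_encode {z. z < ?D \<and> (\<exists>e<?D. \<exists>f<?D. (e \<in> set_decode x \<and> f \<in> set_decode y) \<and> ?g e f = z)}"
    by (rule sum_set_encode)
  also have "{z. z < ?D \<and> (\<exists>e<?D. \<exists>f<?D. (e \<in> set_decode x \<and> f \<in> set_decode y) \<and> ?g e f = z)}
     = (\<lambda>(e, f). ?g e f) ` (set_decode x \<times> set_decode y)"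
  proof (rule image_bounded_eq)
    show "e < ?D" if "e \<in> set_decode x \<or> e \<in> set_decode y" for e
      using that Atm.prems by (auto intro: in_set_decode_less_exp)
    have "opn (ms ! i) (Atm c X Y) x y < 2 ^ ?D"
      using opn_vs[OF m(1), of L x "Atm c X Y" y] m(2,3) Atm.prems(2,3) by simp
    then have "z < ?D" if "z \<in> set_decode (opn (ms ! i) (Atm c X Y) x y)" for z
      using that in_set_decode_less_exp by blast
    then show "(\<lambda>(e, f). ?g e f) ` (set_decode x \<times> set_decode y) \<subseteq> {..<?D}"
      by (simp add: subset_iff)
  qed
  finally show ?case by simp
next
  case (Ng f)
  have xy: "x < T" "y < T" using vs_T[OF Ng.prems(1)] Ng.prems by auto
  have p: "F p = 6" "pos n F (p + 1) f q" using Ng.prems(1) by auto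
  have "p + 1 < n" using pos_le[OF p(2)] by simp
  then show ?case using fix_tab[of p i x y] xy p assms(2) Ng.IH[OF p(2)] Ng.prems(2,3)
    by (simp add: allkE_def opE_def)
next
  case (Bin c f g)
  then obtain u where p: "F p = c" "c \<in> {7..8}" "pos n F (p + 1) f u" "pos n F u g q" by auto
  have le: "p + 1 < u" "u < n" "p + 1 < n" using pos_le[OF p(3)] pos_le[OF p(4)] by auto
  have xy: "x < T" "y < T" using vs_T[OF Bin.prems(1)] Bin.prems by auto
  obtain a b a' b' where ab: "x = prod_encode (a, b)" "a \<in> vs L f" "b \<in> vs L g"
    "y = prod_encode (a', b')" "a' \<in> vs L f" "b' \<in> vs L g" using Bin.prems(2,3) by auto
  have "G (p + 1) i a a' = opn (ms ! i) f a a'" "G u i b b' = opn (ms ! i) g b b'"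
    using Bin.IH(1)[OF p(3)] Bin.IH(2)[OF p(4)] ab by auto
  moreover have "G (p + 1) (NP + 4) 0 0 = u" using pos_end[OF p(3)] .
  ultimately show ?case using fix_tab[of p i x y] xy p(1,2) le assms(2)
    by (simp add: allkE_def opE_def enE_def ab)
next
  case (Qn c v f)
  then obtain x0 where p: "F p = c" "c \<in> {9..12}" "un F (p + 1) x0" "pos n F (p + 2 + x0) f q" by auto
  have le: "p + 2 + x0 < n" using pos_le[OF p(4)] by auto
  have ue: "G (p + 1) (NP + 2) 0 0 = p + 2 + x0" using un_sem[OF p(3)] le by simp
  have xy: "x < T" "y < T" using vs_T[OF Qn.prems(1)] Qn.prems by auto
  obtain f' g' J where m: "ms ! i = (f', g', J)" "\<And>a. a < L \<Longrightarrow> f' a < L" "\<And>a. a < L \<Longrightarrow> g' a < L"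
    using ms_nth[OF assms(2)] by blast
  let ?ga = "\<lambda>e f'. prod_encode (G (p + 2 + x0) i (pfst e) (pfst f'), min 2 (psnd e + psnd f'))"
  let ?g = "\<lambda>e f'. prod_encode (opn (ms ! i) f (pfst e) (pfst f'), min 2 (psnd e + psnd f'))"
  have mem: "pfst e \<in> vs L f" if "e \<in> set_decode x \<or> e \<in> set_decode y" for e
    using that Qn.prems(2,3) vs_Qn_decode by blast
  have "G p i x y = eval w opE (env r (n - 1 - p) i x y) M"
    using fix_tab[of p i x y] xy le assms(2) by (simp add: allkE_def)
  also have "\<dots> = (\<Sum>z<T. if \<exists>e<T. \<exists>f'<T. (e \<in> set_decode x \<and> f' \<in> set_decode y) \<and> ?ga e f' = z then 2 ^ z else 0)"
  proof -
    have m2: "2 - (2 - k) = min 2 k" for k :: nat by auto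
    have "eval w (sumE 14 TE (Ite (exE 10 TE (exE 12 TE
       (andE (andE (memE (Var 10) (Var 26)) (memE (Var 12) (Var 28)))
         (eqE (prE (rdE (ueE p1E) (Var 24) (pfstE 10) (pfstE 12))
            (Minus (Lit 2) (Minus (Lit 2) (Plus (psndE 10) (psndE 12))))) (Var 14))))) (powE (Var 14)) (Lit 0)))
        (env r (n - 1 - p) i x y) M
      = (\<Sum>z<eval w TE (env r (n - 1 - p) i x y) M. if \<exists>e<T. \<exists>f'<T. (e \<in> set_decode x \<and> f' \<in> set_decode y) \<and> ?ga e f' = z then 2 ^ z else 0)"
      by (rule eval_sumE) (use le ue T in \<open>simp add: ueE_def m2\<close>)
    then show ?thesis using p(1,2) le T by (simp add: opE_def)
  qed
  also have "\<dots> = set_encode {z. z < T \<and> (\<exists>e<T. \<exists>f'<T. (e \<in> set_decode x \<and> f' \<in> set_decode y) \<and> ?ga e f' = z)}"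
    by (rule sum_set_encode)
  also have "{z. z < T \<and> (\<exists>e<T. \<exists>f'<T. (e \<in> set_decode x \<and> f' \<in> set_decode y) \<and> ?ga e f' = z)}
     = {z. z < T \<and> (\<exists>e<T. \<exists>f'<T. (e \<in> set_decode x \<and> f' \<in> set_decode y) \<and> ?g e f' = z)}"
  proof -
    have "?ga e f' = ?g e f'" if "e \<in> set_decode x" "f' \<in> set_decode y" for e f'
      using Qn.IH[OF p(4)] mem that by simp
    then show ?thesis by (simp cong: conj_cong)
  qed
  also have "\<dots> = (\<lambda>(e, f'). ?g e f') ` (set_decode x \<times> set_decode y)"
  proof (rule image_bounded_eq)
    show "e < T" if "e \<in> set_decode x \<or> e \<in> set_decode y" for e
      using that xy in_set_decode_less[of e x] in_set_decode_less[of e y] by linarith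
    have "opn (ms ! i) (Qn c v f) x y < T"
      using opn_vs[OF m(1), of L x "Qn c v f" y] m(2,3) Qn.prems vs_T[OF Qn.prems(1)] by blast
    then have "z < T" if "z \<in> set_decode (opn (ms ! i) (Qn c v f) x y)" for z
      using in_set_decode_less[OF that] by simp
    then show "(\<lambda>(e, f'). ?g e f') ` (set_decode x \<times> set_decode y) \<subseteq> {..<T}"
      by (simp add: subset_iff)
  qed
  finally show ?case by simp
qed

lemma mask_T: "S \<subseteq> {..<2 * n + 2} \<Longrightarrow> set_encode S < T"
  using set_encode_less_exp[of S "2 * n + 2"] T2 by simp

theorem G_leaf:
  assumes "pos n F p f q" "S \<subseteq> {..<2 * n + 2}"
  shows "G p NP (set_encode S) 0 = leafn S f"
  using assms
proof (induction f arbitrary: p q S)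
  case (Atm c X Y)
  then obtain x y where u: "F p = c" "c \<in> {2..5}" "un F (p + 1) x" "un F (p + 2 + x) y" "q = p + 3 + x + y" "q \<le> n"
    "X = 2 * x" "Y = 2 * y + of_bool (c = 5)"
    by auto
  have fS: "finite S" using Atm.prems(2) finite_subset by blast
  have ue: "G (p + 1) (NP + 2) 0 0 = p + 2 + x" "G (p + 1) (NP + 3) 0 0 = x" "G (p + 2 + x) (NP + 3) 0 0 = y"
    using un_sem[of "p + 1" x] un_sem[of "p + 2 + x" y] u by auto
  have "G p NP (set_encode S) 0 = eval w leafE (env r (n - 1 - p) NP (set_encode S) 0) M"
    using fix_tab[of p NP "set_encode S" 0] mask_T[OF Atm.prems(2)] T0 u by (simp add: allkE_def)
  also have "\<dots> = 1 + of_bool (X \<in> S \<and> Y \<in> S \<and> 3 < c) * 2 + (of_bool (X \<in> S) * 4 + of_bool (Y \<in> S) * 8)"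
    using u ue fS by (simp add: leafE_def v1E_def v2E_def uvE_def ueE_def mult_2)
  also have "\<dots> = leafn S (Atm c X Y)"
    using u(2) by auto
  finally show ?case .
next
  case (Ng f)
  then show ?case using pos_le[of n F "p + 1" f q] T0 mask_T[of S] fix_tab[of p NP "set_encode S" 0] Ng.IH[of "p + 1" q S]
    by (simp add: allkE_def leafE_def)
next
  case (Bin c f g)
  then obtain u where u: "F p = c" "c \<in> {7..8}" "pos n F (p + 1) f u" "pos n F u g q" by auto
  then show ?case using pos_le[of n F "p + 1" f u] pos_le[of n F u g q] T0 fix_tab[of p NP "set_encode S" 0] mask_T[of S]
      Bin.IH(1)[of "p + 1" u S] Bin.IH(2)[of u q S] Bin.prems(2) pos_end[OF u(3)]
    by (simp add: allkE_def leafE_def enE_def)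
next
  case (Qn c v f)
  then obtain x where u: "F p = c" "c \<in> {9..12}" "un F (p + 1) x" "pos n F (p + 2 + x) f q" "v = 2 * x + of_bool (10 < c)" by auto
  have le: "p + 2 + x < n" using pos_le[OF u(4)] by auto
  have ue: "G (p + 1) (NP + 2) 0 0 = p + 2 + x" "G (p + 1) (NP + 3) 0 0 = x" using un_sem[OF u(3)] le by auto
  have fS: "finite S" using Qn.prems(2) finite_subset by blast
  have v: "v < 2 * n + 2" using u(5) le by (auto split: if_splits)
  have rem: "set_encode S - 2 ^ v = set_encode (S - {v})" if "v \<in> S"
  proof -
    have "insert v (S - {v}) = S" using that by auto
    then have "set_encode S = 2 ^ v + set_encode (S - {v})" using fS set_encode_insert[of "S - {v}" v] by simp
    then show ?thesis by simp
  qed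
  have 1: "(if v \<in> S then set_encode S - 2 ^ v else set_encode S) = set_encode (S - {v})"
    using rem by simp
  have 2: "(if v \<in> S then set_encode S else set_encode S + 2 ^ v) = set_encode (insert v S)"
    using fS by (simp add: insert_absorb)
  have IH: "G (p + 2 + x) NP (set_encode (S - {v})) 0 = leafn (S - {v}) f"
    "G (p + 2 + x) NP (set_encode (insert v S)) 0 = leafn (insert v S) f"
    by (rule Qn.IH[OF u(4)], use Qn.prems(2) v in force)+
  have vq: "x + x + of_bool (10 < c) = v" using u(5) by simp
  have "G p NP (set_encode S) 0 = eval w leafE (env r (n - 1 - p) NP (set_encode S) 0) M"
    using fix_tab[of p NP "set_encode S" 0] mask_T[OF Qn.prems(2)] T0 le by (simp add: allkE_def)
  also have "\<dots> = 2 ^ prod_encode (G (p + 2 + x) NP (if v \<in> S then set_encode S - 2 ^ v else set_encode S) 0, 0)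
     + 2 ^ prod_encode (G (p + 2 + x) NP (if v \<in> S then set_encode S else set_encode S + 2 ^ v) 0, 1)"
    using u(1,2) ue fS le by (simp add: leafE_def v1E_def vqE_def uvE_def ueE_def vq)
  also have "\<dots> = leafn S (Qn c v f)"
    unfolding 1 2 IH by simp
  finally show ?case .
qed

theorem G_acc:
  assumes "pos n F p f q" "x \<in> vs L f"
  shows "G p (NP + 1) x 0 \<noteq> 0 \<longleftrightarrow> accn f x"
  using assms
proof (induction f arbitrary: p q x)
  case (Atm c X Y)
  have "F p = c" "c \<in> {2..5}" "p < n" "x < T" using Atm.prems vs_T[OF Atm.prems(1)] by auto
  then show ?case using fix_tab[of p "NP + 1" x 0] T0 by (simp add: allkE_def accE_def)
next
  case (Ng f)
  then show ?case using pos_le[of n F "p + 1" f q] T0 vs_T[OF Ng.prems(1)] fix_tab[of p "NP + 1" x 0] Ng.IH[of "p + 1" q x]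
    by (simp add: allkE_def accE_def)
next
  case (Bin c f g)
  then obtain u where u: "F p = c" "c \<in> {7..8}" "pos n F (p + 1) f u" "pos n F u g q" by auto
  obtain a b where ab: "x = prod_encode (a, b)" "a \<in> vs L f" "b \<in> vs L g" using Bin.prems(2) by auto
  have "x < T" using vs_T[OF Bin.prems(1)] Bin.prems by auto
  then show ?case using pos_le[OF u(3)] pos_le[OF u(4)] T0 fix_tab[of p "NP + 1" x 0]
      Bin.IH(1)[OF u(3) ab(2)] Bin.IH(2)[OF u(4) ab(3)] pos_end[OF u(3)] u(1,2)
    by (auto simp add: allkE_def accE_def enE_def ab)
next
  case (Qn c v f)
  then obtain x0 where p: "F p = c" "c \<in> {9..12}" "un F (p + 1) x0" "pos n F (p + 2 + x0) f q" by auto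
  have le: "p + 2 + x0 < n" using pos_le[OF p(4)] by auto
  have ue: "G (p + 1) (NP + 2) 0 0 = p + 2 + x0" using un_sem[OF p(3)] le by simp
  have x: "x < T" using vs_T[OF Qn.prems(1)] Qn.prems by auto
  have mem: "pfst e \<in> vs L f" if "e \<in> set_decode x" for e
    using that Qn.prems(2) vs_Qn_decode by blast
  have IH: "0 < G (p + 2 + x0) (NP + 1) (pfst e) 0 \<longleftrightarrow> accn f (pfst e)" if "e \<in> set_decode x" for e
    using Qn.IH[OF p(4) mem[OF that]] by simp
  have eT: "e < T" if "e \<in> set_decode x" for e using in_set_decode_less[OF that] x by simp
  have ex: "(\<exists>e<T. e \<in> set_decode x \<and> Q e) \<longleftrightarrow> (\<exists>e\<in>set_decode x. Q e)" for Q using eT by blast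
  have all: "(\<forall>e<T. e \<in> set_decode x \<longrightarrow> Q e) \<longleftrightarrow> (\<forall>e\<in>set_decode x. Q e)" for Q using eT by blast
  let ?g = "\<lambda>e. 0 < G (p + 2 + x0) (NP + 1) (pfst e) 0"
  have 1: "G p (NP + 1) x 0 = eval w accE (env r (n - 1 - p) (NP + 1) x 0) M"
    using fix_tab[of p "NP + 1" x 0] x T0 le by (simp add: allkE_def)
  have 2: "eval w accE (env r (n - 1 - p) (NP + 1) x 0) M \<noteq> 0 \<longleftrightarrow> (if c = 9 then \<exists>e<T. e \<in> set_decode x \<and> psnd e = 1 \<and> ?g e
      else if c = 10 then \<forall>e<T. e \<in> set_decode x \<longrightarrow> psnd e = 1 \<longrightarrow> ?g e
      else if c = 11 then \<exists>e<T. e \<in> set_decode x \<and> ?g e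
      else \<forall>e<T. e \<in> set_decode x \<longrightarrow> ?g e)"
  proof -
    have "p < n - 1 + 1" "n - 1 - (n - 1 - p) = p" using le by simp_all
    moreover have "p < p + 1" "p < p + 2 + x0" by simp_all
    ultimately show ?thesis
      using p(1,2) ue T by (simp add: accE_def ueE_def Let_def) blast
  qed
  show ?case
    unfolding 1 2 ex all accn.simps using IH by (auto cong: conj_cong)
qed

end

section \<open>Searching for splits and labels\<close>

text \<open>A list of the elements is padded with its head. This is the reason for asking that the
  seeds and the tests of a split are nonempty.\<close>

lemma finite_set_enum:
  assumes "finite Q" "Q \<noteq> {}" "card Q \<le> k"
  obtains q :: "nat \<Rightarrow> 'a" where "Q = q ` {..<k}"
proof -
  obtain xs where xs: "set xs = Q" "length xs = card Q"
    using assms(1) by (metis distinct_card finite_distinct_list)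
  define q where "q i = (if i < length xs then xs ! i else hd xs)" for i
  have "xs \<noteq> []" using xs assms(2) by auto
  then have "hd xs \<in> Q" using xs by (metis hd_in_set)
  then have "q ` {..<k} \<subseteq> Q" using xs by (auto simp: q_def)
  moreover have "Q \<subseteq> q ` {..<k}"
  proof
    fix x assume "x \<in> Q"
    then obtain i where "i < length xs" "x = xs ! i" using xs by (metis in_set_conv_nth)
    then show "x \<in> q ` {..<k}" using xs assms(3) by (auto simp: q_def)
  qed
  ultimately show thesis using that by blast
qed

section \<open>Ranks and closures in a form that can be computed by search\<close>

context igraph
begin

lemma sm_singleton: "sm X {c} = {u \<in> X. A u c}"
proof -
  have "{w. w = c \<and> A w y} = (if A c y then {c} else {})" for y by auto
  then show ?thesis by (auto simp: sm_def A_sym[of c] split: if_splits)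
qed

text \<open>A certificate for small rank: \<open>m\<close> vertices such that adjacency to any
  vertex outside of \<open>X\<close> is a parity of adjacencies to some of them. Those that happen
  to lie in \<open>X\<close> are ignored, so any tuple of vertices is admissible.\<close>

lemma rank_leI:
  assumes X: "X \<subseteq> V"
    and "\<And>c. c \<in> V - X \<Longrightarrow> \<exists>J\<subseteq>{..<m}. \<forall>u\<in>X. A u c \<longleftrightarrow> odd (card {j \<in> J. \<gamma> j \<in> V - X \<and> A u (\<gamma> j)})"
  shows "R X \<le> 2 ^ m"
proof -
  define G where "G = \<gamma> ` {..<m} \<inter> (V - X)"
  have finG: "finite G" by (simp add: G_def)
  have *: "{u \<in> X. odd (card {j \<in> J. \<gamma> j \<in> V - X \<and> A u (\<gamma> j)})} \<in> sp X G" if "finite J" "J \<subseteq> {..<m}" for J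
    using that
  proof (induction J)
    case empty
    then show ?case by (simp add: empty_in_sp)
  next
    case (insert i J)
    let ?f = "\<lambda>J. {u \<in> X. odd (card {j \<in> J. \<gamma> j \<in> V - X \<and> A u (\<gamma> j)})}"
    have "{j \<in> insert i J. \<gamma> j \<in> V - X \<and> A u (\<gamma> j)} =
       (if \<gamma> i \<in> V - X \<and> A u (\<gamma> i) then insert i {j \<in> J. \<gamma> j \<in> V - X \<and> A u (\<gamma> j)}
        else {j \<in> J. \<gamma> j \<in> V - X \<and> A u (\<gamma> j)})" for u by auto
    note * = this
    have gen: "odd (card (if P then insert i S else S)) \<longleftrightarrow> P \<noteq> odd (card S)" if "finite S" "i \<notin> S" for P and S :: "nat set"
      using that by simp
    have "odd (card {j \<in> insert i J. \<gamma> j \<in> V - X \<and> A u (\<gamma> j)}) \<longleftrightarrow>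
       (\<gamma> i \<in> V - X \<and> A u (\<gamma> i)) \<noteq> odd (card {j \<in> J. \<gamma> j \<in> V - X \<and> A u (\<gamma> j)})" for u
      unfolding * by (rule gen) (use insert.hyps in auto)
    then have "u \<in> ?f (insert i J) \<longleftrightarrow> u \<in> X \<and> (\<gamma> i \<in> V - X \<and> A u (\<gamma> i)) \<noteq> (u \<in> ?f J)" for u
      unfolding mem_Collect_eq by blast
    then have eq: "?f (insert i J) = (if \<gamma> i \<in> V - X then sdiff (sm X {\<gamma> i}) (?f J) else ?f J)"
      unfolding set_eq_iff by (simp only: sm_singleton split: if_split) (simp only: in_sdiff mem_Collect_eq, blast)
    have "sm X {\<gamma> i} \<in> sp X G" if "\<gamma> i \<in> V - X"
      using that insert.prems by (auto simp: sp_def G_def)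
    moreover have "?f J \<in> sp X G" using insert by simp
    ultimately show ?case unfolding eq using sp_sdiff[OF finG] by simp
  qed
  have "sp X (V - X) \<subseteq> sp X G"
  proof (rule sp_trans[OF finG])
    show "finite (V - X)" using finV by simp
    fix c assume c: "c \<in> V - X"
    then obtain J where J: "J \<subseteq> {..<m}" "\<forall>u\<in>X. A u c \<longleftrightarrow> odd (card {j \<in> J. \<gamma> j \<in> V - X \<and> A u (\<gamma> j)})"
      using assms(2) by blast
    then have "sm X {c} = {u \<in> X. odd (card {j \<in> J. \<gamma> j \<in> V - X \<and> A u (\<gamma> j)})}"
      by (auto simp: sm_singleton)
    then show "sm X {c} \<in> sp X G" using *[of J] J(1) finite_subset by auto
  qed
  then have "R X \<le> card (sp X G)" unfolding R_def using finG by (intro card_mono) auto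
  also have "\<dots> \<le> 2 ^ card G" using finG by (rule card_sp_rows)
  also have "\<dots> \<le> 2 ^ m"
  proof -
    have "card G \<le> card (\<gamma> ` {..<m})" unfolding G_def by (intro card_mono) auto
    also have "\<dots> \<le> m" using card_image_le[of "{..<m}" \<gamma>] by simp
    finally show ?thesis by simp
  qed
  finally show ?thesis .
qed

text \<open>A basis of the rows has at most \<open>m\<close> elements and is padded to length
  \<open>m\<close> by an arbitrary vertex; the index sets \<open>J\<close> avoid the
  padding.\<close>

lemma rank_leD:
  assumes X: "X \<subseteq> V" "V \<noteq> {}" and R: "R X \<le> 2 ^ m"
  shows "\<exists>\<gamma>. (\<forall>j. \<gamma> j \<in> V) \<and>
    (\<forall>c\<in>V - X. \<exists>J\<subseteq>{..<m}. \<forall>u\<in>X. A u c \<longleftrightarrow> odd (card {j \<in> J. \<gamma> j \<in> V - X \<and> A u (\<gamma> j)}))"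
proof -
  obtain G where G: "G \<subseteq> V - X" "sp X G = sp X (V - X)" "2 ^ card G = card (sp X (V - X))"
    using basis_exists[of "V - X" X] finV by auto
  have finG: "finite G" using G(1) finV by (meson finite_Diff finite_subset)
  have "(2 :: nat) ^ card G \<le> 2 ^ m" using G(3) R by (simp add: R_def)
  then have cG: "card G \<le> m" by simp
  obtain xs where xs: "set xs = G" "distinct xs" using finG finite_distinct_list by blast
  have len: "length xs \<le> m" using cG xs distinct_card by metis
  obtain v0 where v0: "v0 \<in> V" using X(2) by blast
  define \<gamma> where "\<gamma> j = (if j < length xs then xs ! j else v0)" for j
  have "\<gamma> j \<in> V" for j using xs G(1) v0 nth_mem[of j xs] by (auto simp: \<gamma>_def)
  moreover have "\<exists>J\<subseteq>{..<m}. \<forall>u\<in>X. A u c \<longleftrightarrow> odd (card {j \<in> J. \<gamma> j \<in> V - X \<and> A u (\<gamma> j)})" if c: "c \<in> V - X" for c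
  proof -
    have "sm X {c} \<in> sp X G" unfolding G(2) using c by (auto simp: sp_def)
    then obtain S where S: "S \<subseteq> G" "sm X {c} = sm X S" by (auto simp: sp_def)
    define J where "J = {j. j < length xs \<and> xs ! j \<in> S}"
    have "A u c \<longleftrightarrow> odd (card {j \<in> J. \<gamma> j \<in> V - X \<and> A u (\<gamma> j)})" if u: "u \<in> X" for u
    proof -
      have "bij_betw (\<lambda>j. xs ! j) {j \<in> J. \<gamma> j \<in> V - X \<and> A u (\<gamma> j)} {x \<in> S. A x u}"
        unfolding bij_betw_def
      proof
        show "inj_on ((!) xs) {j \<in> J. \<gamma> j \<in> V - X \<and> A u (\<gamma> j)}"
          using xs(2) by (auto simp: inj_on_def J_def nth_eq_iff_index_eq)
        show "(!) xs ` {j \<in> J. \<gamma> j \<in> V - X \<and> A u (\<gamma> j)} = {x \<in> S. A x u}"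
        proof (intro equalityI subsetI)
          fix x assume "x \<in> (!) xs ` {j \<in> J. \<gamma> j \<in> V - X \<and> A u (\<gamma> j)}"
          then show "x \<in> {x \<in> S. A x u}" using A_sym by (auto simp: J_def \<gamma>_def)
        next
          fix x assume x: "x \<in> {x \<in> S. A x u}"
          then have "x \<in> set xs" using S(1) xs(1) by auto
          then obtain j where j: "j < length xs" "x = xs ! j" by (metis in_set_conv_nth)
          then have "j \<in> {j \<in> J. \<gamma> j \<in> V - X \<and> A u (\<gamma> j)}"
            using x S(1) G(1) A_sym by (auto simp: J_def \<gamma>_def)
          then show "x \<in> (!) xs ` {j \<in> J. \<gamma> j \<in> V - X \<and> A u (\<gamma> j)}" using j(2) by blast
        qed
      qed
      then have "card {j \<in> J. \<gamma> j \<in> V - X \<and> A u (\<gamma> j)} = card {x \<in> S. A x u}" by (rule bij_betw_same_card)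
      moreover have "A u c \<longleftrightarrow> u \<in> sm X {c}" using u by (simp add: sm_singleton)
      moreover have "u \<in> sm X S \<longleftrightarrow> odd (card {x \<in> S. A x u})" using u by (simp add: sm_def)
      ultimately show ?thesis using S(2) by simp
    qed
    moreover have "J \<subseteq> {..<m}" using len by (auto simp: J_def)
    ultimately show ?thesis by blast
  qed
  ultimately show ?thesis by blast
qed

primrec rounds :: "'a set \<Rightarrow> 'a set \<Rightarrow> nat \<Rightarrow> 'a set" where
  "rounds Q T 0 = Q"
| "rounds Q T (Suc r) = rounds Q T r \<union> bad Q T `` rounds Q T r"

lemma bad_subset: "bad Q T \<subseteq> V \<times> V"
  by (auto simp: bad_def)

text \<open>A path needs at most as many steps as there are bad pairs, and there are at most
  \<open>card V * card V\<close> of these. The bound is generous but polynomial.\<close>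

lemma rounds_clos:
  assumes "card V * card V \<le> r"
  shows "rounds Q T r = clos Q T"
proof -
  have fin: "finite (bad Q T)" using bad_subset finV by (meson finite_SigmaI finite_subset)
  have "card (bad Q T) \<le> r"
    using assms card_mono[OF _ bad_subset[of Q T]] finV by (auto simp: card_cartesian_product intro: le_trans)
  moreover have "rounds Q T r = (\<Union>i\<in>{..r}. bad Q T ^^ i) `` Q" for r
  proof (induction r)
    case (Suc r)
    have "bad Q T `` ((\<Union>i\<in>{..r}. bad Q T ^^ i) `` Q) = (\<Union>i\<in>{..r}. bad Q T ^^ Suc i) `` Q"
      by auto
    moreover have "(\<Union>i\<in>{..Suc r}. bad Q T ^^ i) = (\<Union>i\<in>{..r}. bad Q T ^^ i) \<union> (\<Union>i\<in>{..r}. bad Q T ^^ Suc i)"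
    proof -
      have "{..Suc r} = {..r} \<union> Suc ` {..r}"
        using atMost_Suc_eq_insert_0[of r] by auto
      then have "(\<Union>i\<in>{..Suc r}. bad Q T ^^ i) = (\<Union>i\<in>{..r} \<union> Suc ` {..r}. bad Q T ^^ i)" by (rule arg_cong)
      then show ?thesis by (simp only: UN_Un image_image)
    qed
    ultimately show ?case by (simp add: Suc.IH Un_Image)
  qed auto
  moreover have "(\<Union>i\<in>{..r}. bad Q T ^^ i) = (bad Q T)\<^sup>*" if "card (bad Q T) \<le> r" for r
  proof
    show "(\<Union>i\<in>{..r}. bad Q T ^^ i) \<subseteq> (bad Q T)\<^sup>*" by (auto intro: relpow_imp_rtrancl)
    show "(bad Q T)\<^sup>* \<subseteq> (\<Union>i\<in>{..r}. bad Q T ^^ i)"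
      unfolding rtrancl_finite_eq_relpow[OF fin] by (rule UN_mono) (use that in auto)
  qed
  ultimately show ?thesis by (simp add: clos_def)
qed

end

subsection \<open>Codes of tuples\<close>

primrec tcd :: "nat list \<Rightarrow> nat" where
  "tcd [] = 0"
| "tcd (d # ds) = prod_encode (d, tcd ds)"

text \<open>The exponent of a polynomial bound on the codes of tuples of length \<open>j\<close>:
  pairing numbers of at most \<open>l ^ e\<close> gives at most
  \<open>l ^ (2 * e + 4)\<close>.\<close>

primrec kk :: "nat \<Rightarrow> nat" where
  "kk 0 = 1"
| "kk (Suc j) = 2 * kk j + 4"

lemma triangle_le: "triangle s \<le> s * s"
  by (induction s) auto

lemma prod_encode_le_power:
  assumes "2 \<le> (l :: nat)" "a \<le> l ^ k" "b \<le> l ^ k"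
  shows "prod_encode (a, b) \<le> l ^ (2 * k + 4)"
proof -
  have "1 \<le> l ^ k" using assms(1) by simp
  then have s: "a + b + 1 \<le> 4 * l ^ k" using assms by linarith
  have "4 \<le> l ^ 2" using power_mono[of 2 l 2] assms(1) by simp
  then have "4 * l ^ k \<le> l ^ 2 * l ^ k" by (rule mult_right_mono) simp
  moreover have "l ^ 2 * l ^ k = l ^ (k + 2)" by (simp only: power_add mult.commute)
  ultimately have s2: "a + b + 1 \<le> l ^ (k + 2)" using s by linarith
  have "prod_encode (a, b) \<le> (a + b) * (a + b) + a" using triangle_le by (simp add: prod_encode_def)
  also have "\<dots> \<le> (a + b + 1) * (a + b + 1)" by (simp add: algebra_simps)
  also have "\<dots> \<le> l ^ (k + 2) * l ^ (k + 2)" using s2 by (intro mult_mono) auto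
  also have "\<dots> = l ^ ((k + 2) + (k + 2))" by (rule power_add[symmetric])
  also have "(k + 2) + (k + 2) = 2 * k + 4" by simp
  finally show ?thesis .
qed

lemma kk_pos: "1 \<le> kk j"
  by (induction j) auto

lemma tcd_le:
  assumes "2 \<le> l" "\<And>d. d \<in> set ds \<Longrightarrow> d \<le> l"
  shows "tcd ds \<le> l ^ kk (length ds)"
  using assms(2)
proof (induction ds)
  case (Cons d ds)
  have "d \<le> l ^ kk (length ds)"
    using Cons.prems[of d] kk_pos[of "length ds"] assms(1) self_le_power[of l "kk (length ds)"] by force
  then show ?case using Cons assms(1) by (simp only: tcd.simps kk.simps list.size prod_encode_le_power add_Suc_right add_0_right) (auto intro: prod_encode_le_power)
qed simp

section \<open>The program\<close>

text \<open>Cells of array \<open>a\<close> outside of the range of \<open>ix\<close> keep their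
  values and may be read meanwhile, so the rows of a table can refer to earlier rows of the same
  table.\<close>

lemma run_fill:
  fixes r :: env and s :: mem
  assumes N: "eval w e r s = N" and inj: "inj_on ix {..<N}"
    and ev: "\<And>v t. v < N \<Longrightarrow> (\<And>b. b \<noteq> a \<Longrightarrow> t b = s b) \<Longrightarrow> (\<And>z. z \<notin> ix ` {..<N} \<Longrightarrow> t a z = s a z) \<Longrightarrow>
        eval w ie (r(x := v)) t = ix v \<and> eval w e' (r(x := v)) t = h v"
  defines "s' \<equiv> run w (For x e (Asg a ie e')) r s"
  shows "(\<forall>v<N. s' a (ix v) = h v) \<and> (\<forall>z. z \<notin> ix ` {..<N} \<longrightarrow> s' a z = s a z) \<and> (\<forall>b. b \<noteq> a \<longrightarrow> s' b = s b)"
proof -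
  define f where "f k = fold (\<lambda>j s. run w (Asg a ie e') (r(x := j)) s) [0..<k] s" for k
  have "k \<le> N \<Longrightarrow> (\<forall>v<k. f k a (ix v) = h v) \<and> (\<forall>z. z \<notin> ix ` {..<N} \<longrightarrow> f k a z = s a z) \<and> (\<forall>b. b \<noteq> a \<longrightarrow> f k b = s b)" for k
  proof (induction k)
    case 0
    then show ?case by (simp add: f_def)
  next
    case (Suc k)
    then have IH: "\<forall>v<k. f k a (ix v) = h v" "\<And>z. z \<notin> ix ` {..<N} \<Longrightarrow> f k a z = s a z" "\<And>b. b \<noteq> a \<Longrightarrow> f k b = s b" by auto
    have k: "k < N" using Suc.prems by simp
    have "f (Suc k) = run w (Asg a ie e') (r(x := k)) (f k)" by (simp add: f_def)
    also have "\<dots> = (f k)(a := (f k a)(ix k := h k))"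
      using ev[OF k IH(3,2)] by simp
    finally have S: "f (Suc k) = (f k)(a := (f k a)(ix k := h k))" .
    have "ix v \<noteq> ix k" if "v < k" for v using inj that k by (auto simp: inj_on_def)
    then show ?case unfolding S using IH k by (auto simp: less_Suc_eq)
  qed
  from this[of N] show ?thesis by (simp add: s'_def f_def N)
qed

text \<open>For loops that build a table level by level: iteration \<open>i\<close> writes only into
  the cells \<open>W i\<close>, and its result must be insensitive to the cells of later
  levels.\<close>

lemma run_For_levels:
  fixes r :: env and s0 :: mem
  defines "ch \<equiv> \<lambda>W (s :: mem) s'. \<forall>a z. s' a z \<noteq> s a z \<longrightarrow> z \<in> W a"
  assumes N: "eval w e r s0 = N"
    and body: "\<And>i s. i < N \<Longrightarrow> ch (\<lambda>a. \<Union>j<N. W j a) s0 s \<Longrightarrow>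
       ch (W i) s (run w c (r(x := i)) s) \<and> Q i (run w c (r(x := i)) s)"
    and stable: "\<And>i j s s'. i < j \<Longrightarrow> j < N \<Longrightarrow> Q i s \<Longrightarrow> ch (W j) s s' \<Longrightarrow> Q i s'"
  shows "ch (\<lambda>a. \<Union>j<N. W j a) s0 (run w (For x e c) r s0) \<and> (\<forall>i<N. Q i (run w (For x e c) r s0))"
proof -
  define f where "f k = fold (\<lambda>j s. run w c (r(x := j)) s) [0..<k] s0" for k
  have "k \<le> N \<Longrightarrow> ch (\<lambda>a. \<Union>j<N. W j a) s0 (f k) \<and> (\<forall>i<k. Q i (f k))" for k
  proof (induction k)
    case 0
    then show ?case by (simp add: f_def ch_def)
  next
    case (Suc k)
    then have IH: "ch (\<lambda>a. \<Union>j<N. W j a) s0 (f k)" "\<And>i. i < k \<Longrightarrow> Q i (f k)" and k: "k < N" by auto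
    have S: "f (Suc k) = run w c (r(x := k)) (f k)" by (simp add: f_def)
    have b: "ch (W k) (f k) (f (Suc k))" "Q k (f (Suc k))" unfolding S using body[OF k IH(1)] by auto
    have "Q i (f (Suc k))" if "i < Suc k" for i
    proof (cases "i = k")
      case False
      then have "i < k" using that by simp
      then show ?thesis using stable[OF _ k IH(2) b(1)] by blast
    qed (use b in simp)
    moreover have "ch (\<lambda>a. \<Union>j<N. W j a) s0 (f (Suc k))"
      unfolding ch_def
    proof (intro allI impI)
      fix a z assume ne: "f (Suc k) a z \<noteq> s0 a z"
      show "z \<in> (\<Union>j<N. W j a)"
      proof (cases "f (Suc k) a z = f k a z")
        case True
        then show ?thesis using IH(1) ne by (simp add: ch_def)
      next
        case False
        then show ?thesis using b(1) k by (auto simp: ch_def)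
      qed
    qed
    ultimately show ?case by blast
  qed
  from this[of N] show ?thesis by (simp add: f_def N)
qed

text \<open>A loop with a single iteration whose accumulator starts with \<open>e\<close> serves as
  a binding; the index \<open>Suc x\<close> is set to 0 on the way.\<close>

definition letE :: "nat \<Rightarrow> exp \<Rightarrow> exp \<Rightarrow> exp" where
  "letE x e b = Fold (Suc x) x (Lit 1) e b"

lemma eval_letE [simp]: "eval w (letE x e b) r s = eval w b (r(Suc x := 0, x := eval w e r s)) s"
  by (simp add: letE_def)

definition orL :: "exp list \<Rightarrow> exp" where "orL es = foldr orE es (Lit 0)"
definition xorL :: "exp list \<Rightarrow> exp" where "xorL es = foldr (\<lambda>e acc. Ite e (notE acc) acc) es (Lit 0)"
definition neE :: "exp \<Rightarrow> exp" where "neE e = notE (notE e)"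

lemma eval_neE [simp]: "eval w (neE e) r s = of_bool (eval w e r s \<noteq> 0)"
  by (simp add: neE_def)

lemma eval_orL: "eval w (orL es) r s \<noteq> 0 \<longleftrightarrow> (\<exists>e\<in>set es. eval w e r s \<noteq> 0)"
  by (induction es) (auto simp: orL_def)

lemma eval_xorL: "distinct js \<Longrightarrow>
  eval w (xorL (map f js)) r s = of_bool (odd (card {j \<in> set js. eval w (f j) r s \<noteq> 0}))"
proof (induction js)
  case (Cons i js)
  have "{j \<in> set (i # js). eval w (f j) r s \<noteq> 0} =
    (if eval w (f i) r s \<noteq> 0 then insert i {j \<in> set js. eval w (f j) r s \<noteq> 0} else {j \<in> set js. eval w (f j) r s \<noteq> 0})"
    by auto
  moreover have "i \<notin> {j \<in> set js. eval w (f j) r s \<noteq> 0}" using Cons by simp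
  ultimately show ?case using Cons by (simp add: xorL_def)
qed (simp add: xorL_def)

abbreviation "lenE \<equiv> Arr 0 (Lit 0)"
abbreviation "nE \<equiv> Arr 6 (Lit 0)"
abbreviation "NTE \<equiv> Arr 7 (Lit 0)"
abbreviation "NBE \<equiv> Arr 8 (Lit 0)"

text \<open>Computing triangular numbers by a loop would violate the discipline of loop bounds that
  makes the cost polynomial, so they are looked up. \<open>prJ\<close> addresses the tables of
  types, whose indices are not polynomially bounded, and has an array of its own that is filled
  along with these tables.\<close>

definition prG :: "exp \<Rightarrow> exp \<Rightarrow> exp" where "prG a b = Plus (Arr 9 (Plus a b)) a"
definition prJ :: "exp \<Rightarrow> exp \<Rightarrow> exp" where "prJ a b = Plus (Arr 5 (Plus a b)) a"
definition adjE :: "exp \<Rightarrow> exp \<Rightarrow> exp" where "adjE u v = Ite (ltE u (Arr 6 (Lit 0))) (Inp (Plus (Arr 10 u) v)) (Lit 0)"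

primrec sndsE :: "nat \<Rightarrow> exp \<Rightarrow> exp" where
  "sndsE 0 t = t"
| "sndsE (Suc j) t = Arr 13 (sndsE j t)"

definition digE :: "nat \<Rightarrow> exp \<Rightarrow> exp" where "digE j t = Arr 12 (sndsE j t)"

text \<open>Array 6 contains the number \<open>n\<close> of vertices, array 7 a bound \<open>NT\<close> on the codes of tuples of vertices,
  array 8 a bound \<open>NB\<close> on all indices, arrays 5 and 9 triangular numbers for the pairing function,
  array 10 the positions of the rows of the adjacency matrix, and arrays 12 and 13 the two projections
  of pairs. Closures are computed in array 14, at index (round, (vertex, tuple)). Array 15 contains at
  \<open>(s, v)\<close> the block of the vertex \<open>v\<close> after \<open>s\<close> splits, of which the last one splits the block
  given by array 16 with the tuple given by array 17. After \<open>i\<close> merges, array 18 contains at \<open>(i, v)\<close>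
  the label of \<open>v\<close> and array 19 at \<open>(i, b)\<close> the type of the block \<open>b\<close>; arrays 20 and 21 describe the
  merges. The entries of arrays 16, 17, 20 and 21 are shifted by 1, since 0 means that a search failed.\<close>

locale graph_prog = tables +
  fixes m a1 a2 :: nat
begin

subsection \<open>Closures\<close>

text \<open>A code \<open>z\<close> of the tables of closures stands for a vertex and a tuple. The tuple consists of \<open>a1\<close>
  seeds, which are also the representatives, and of \<open>a2\<close> test vertices.\<close>

definition zc0 :: com where
  "zc0 = For 22 NTE (Asg 14 (prG (Lit 0) (Var 22))
     (orL (map (\<lambda>j. eqE (Arr 12 (Var 22)) (digE j (Arr 13 (Var 22)))) [0..<a1])))"

definition badE :: exp where
  "badE = orL (map (\<lambda>i. andE (notE (orL (map (\<lambda>j. notE (eqE (neE (adjE (Var 24) (digE (a1 + j) (Arr 13 (Var 22)))))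
       (neE (adjE (digE i (Arr 13 (Var 22))) (digE (a1 + j) (Arr 13 (Var 22))))))) [0..<a2])))
     (notE (eqE (neE (adjE (Var 24) (Arr 12 (Var 22)))) (neE (adjE (digE i (Arr 13 (Var 22))) (Arr 12 (Var 22))))))) [0..<a1])"

definition zcS :: com where
  "zcS = For 20 NTE (For 22 NTE (Asg 14 (prG (Plus (Var 20) (Lit 1)) (Var 22))
     (orE (Arr 14 (prG (Var 20) (Var 22)))
       (exE 24 nE (andE (Arr 14 (prG (Var 20) (prG (Var 24) (Arr 13 (Var 22))))) badE)))))"

subsection \<open>Splitting\<close>

definition partE :: "exp \<Rightarrow> exp \<Rightarrow> exp" where "partE s v = Arr 15 (prG s v)"

definition mXE :: "bool \<Rightarrow> exp \<Rightarrow> exp" where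
  "mXE f v = andE (eqE (partE (Var 20) v) (Var 26)) (eqE (neE (Arr 14 (prG NTE (prG v (Var 24))))) (Lit (of_bool f)))"

definition bitE :: "(exp \<Rightarrow> exp) \<Rightarrow> exp \<Rightarrow> exp \<Rightarrow> nat \<Rightarrow> exp" where
  "bitE X g u j = andE (ltE (digE j g) nE) (andE (notE (X (digE j g))) (adjE u (digE j g)))"

text \<open>The certificate for small rank is searched for. The subsets of the generating tuple are
  enumerated when the program is written and contribute a constant factor only.\<close>

definition rkE :: "bool \<Rightarrow> exp" where
  "rkE f = exE 30 NTE (allE' 32 nE (orE (mXE f (Var 32))
     (orL (map (\<lambda>J. allE' 34 nE (orE (notE (mXE f (Var 34)))
        (eqE (neE (adjE (Var 34) (Var 32))) (xorL (map (bitE (mXE f) (Var 30) (Var 34)) J))))) (subseqs [0..<m])))))"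

definition chkE :: exp where
  "chkE = andE (andE (exE 30 nE (mXE True (Var 30))) (exE 30 nE (mXE False (Var 30)))) (andE (rkE True) (rkE False))"

text \<open>A search returns one number, but a split consists of a tuple and a block. So the tuple
  is found by a search over both, and the block by a second search with the tuple fixed.\<close>

definition split_body :: com where
  "split_body = Seq (Asg 17 (Plus (Var 20) (Lit 1)) (selE 24 NTE (exE 26 nE chkE)))
    (Seq (Asg 16 (Plus (Var 20) (Lit 1)) (letE 24 (Minus (Arr 17 (Plus (Var 20) (Lit 1))) (Lit 1)) (selE 26 nE chkE)))
      (For 22 nE (Asg 15 (prG (Plus (Var 20) (Lit 1)) (Var 22))
         (letE 24 (Minus (Arr 17 (Plus (Var 20) (Lit 1))) (Lit 1))
           (letE 26 (Minus (Arr 16 (Plus (Var 20) (Lit 1))) (Lit 1))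
             (Ite (mXE True (Var 22)) (Plus (Var 20) (Lit 1)) (partE (Var 20) (Var 22))))))))"

definition split_com :: com where
  "split_com = For 20 (Minus nE (Lit 1)) split_body"

subsection \<open>Merging\<close>

text \<open>Local 36 contains the number \<open>s\<close> of the last block, local 26 the block with which it is merged,
  local 24 the code of the vertices that define the new labels, and local 28 the kind of merge.\<close>

definition mE :: "exp \<Rightarrow> exp" where "mE v = eqE (partE (Minus (Var 36) (Lit 1)) v) (Var 26)"
definition m1E :: "exp \<Rightarrow> exp" where "m1E v = eqE (partE (Var 36) v) (Var 26)"
definition m2E :: "exp \<Rightarrow> exp" where "m2E v = eqE (partE (Var 36) v) (Var 36)"

text \<open>The label lists, as a binary number, the adjacencies to the outer vertices among the
  \<open>m\<close> vertices coded by local 24.\<close>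

definition labE :: "exp \<Rightarrow> exp" where
  "labE u = foldr (\<lambda>j acc. Plus (Ite (bitE mE (Var 24) u j) (Lit (2 ^ j)) (Lit 0)) acc) [0..<m] (Lit 0)"

definition LBE :: "exp \<Rightarrow> exp" where "LBE v = Arr 18 (prG (Var 20) v)"

definition goodE :: exp where
  "goodE = allE' 30 nE (allE' 32 nE (orE (notE (andE (mE (Var 30)) (andE (mE (Var 32)) (eqE (labE (Var 30)) (labE (Var 32))))))
     (allE' 34 nE (orE (mE (Var 34)) (eqE (neE (adjE (Var 30) (Var 34))) (neE (adjE (Var 32) (Var 34))))))))"

definition rho1E :: "exp \<Rightarrow> exp" where
  "rho1E e = tabE (\<lambda>i. tabE (\<lambda>l. Lit (fst (ms ! i) l)) L e) NP (Var 28)"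
definition rho2E :: "exp \<Rightarrow> exp" where
  "rho2E e = tabE (\<lambda>i. tabE (\<lambda>l. Lit (fst (snd (ms ! i)) l)) L e) NP (Var 28)"
definition joinE :: "exp \<Rightarrow> exp \<Rightarrow> exp" where
  "joinE e f = tabE (\<lambda>i. tabE (\<lambda>l. tabE (\<lambda>l'. Lit (of_bool (snd (snd (ms ! i)) l l'))) L f) L e) NP (Var 28)"

definition consE :: exp where
  "consE = andE
    (allE' 30 nE (andE (orE (notE (m1E (Var 30))) (eqE (rho1E (LBE (Var 30))) (labE (Var 30))))
       (orE (notE (m2E (Var 30))) (eqE (rho2E (LBE (Var 30))) (labE (Var 30))))))
    (allE' 30 nE (allE' 32 nE (orE (notE (andE (m1E (Var 30)) (m2E (Var 32))))
       (eqE (neE (adjE (Var 30) (Var 32))) (joinE (LBE (Var 30)) (LBE (Var 32)))))))"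

text \<open>The merges undo the splits in reverse order: merge \<open>i\<close> belongs to split
  number \<open>n - 1 - i\<close>. The subtraction of 1 undoes the shift of array 16.\<close>

definition sbE :: "exp \<Rightarrow> exp" where
  "sbE e = letE 36 (Minus (Minus nE (Lit 1)) (Var 20)) (letE 26 (Minus (Arr 16 (Var 36)) (Lit 1)) e)"

abbreviation "i1E \<equiv> Plus (Var 20) (Lit 1)"

definition merge_body :: com where
  "merge_body = Seq (Asg 20 i1E (sbE (selE 24 NTE (exE 28 (Lit NP) (andE goodE consE)))))
    (Seq (Asg 21 i1E (sbE (letE 24 (Minus (Arr 20 i1E) (Lit 1)) (selE 28 (Lit NP) (andE goodE consE)))))
    (Seq (For 22 nE (Asg 18 (prG i1E (Var 22))
            (sbE (letE 24 (Minus (Arr 20 i1E) (Lit 1)) (Ite (mE (Var 22)) (labE (Var 22)) (LBE (Var 22)))))))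
         (For 22 nE (Asg 19 (prG i1E (Var 22))
            (sbE (Ite (eqE (Var 22) (Var 26))
               (Arr 4 (prJ (Lit 0) (prJ (Minus (Arr 21 i1E) (Lit 1))
                  (prJ (Arr 19 (prG (Var 20) (Var 26))) (Arr 19 (prG (Var 20) (Var 36)))))))
               (Arr 19 (prG (Var 20) (Var 22)))))))))"

text \<open>Every block starts as a single vertex with the type of a leaf for the empty set of
  variables, whose code is 0. Its label 0 is the initial content of array 18.\<close>

definition merge_com :: com where
  "merge_com = Seq (For 22 nE (Asg 19 (prG (Lit 0) (Var 22)) (Arr 4 (prJ (Lit 0) (prJ (Lit NP) (prJ (Lit 0) (Lit 0)))))))
     (For 20 (Minus nE (Lit 1)) merge_body)"

definition ansE :: exp where
  "ansE = Arr 4 (prJ (Lit 0) (prJ (Lit (NP + 1)) (prJ (Arr 19 (prG (Minus nE (Lit 1)) (Lit 0))) (Lit 0))))"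

definition tri_com :: com where
  "tri_com = For 20 NBE (Asg 9 i1E (Plus (Arr 9 (Var 20)) i1E))"

definition fs_com :: com where
  "fs_com = Seq (For 20 NTE (For 22 NTE (Asg 12 (prG (Var 20) (Var 22)) (Var 20))))
     (For 20 NTE (For 22 NTE (Asg 13 (prG (Var 20) (Var 22)) (Var 22))))"

definition graph_com :: com where
  "graph_com = Seq tri_com (Seq fs_com (Seq zc0 (Seq zcS (Seq split_com merge_com))))"

end

text \<open>\<open>fs\<close> and \<open>sn\<close> are the contents of arrays 12 and 13; up to the
  final assembly only their bounds matter. \<open>NB\<close> covers an index made of a round, a
  vertex and a tuple, so that every triangular number needed for addressing is available.\<close>

locale graph_sem = graph_prog +
  fixes w :: "nat list" and n NT NB :: nat and fs sn :: "nat \<Rightarrow> nat"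
  assumes n1: "1 \<le> n" and nNT: "n \<le> NT" and NB: "prod_encode (NT + 1, prod_encode (NT + 1, NT + 1)) \<le> NB"
    and L: "L = 2 ^ m" and fs_le: "fs z \<le> NT" and sn_le: "sn z \<le> NT"
begin

text \<open>The matrix begins behind the \<open>n + 1\<close> letters of the unary number.\<close>

definition Ad :: "nat \<Rightarrow> nat \<Rightarrow> bool" where
  "Ad u v \<longleftrightarrow> u < n \<and> eval w (Inp (Lit (n + 1 + u * n + v))) (\<lambda>_. 0) (\<lambda>_ _. 0) \<noteq> 0"

definition dig :: "nat \<Rightarrow> nat \<Rightarrow> nat" where "dig t j = fs ((sn ^^ j) t)"

definition base0 :: "mem \<Rightarrow> bool" where
  "base0 t \<longleftrightarrow> t 6 0 = n \<and> t 7 0 = NT \<and> t 8 0 = NB \<and> (\<forall>u<n. t 10 u = n + 1 + u * n) \<and> (\<forall>i\<le>NB. t 9 i = triangle i)"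

definition base :: "mem \<Rightarrow> bool" where
  "base t \<longleftrightarrow> base0 t \<and> t 12 = fs \<and> t 13 = sn"

lemma base_base0: "base t \<Longrightarrow> base0 t"
  by (simp add: base_def)

lemma evals0 [simp]:
  assumes "base0 t"
  shows "t 6 0 = n" "t 7 0 = NT" "t 8 0 = NB" "i \<le> NB \<Longrightarrow> t 9 i = triangle i" "u < n \<Longrightarrow> t 10 u = n + 1 + u * n"
  using assms by (auto simp: base0_def)

lemma eval_prG [simp]: "base0 t \<Longrightarrow> eval w a r t + eval w b r t \<le> NB \<Longrightarrow>
  eval w (prG a b) r t = prod_encode (eval w a r t, eval w b r t)"
  by (simp add: prG_def prod_encode_def)

lemma eval_adjE: "base0 t \<Longrightarrow>
  eval w (adjE u v) r t \<noteq> 0 \<longleftrightarrow> Ad (eval w u r t) (eval w v r t)"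
  by (simp add: adjE_def Ad_def)

lemma eval_sndsE: "t 13 = sn \<Longrightarrow> eval w (sndsE j e) r t = (sn ^^ j) (eval w e r t)"
  by (induction j) auto

lemma eval_digE [simp]: "base t \<Longrightarrow> eval w (digE j e) r t = dig (eval w e r t) j"
  by (simp add: digE_def base_def dig_def eval_sndsE)

lemma NB_bounds: "2 * NT + 2 \<le> NB" "prod_encode (a, b) + c \<le> NB" if "a \<le> NT" "b \<le> NT" "c \<le> NT + 1"
proof -
  have "triangle (a + b) \<le> triangle (NT + 1 + (NT + 1))" using that by (intro triangle_mono) auto
  then have 1: "prod_encode (a, b) \<le> prod_encode (NT + 1, NT + 1)" using that by (simp add: prod_encode_def)
  have "prod_encode (NT + 1, NT + 1) + (NT + 1) \<le> triangle (NT + 1 + prod_encode (NT + 1, NT + 1))"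
    by (simp add: le_triangle add.commute)
  also have "\<dots> \<le> NB"
  proof -
    have "triangle (i + j) \<le> prod_encode (i, j)" for i j by (simp add: prod_encode_def)
    then show ?thesis using NB by (rule le_trans)
  qed
  finally have 2: "prod_encode (NT + 1, NT + 1) + (NT + 1) \<le> NB" .
  then show "prod_encode (a, b) + c \<le> NB" using 1 that(3) by linarith
  have "NT + 1 \<le> prod_encode (NT + 1, NT + 1)" by (rule le_prod_encode_1)
  then show "2 * NT + 2 \<le> NB" using 2 by linarith
qed

definition bit :: "nat set \<Rightarrow> nat \<Rightarrow> nat \<Rightarrow> nat \<Rightarrow> bool" where
  "bit X g u j \<longleftrightarrow> dig g j < n \<and> dig g j \<notin> X \<and> Ad u (dig g j)"

definition rk :: "nat set \<Rightarrow> bool" where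
  "rk X \<longleftrightarrow> (\<exists>g<NT. \<forall>c<n. c \<in> X \<or> (\<exists>J\<subseteq>{..<m}. \<forall>u<n. u \<in> X \<longrightarrow> (Ad u c \<longleftrightarrow> odd (card {j \<in> J. bit X g u j}))))"

lemma eval_bitE:
  assumes "base t" "\<And>e. eval w e r t < n \<Longrightarrow> eval w (X e) r t \<noteq> 0 \<longleftrightarrow> eval w e r t \<in> S"
  shows "eval w (bitE X g u j) r t \<noteq> 0 \<longleftrightarrow> bit S (eval w g r t) (eval w u r t) j"
proof (cases "dig (eval w g r t) j < n")
  case True
  then have d: "eval w (digE j g) r t < n" using assms(1) by simp
  show ?thesis
    using assms(2)[OF d] eval_adjE[OF base_base0[OF assms(1)], of u "digE j g" r] assms(1)
    by (simp add: bitE_def bit_def base_base0 True)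
next
  case False
  then show ?thesis using assms(1) by (simp add: bitE_def bit_def base_base0)
qed

definition Zs :: "mem \<Rightarrow> nat \<Rightarrow> nat \<Rightarrow> bool" where
  "Zs t c v \<longleftrightarrow> t 14 (prod_encode (NT, prod_encode (v, c))) \<noteq> 0"

definition half :: "(nat \<Rightarrow> nat) \<Rightarrow> (nat \<Rightarrow> bool) \<Rightarrow> nat \<Rightarrow> bool \<Rightarrow> nat set" where
  "half P Z b f = {v. v < n \<and> P v = b \<and> Z v = f}"

definition chk :: "(nat \<Rightarrow> nat) \<Rightarrow> (nat \<Rightarrow> bool) \<Rightarrow> nat \<Rightarrow> bool" where
  "chk P Z b \<longleftrightarrow> half P Z b True \<noteq> {} \<and> half P Z b False \<noteq> {} \<and> rk (half P Z b True) \<and> rk (half P Z b False)"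

abbreviation row :: "mem \<Rightarrow> nat \<Rightarrow> nat \<Rightarrow> nat \<Rightarrow> nat" where
  "row t a i v \<equiv> t a (prod_encode (i, v))"

lemma eval_partE: "base t \<Longrightarrow> eval w s r t \<le> NT \<Longrightarrow> eval w v r t < n \<Longrightarrow>
   eval w (partE s v) r t = row t 15 (eval w s r t) (eval w v r t)"
  using nNT NB_bounds(1)[of 0 0 0] by (simp add: partE_def base_base0)

lemma eval_mXE:
  assumes "base t" "r 20 \<le> NT" "r 24 \<le> NT" "eval w e r t < n"
  shows "eval w (mXE f e) r t \<noteq> 0 \<longleftrightarrow> eval w e r t \<in> half (row t 15 (r 20)) (Zs t (r 24)) (r 26) f"
proof -
  have b: "base0 t" using assms base_base0 by blast
  have 1: "eval w (prG e (Var 24)) r t = prod_encode (eval w e r t, r 24)"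
    using assms nNT NB_bounds(1)[of 0 0 0] b by simp
  have 2: "eval w (prG NTE (prG e (Var 24))) r t = prod_encode (NT, prod_encode (eval w e r t, r 24))"
    using 1 b assms nNT NB_bounds(2)[of "eval w e r t" "r 24" NT] by (simp add: add.commute)
  show ?thesis
    using assms 2 eval_partE[of t "Var 20" r e] by (auto simp: mXE_def half_def Zs_def)
qed

lemma eval_rkE:
  fixes f :: bool
  assumes "base t" "r 20 \<le> NT" "r 24 \<le> NT"
  defines "X \<equiv> half (row t 15 (r 20)) (Zs t (r 24)) (r 26) f"
  shows "eval w (rkE f) r t \<noteq> 0 \<longleftrightarrow> rk X"
proof -
  have b: "base0 t" using assms base_base0 by blast
  let ?r = "\<lambda>g c u. r(30 := g, 31 := 0, 32 := c, 33 := 0, 34 := u, 35 := 0)"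
  have mX: "eval w (mXE f e) r' t \<noteq> 0 \<longleftrightarrow> eval w e r' t \<in> X"
    if "eval w e r' t < n" "r' 20 = r 20" "r' 24 = r 24" "r' 26 = r 26" for e r'
    using eval_mXE[of t r' e f] that assms by (simp add: X_def)
  have bit: "eval w (bitE (mXE f) (Var 30) (Var 34) j) (?r g c u) t \<noteq> 0 \<longleftrightarrow> bit X g u j" if "u < n" for g c u j
    using eval_bitE[OF assms(1), of "?r g c u" "mXE f" X "Var 30" "Var 34" j] that mX[of _ "?r g c u"] by simp
  have xor: "eval w (xorL (map (bitE (mXE f) (Var 30) (Var 34)) J)) (?r g c u) t = of_bool (odd (card {j \<in> set J. bit X g u j}))"
    if "u < n" "J \<in> set (subseqs [0..<m])" for g c u J
  proof -
    have "distinct J" using that(2) by (simp add: subseqs_distinctD)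
    then show ?thesis using bit[OF that(1)] by (simp only: eval_xorL)
  qed
  have adj: "eval w (adjE (Var 34) (Var 32)) (?r g c u) t \<noteq> 0 \<longleftrightarrow> Ad u c" if "u < n" for g c u
    using eval_adjE[OF b, of "Var 34" "Var 32" "?r g c u"] that by simp
  have all: "eval w (allE' 34 nE (orE (notE (mXE f (Var 34)))
        (eqE (neE (adjE (Var 34) (Var 32))) (xorL (map (bitE (mXE f) (Var 30) (Var 34)) J)))))
      (r(30 := g, 31 := 0, 32 := c, 33 := 0)) t \<noteq> 0 \<longleftrightarrow> (\<forall>u<n. u \<in> X \<longrightarrow> (Ad u c \<longleftrightarrow> odd (card {j \<in> set J. bit X g u j})))"
    if "J \<in> set (subseqs [0..<m])" for g c J
    using that b xor adj mX[of "Var 34"] by (simp add: of_bool_eq_iff) blast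
  have ors: "eval w (orL (map (\<lambda>J. allE' 34 nE (orE (notE (mXE f (Var 34)))
        (eqE (neE (adjE (Var 34) (Var 32))) (xorL (map (bitE (mXE f) (Var 30) (Var 34)) J))))) (subseqs [0..<m])))
      (r(30 := g, 31 := 0, 32 := c, 33 := 0)) t \<noteq> 0
     \<longleftrightarrow> (\<exists>J\<subseteq>{..<m}. \<forall>u<n. u \<in> X \<longrightarrow> (Ad u c \<longleftrightarrow> odd (card {j \<in> J. bit X g u j})))" for g c
  proof -
    have "(\<exists>J\<subseteq>{..<m}. Q J) \<longleftrightarrow> (\<exists>J\<in>set (subseqs [0..<m]). Q (set J))" for Q
    proof -
      have "Pow {..<m} = set ` set (subseqs [0..<m])" using subseqs_powset[of "[0..<m]"] by (simp add: atLeast0LessThan)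
      then show ?thesis by (metis (no_types, lifting) Pow_iff image_iff)
    qed
    then show ?thesis unfolding eval_orL using all by auto
  qed
  have main: "eval w (orE (mXE f (Var 32)) (orL (map (\<lambda>J. allE' 34 nE (orE (notE (mXE f (Var 34)))
        (eqE (neE (adjE (Var 34) (Var 32))) (xorL (map (bitE (mXE f) (Var 30) (Var 34)) J))))) (subseqs [0..<m]))))
      (r(30 := g, 31 := 0, 32 := c, 33 := 0)) t \<noteq> 0
     \<longleftrightarrow> c \<in> X \<or> (\<exists>J\<subseteq>{..<m}. \<forall>u<n. u \<in> X \<longrightarrow> (Ad u c \<longleftrightarrow> odd (card {j \<in> J. bit X g u j})))" if "c < n" for g c
  proof -
    have "eval w (mXE f (Var 32)) (r(30 := g, 31 := 0, 32 := c, 33 := 0)) t \<noteq> 0 \<longleftrightarrow> c \<in> X"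
      using mX[of "Var 32" "r(30 := g, 31 := 0, 32 := c, 33 := 0)"] that by simp
    then show ?thesis by (simp only: eval_bool of_bool_eq_0_iff not_not ors)
  qed
  show ?thesis
    unfolding rkE_def eval_exE eval_allE
    by (simp only: eval.simps evals0[OF b] of_bool_eq_0_iff not_not rk_def Suc_numeral add_num_simps main cong: imp_cong)
qed

lemma eval_chkE:
  assumes "base t" "r 20 \<le> NT" "r 24 \<le> NT"
  shows "eval w chkE r t \<noteq> 0 \<longleftrightarrow> chk (row t 15 (r 20)) (Zs t (r 24)) (r 26)"
proof -
  have b: "base0 t" using assms base_base0 by blast
  have ex: "eval w (exE 30 nE (mXE f (Var 30))) r t \<noteq> 0 \<longleftrightarrow> half (row t 15 (r 20)) (Zs t (r 24)) (r 26) f \<noteq> {}" for f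
  proof -
    have "eval w (mXE f (Var 30)) (r(30 := u, 31 := 0)) t \<noteq> 0 \<longleftrightarrow> u \<in> half (row t 15 (r 20)) (Zs t (r 24)) (r 26) f" if "u < n" for u
      using eval_mXE[of t "r(30 := u, 31 := 0)" "Var 30" f] that assms by simp
    then have "eval w (exE 30 nE (mXE f (Var 30))) r t \<noteq> 0 \<longleftrightarrow> (\<exists>u<n. u \<in> half (row t 15 (r 20)) (Zs t (r 24)) (r 26) f)"
      using b by (simp cong: conj_cong)
    then show ?thesis by (auto simp: half_def)
  qed
  show ?thesis using ex[of True] ex[of False] eval_rkE[OF assms, of True] eval_rkE[OF assms, of False]
    by (simp add: chkE_def chk_def) blast
qed

end

lemma run_fill2:
  fixes r :: env and s :: mem
  assumes N: "eval w e r s = N" and K: "\<And>u t. (\<And>b. b \<noteq> a \<Longrightarrow> t b = s b) \<Longrightarrow> eval w e2 (r(x := u)) t = K"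
    and ev: "\<And>u v t. u < N \<Longrightarrow> v < K \<Longrightarrow> (\<And>b. b \<noteq> a \<Longrightarrow> t b = s b) \<Longrightarrow>
        eval w ie (r(x := u, y := v)) t = prod_encode (u, v) \<and> eval w e' (r(x := u, y := v)) t = h u v"
  defines "s' \<equiv> run w (For x e (For y e2 (Asg a ie e'))) r s"
  shows "(\<forall>u<N. \<forall>v<K. s' a (prod_encode (u, v)) = h u v)
    \<and> (\<forall>z. (\<forall>u<N. \<forall>v<K. z \<noteq> prod_encode (u, v)) \<longrightarrow> s' a z = s a z) \<and> (\<forall>b. b \<noteq> a \<longrightarrow> s' b = s b)"
proof -
  define W where "W i b = (if b = a then prod_encode ` ({i} \<times> {..<K}) else {})" for i b :: nat
  define Q where "Q i t \<longleftrightarrow> (\<forall>v<K. t a (prod_encode (i, v)) = h i v)" for i and t :: mem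
  have "(\<forall>b z. s' b z \<noteq> s b z \<longrightarrow> z \<in> (\<Union>j<N. W j b)) \<and> (\<forall>i<N. Q i s')"
    unfolding s'_def
  proof (rule run_For_levels[OF N])
    fix i t assume i: "i < N" and t: "\<forall>b z. t b z \<noteq> s b z \<longrightarrow> z \<in> (\<Union>j<N. W j b)"
    have tb: "t b = s b" if "b \<noteq> a" for b
    proof
      fix z
      have "z \<notin> (\<Union>j<N. W j b)" using that by (simp add: W_def)
      then show "t b z = s b z" using t by blast
    qed
    let ?t' = "run w (For y e2 (Asg a ie e')) (r(x := i)) t"
    have *: "(\<forall>v<K. ?t' a (prod_encode (i, v)) = h i v) \<and> (\<forall>z. z \<notin> (\<lambda>v. prod_encode (i, v)) ` {..<K} \<longrightarrow> ?t' a z = t a z) \<and> (\<forall>b. b \<noteq> a \<longrightarrow> ?t' b = t b)"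
    proof (rule run_fill)
      show "eval w e2 (r(x := i)) t = K" by (rule K[OF tb])
      show "inj_on (\<lambda>v. prod_encode (i, v)) {..<K}" by (auto simp: inj_on_def)
      fix v u assume v: "v < K" and u: "\<And>b. b \<noteq> a \<Longrightarrow> u b = t b"
      then have "\<And>b. b \<noteq> a \<Longrightarrow> u b = s b" using tb by simp
      then show "eval w ie (r(x := i, y := v)) u = prod_encode (i, v) \<and> eval w e' (r(x := i, y := v)) u = h i v"
        by (rule ev[OF i v])
    qed
    have "z \<in> W i b" if ne: "?t' b z \<noteq> t b z" for b z
    proof (cases "b = a")
      case True
      then have "z \<in> (\<lambda>v. prod_encode (i, v)) ` {..<K}" using * ne by metis
      then show ?thesis using True by (auto simp: W_def)
    next
      case False
      then show ?thesis using * ne by metis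
    qed
    moreover have "Q i ?t'" unfolding Q_def using * by blast
    ultimately show "(\<forall>b z. ?t' b z \<noteq> t b z \<longrightarrow> z \<in> W i b) \<and> Q i ?t'"
      by blast
  next
    fix i j t t' assume ij: "i < j" and Q: "Q i t" and c: "\<forall>b z. t' b z \<noteq> t b z \<longrightarrow> z \<in> W j b"
    have "prod_encode (i, v) \<notin> W j a" for v using ij by (auto simp: W_def)
    then show "Q i t'" using Q c unfolding Q_def by metis
  qed
  then show ?thesis by (force simp: W_def Q_def fun_eq_iff)
qed

lemma first_cong_less:
  assumes "\<And>i. i < k \<Longrightarrow> P i \<longleftrightarrow> Q i"
  shows "first k P = first k Q"
proof (cases "\<exists>i<k. P i")
  case True
  define l where "l = (LEAST i. P i)"
  obtain i where i: "i < k" "P i" using True by blast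
  have l: "P l" "l < k" using LeastI[of P, OF i(2)] Least_le[of P, OF i(2)] i(1) by (auto simp: l_def)
  have "(LEAST i. Q i) = l"
  proof (rule Least_equality)
    show "Q l" using l assms by simp
    fix j assume "Q j"
    then show "l \<le> j"
      using assms[of j] Least_le[of P j] l(2) by (cases "j < k") (auto simp: l_def)
  qed
  then show ?thesis using True assms l by (auto simp: first_def l_def)
next
  case False
  then show ?thesis using assms by (auto simp: first_def)
qed

lemma eval_tabE': "eval w (tabE F k e) r s = (if eval w e r s < k then eval w (F (eval w e r s)) r s else 0)"
  by (induction k) auto

section \<open>Labels and merges in the program\<close>

context graph_sem
begin

lemma base_cong:
  assumes "base s" "\<And>b. b \<in> {6, 7, 8, 9, 10, 12, 13} \<Longrightarrow> t b = s b"
  shows "base t"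
proof -
  have "t 6 = s 6" "t 7 = s 7" "t 8 = s 8" "t 9 = s 9" "t 10 = s 10" "t 12 = s 12" "t 13 = s 13"
    using assms(2) by simp_all
  then show ?thesis using assms(1) by (simp only: base_def base0_def) blast
qed

definition blk :: "(nat \<Rightarrow> nat) \<Rightarrow> nat \<Rightarrow> nat set" where
  "blk P b = {v. v < n \<and> P v = b}"

definition lab :: "nat set \<Rightarrow> nat \<Rightarrow> nat \<Rightarrow> nat" where
  "lab X g u = (\<Sum>j<m. if bit X g u j then 2 ^ j else 0)"

definition good_code :: "nat set \<Rightarrow> nat \<Rightarrow> bool" where
  "good_code X g \<longleftrightarrow> (\<forall>u<n. \<forall>v<n. u \<in> X \<and> v \<in> X \<and> lab X g u = lab X g v \<longrightarrow> (\<forall>c<n. c \<in> X \<or> (Ad u c \<longleftrightarrow> Ad v c)))"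

text \<open>The components of a merge, with the default 0 that \<open>tabE\<close> delivers outside
  of its range.\<close>

definition rho1 :: "nat \<Rightarrow> nat \<Rightarrow> nat" where "rho1 i l = (if i < NP \<and> l < L then fst (ms ! i) l else 0)"
definition rho2 :: "nat \<Rightarrow> nat \<Rightarrow> nat" where "rho2 i l = (if i < NP \<and> l < L then fst (snd (ms ! i)) l else 0)"
definition joinl :: "nat \<Rightarrow> nat \<Rightarrow> nat \<Rightarrow> bool" where
  "joinl i l l' \<longleftrightarrow> i < NP \<and> l < L \<and> l' < L \<and> snd (snd (ms ! i)) l l'"

definition cons_code :: "nat set \<Rightarrow> nat set \<Rightarrow> nat set \<Rightarrow> nat \<Rightarrow> nat \<Rightarrow> (nat \<Rightarrow> nat) \<Rightarrow> bool" where
  "cons_code X X1 X2 g i Lb \<longleftrightarrow>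
     (\<forall>u<n. (u \<in> X1 \<longrightarrow> rho1 i (Lb u) = lab X g u) \<and> (u \<in> X2 \<longrightarrow> rho2 i (Lb u) = lab X g u))
     \<and> (\<forall>u<n. \<forall>v<n. u \<in> X1 \<and> v \<in> X2 \<longrightarrow> (Ad u v \<longleftrightarrow> joinl i (Lb u) (Lb v)))"

text \<open>A lookup at position 0, that is, for the whole formula. It is taken with array 5 as it
  stands; that the intended cell is hit follows once the size of this array is known.\<close>

definition OPv :: "mem \<Rightarrow> nat \<Rightarrow> nat \<Rightarrow> nat \<Rightarrow> nat" where
  "OPv t i x y = eval w (Arr 4 (prJ (Lit 0) (prJ (Lit i) (prJ (Lit x) (Lit y))))) (\<lambda>_. 0) t"

lemma eval_mE:
  assumes "base t" "r 36 \<le> NT" "eval w v r t < n"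
  shows "eval w (mE v) r t \<noteq> 0 \<longleftrightarrow> eval w v r t \<in> blk (row t 15 (r 36 - 1)) (r 26)"
  using assms eval_partE[of t "Minus (Var 36) (Lit 1)" r v] by (simp add: mE_def blk_def)

lemma eval_m1E:
  assumes "base t" "r 36 \<le> NT" "eval w v r t < n"
  shows "eval w (m1E v) r t \<noteq> 0 \<longleftrightarrow> eval w v r t \<in> blk (row t 15 (r 36)) (r 26)"
  using assms eval_partE[of t "Var 36" r v] by (simp add: m1E_def blk_def)

lemma eval_m2E:
  assumes "base t" "r 36 \<le> NT" "eval w v r t < n"
  shows "eval w (m2E v) r t \<noteq> 0 \<longleftrightarrow> eval w v r t \<in> blk (row t 15 (r 36)) (r 36)"
  using assms eval_partE[of t "Var 36" r v] by (simp add: m2E_def blk_def)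

lemma eval_labE:
  assumes "base t" "r 36 \<le> NT" "X = blk (row t 15 (r 36 - 1)) (r 26)"
  shows "eval w (labE u) r t = lab X (r 24) (eval w u r t)"
proof -
  have b: "eval w (bitE mE (Var 24) u j) r t \<noteq> 0 \<longleftrightarrow> bit X (r 24) (eval w u r t) j" for j
    using eval_bitE[OF assms(1), of r mE X "Var 24" u j] eval_mE[of t r] assms by simp
  have "eval w (foldr (\<lambda>j acc. Plus (Ite (bitE mE (Var 24) u j) (Lit (2 ^ j)) (Lit 0)) acc) js (Lit 0)) r t
     = (\<Sum>j\<leftarrow>js. if bit X (r 24) (eval w u r t) j then 2 ^ j else 0)" for js
  proof (induction js)
    case (Cons j js)
    have "(eval w (bitE mE (Var 24) u j) r t = 0) = (\<not> bit X (r 24) (eval w u r t) j)" using b[of j] by blast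
    then show ?case using Cons by simp
  qed simp
  then show ?thesis by (simp add: labE_def lab_def interv_sum_list_conv_sum_set_nat atLeast0LessThan)
qed

lemma eval_LBE: "base t \<Longrightarrow> r 20 \<le> NT \<Longrightarrow> eval w v r t < n \<Longrightarrow> eval w (LBE v) r t = row t 18 (r 20) (eval w v r t)"
  using nNT NB_bounds(1)[of 0 0 0] by (simp add: LBE_def base_base0)

lemma eval_goodE:
  assumes "base t" "r 36 \<le> NT" "X = blk (row t 15 (r 36 - 1)) (r 26)"
  shows "eval w goodE r t \<noteq> 0 \<longleftrightarrow> good_code X (r 24)"
proof -
  have b: "base0 t" using assms base_base0 by blast
  let ?r2 = "\<lambda>u v. r(30 := u, 31 := 0, 32 := v, 33 := 0)"
  let ?r3 = "\<lambda>u v c. r(30 := u, 31 := 0, 32 := v, 33 := 0, 34 := c, 35 := 0)"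
  have m: "(0 < eval w (mE (Var 30)) (?r2 u v) t) = (u \<in> X)" "(0 < eval w (mE (Var 32)) (?r2 u v) t) = (v \<in> X)"
    "(0 < eval w (mE (Var 34)) (?r3 u v c) t) = (c \<in> X)" if "u < n" "v < n" "c < n" for u v c
    using eval_mE[OF assms(1), of "?r2 u v" "Var 30"] eval_mE[OF assms(1), of "?r2 u v" "Var 32"]
      eval_mE[OF assms(1), of "?r3 u v c" "Var 34"] that assms(2,3) by auto
  have l: "eval w (labE (Var 30)) (?r2 u v) t = lab X (r 24) u" "eval w (labE (Var 32)) (?r2 u v) t = lab X (r 24) v" for u v
    using eval_labE[OF assms(1), of "?r2 u v" X] assms(2,3) by auto
  have ad: "(0 < eval w (adjE (Var 30) (Var 34)) (?r3 u v c) t) = Ad u c" "(0 < eval w (adjE (Var 32) (Var 34)) (?r3 u v c) t) = Ad v c" for u v c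
    using eval_adjE[OF b, of "Var 30" "Var 34" "?r3 u v c"] eval_adjE[OF b, of "Var 32" "Var 34" "?r3 u v c"] by auto
  have "eval w goodE r t \<noteq> 0 \<longleftrightarrow> (\<forall>u<n. \<forall>v<n. u \<in> X \<and> v \<in> X \<and> lab X (r 24) u = lab X (r 24) v \<longrightarrow> (\<forall>c<n. c \<in> X \<or> (Ad u c = Ad v c)))"
    using b by (simp add: goodE_def m l ad) blast
  then show ?thesis by (simp add: good_code_def)
qed

lemma eval_consE:
  assumes "base t" "r 36 \<le> NT" "r 20 \<le> NT" "X = blk (row t 15 (r 36 - 1)) (r 26)"
    "X1 = blk (row t 15 (r 36)) (r 26)" "X2 = blk (row t 15 (r 36)) (r 36)"
  shows "eval w consE r t \<noteq> 0 \<longleftrightarrow> cons_code X X1 X2 (r 24) (r 28) (row t 18 (r 20))"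
proof -
  have b: "base0 t" using assms base_base0 by blast
  let ?Lb = "row t 18 (r 20)"
  let ?r1 = "\<lambda>u. r(30 := u, 31 := 0)"
  let ?r2 = "\<lambda>u v. r(30 := u, 31 := 0, 32 := v, 33 := 0)"
  have m: "(0 < eval w (m1E (Var 30)) (?r1 u) t) = (u \<in> X1)" "(0 < eval w (m2E (Var 30)) (?r1 u) t) = (u \<in> X2)"
    "(0 < eval w (m1E (Var 30)) (?r2 u v) t) = (u \<in> X1)" "(0 < eval w (m2E (Var 32)) (?r2 u v) t) = (v \<in> X2)"
    if "u < n" "v < n" for u v
    using eval_m1E[OF assms(1), of "?r1 u" "Var 30"] eval_m2E[OF assms(1), of "?r1 u" "Var 30"]
      eval_m1E[OF assms(1), of "?r2 u v" "Var 30"] eval_m2E[OF assms(1), of "?r2 u v" "Var 32"] that assms(2,5,6) by auto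
  have l: "eval w (labE (Var 30)) (?r1 u) t = lab X (r 24) u" for u
    using eval_labE[OF assms(1), of "?r1 u" X] assms(2,4) by auto
  have LB: "eval w (LBE (Var 30)) (?r1 u) t = ?Lb u" "eval w (LBE (Var 30)) (?r2 u v) t = ?Lb u" "eval w (LBE (Var 32)) (?r2 u v) t = ?Lb v"
    if "u < n" "v < n" for u v
    using eval_LBE[OF assms(1), of "?r1 u" "Var 30"] eval_LBE[OF assms(1), of "?r2 u v" "Var 30"]
      eval_LBE[OF assms(1), of "?r2 u v" "Var 32"] that assms(3) by auto
  have ad: "(0 < eval w (adjE (Var 30) (Var 32)) (?r2 u v) t) = Ad u v" for u v
    using eval_adjE[OF b, of "Var 30" "Var 32" "?r2 u v"] by auto
  have rh: "eval w (rho1E (LBE (Var 30))) (?r1 u) t = rho1 (r 28) (?Lb u)" "eval w (rho2E (LBE (Var 30))) (?r1 u) t = rho2 (r 28) (?Lb u)"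
    if "u < n" for u
    using LB[OF that that] by (simp_all add: rho1E_def rho2E_def rho1_def rho2_def eval_tabE')
  have jn: "eval w (joinE (LBE (Var 30)) (LBE (Var 32))) (?r2 u v) t = of_bool (joinl (r 28) (?Lb u) (?Lb v))"
    if "u < n" "v < n" for u v
    using LB[OF that] by (simp add: joinE_def joinl_def eval_tabE')
  have "eval w consE r t \<noteq> 0 \<longleftrightarrow>
     (\<forall>u<n. (u \<in> X1 \<longrightarrow> rho1 (r 28) (?Lb u) = lab X (r 24) u) \<and> (u \<in> X2 \<longrightarrow> rho2 (r 28) (?Lb u) = lab X (r 24) u))
     \<and> (\<forall>u<n. \<forall>v<n. u \<in> X1 \<and> v \<in> X2 \<longrightarrow> (Ad u v = joinl (r 28) (?Lb u) (?Lb v)))"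
    using b by (simp add: consE_def m l ad rh jn of_bool_eq_iff) blast
  then show ?thesis by (simp add: cons_code_def)
qed

subsection \<open>The defining equations of the tables\<close>

definition tri_ok :: "mem \<Rightarrow> bool" where "tri_ok t \<longleftrightarrow> (\<forall>i\<le>NB. t 9 i = triangle i)"

definition bd_step :: "nat \<Rightarrow> nat \<Rightarrow> bool" where
  "bd_step u z \<longleftrightarrow> (\<exists>i<a1. (\<forall>j<a2. Ad u (dig (sn z) (a1 + j)) \<longleftrightarrow> Ad (dig (sn z) i) (dig (sn z) (a1 + j)))
     \<and> Ad u (fs z) \<noteq> Ad (dig (sn z) i) (fs z))"

definition zc_eqs :: "mem \<Rightarrow> bool" where
  "zc_eqs t \<longleftrightarrow> (\<forall>z<NT. t 14 (prod_encode (0, z)) \<noteq> 0 \<longleftrightarrow> (\<exists>j<a1. fs z = dig (sn z) j))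
    \<and> (\<forall>i<NT. \<forall>z<NT. t 14 (prod_encode (Suc i, z)) \<noteq> 0 \<longleftrightarrow> t 14 (prod_encode (i, z)) \<noteq> 0
        \<or> (\<exists>u<n. t 14 (prod_encode (i, prod_encode (u, sn z))) \<noteq> 0 \<and> bd_step u z))"

text \<open>A property of the final memory that mentions neither program nor run. The correctness of
  the decomposition is derived from such equations only. \<open>c - 1\<close> and
  \<open>b - 1\<close> undo the shift of the searches.\<close>

definition split_eq :: "nat \<Rightarrow> mem \<Rightarrow> bool" where
  "split_eq i t \<longleftrightarrow> (let P = row t 15 i; c = t 17 (Suc i); b = t 16 (Suc i) in
     c = first NT (\<lambda>c. \<exists>b<n. chk P (Zs t c) b) \<and> b = first n (chk P (Zs t (c - 1)))
     \<and> (\<forall>v<n. row t 15 (Suc i) v = (if v \<in> half P (Zs t (c - 1)) (b - 1) True then Suc i else P v)))"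

definition merge_eq :: "nat \<Rightarrow> mem \<Rightarrow> bool" where
  "merge_eq i t \<longleftrightarrow> (let s = n - 1 - i; b = t 16 s - 1; X = blk (row t 15 (s - 1)) b;
     X1 = blk (row t 15 s) b; X2 = blk (row t 15 s) s; Lb = row t 18 i; g = t 20 (Suc i); p = t 21 (Suc i) in
     g = first NT (\<lambda>g. \<exists>q<NP. good_code X g \<and> cons_code X X1 X2 g q Lb)
     \<and> p = first NP (\<lambda>q. good_code X (g - 1) \<and> cons_code X X1 X2 (g - 1) q Lb)
     \<and> (\<forall>v<n. row t 18 (Suc i) v = (if v \<in> X then lab X (g - 1) v else Lb v))
     \<and> (\<forall>v<n. row t 19 (Suc i) v = (if v = b then OPv t (p - 1) (row t 19 i b) (row t 19 i s) else row t 19 i v)))"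

lemma run_tri:
  assumes "s 8 0 = NB" "s 9 = (\<lambda>_. 0)"
  shows "tri_ok (run w tri_com r s) \<and> (\<forall>a. a \<noteq> 9 \<longrightarrow> run w tri_com r s a = s a)"
proof -
  define f where "f k = fold (\<lambda>j s. run w (Asg 9 i1E (Plus (Arr 9 (Var 20)) i1E)) (r(20 := j)) s) [0..<k] s" for k
  have "(\<forall>i\<le>k. f k 9 i = triangle i) \<and> (\<forall>a. a \<noteq> 9 \<longrightarrow> f k a = s a)" for k
  proof (induction k)
    case 0
    then show ?case using assms by (simp add: f_def)
  next
    case (Suc k)
    have "f (Suc k) = run w (Asg 9 i1E (Plus (Arr 9 (Var 20)) i1E)) (r(20 := k)) (f k)" by (simp add: f_def)
    then have "f (Suc k) = (f k)(9 := (f k 9)(Suc k := f k 9 k + Suc k))" by simp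
    then show ?case using Suc by (auto simp: le_Suc_eq)
  qed
  from this[of NB] show ?thesis using assms by (simp add: tri_com_def f_def tri_ok_def)
qed

lemma run_zc0:
  fixes s :: mem and r :: env
  assumes "base s"
  defines "s' \<equiv> run w zc0 r s"
  shows "(\<forall>z<NT. s' 14 (prod_encode (0, z)) \<noteq> 0 \<longleftrightarrow> (\<exists>j<a1. fs z = dig (sn z) j)) \<and> (\<forall>a. a \<noteq> 14 \<longrightarrow> s' a = s a)"
proof -
  have "(\<forall>v<NT. s' 14 (prod_encode (0, v)) = eval w (orL (map (\<lambda>j. eqE (Arr 12 (Var 22)) (digE j (Arr 13 (Var 22)))) [0..<a1])) (r(22 := v)) s)
    \<and> (\<forall>z. z \<notin> (\<lambda>v. prod_encode (0, v)) ` {..<NT} \<longrightarrow> s' 14 z = s 14 z) \<and> (\<forall>b. b \<noteq> 14 \<longrightarrow> s' b = s b)"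
    unfolding s'_def zc0_def
  proof (rule run_fill)
    show "eval w NTE r s = NT" using assms(1) base_base0 by simp
    show "inj_on (\<lambda>v. prod_encode (0, v)) {..<NT}" by (auto simp: inj_on_def)
    fix v t assume v: "v < NT" and t: "\<And>b. b \<noteq> 14 \<Longrightarrow> t b = s b"
    have bt: "base t" by (rule base_cong[OF assms(1)]) (auto intro: t)
    have "eval w (digE j (Arr 13 (Var 22))) (r(22 := v)) t = eval w (digE j (Arr 13 (Var 22))) (r(22 := v)) s" for j
      using bt assms(1) by (simp add: base_def)
    then have "eval w (orL (map (\<lambda>j. eqE (Arr 12 (Var 22)) (digE j (Arr 13 (Var 22)))) js)) (r(22 := v)) t =
      eval w (orL (map (\<lambda>j. eqE (Arr 12 (Var 22)) (digE j (Arr 13 (Var 22)))) js)) (r(22 := v)) s" for js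
      using t by (induction js) (auto simp: orL_def)
    then show "eval w (prG (Lit 0) (Var 22)) (r(22 := v)) t = prod_encode (0, v) \<and>
      eval w (orL (map (\<lambda>j. eqE (Arr 12 (Var 22)) (digE j (Arr 13 (Var 22)))) [0..<a1])) (r(22 := v)) t =
      eval w (orL (map (\<lambda>j. eqE (Arr 12 (Var 22)) (digE j (Arr 13 (Var 22)))) [0..<a1])) (r(22 := v)) s"
      using base_base0[OF bt] v NB_bounds(1)[of 0 0 0] by simp
  qed
  moreover have "eval w (orL (map (\<lambda>j. eqE (Arr 12 (Var 22)) (digE j (Arr 13 (Var 22)))) [0..<a1])) (r(22 := v)) s \<noteq> 0
     \<longleftrightarrow> (\<exists>j<a1. fs v = dig (sn v) j)" for v
    unfolding eval_orL using assms(1) by (auto simp: base_def)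
  ultimately show ?thesis by simp
qed

lemma eval_badE:
  assumes "base t"
  shows "eval w badE r t \<noteq> 0 \<longleftrightarrow> bd_step (r 24) (r 22)"
proof -
  have b: "base0 t" using assms base_base0 by blast
  have f: "t 12 = fs" "t 13 = sn" using assms by (auto simp: base_def)
  have ad: "(eval w (adjE u v) r t = 0) = (\<not> Ad (eval w u r t) (eval w v r t))" for u v
    using eval_adjE[OF b, of u v r] by blast
  have d: "eval w (digE j (Arr 13 (Var 22))) r t = dig (sn (r 22)) j" for j using assms f by simp
  have in1: "eval w (orL (map (\<lambda>j. notE (eqE (neE (adjE (Var 24) (digE (a1 + j) (Arr 13 (Var 22)))))
       (neE (adjE (digE i (Arr 13 (Var 22))) (digE (a1 + j) (Arr 13 (Var 22))))))) [0..<a2])) r t \<noteq> 0 \<longleftrightarrow>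
     (\<exists>j<a2. Ad (r 24) (dig (sn (r 22)) (a1 + j)) \<noteq> Ad (dig (sn (r 22)) i) (dig (sn (r 22)) (a1 + j)))" for i
    unfolding eval_orL by (auto simp: ad d simp del: eval_digE)
  then have in2: "(eval w (orL (map (\<lambda>j. notE (eqE (neE (adjE (Var 24) (digE (a1 + j) (Arr 13 (Var 22)))))
       (neE (adjE (digE i (Arr 13 (Var 22))) (digE (a1 + j) (Arr 13 (Var 22))))))) [0..<a2])) r t = 0) \<longleftrightarrow>
     (\<forall>j<a2. Ad (r 24) (dig (sn (r 22)) (a1 + j)) = Ad (dig (sn (r 22)) i) (dig (sn (r 22)) (a1 + j)))" for i
    by blast
  show ?thesis
    unfolding badE_def eval_orL bd_step_def
    by (auto simp: in2 ad d f simp del: eval_digE)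
qed

lemma run_zcS:
  fixes s :: mem and r :: env
  assumes "base s" "\<forall>z<NT. s 14 (prod_encode (0, z)) \<noteq> 0 \<longleftrightarrow> (\<exists>j<a1. fs z = dig (sn z) j)"
  defines "s' \<equiv> run w zcS r s"
  shows "zc_eqs s' \<and> (\<forall>a. a \<noteq> 14 \<longrightarrow> s' a = s a)"
proof -
  define W where "W i b = (if b = 14 then prod_encode ` ({Suc i} \<times> {..<NT}) else {})" for i b :: nat
  define Q where "Q i t \<longleftrightarrow> (\<forall>z<NT. t 14 (prod_encode (Suc i, z)) \<noteq> 0 \<longleftrightarrow> t 14 (prod_encode (i, z)) \<noteq> 0
        \<or> (\<exists>u<n. t 14 (prod_encode (i, prod_encode (u, sn z))) \<noteq> 0 \<and> bd_step u z))" for i and t :: mem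
  have "(\<forall>b z. s' b z \<noteq> s b z \<longrightarrow> z \<in> (\<Union>j<NT. W j b)) \<and> (\<forall>i<NT. Q i s')"
    unfolding s'_def zcS_def
  proof (rule run_For_levels)
    show "eval w NTE r s = NT" using assms(1) base_base0 by simp
  next
    fix i t assume i: "i < NT" and t: "\<forall>b z. t b z \<noteq> s b z \<longrightarrow> z \<in> (\<Union>j<NT. W j b)"
    have tb: "t b = s b" if "b \<noteq> 14" for b
    proof
      fix z
      have "z \<notin> (\<Union>j<NT. W j b)" using that by (simp add: W_def)
      then show "t b z = s b z" using t by blast
    qed
    let ?e = "orE (Arr 14 (prG (Var 20) (Var 22)))
       (exE 24 nE (andE (Arr 14 (prG (Var 20) (prG (Var 24) (Arr 13 (Var 22))))) badE))"
    define t' where "t' = run w (For 22 NTE (Asg 14 (prG (Plus (Var 20) (Lit 1)) (Var 22)) ?e)) (r(20 := i)) t"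
    define h :: "nat \<Rightarrow> nat" where "h z = of_bool (t 14 (prod_encode (i, z)) \<noteq> 0
        \<or> (\<exists>u<n. t 14 (prod_encode (i, prod_encode (u, sn z))) \<noteq> 0 \<and> bd_step u z))" for z :: nat
    have *: "(\<forall>v<NT. t' 14 (prod_encode (Suc i, v)) = h v) \<and> (\<forall>z. z \<notin> (\<lambda>v. prod_encode (Suc i, v)) ` {..<NT} \<longrightarrow> t' 14 z = t 14 z) \<and> (\<forall>b. b \<noteq> 14 \<longrightarrow> t' b = t b)"
      unfolding t'_def
    proof (rule run_fill)
      show "eval w NTE (r(20 := i)) t = NT" using assms(1) base_base0 tb by simp
      show "inj_on (\<lambda>v. prod_encode (Suc i, v)) {..<NT}" by (auto simp: inj_on_def)
      fix v u assume v: "v < NT" and u: "\<And>b. b \<noteq> 14 \<Longrightarrow> u b = t b"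
        and u2: "\<And>z. z \<notin> (\<lambda>v. prod_encode (Suc i, v)) ` {..<NT} \<Longrightarrow> u 14 z = t 14 z"
      have bu: "base u" by (rule base_cong[OF assms(1)]) (auto simp: u tb)
      have b0: "base0 u" using base_base0[OF bu] .
      have lvl: "u 14 (prod_encode (i, z)) = t 14 (prod_encode (i, z))" for z by (rule u2) auto
      have sn: "u 13 = sn" using bu by (simp add: base_def)
      have p1: "eval w (prG (Var 24) (Arr 13 (Var 22))) r' u = prod_encode (r' 24, sn (r' 22))" if "r' 24 < n" for r'
        using that b0 sn nNT sn_le[of "r' 22"] NB_bounds(1)[of 0 0 0] by simp
      have p2: "eval w (prG (Var 20) (prG (Var 24) (Arr 13 (Var 22)))) r' u = prod_encode (r' 20, prod_encode (r' 24, sn (r' 22)))"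
        if "r' 24 < n" "r' 20 < NT" for r'
        using p1[of r'] that b0 nNT sn_le[of "r' 22"] NB_bounds(2)[of "r' 24" "sn (r' 22)" "r' 20"] by (simp add: add.commute)
      have bad: "(0 < eval w badE r' u) = bd_step (r' 24) (r' 22)" for r' using eval_badE[OF bu, of r'] by simp
      have "eval w ?e (r(20 := i, 22 := v)) u = h v"
        using b0 i v NB_bounds(1)[of 0 0 0] by (simp add: h_def p2 bad lvl cong: conj_cong)
      then show "eval w (prG (Plus (Var 20) (Lit 1)) (Var 22)) (r(20 := i, 22 := v)) u = prod_encode (Suc i, v) \<and> eval w ?e (r(20 := i, 22 := v)) u = h v"
        using b0 i v NB_bounds(1)[of 0 0 0] by simp
    qed
    have "Q i t'"
      unfolding Q_def
    proof (intro allI impI)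
      fix z assume z: "z < NT"
      have "t' 14 (prod_encode (i, z)) = t 14 (prod_encode (i, z))" for z
      proof -
        have "prod_encode (i, z) \<notin> (\<lambda>v. prod_encode (Suc i, v)) ` {..<NT}" by auto
        then show ?thesis using * by blast
      qed
      then show "t' 14 (prod_encode (Suc i, z)) \<noteq> 0 \<longleftrightarrow> t' 14 (prod_encode (i, z)) \<noteq> 0
        \<or> (\<exists>u<n. t' 14 (prod_encode (i, prod_encode (u, sn z))) \<noteq> 0 \<and> bd_step u z)"
        using * z by (simp only: h_def of_bool_eq_0_iff not_not)
    qed
    moreover have "\<forall>b z. t' b z \<noteq> t b z \<longrightarrow> z \<in> W i b" using * by (force simp: W_def)
    ultimately show "(\<forall>b z. run w (For 22 NTE (Asg 14 (prG (Plus (Var 20) (Lit 1)) (Var 22)) ?e)) (r(20 := i)) t b z \<noteq> t b z \<longrightarrow> z \<in> W i b) \<and> Q i (run w (For 22 NTE (Asg 14 (prG (Plus (Var 20) (Lit 1)) (Var 22)) ?e)) (r(20 := i)) t)"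
      unfolding t'_def by blast
  next
    fix i j t t' assume ij: "i < j" and Q: "Q i t" and c: "\<forall>b z. t' b z \<noteq> t b z \<longrightarrow> z \<in> W j b"
    have "prod_encode (k, v) \<notin> W j 14" if "k \<le> Suc i" for v k using ij that by (auto simp: W_def)
    then have "t' 14 (prod_encode (k, v)) = t 14 (prod_encode (k, v))" if "k \<le> Suc i" for v k using c that by metis
    then show "Q i t'" using Q unfolding Q_def by simp
  qed
  then have 1: "\<forall>b z. s' b z \<noteq> s b z \<longrightarrow> z \<in> (\<Union>j<NT. W j b)" and 2: "\<forall>i<NT. Q i s'" by auto
  have "prod_encode (0, z) \<notin> (\<Union>j<NT. W j 14)" for z by (auto simp: W_def)
  then have "s' 14 (prod_encode (0, z)) = s 14 (prod_encode (0, z))" for z using 1 by blast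
  moreover have "s' b = s b" if "b \<noteq> 14" for b
  proof
    fix z
    have "z \<notin> (\<Union>j<NT. W j b)" using that by (simp add: W_def)
    then show "s' b z = s b z" using 1 by blast
  qed
  ultimately show ?thesis using 2 assms(2) by (simp add: zc_eqs_def Q_def)
qed

lemma first_le: "first k P \<le> k"
  by (cases rule: first_cases[of k P]) auto

text \<open>The equations describe the computation whether or not the searches succeed; that they do
  is a matter of graph theory and is shown later.\<close>

lemma run_split_body:
  fixes t :: mem and r :: env
  assumes t: "base t" and i: "i < n - 1"
  defines "t' \<equiv> run w split_body (r(20 := i)) t"
  shows "split_eq i t' \<and> (\<forall>b z. t' b z \<noteq> t b z \<longrightarrow>
     b = 15 \<and> z \<in> prod_encode ` ({Suc i} \<times> {..<n}) \<or> (b = 16 \<or> b = 17) \<and> z = Suc i)"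
proof -
  let ?r = "r(20 := i)"
  define P where "P = row t 15 i"
  define c where "c = first NT (\<lambda>c. \<exists>b<n. chk P (Zs t c) b)"
  define b where "b = first n (chk P (Zs t (c - 1)))"
  have iNT: "i \<le> NT" "Suc i \<le> NT" using i nNT by auto
  have c_le: "c - 1 \<le> NT" using first_le[of NT] by (simp add: c_def le_diff_conv le_SucI)
  have b0: "base0 t" using t base_base0 by blast
  define t1 where "t1 = t(17 := (t 17)(Suc i := c))"
  have base1: "base t1" by (rule base_cong[OF t]) (auto simp: t1_def)
  have ck: "(0 < eval w chkE (r'(20 := i, 24 := x, 25 := 0, 26 := y, 27 := 0)) t) = chk P (Zs t x) y" if "x \<le> NT" for x y and r' :: env
    using eval_chkE[OF t, of "r'(20 := i, 24 := x, 25 := 0, 26 := y, 27 := 0)"] that iNT by (simp add: P_def)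
  have e1: "eval w (selE 24 NTE (exE 26 nE chkE)) ?r t = c"
  proof -
    have "first NT (\<lambda>x. \<exists>y<n. 0 < eval w chkE (r(20 := i, 24 := x, 25 := 0, 26 := y, 27 := 0)) t)
       = first NT (\<lambda>c. \<exists>b<n. chk P (Zs t c) b)"
      by (rule first_cong_less) (simp add: ck)
    then show ?thesis using b0 by (simp add: c_def)
  qed
  have Zs1: "Zs t1 = Zs t" by (simp add: Zs_def t1_def fun_eq_iff)
  have ck1: "(0 < eval w chkE (r'(20 := i, 25 := 0, 24 := x, 26 := y, 27 := 0)) t1) = chk P (Zs t x) y" if "x \<le> NT" for x y and r' :: env
    using eval_chkE[OF base1, of "r'(20 := i, 25 := 0, 24 := x, 26 := y, 27 := 0)"] that iNT by (simp add: P_def Zs1) (simp add: t1_def)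
  have e2: "eval w (letE 24 (Minus (Arr 17 (Plus (Var 20) (Lit 1))) (Lit 1)) (selE 26 nE chkE)) ?r t1 = b"
  proof -
    have c1: "t1 17 (Suc i) = c" by (simp add: t1_def)
    have "first n (\<lambda>y. 0 < eval w chkE (r(20 := i, 25 := 0, 24 := c - Suc 0, 26 := y, 27 := 0)) t1) = first n (chk P (Zs t (c - 1)))"
      by (rule first_cong) (use ck1[of "c - Suc 0" r] c_le in simp)
    then show ?thesis using base_base0[OF base1] c1 by (simp add: b_def)
  qed
  define t2 where "t2 = t1(16 := (t1 16)(Suc i := b))"
  let ?e = "letE 24 (Minus (Arr 17 (Plus (Var 20) (Lit 1))) (Lit 1))
           (letE 26 (Minus (Arr 16 (Plus (Var 20) (Lit 1))) (Lit 1))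
             (Ite (mXE True (Var 22)) (Plus (Var 20) (Lit 1)) (partE (Var 20) (Var 22))))"
  define h where "h v = (if v \<in> half P (Zs t (c - 1)) (b - 1) True then Suc i else P v)" for v
  have t'_eq: "t' = run w (For 22 nE (Asg 15 (prG (Plus (Var 20) (Lit 1)) (Var 22)) ?e)) ?r t2"
    using e1 e2 by (simp add: t'_def split_body_def t1_def t2_def del: run.simps(3) eval_letE eval_selE)
  have base2: "base t2" by (rule base_cong[OF t]) (auto simp: t1_def t2_def)
  have *: "(\<forall>v<n. t' 15 (prod_encode (Suc i, v)) = h v) \<and> (\<forall>z. z \<notin> (\<lambda>v. prod_encode (Suc i, v)) ` {..<n} \<longrightarrow> t' 15 z = t2 15 z) \<and> (\<forall>b. b \<noteq> 15 \<longrightarrow> t' b = t2 b)"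
    unfolding t'_eq
  proof (rule run_fill)
    show "eval w nE ?r t2 = n" using base_base0[OF base2] by simp
    show "inj_on (\<lambda>v. prod_encode (Suc i, v)) {..<n}" by (auto simp: inj_on_def)
    fix v u assume v: "v < n" and u: "\<And>b. b \<noteq> 15 \<Longrightarrow> u b = t2 b"
      and u2: "\<And>z. z \<notin> (\<lambda>v. prod_encode (Suc i, v)) ` {..<n} \<Longrightarrow> u 15 z = t2 15 z"
    have bu: "base u" by (rule base_cong[OF base2]) (auto simp: u)
    have b0u: "base0 u" using base_base0[OF bu] .
    have P: "row u 15 i = P"
    proof
      fix x
      have "prod_encode (i, x) \<notin> (\<lambda>v. prod_encode (Suc i, v)) ` {..<n}" by auto
      then show "u 15 (prod_encode (i, x)) = P x" using u2 by (simp add: t2_def t1_def P_def)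
    qed
    have uu: "u 17 (Suc i) = c" "u 16 (Suc i) = b" using u[of 17] u[of 16] by (simp_all add: t2_def t1_def)
    have Zu: "Zs u = Zs t" using u[of 14] by (simp add: Zs_def t2_def t1_def fun_eq_iff)
    let ?q = "r(20 := i, 22 := v, 25 := 0, 24 := c - Suc 0, 27 := 0, 26 := b - Suc 0)"
    have mX: "(0 < eval w (mXE True (Var 22)) ?q u) = (v \<in> half P (Zs t (c - 1)) (b - 1) True)"
      using eval_mXE[OF bu, of ?q "Var 22" True] iNT c_le v by (simp add: P Zu)
    have pe: "eval w (partE (Var 20) (Var 22)) ?q u = P v"
      using eval_partE[OF bu, of "Var 20" ?q "Var 22"] iNT v P[THEN fun_cong, of v] by simp
    have "eval w ?e (r(20 := i, 22 := v)) u = h v"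
      by (cases "eval w (mXE True (Var 22)) ?q u = 0") (use mX pe uu in \<open>simp_all add: h_def\<close>)
    then show "eval w (prG (Plus (Var 20) (Lit 1)) (Var 22)) (r(20 := i, 22 := v)) u = prod_encode (Suc i, v) \<and> eval w ?e (r(20 := i, 22 := v)) u = h v"
      using b0u iNT v nNT NB_bounds(1)[of 0 0 0] by simp
  qed
  have t't: "t' 15 z = t 15 z" if "z \<notin> (\<lambda>v. prod_encode (Suc i, v)) ` {..<n}" for z
    using * that by (simp add: t2_def t1_def)
  have P': "row t' 15 i = P" unfolding P_def by (rule ext, rule t't) auto
  have o: "t' 14 = t 14" "t' 17 (Suc i) = c" "t' 16 (Suc i) = b" using * by (simp_all add: t2_def t1_def)
  have Z': "Zs t' = Zs t" by (simp add: Zs_def o fun_eq_iff)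
  have "split_eq i t'"
    unfolding split_eq_def Let_def P' o Z' using * by (simp add: c_def b_def h_def)
  moreover have "b = 15 \<and> z \<in> prod_encode ` ({Suc i} \<times> {..<n}) \<or> (b = 16 \<or> b = 17) \<and> z = Suc i" if ne: "t' b z \<noteq> t b z" for b z
  proof (cases "b = 15")
    case True
    then have "z \<in> (\<lambda>v. prod_encode (Suc i, v)) ` {..<n}" using ne t't by blast
    then show ?thesis using True by auto
  next
    case False
    then have "t' b = t2 b" using * by simp
    then show ?thesis using ne by (auto simp: t2_def t1_def split: if_splits)
  qed
  ultimately show ?thesis by blast
qed

lemma run_split:
  fixes s :: mem and r :: env
  assumes s: "base s"
  defines "s' \<equiv> run w split_com r s"
  shows "(\<forall>i<n - 1. split_eq i s') \<and> (\<forall>b. b \<notin> {15, 16, 17} \<longrightarrow> s' b = s b) \<and> row s' 15 0 = row s 15 0"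
proof -
  define W where "W i b = (if b = 15 then prod_encode ` ({Suc i} \<times> {..<n}) else if b = 16 \<or> b = 17 then {Suc i} else {})" for i b :: nat
  have "(\<forall>b z. s' b z \<noteq> s b z \<longrightarrow> z \<in> (\<Union>j<n - 1. W j b)) \<and> (\<forall>i<n - 1. split_eq i s')"
    unfolding s'_def split_com_def
  proof (rule run_For_levels)
    show "eval w (Minus nE (Lit 1)) r s = n - 1" using base_base0[OF s] by simp
  next
    fix i t assume i: "i < n - 1" and t: "\<forall>b z. t b z \<noteq> s b z \<longrightarrow> z \<in> (\<Union>j<n - 1. W j b)"
    have tb: "t b = s b" if "b \<notin> {15, 16, 17}" for b
    proof
      fix z
      have "z \<notin> (\<Union>j<n - 1. W j b)" using that by (simp add: W_def)
      then show "t b z = s b z" using t by blast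
    qed
    have "base t" by (rule base_cong[OF s]) (auto intro: tb)
    from run_split_body[OF this i, of r]
    show "(\<forall>b z. run w split_body (r(20 := i)) t b z \<noteq> t b z \<longrightarrow> z \<in> W i b) \<and> split_eq i (run w split_body (r(20 := i)) t)"
      by (fastforce simp: W_def)
  next
    fix i j t t' assume ij: "i < j" and Q: "split_eq i t" and c: "\<forall>b z. t' b z \<noteq> t b z \<longrightarrow> z \<in> W j b"
    have "prod_encode (k, v) \<notin> W j 15" if "k \<le> Suc i" for v k using ij that by (auto simp: W_def)
    then have "t' 15 (prod_encode (k, v)) = t 15 (prod_encode (k, v))" if "k \<le> Suc i" for v k using c that by metis
    moreover have "Suc i \<notin> W j 16" "Suc i \<notin> W j 17" using ij by (auto simp: W_def)
    then have "t' 16 (Suc i) = t 16 (Suc i)" "t' 17 (Suc i) = t 17 (Suc i)" using c by metis+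
    moreover have "z \<notin> W j 14" for z by (simp add: W_def)
    then have "t' 14 z = t 14 z" for z using c by metis
    then have "Zs t' = Zs t" by (simp add: Zs_def fun_eq_iff)
    ultimately show "split_eq i t'" using Q unfolding split_eq_def by simp
  qed
  then have 1: "\<forall>b z. s' b z \<noteq> s b z \<longrightarrow> z \<in> (\<Union>j<n - 1. W j b)" and 2: "\<forall>i<n - 1. split_eq i s'" by auto
  have "prod_encode (0, z) \<notin> (\<Union>j<n - 1. W j 15)" for z by (auto simp: W_def)
  then have "s' 15 (prod_encode (0, z)) = s 15 (prod_encode (0, z))" for z using 1 by blast
  moreover have "s' b = s b" if "b \<notin> {15, 16, 17}" for b
  proof
    fix z
    have "z \<notin> (\<Union>j<n - 1. W j b)" using that by (simp add: W_def)
    then show "s' b z = s b z" using 1 by blast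
  qed
  ultimately show ?thesis using 2 by blast
qed

end

section \<open>The merging loop\<close>

context graph_sem
begin

lemma eval_OP: "eval w (Arr 4 (prJ (Lit 0) (prJ a (prJ b c)))) r t
    = OPv t (eval w a r t) (eval w b r t) (eval w c r t)"
  by (simp add: OPv_def prJ_def)

lemma run_merge_body:
  fixes t :: mem and r :: env
  assumes t: "base t" and i: "i < n - 1"
  defines "t' \<equiv> run w merge_body (r(20 := i)) t"
  shows "merge_eq i t' \<and> (\<forall>b z. t' b z \<noteq> t b z \<longrightarrow>
     (b = 18 \<or> b = 19) \<and> z \<in> prod_encode ` ({Suc i} \<times> {..<n}) \<or> (b = 20 \<or> b = 21) \<and> z = Suc i)"
proof -
  define s where "s = n - 1 - i"
  define b where "b = t 16 s - 1"
  define X where "X = blk (row t 15 (s - 1)) b"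
  define X1 where "X1 = blk (row t 15 s) b"
  define X2 where "X2 = blk (row t 15 s) s"
  define Lb where "Lb = row t 18 i"
  define g where "g = first NT (\<lambda>g. \<exists>q<NP. good_code X g \<and> cons_code X X1 X2 g q Lb)"
  define p where "p = first NP (\<lambda>q. good_code X (g - 1) \<and> cons_code X X1 X2 (g - 1) q Lb)"
  let ?r = "r(20 := i)"
  have sNT: "s \<le> NT" "i \<le> NT" "Suc i \<le> NT" "s \<le> n" using i nNT by (auto simp: s_def)
  have b0: "base0 t" using t base_base0 by blast
  have sb: "eval w (sbE e) r' u = eval w e (r'(37 := 0, 36 := s, 27 := 0, 26 := b)) u"
    if "base u" "u 16 = t 16" "r' 20 = i" for e u r'
    using base_base0[OF that(1)] that(2,3) i by (simp add: sbE_def s_def b_def)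
  have gc: "(0 < eval w goodE r' u) = good_code X (r' 24)" if "base u" "u 15 = t 15" "r' 36 = s" "r' 26 = b" for u r'
    using eval_goodE[OF that(1), of r' X] that sNT by (simp add: X_def)
  have cc: "(0 < eval w consE r' u) = cons_code X X1 X2 (r' 24) (r' 28) Lb"
    if "base u" "u 15 = t 15" "u 18 = t 18" "r' 36 = s" "r' 26 = b" "r' 20 = i" for u r'
    using eval_consE[OF that(1), of r' X X1 X2] that sNT by (simp add: X_def X1_def X2_def Lb_def)
  define t1 where "t1 = t(20 := (t 20)(Suc i := g))"
  have base1: "base t1" by (rule base_cong[OF t]) (auto simp: t1_def)
  have e1: "eval w (sbE (selE 24 NTE (exE 28 (Lit NP) (andE goodE consE)))) ?r t = g"
  proof -
    have "first NT (\<lambda>x. \<exists>q<NP. 0 < eval w goodE (r(20 := i, 37 := 0, 36 := s, 27 := 0, 26 := b, 24 := x, 25 := 0, 28 := q, 29 := 0)) t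
         \<and> 0 < eval w consE (r(20 := i, 37 := 0, 36 := s, 27 := 0, 26 := b, 24 := x, 25 := 0, 28 := q, 29 := 0)) t)
       = g" unfolding g_def
      by (rule first_cong_less) (simp add: gc[OF t] cc[OF t])
    then show ?thesis using b0 by (simp add: sb[OF t])
  qed
  define t2 where "t2 = t1(21 := (t1 21)(Suc i := p))"
  have base2: "base t2" by (rule base_cong[OF t]) (auto simp: t1_def t2_def)
  have e2: "eval w (sbE (letE 24 (Minus (Arr 20 i1E) (Lit 1)) (selE 28 (Lit NP) (andE goodE consE)))) ?r t1 = p"
  proof -
    have a: "t1 15 = t 15" "t1 16 = t 16" "t1 18 = t 18" "t1 20 (Suc i) = g" by (simp_all add: t1_def)
    have "first NP (\<lambda>q. 0 < eval w goodE (r(20 := i, 37 := 0, 36 := s, 27 := 0, 26 := b, 25 := 0, 24 := g - Suc 0, 28 := q, 29 := 0)) t1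
         \<and> 0 < eval w consE (r(20 := i, 37 := 0, 36 := s, 27 := 0, 26 := b, 25 := 0, 24 := g - Suc 0, 28 := q, 29 := 0)) t1)
       = p" unfolding p_def
      by (rule first_cong_less) (simp add: gc[OF base1 a(1)] cc[OF base1 a(1,3)])
    then show ?thesis by (simp add: sb[OF base1 a(2)] a(4))
  qed
  let ?e = "sbE (letE 24 (Minus (Arr 20 i1E) (Lit 1)) (Ite (mE (Var 22)) (labE (Var 22)) (LBE (Var 22))))"
  define h where "h v = (if v \<in> X then lab X (g - 1) v else Lb v)" for v
  define t3 where "t3 = run w (For 22 nE (Asg 18 (prG i1E (Var 22)) ?e)) ?r t2"
  have 3: "(\<forall>v<n. t3 18 (prod_encode (Suc i, v)) = h v) \<and> (\<forall>z. z \<notin> (\<lambda>v. prod_encode (Suc i, v)) ` {..<n} \<longrightarrow> t3 18 z = t2 18 z) \<and> (\<forall>b. b \<noteq> 18 \<longrightarrow> t3 b = t2 b)"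
    unfolding t3_def
  proof (rule run_fill)
    show "eval w nE ?r t2 = n" using base_base0[OF base2] by simp
    show "inj_on (\<lambda>v. prod_encode (Suc i, v)) {..<n}" by (auto simp: inj_on_def)
    fix v u assume v: "v < n" and u: "\<And>b. b \<noteq> 18 \<Longrightarrow> u b = t2 b"
      and u2: "\<And>z. z \<notin> (\<lambda>v. prod_encode (Suc i, v)) ` {..<n} \<Longrightarrow> u 18 z = t2 18 z"
    have bu: "base u" by (rule base_cong[OF base2]) (auto simp: u)
    have uu: "u 15 = t 15" "u 16 = t 16" "u 20 (Suc i) = g" by (simp_all add: u t2_def t1_def)
    have uL: "u 18 (prod_encode (i, v)) = Lb v"
    proof -
      have "prod_encode (i, v) \<notin> (\<lambda>v. prod_encode (Suc i, v)) ` {..<n}" by auto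
      then show ?thesis using u2 by (simp add: t2_def t1_def Lb_def)
    qed
    let ?q = "r(20 := i, 22 := v, 37 := 0, 36 := s, 27 := 0, 26 := b, 25 := 0, 24 := g - Suc 0)"
    have "eval w (mE (Var 22)) ?q u \<noteq> 0 \<longleftrightarrow> v \<in> X"
      using eval_mE[OF bu, of ?q "Var 22"] sNT v by (simp add: uu X_def)
    then have m: "(eval w (mE (Var 22)) ?q u = 0) = (v \<notin> X)" by blast
    have l: "eval w (labE (Var 22)) ?q u = lab X (g - 1) v"
      using eval_labE[OF bu, of ?q X "Var 22"] sNT by (simp add: uu X_def)
    have lb: "eval w (LBE (Var 22)) ?q u = Lb v"
      using eval_LBE[OF bu, of ?q "Var 22"] sNT v uL by simp
    have "eval w ?e (r(20 := i, 22 := v)) u = h v"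
      using m l lb by (simp add: sb[OF bu uu(2)] uu(3) h_def)
    then show "eval w (prG i1E (Var 22)) (r(20 := i, 22 := v)) u = prod_encode (Suc i, v) \<and> eval w ?e (r(20 := i, 22 := v)) u = h v"
      using base_base0[OF bu] sNT v nNT NB_bounds(1)[of 0 0 0] by simp
  qed
  have base3: "base t3" by (rule base_cong[OF base2]) (use 3 in auto)
  let ?f = "sbE (Ite (eqE (Var 22) (Var 26))
               (Arr 4 (prJ (Lit 0) (prJ (Minus (Arr 21 i1E) (Lit 1))
                  (prJ (Arr 19 (prG (Var 20) (Var 26))) (Arr 19 (prG (Var 20) (Var 36)))))))
               (Arr 19 (prG (Var 20) (Var 22))))"
  have bn: "b < n \<or> n \<le> b" by linarith
  define h2 where "h2 v = (if v = b then OPv t (p - 1) (row t 19 i b) (row t 19 i s) else row t 19 i v)" for v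
  have t'_eq: "t' = run w (For 22 nE (Asg 19 (prG i1E (Var 22)) ?f)) ?r t3"
    using e1 e2 by (simp add: t'_def merge_body_def t1_def t2_def t3_def del: run.simps(3) eval_letE eval_selE)
  have 4: "(\<forall>v<n. t' 19 (prod_encode (Suc i, v)) = h2 v) \<and> (\<forall>z. z \<notin> (\<lambda>v. prod_encode (Suc i, v)) ` {..<n} \<longrightarrow> t' 19 z = t3 19 z) \<and> (\<forall>b. b \<noteq> 19 \<longrightarrow> t' b = t3 b)"
    unfolding t'_eq
  proof (rule run_fill)
    show "eval w nE ?r t3 = n" using base_base0[OF base3] by simp
    show "inj_on (\<lambda>v. prod_encode (Suc i, v)) {..<n}" by (auto simp: inj_on_def)
    fix v u assume v: "v < n" and u: "\<And>b. b \<noteq> 19 \<Longrightarrow> u b = t3 b"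
      and u2: "\<And>z. z \<notin> (\<lambda>v. prod_encode (Suc i, v)) ` {..<n} \<Longrightarrow> u 19 z = t3 19 z"
    have bu: "base u" by (rule base_cong[OF base3]) (auto simp: u)
    have uu: "u 16 = t 16" "u 21 (Suc i) = p" "u 4 = t 4" "u 5 = t 5" using 3 by (simp_all add: u t2_def t1_def)
    have uT: "u 19 (prod_encode (i, x)) = row t 19 i x" for x
    proof -
      have "prod_encode (i, x) \<notin> (\<lambda>v. prod_encode (Suc i, v)) ` {..<n}" by auto
      then show ?thesis using u2 3 by (simp add: t2_def t1_def)
    qed
    have op: "OPv u = OPv t" by (simp add: OPv_def prJ_def uu fun_eq_iff)
    let ?q = "r(20 := i, 22 := v, 37 := 0, 36 := s, 27 := 0, 26 := b)"
    have "eval w ?f (r(20 := i, 22 := v)) u = h2 v"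
    proof (cases "v = b")
      case True
      have "eval w (Arr 19 (prG (Var 20) (Var 26))) ?q u = row t 19 i b" "eval w (Arr 19 (prG (Var 20) (Var 36))) ?q u = row t 19 i s"
        using base_base0[OF bu] sNT nNT v True NB_bounds(1)[of 0 0 0] uT by simp_all
      then show ?thesis using True uu(2) by (simp add: sb[OF bu uu(1)] eval_OP op h2_def del: eval.simps(3)) (simp add: uu(2))
    next
      case False
      have "eval w (Arr 19 (prG (Var 20) (Var 22))) ?q u = row t 19 i v"
        using base_base0[OF bu] sNT nNT v NB_bounds(1)[of 0 0 0] uT by simp
      then show ?thesis using False by (simp add: sb[OF bu uu(1)] h2_def)
    qed
    then show "eval w (prG i1E (Var 22)) (r(20 := i, 22 := v)) u = prod_encode (Suc i, v) \<and> eval w ?f (r(20 := i, 22 := v)) u = h2 v"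
      using base_base0[OF bu] sNT v nNT NB_bounds(1)[of 0 0 0] by simp
  qed
  have ni: "prod_encode (i, x) \<notin> (\<lambda>v. prod_encode (Suc i, v)) ` {..<n}" for x by auto
  have o: "t' 15 = t 15" "t' 16 = t 16" "t' 4 = t 4" "t' 5 = t 5" "t' 20 (Suc i) = g" "t' 21 (Suc i) = p"
    using 3 4 by (simp_all add: t2_def t1_def)
  have o18: "t' 18 = t3 18" using 4 by simp
  have oL: "row t' 18 i = Lb" "row t' 19 i = row t 19 i"
    using 3 4 ni by (simp_all add: o18 t2_def t1_def Lb_def fun_eq_iff)
  have op: "OPv t' = OPv t" by (simp add: OPv_def prJ_def o fun_eq_iff)
  have 18: "\<forall>v<n. row t' 18 (Suc i) v = h v" using 3 o18 by simp
  have 19: "\<forall>v<n. row t' 19 (Suc i) v = h2 v" using 4 by simp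
  have "merge_eq i t'"
    unfolding merge_eq_def Let_def s_def[symmetric] oL o op b_def[symmetric] X_def[symmetric] X1_def[symmetric] X2_def[symmetric]
    using 18 19 oL(2)[THEN fun_cong] unfolding h_def h2_def by (intro conjI) (simp_all only: g_def p_def)
  moreover have "(c = 18 \<or> c = 19) \<and> z \<in> prod_encode ` ({Suc i} \<times> {..<n}) \<or> (c = 20 \<or> c = 21) \<and> z = Suc i"
    if ne: "t' c z \<noteq> t c z" for c z
  proof -
    have im: "(\<lambda>v. prod_encode (Suc i, v)) ` {..<n} = prod_encode ` ({Suc i} \<times> {..<n})" by auto
    consider "c = 18" | "c = 19" | "c \<noteq> 18" "c \<noteq> 19" by blast
    then show ?thesis
    proof cases
      case 1
      then have "z \<in> (\<lambda>v. prod_encode (Suc i, v)) ` {..<n}" using ne 3 o18 by (metis fun_upd_apply num.simps(9) numeral_eq_iff t1_def t2_def num.distinct(1) num.inject(1) num.inject(2) num.distinct(3) num.distinct(5))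
      then show ?thesis using 1 im by simp
    next
      case 2
      have "t3 19 = t 19" using 3 by (simp add: t2_def t1_def)
      then have "z \<in> (\<lambda>v. prod_encode (Suc i, v)) ` {..<n}" using ne 4 2 by metis
      then show ?thesis using 2 im by simp
    next
      case 3
      then have "t' c = t2 c" using 4 \<open>(\<forall>v<n. t3 18 (prod_encode (Suc i, v)) = h v) \<and> _ \<and> _\<close> by simp
      then show ?thesis using ne by (auto simp: t2_def t1_def split: if_splits)
    qed
  qed
  ultimately show ?thesis by blast
qed

lemma run_merge:
  fixes s :: mem and r :: env
  assumes s: "base s"
  defines "s' \<equiv> run w merge_com r s"
  shows "(\<forall>i<n - 1. merge_eq i s') \<and> (\<forall>b. b \<notin> {18, 19, 20, 21} \<longrightarrow> s' b = s b) \<and> row s' 18 0 = row s 18 0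
    \<and> (\<forall>b<n. row s' 19 0 b = OPv s NP 0 0)"
proof -
  define t0 where "t0 = run w (For 22 nE (Asg 19 (prG (Lit 0) (Var 22)) (Arr 4 (prJ (Lit 0) (prJ (Lit NP) (prJ (Lit 0) (Lit 0))))))) r s"
  have 0: "(\<forall>v<n. t0 19 (prod_encode (0, v)) = OPv s NP 0 0) \<and> (\<forall>z. z \<notin> (\<lambda>v. prod_encode (0, v)) ` {..<n} \<longrightarrow> t0 19 z = s 19 z) \<and> (\<forall>b. b \<noteq> 19 \<longrightarrow> t0 b = s b)"
    unfolding t0_def
  proof (rule run_fill)
    show "eval w nE r s = n" using base_base0[OF s] by simp
    show "inj_on (\<lambda>v. prod_encode (0, v)) {..<n}" by (auto simp: inj_on_def)
    fix v u assume v: "v < n" and u: "\<And>b. b \<noteq> 19 \<Longrightarrow> u b = s b"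
    have bu: "base u" by (rule base_cong[OF s]) (auto simp: u)
    have "OPv u = OPv s" by (simp add: OPv_def prJ_def u fun_eq_iff)
    then show "eval w (prG (Lit 0) (Var 22)) (r(22 := v)) u = prod_encode (0, v) \<and>
       eval w (Arr 4 (prJ (Lit 0) (prJ (Lit NP) (prJ (Lit 0) (Lit 0))))) (r(22 := v)) u = OPv s NP 0 0"
      unfolding eval_OP using base_base0[OF bu] v nNT NB_bounds(1)[of 0 0 0] by simp
  qed
  have base0: "base t0" by (rule base_cong[OF s]) (use 0 in auto)
  define W where "W i b = (if b = 18 \<or> b = 19 then prod_encode ` ({Suc i} \<times> {..<n}) else if b = 20 \<or> b = 21 then {Suc i} else {})" for i b :: nat
  have "(\<forall>b z. run w (For 20 (Minus nE (Lit 1)) merge_body) r t0 b z \<noteq> t0 b z \<longrightarrow> z \<in> (\<Union>j<n - 1. W j b)) \<and>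
     (\<forall>i<n - 1. merge_eq i (run w (For 20 (Minus nE (Lit 1)) merge_body) r t0))"
  proof (rule run_For_levels)
    show "eval w (Minus nE (Lit 1)) r t0 = n - 1" using base_base0[OF base0] by simp
  next
    fix i t assume i: "i < n - 1" and t: "\<forall>b z. t b z \<noteq> t0 b z \<longrightarrow> z \<in> (\<Union>j<n - 1. W j b)"
    have tb: "t b = t0 b" if "b \<notin> {18, 19, 20, 21}" for b
    proof
      fix z
      have "z \<notin> (\<Union>j<n - 1. W j b)" using that by (simp add: W_def)
      then show "t b z = t0 b z" using t by blast
    qed
    have "base t" by (rule base_cong[OF base0]) (auto intro: tb)
    from run_merge_body[OF this i, of r]
    show "(\<forall>b z. run w merge_body (r(20 := i)) t b z \<noteq> t b z \<longrightarrow> z \<in> W i b) \<and> merge_eq i (run w merge_body (r(20 := i)) t)"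
      by (fastforce simp: W_def)
  next
    fix i j t t' assume ij: "i < j" and Q: "merge_eq i t" and c: "\<forall>b z. t' b z \<noteq> t b z \<longrightarrow> z \<in> W j b"
    have "prod_encode (k, v) \<notin> W j 18" "prod_encode (k, v) \<notin> W j 19" if "k \<le> Suc i" for v k using ij that by (auto simp: W_def)
    then have "t' 18 (prod_encode (k, v)) = t 18 (prod_encode (k, v))" "t' 19 (prod_encode (k, v)) = t 19 (prod_encode (k, v))"
      if "k \<le> Suc i" for v k using c that by metis+
    moreover have "Suc i \<notin> W j 20" "Suc i \<notin> W j 21" using ij by (auto simp: W_def)
    then have "t' 20 (Suc i) = t 20 (Suc i)" "t' 21 (Suc i) = t 21 (Suc i)" using c by metis+
    moreover have tb: "t' b = t b" if "b \<notin> {18, 19, 20, 21}" for b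
    proof
      fix z
      have "z \<notin> W j b" using that by (simp add: W_def)
      then show "t' b z = t b z" using c by metis
    qed
    then have "OPv t' = OPv t" "t' 15 = t 15" "t' 16 = t 16" by (simp_all add: OPv_def prJ_def tb fun_eq_iff)
    ultimately show "merge_eq i t'" using Q unfolding merge_eq_def Let_def by simp
  qed
  then have 1: "\<forall>b z. s' b z \<noteq> t0 b z \<longrightarrow> z \<in> (\<Union>j<n - 1. W j b)" and 2: "\<forall>i<n - 1. merge_eq i s'"
    by (auto simp: s'_def merge_com_def t0_def)
  have nin: "prod_encode (0, z) \<notin> (\<Union>j<n - 1. W j 18)" "prod_encode (0, z) \<notin> (\<Union>j<n - 1. W j 19)" for z by (auto simp: W_def)
  have "s' 18 (prod_encode (0, z)) = t0 18 (prod_encode (0, z))" "s' 19 (prod_encode (0, z)) = t0 19 (prod_encode (0, z))" for z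
    using nin[of z] 1[rule_format, of 18 "prod_encode (0, z)"] 1[rule_format, of 19 "prod_encode (0, z)"] by argo+
  moreover have "s' b = t0 b" if "b \<notin> {18, 19, 20, 21}" for b
  proof
    fix z
    have "z \<notin> (\<Union>j<n - 1. W j b)" using that by (simp add: W_def)
    then show "s' b z = t0 b z" using 1 by blast
  qed
  ultimately show ?thesis using 0 2 by simp
qed

end

text \<open>Only the codes of pairs of numbers below \<open>N\<close> are written; elsewhere the
  array keeps its initial value 0.\<close>

definition fsf :: "nat \<Rightarrow> nat \<Rightarrow> nat" where
  "fsf N z = (if pfst z < N \<and> psnd z < N then pfst z else 0)"
definition snf :: "nat \<Rightarrow> nat \<Rightarrow> nat" where
  "snf N z = (if pfst z < N \<and> psnd z < N then psnd z else 0)"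

context graph_sem
begin

lemma run_fs_aux:
  fixes s :: mem and r :: env
  assumes s: "base0 s" and a: "s a = (\<lambda>_. 0)" "a \<notin> {6, 7, 8, 9, 10}" and x: "x = 20 \<or> x = 22"
  defines "s' \<equiv> run w (For 20 NTE (For 22 NTE (Asg a (prG (Var 20) (Var 22)) (Var x)))) r s"
  shows "s' a = (if x = 20 then fsf NT else snf NT) \<and> (\<forall>b. b \<noteq> a \<longrightarrow> s' b = s b) \<and> base0 s'"
proof -
  have cong: "base0 t" if "\<And>b. b \<noteq> a \<Longrightarrow> t b = s b" for t
  proof -
    have "t 6 = s 6" "t 7 = s 7" "t 8 = s 8" "t 9 = s 9" "t 10 = s 10" using that a(2) by simp_all
    then show ?thesis using s by (simp only: base0_def) blast
  qed
  have *: "(\<forall>u<NT. \<forall>v<NT. s' a (prod_encode (u, v)) = (if x = 20 then u else v))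
    \<and> (\<forall>z. (\<forall>u<NT. \<forall>v<NT. z \<noteq> prod_encode (u, v)) \<longrightarrow> s' a z = s a z) \<and> (\<forall>b. b \<noteq> a \<longrightarrow> s' b = s b)"
    unfolding s'_def
  proof (rule run_fill2)
    show "eval w NTE r s = NT" using s by simp
    show "eval w NTE (r(20 := u)) t = NT" if "\<And>b. b \<noteq> a \<Longrightarrow> t b = s b" for u t
      using cong[OF that] by simp
    show "eval w (prG (Var 20) (Var 22)) (r(20 := u, 22 := v)) t = prod_encode (u, v) \<and>
       eval w (Var x) (r(20 := u, 22 := v)) t = (if x = 20 then u else v)"
      if "u < NT" "v < NT" "\<And>b. b \<noteq> a \<Longrightarrow> t b = s b" for u v t
      using cong[OF that(3)] that(1,2) x NB_bounds(1)[of 0 0 0] by auto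
  qed
  have "s' a z = (if x = 20 then fsf NT else snf NT) z" for z
  proof (cases "pfst z < NT \<and> psnd z < NT")
    case True
    have "z = prod_encode (pfst z, psnd z)" by simp
    then have "s' a z = (if x = 20 then pfst z else psnd z)" using * True by metis
    then show ?thesis using True by (simp add: fsf_def snf_def)
  next
    case False
    then have "\<forall>u<NT. \<forall>v<NT. z \<noteq> prod_encode (u, v)" by auto
    then have "s' a z = 0" using * a(1) by simp
    then show ?thesis using False by (auto simp: fsf_def snf_def)
  qed
  then show ?thesis using * cong by blast
qed

text \<open>Each phase writes to arrays that the equations of the earlier phases do not mention, so
  all equations hold together in the final memory.\<close>

theorem run_graph:
  fixes s :: mem and r :: env
  assumes fs: "fs = fsf NT" "sn = snf NT"
    and s: "s 6 0 = n" "s 7 0 = NT" "s 8 0 = NB" "\<And>u. u < n \<Longrightarrow> s 10 u = n + 1 + u * n"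
    and z: "\<And>a. a \<in> {9, 12, 13, 14, 15, 16, 17, 18, 19, 20, 21} \<Longrightarrow> s a = (\<lambda>_. 0)"
  defines "M \<equiv> run w graph_com r s"
  shows "zc_eqs M" "\<And>i. i < n - 1 \<Longrightarrow> split_eq i M" "\<And>i. i < n - 1 \<Longrightarrow> merge_eq i M"
    "row M 15 0 = (\<lambda>_. 0)" "row M 18 0 = (\<lambda>_. 0)" "\<And>b. b < n \<Longrightarrow> row M 19 0 b = OPv M NP 0 0"
    "M 4 = s 4" "M 5 = s 5"
    "eval w ansE r' M = OPv M (NP + 1) (row M 19 (n - 1) 0) 0"
proof -
  define s1 where "s1 = run w tri_com r s"
  have t: "tri_ok s1" "\<And>a. a \<noteq> 9 \<Longrightarrow> s1 a = s a"
    using run_tri[of s r] s(3) z by (auto simp: s1_def)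
  have b1: "base0 s1" using t s by (simp add: base0_def tri_ok_def del: evals0)
  define s2 where "s2 = run w (For 20 NTE (For 22 NTE (Asg 12 (prG (Var 20) (Var 22)) (Var 20)))) r s1"
  have 2: "s2 12 = fs" "\<And>b. b \<noteq> 12 \<Longrightarrow> s2 b = s1 b" "base0 s2"
    using run_fs_aux[OF b1, of 12 20 r] t(2) z fs by (auto simp: s2_def)
  define s3 where "s3 = run w (For 20 NTE (For 22 NTE (Asg 13 (prG (Var 20) (Var 22)) (Var 22)))) r s2"
  have 3: "s3 13 = sn" "\<And>b. b \<noteq> 13 \<Longrightarrow> s3 b = s2 b" "base0 s3"
    using run_fs_aux[OF 2(3), of 13 22 r] 2(2) t(2) z fs by (auto simp: s3_def)
  have b3: "base s3" using 2 3 by (simp add: base_def)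
  define s4 where "s4 = run w zc0 r s3"
  note r4 = run_zc0[OF b3, of r, folded s4_def]
  have b4: "base s4" by (rule base_cong[OF b3]) (use r4 in auto)
  define s5 where "s5 = run w zcS r s4"
  note r5 = run_zcS[OF b4, of r, folded s5_def]
  have zc5: "zc_eqs s5" "\<And>a. a \<noteq> 14 \<Longrightarrow> s5 a = s4 a" using r4 r5 by auto
  have b5: "base s5" by (rule base_cong[OF b4]) (use zc5 in auto)
  define s6 where "s6 = run w split_com r s5"
  have 6: "\<And>i. i < n - 1 \<Longrightarrow> split_eq i s6" "\<And>b. b \<notin> {15, 16, 17} \<Longrightarrow> s6 b = s5 b" "row s6 15 0 = row s5 15 0"
    using run_split[OF b5, of r, folded s6_def] by auto
  have b6: "base s6" by (rule base_cong[OF b5]) (use 6 in auto)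
  have M_eq: "M = run w merge_com r s6"
    by (simp only: M_def graph_com_def fs_com_def run.simps(2) s1_def s2_def s3_def s4_def s5_def s6_def)
  note rm = run_merge[OF b6, of r, folded M_eq]
  have M: "\<And>b. b \<notin> {18, 19, 20, 21} \<Longrightarrow> M b = s6 b" using rm by blast
  have bM: "base M" by (rule base_cong[OF b6]) (use M in auto)
  have M14: "M 14 = s5 14" using M[of 14] 6(2)[of 14] by simp
  show "zc_eqs M" using zc5(1) by (simp add: zc_eqs_def M14)
  have M5: "M 14 = s6 14" "M 15 = s6 15" "M 16 = s6 16" "M 17 = s6 17" using M by simp_all
  have ZM: "Zs M = Zs s6" by (simp add: Zs_def M5 fun_eq_iff)
  show "split_eq i M" if "i < n - 1" for i
    using 6(1)[OF that] by (simp add: split_eq_def M5 ZM)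
  show "merge_eq i M" if "i < n - 1" for i using rm that by blast
  have s5z: "s5 a = s a" if "a \<notin> {9, 12, 13, 14}" for a
    using that zc5(2)[of a] r4 3(2)[of a] 2(2)[of a] t(2)[of a] by simp
  show "row M 15 0 = (\<lambda>_. 0)" using 6(3) s5z[of 15] z[of 15] M5 by simp
  have "s6 18 = (\<lambda>_. 0)" using 6(2)[of 18] s5z[of 18] z[of 18] by simp
  then show "row M 18 0 = (\<lambda>_. 0)" using rm by simp
  have M45: "M 4 = s6 4" "M 5 = s6 5" using M by simp_all
  have "OPv M = OPv s6" by (simp add: OPv_def prJ_def M45 fun_eq_iff)
  then show "row M 19 0 b = OPv M NP 0 0" if "b < n" for b using rm that by simp
  show "M 4 = s 4" "M 5 = s 5" using M45 6(2)[of 4] 6(2)[of 5] s5z[of 4] s5z[of 5] by simp_all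
  have "eval w (Arr 19 (prG (Minus nE (Lit 1)) (Lit 0))) r' M = row M 19 (n - 1) 0"
    using base_base0[OF bM] nNT NB_bounds(1)[of 0 0 0] by simp
  then show "eval w ansE r' M = OPv M (NP + 1) (row M 19 (n - 1) 0) 0"
    by (simp only: ansE_def eval_OP) simp
qed

end

section \<open>Correctness of the program\<close>

lemma st_cong_lab:
  assumes "\<And>u. u \<in> B \<Longrightarrow> lab u = lab' u"
  shows "st A r lab B \<sigma> p = st A r lab' B \<sigma> p"
proof (induction p arbitrary: \<sigma>)
  case (Atm c X Y)
  have "(\<lambda>u. XT (lab u)) ` (\<sigma> X \<inter> B) = (\<lambda>u. XT (lab' u)) ` (\<sigma> X \<inter> B)"
    "(\<lambda>u. YT (lab u)) ` (\<sigma> Y \<inter> B) = (\<lambda>u. YT (lab' u)) ` (\<sigma> Y \<inter> B)"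
    using assms by (auto intro!: image_cong)
  then show ?case by (simp add: toks_def)
qed simp_all

lemma strict_linear_Un:
  assumes "strict_linear_order_on X r1" "r1 \<subseteq> X \<times> X" "strict_linear_order_on Y r2" "r2 \<subseteq> Y \<times> Y" "X \<inter> Y = {}"
  shows "strict_linear_order_on (X \<union> Y) (r1 \<union> r2 \<union> X \<times> Y)"
proof -
  have "trans (r1 \<union> r2 \<union> X \<times> Y)"
    using assms unfolding strict_linear_order_on_def trans_def by blast
  moreover have "irrefl (r1 \<union> r2 \<union> X \<times> Y)"
    using assms unfolding strict_linear_order_on_def irrefl_def by blast
  moreover have "total_on (X \<union> Y) (r1 \<union> r2 \<union> X \<times> Y)"
    using assms unfolding strict_linear_order_on_def total_on_def by blast
  ultimately show ?thesis by (simp add: strict_linear_order_on_def)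
qed

text \<open>Codes are needed for tuples of \<open>a1 + a2\<close> vertices with one vertex in front,
  as indices of closures, and for tuples of \<open>m\<close> vertices that certify ranks and define
  labels. The memory \<open>M\<close> enters only through the equations that it satisfies.\<close>

locale mc_run = graph_sem +
  fixes k :: nat and f :: fm and M :: mem
  assumes k1: "1 \<le> k" and mk: "m = 6 * k + 1" and a1: "k + 2 ^ (2 * k) \<le> a1" and a2: "k * k + 1 \<le> a2" "m \<le> a2"
    and sym: "\<And>u v. u < n \<Longrightarrow> v < n \<Longrightarrow> Ad u v \<longleftrightarrow> Ad v u" and irr: "\<And>u. u < n \<Longrightarrow> \<not> Ad u u"
    and bal: "igraph.balanced {..<n} (\<lambda>u v. u < n \<and> v < n \<and> Ad u v) k"
    and codes: "\<And>ds. length ds \<le> a1 + a2 + 1 \<Longrightarrow> set ds \<subseteq> {..<n} \<Longrightarrow> tcd ds < NT" and nn: "n * n \<le> NT"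
    and fs: "fs = fsf NT" "sn = snf NT"
    and zc: "zc_eqs M" and sp_eq: "\<And>i. i < n - 1 \<Longrightarrow> split_eq i M" and mg_eq: "\<And>i. i < n - 1 \<Longrightarrow> merge_eq i M"
    and P0: "row M 15 0 = (\<lambda>_. 0)" and L0: "row M 18 0 = (\<lambda>_. 0)" and T0: "\<And>b. b < n \<Longrightarrow> row M 19 0 b = OPv M NP 0 0"
    and op: "\<And>i x y. i < NP \<Longrightarrow> x \<in> vs L f \<Longrightarrow> y \<in> vs L f \<Longrightarrow> OPv M i x y = opn (ms ! i) f x y"
    and leaf: "OPv M NP 0 0 = leafn {} f"
    and ms_ok: "\<And>p. p \<in> set ms \<Longrightarrow> \<exists>f g J. p = (f, g, J) \<and> (\<forall>a<L. f a < L \<and> g a < L)"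
    and ms_all: "\<And>f g J. (\<forall>a<L. f a < L \<and> g a < L) \<Longrightarrow> \<exists>i<NP. (\<forall>a<L. fst (ms ! i) a = f a \<and> fst (snd (ms ! i)) a = g a)
        \<and> (\<forall>a<L. \<forall>b<L. snd (snd (ms ! i)) a b \<longleftrightarrow> J a b)"
begin

text \<open>If \<open>v\<close> is not a vertex then \<open>Ad u v\<close> reads a letter beyond the
  row of \<open>u\<close>; the restriction makes the relation symmetric.\<close>

definition A :: "nat \<Rightarrow> nat \<Rightarrow> bool" where "A u v \<longleftrightarrow> u < n \<and> v < n \<and> Ad u v"

sublocale ig: igraph "{..<n}" A
  by unfold_locales (auto simp: A_def sym)

lemma bal': "ig.balanced k"
  using bal by (simp add: A_def[abs_def])

lemma fs_pr: "x < NT \<Longrightarrow> y < NT \<Longrightarrow> fs (prod_encode (x, y)) = x" and sn_pr: "x < NT \<Longrightarrow> y < NT \<Longrightarrow> sn (prod_encode (x, y)) = y"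
  by (simp_all add: fs fsf_def snf_def)

lemma dig_tcd:
  assumes "length ds \<le> a1 + a2 + 1" "set ds \<subseteq> {..<n}" "j < length ds"
  shows "dig (tcd ds) j = ds ! j"
proof -
  have lt: "d < NT" if "d \<in> set ds" for d using that assms(2) nNT by auto
  have "j \<le> length ds \<Longrightarrow> (sn ^^ j) (tcd ds) = tcd (drop j ds)" for j
  proof (induction j)
    case (Suc j)
    then have d: "drop j ds = ds ! j # drop (Suc j) ds" by (simp add: Cons_nth_drop_Suc)
    have "tcd (drop (Suc j) ds) < NT" using assms(1,2) by (intro codes) (auto dest: in_set_dropD)
    then show ?case using Suc d lt[of "ds ! j"] by (simp add: sn_pr)
  qed simp
  then have "(sn ^^ j) (tcd ds) = prod_encode (ds ! j, tcd (drop (Suc j) ds))"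
    using assms(3) by (simp add: Cons_nth_drop_Suc[symmetric] del: Cons_nth_drop_Suc)
  moreover have "tcd (drop (Suc j) ds) < NT" using assms(1,2) by (intro codes) (auto dest: in_set_dropD)
  ultimately show ?thesis using lt[of "ds ! j"] assms(3) by (simp add: dig_def fs_pr)
qed

lemma A_Ad: "u < n \<Longrightarrow> v < n \<Longrightarrow> A u v \<longleftrightarrow> Ad u v"
  by (simp add: A_def)

lemma rk_iff:
  assumes X: "X \<subseteq> {..<n}"
  shows "rk X \<longleftrightarrow> ig.R X \<le> 2 ^ m"
proof
  assume "rk X"
  then obtain g where g: "\<And>c. c < n \<Longrightarrow> c \<notin> X \<Longrightarrow> \<exists>J\<subseteq>{..<m}. \<forall>u<n. u \<in> X \<longrightarrow> (Ad u c \<longleftrightarrow> odd (card {j \<in> J. bit X g u j}))"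
    unfolding rk_def by blast
  show "ig.R X \<le> 2 ^ m"
  proof (rule ig.rank_leI[OF X, where \<gamma> = "dig g"])
    fix c assume c: "c \<in> {..<n} - X"
    then obtain J where J: "J \<subseteq> {..<m}" "\<forall>u<n. u \<in> X \<longrightarrow> (Ad u c \<longleftrightarrow> odd (card {j \<in> J. bit X g u j}))"
      using g[of c] by auto
    have "A u c \<longleftrightarrow> odd (card {j \<in> J. dig g j \<in> {..<n} - X \<and> A u (dig g j)})" if u: "u \<in> X" for u
    proof -
      have "u < n" using u X by auto
      moreover have "{j \<in> J. bit X g u j} = {j \<in> J. dig g j \<in> {..<n} - X \<and> A u (dig g j)}"
        using \<open>u < n\<close> by (auto simp: bit_def A_def)
      ultimately show ?thesis using J(2) u c by (simp add: A_Ad)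
    qed
    then show "\<exists>J\<subseteq>{..<m}. \<forall>u\<in>X. A u c \<longleftrightarrow> odd (card {j \<in> J. dig g j \<in> {..<n} - X \<and> A u (dig g j)})"
      using J(1) by blast
  qed
next
  assume R: "ig.R X \<le> 2 ^ m"
  have "0 \<in> {..<n}" using n1 by simp
  then have "{..<n} \<noteq> {}" by blast
  then obtain \<gamma> where \<gamma>: "\<And>j. \<gamma> j \<in> {..<n}"
    "\<forall>c\<in>{..<n} - X. \<exists>J\<subseteq>{..<m}. \<forall>u\<in>X. A u c \<longleftrightarrow> odd (card {j \<in> J. \<gamma> j \<in> {..<n} - X \<and> A u (\<gamma> j)})"
    using ig.rank_leD[OF X _ R] by blast
  define ds where "ds = map \<gamma> [0..<m]"
  have ds: "length ds \<le> a1 + a2 + 1" "set ds \<subseteq> {..<n}" using \<gamma>(1) a2 by (auto simp: ds_def)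
  have dg: "dig (tcd ds) j = \<gamma> j" if "j < m" for j using dig_tcd[OF ds, of j] that by (simp add: ds_def)
  have "c \<in> X \<or> (\<exists>J\<subseteq>{..<m}. \<forall>u<n. u \<in> X \<longrightarrow> (Ad u c \<longleftrightarrow> odd (card {j \<in> J. bit X (tcd ds) u j})))" if c: "c < n" for c
  proof (cases "c \<in> X")
    case False
    then have "c \<in> {..<n} - X" using c by simp
    from \<gamma>(2)[rule_format, OF this] obtain J where J: "J \<subseteq> {..<m}"
      "\<And>u. u \<in> X \<Longrightarrow> A u c \<longleftrightarrow> odd (card {j \<in> J. \<gamma> j \<in> {..<n} - X \<and> A u (\<gamma> j)})" by (elim exE conjE) simp
    have "Ad u c \<longleftrightarrow> odd (card {j \<in> J. bit X (tcd ds) u j})" if u: "u < n" "u \<in> X" for u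
    proof -
      have "{j \<in> J. bit X (tcd ds) u j} = {j \<in> J. \<gamma> j \<in> {..<n} - X \<and> A u (\<gamma> j)}"
        using J(1) dg \<gamma>(1) u by (auto simp: bit_def A_def subset_iff)
      then show ?thesis using J(2)[OF u(2)] u c by (simp add: A_Ad)
    qed
    with J(1) show ?thesis by blast
  qed simp
  then show "rk X" unfolding rk_def using codes[OF ds] by blast
qed

text \<open>The closures of all tuples are computed simultaneously, one application of the rule per
  round, and \<open>NT\<close> rounds suffice since \<open>n * n \<le> NT\<close>.\<close>

lemma Zs_clos:
  assumes ds: "length ds = a1 + a2" "set ds \<subseteq> {..<n}" and v: "v < n"
  defines "Q \<equiv> (!) ds ` {..<a1}" and "T \<equiv> (!) ds ` {a1..<a1 + a2}"
  shows "Zs M (tcd ds) v \<longleftrightarrow> v \<in> ig.clos Q T"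
proof -
  define c where "c = tcd ds"
  have cNT: "c < NT" unfolding c_def using ds by (intro codes) auto
  have z: "prod_encode (u, c) < NT" if "u < n" for u
    using codes[of "u # ds"] ds that by (simp add: c_def)
  have dg: "dig c j = ds ! j" if "j < a1 + a2" for j
    unfolding c_def using dig_tcd[of ds j] ds that by simp
  have dn: "ds ! j < n" if "j < a1 + a2" for j using ds that nth_mem[of j ds] by (metis lessThan_iff subsetD)
  have T: "T = (\<lambda>j. ds ! (a1 + j)) ` {..<a2}"
  proof -
    have "{a1..<a1 + a2} = (\<lambda>j. a1 + j) ` {..<a2}" by (simp add: lessThan_atLeast0 add.commute)
    then show ?thesis by (simp add: T_def image_image)
  qed
  have bd: "bd_step u (prod_encode (v, c)) \<longleftrightarrow> (u, v) \<in> ig.bad Q T" if uv: "u < n" "v < n" for u v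
  proof -
    have fsv: "fs (prod_encode (v, c)) = v" "sn (prod_encode (v, c)) = c" using uv nNT cNT by (auto simp: fs_pr sn_pr)
    have "bd_step u (prod_encode (v, c)) \<longleftrightarrow> (\<exists>i<a1. (\<forall>j<a2. A u (ds ! (a1 + j)) \<longleftrightarrow> A (ds ! i) (ds ! (a1 + j))) \<and> A u v \<noteq> A (ds ! i) v)"
      unfolding bd_step_def fsv using uv by (simp add: dg A_Ad dn cong: conj_cong)
    also have "\<dots> \<longleftrightarrow> (u, v) \<in> ig.bad Q T"
      unfolding ig.bad_def Q_def T using uv by auto
    finally show ?thesis .
  qed
  have "r \<le> NT \<Longrightarrow> \<forall>v<n. M 14 (prod_encode (r, prod_encode (v, c))) \<noteq> 0 \<longleftrightarrow> v \<in> ig.rounds Q T r" for r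
  proof (induction r)
    case 0
    have "M 14 (prod_encode (0, prod_encode (v, c))) \<noteq> 0 \<longleftrightarrow> v \<in> Q" if v: "v < n" for v
    proof -
      have fsv: "fs (prod_encode (v, c)) = v" "sn (prod_encode (v, c)) = c" using v nNT cNT by (auto simp: fs_pr sn_pr)
      have "M 14 (prod_encode (0, prod_encode (v, c))) \<noteq> 0 \<longleftrightarrow> (\<exists>j<a1. v = dig c j)"
        using conjunct1[OF zc[unfolded zc_eqs_def], rule_format, OF z[OF v]] unfolding fsv .
      also have "\<dots> \<longleftrightarrow> v \<in> Q" using dg by (auto simp: Q_def)
      finally show ?thesis .
    qed
    then show ?case by simp
  next
    case (Suc r)
    then have IH: "\<And>v. v < n \<Longrightarrow> M 14 (prod_encode (r, prod_encode (v, c))) \<noteq> 0 \<longleftrightarrow> v \<in> ig.rounds Q T r" by simp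
    have "M 14 (prod_encode (Suc r, prod_encode (v, c))) \<noteq> 0 \<longleftrightarrow> v \<in> ig.rounds Q T (Suc r)" if v: "v < n" for v
    proof -
      have snv: "sn (prod_encode (v, c)) = c" using v nNT cNT by (simp add: sn_pr)
      have "M 14 (prod_encode (Suc r, prod_encode (v, c))) \<noteq> 0 \<longleftrightarrow> M 14 (prod_encode (r, prod_encode (v, c))) \<noteq> 0
        \<or> (\<exists>u<n. M 14 (prod_encode (r, prod_encode (u, c))) \<noteq> 0 \<and> bd_step u (prod_encode (v, c)))"
        using conjunct2[OF zc[unfolded zc_eqs_def], rule_format, OF _ z[OF v], of r] Suc.prems unfolding snv by simp
      also have "\<dots> \<longleftrightarrow> v \<in> ig.rounds Q T r \<or> (\<exists>u<n. u \<in> ig.rounds Q T r \<and> (u, v) \<in> ig.bad Q T)"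
        using IH v bd by blast
      also have "\<dots> \<longleftrightarrow> v \<in> ig.rounds Q T (Suc r)"
        using ig.bad_subset[of Q T] by auto
      finally show ?thesis .
    qed
    then show ?case by blast
  qed
  from this[of NT] have "Zs M c v \<longleftrightarrow> v \<in> ig.rounds Q T NT" using v by (simp add: Zs_def)
  also have "ig.rounds Q T NT = ig.clos Q T" by (rule ig.rounds_clos) (use nn in simp)
  finally show ?thesis by (simp add: c_def)
qed

subsection \<open>The partitions\<close>

definition P :: "nat \<Rightarrow> nat \<Rightarrow> nat" where "P i = row M 15 i"

text \<open>Blocks 0 to \<open>i\<close> are all in use, so that after \<open>n - 1\<close> splits
  each of them must be a single vertex.\<close>

definition part_ok :: "nat \<Rightarrow> bool" where
  "part_ok i \<longleftrightarrow> (\<forall>v<n. P i v \<le> i) \<and> (\<forall>b\<le>i. blk (P i) b \<noteq> {} \<and> rk (blk (P i) b))"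

lemma blk_sub: "blk Q b \<subseteq> {..<n}" and half_sub: "half Q Z b h \<subseteq> {..<n}"
  by (auto simp: blk_def half_def)

text \<open>The vertices occupy only \<open>i + 1 < n\<close> blocks, so some block has two vertices
  and can be split. The seeds and tests of this split are listed by a tuple, which is among those
  that are tried.\<close>

lemma chk_exists:
  assumes ok: "part_ok i" and i: "i < n - 1"
  shows "\<exists>c<NT. \<exists>b<n. chk (P i) (Zs M c) b"
proof -
  have "\<not> inj_on (P i) {..<n}"
  proof
    assume "inj_on (P i) {..<n}"
    then have "n = card (P i ` {..<n})" by (simp add: card_image)
    also have "\<dots> \<le> card {..i}" using ok by (intro card_mono) (auto simp: part_ok_def)
    finally show False using i by simp
  qed
  then obtain u v where uv: "u < n" "v < n" "u \<noteq> v" "P i u = P i v" by (auto simp: inj_on_def)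
  define b where "b = P i u"
  define B where "B = blk (P i) b"
  have b: "b \<le> i" "b < n" using ok uv(1) i by (auto simp: part_ok_def b_def)
  have "{u, v} \<subseteq> B" using uv by (auto simp: B_def blk_def b_def)
  then have "card {u, v} \<le> card B" by (intro card_mono) (auto simp: B_def blk_def)
  then have B2: "2 \<le> card B" using uv(3) by simp
  have BV: "B \<subseteq> {..<n}" unfolding B_def by (rule blk_sub)
  have "rk B" using ok b(1) unfolding part_ok_def B_def by blast
  then have "ig.R B \<le> 2 ^ m" by (rule rk_iff[OF BV, THEN iffD1])
  then have "ig.R B \<le> 2 ^ (6 * k + 1)" by (simp only: mk)
  from ig.split_exists[OF k1 bal' BV B2 this] obtain Q T where
    QT: "Q \<subseteq> {..<n}" "T \<subseteq> {..<n}" "Q \<noteq> {}" "T \<noteq> {}" "card Q \<le> k + 2 ^ (2 * k)" "card T \<le> k * k + 1"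
     "B \<inter> ig.clos Q T \<noteq> {}" "B - ig.clos Q T \<noteq> {}"
     "ig.R (B \<inter> ig.clos Q T) \<le> 2 ^ m" "ig.R (B - ig.clos Q T) \<le> 2 ^ m" using mk by auto
  have fin: "finite Q" "finite T" using QT(1,2) by (auto intro: finite_subset)
  obtain q where q: "Q = q ` {..<a1}" using finite_set_enum[OF fin(1) QT(3)] QT(5) a1 by (meson le_trans)
  obtain t where t: "T = t ` {..<a2}" using finite_set_enum[OF fin(2) QT(4)] QT(6) a2 by (meson le_trans)
  define ds where "ds = map q [0..<a1] @ map t [0..<a2]"
  have "set ds = Q \<union> T" unfolding ds_def q t by (simp add: atLeast0LessThan)
  then have ds: "length ds = a1 + a2" "set ds \<subseteq> {..<n}" using QT(1,2) by (simp_all add: ds_def)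
  have "(!) ds ` {..<a1} = q ` {..<a1}" by (rule image_cong) (auto simp: ds_def nth_append)
  moreover have "(!) ds ` {a1..<a1 + a2} = t ` {..<a2}"
  proof -
    have "{a1..<a1 + a2} = (\<lambda>j. j + a1) ` {0..<a2}" by (simp add: image_add_atLeastLessThan' add.commute)
    then have "(!) ds ` {a1..<a1 + a2} = (\<lambda>j. ds ! (j + a1)) ` {0..<a2}" by (simp only: image_image)
    also have "\<dots> = t ` {0..<a2}" by (rule image_cong) (auto simp: ds_def nth_append)
    finally show ?thesis by (simp add: atLeast0LessThan)
  qed
  ultimately have Z: "Zs M (tcd ds) v \<longleftrightarrow> v \<in> ig.clos Q T" if "v < n" for v
    using Zs_clos[OF ds that] q t by simp
  have "half (P i) (Zs M (tcd ds)) b True = B \<inter> ig.clos Q T" "half (P i) (Zs M (tcd ds)) b False = B - ig.clos Q T"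
    using Z by (auto simp: half_def B_def blk_def)
  then have "chk (P i) (Zs M (tcd ds)) b"
    using QT rk_iff[of "B \<inter> ig.clos Q T"] rk_iff[of "B - ig.clos Q T"] BV by (simp add: chk_def le_infI1 subset_trans[OF Diff_subset])
  moreover have "tcd ds < NT" using ds by (intro codes) auto
  ultimately show ?thesis using b(2) by blast
qed

lemma split_step:
  assumes ok: "part_ok i" and i: "i < n - 1"
  defines "b \<equiv> M 16 (Suc i) - 1"
  shows "part_ok (Suc i)" "b \<le> i" "blk (P i) b = blk (P (Suc i)) b \<union> blk (P (Suc i)) (Suc i)"
    "\<And>b'. b' \<le> i \<Longrightarrow> b' \<noteq> b \<Longrightarrow> blk (P (Suc i)) b' = blk (P i) b'"
proof -
  define c where "c = M 17 (Suc i)"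
  have eq: "c = first NT (\<lambda>c. \<exists>b<n. chk (P i) (Zs M c) b)" "M 16 (Suc i) = first n (chk (P i) (Zs M (c - 1)))"
    "\<And>v. v < n \<Longrightarrow> P (Suc i) v = (if v \<in> half (P i) (Zs M (c - 1)) b True then Suc i else P i v)"
    using sp_eq[OF i] unfolding split_eq_def Let_def P_def c_def b_def by auto
  have "\<exists>b<n. chk (P i) (Zs M (c - 1)) b"
    using chk_exists[OF ok i] eq(1) by (cases rule: first_cases[of NT "\<lambda>c. \<exists>b<n. chk (P i) (Zs M c) b"]) auto
  then have ck: "chk (P i) (Zs M (c - 1)) b"
    using eq(2) by (cases rule: first_cases[of n "chk (P i) (Zs M (c - 1))"]) (auto simp: b_def)
  let ?H = "half (P i) (Zs M (c - 1)) b"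
  obtain v where "v \<in> ?H True" using ck by (auto simp: chk_def)
  then show bi: "b \<le> i" using ok by (auto simp: part_ok_def half_def)
  have le: "\<And>v. v < n \<Longrightarrow> P i v \<le> i" using ok by (auto simp: part_ok_def)
  have new: "blk (P (Suc i)) (Suc i) = ?H True"
  proof (rule set_eqI)
    fix v
    show "v \<in> blk (P (Suc i)) (Suc i) \<longleftrightarrow> v \<in> ?H True"
      using eq(3)[of v] le[of v] by (cases "v < n") (auto simp: blk_def half_def)
  qed
  have old: "blk (P (Suc i)) b = ?H False"
  proof (rule set_eqI)
    fix v
    show "v \<in> blk (P (Suc i)) b \<longleftrightarrow> v \<in> ?H False"
      using eq(3)[of v] bi by (cases "v < n") (auto simp: blk_def half_def)
  qed
  show "blk (P i) b = blk (P (Suc i)) b \<union> blk (P (Suc i)) (Suc i)"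
    unfolding new old by (auto simp: blk_def half_def)
  show other: "blk (P (Suc i)) b' = blk (P i) b'" if "b' \<le> i" "b' \<noteq> b" for b'
  proof (rule set_eqI)
    fix v
    show "v \<in> blk (P (Suc i)) b' \<longleftrightarrow> v \<in> blk (P i) b'"
      using eq(3)[of v] that by (cases "v < n") (auto simp: blk_def half_def)
  qed
  show "part_ok (Suc i)"
    unfolding part_ok_def
  proof (intro conjI allI impI)
    fix v assume "v < n" then show "P (Suc i) v \<le> Suc i" using eq(3)[of v] le[of v] by auto
  next
    fix b' assume b': "b' \<le> Suc i"
    consider "b' = Suc i" | "b' = b" | "b' \<le> i" "b' \<noteq> b" using b' by linarith
    then have "blk (P (Suc i)) b' \<noteq> {} \<and> rk (blk (P (Suc i)) b')"
    proof cases
      case 3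
      then show ?thesis using other[OF 3] ok by (simp add: part_ok_def)
    qed (use new old ck in \<open>simp_all add: chk_def\<close>)
    then show "blk (P (Suc i)) b' \<noteq> {}" "rk (blk (P (Suc i)) b')" by auto
  qed
qed

lemma part_ok: "i \<le> n - 1 \<Longrightarrow> part_ok i"
proof (induction i)
  case 0
  have "0 \<in> {..<n}" using n1 by simp
  have b: "blk (P 0) 0 = {..<n}" using P0 by (auto simp: blk_def P_def)
  have "ig.R {..<n} = 1" by (simp add: ig.R_def ig.sp_def)
  then have "rk {..<n}" using rk_iff[of "{..<n}"] by simp
  moreover have "P 0 v = 0" for v using P0 by (simp add: P_def fun_eq_iff)
  ultimately show ?case using b \<open>0 \<in> {..<n}\<close> by (auto simp: part_ok_def)
next
  case (Suc i)
  then show ?case using split_step(1)[of i] by simp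
qed

subsection \<open>The merges\<close>

definition labelled :: "nat set \<Rightarrow> (nat \<Rightarrow> nat) \<Rightarrow> bool" where
  "labelled X Lb \<longleftrightarrow> X \<subseteq> {..<n} \<and> (\<forall>u\<in>X. Lb u < L) \<and> (\<forall>u\<in>X. \<forall>v\<in>X. Lb u = Lb v \<longrightarrow> (\<forall>c<n. c \<notin> X \<longrightarrow> (Ad u c \<longleftrightarrow> Ad v c)))"

text \<open>The order is only claimed to exist: the program never stores it, and it is implicit in
  which half comes first in each merge.\<close>

definition piece :: "nat set \<Rightarrow> (nat \<Rightarrow> nat) \<Rightarrow> nat \<Rightarrow> bool" where
  "piece X Lb x \<longleftrightarrow> labelled X Lb \<and> x \<in> vs L f
     \<and> (\<exists>r. r \<subseteq> X \<times> X \<and> strict_linear_order_on X r \<and> x = st A r Lb X (\<lambda>_. {}) f)"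

lemma labelledD: "labelled X Lb \<Longrightarrow> u \<in> X \<Longrightarrow> v \<in> X \<Longrightarrow> Lb u = Lb v \<Longrightarrow> c < n \<Longrightarrow> c \<notin> X \<Longrightarrow> Ad u c \<longleftrightarrow> Ad v c"
  unfolding labelled_def by blast

lemma lab_set_encode: "lab X g u = set_encode {j \<in> {..<m}. bit X g u j}"
  unfolding lab_def set_encode_def by (rule sum.inter_filter[symmetric]) simp

lemma lab_less: "lab X g u < L"
  unfolding lab_set_encode L by (rule set_encode_less_exp) auto

lemma lab_eqD: "lab X g u = lab X g v \<Longrightarrow> j < m \<Longrightarrow> bit X g u j \<longleftrightarrow> bit X g v j"
proof -
  assume e: "lab X g u = lab X g v" and j: "j < m"
  have "{j \<in> {..<m}. bit X g u j} = {j \<in> {..<m}. bit X g v j}"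
    by (rule inj_onD[OF inj_on_set_encode]) (use e in \<open>simp_all add: lab_set_encode\<close>)
  then have "j \<in> {j \<in> {..<m}. bit X g u j} \<longleftrightarrow> j \<in> {j \<in> {..<m}. bit X g v j}" by simp
  then show ?thesis using j by simp
qed

text \<open>The certificate of the rank provides the labels: adjacency to any outer vertex is a
  parity of label bits, hence determined by the label.\<close>

lemma code_exists:
  assumes X: "X \<subseteq> {..<n}" and "rk X"
  shows "\<exists>g<NT. good_code X g"
proof -
  from assms(2) obtain g where g: "g < NT"
    "\<And>c. c < n \<Longrightarrow> c \<notin> X \<Longrightarrow> \<exists>J\<subseteq>{..<m}. \<forall>u<n. u \<in> X \<longrightarrow> (Ad u c \<longleftrightarrow> odd (card {j \<in> J. bit X g u j}))"
    unfolding rk_def by blast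
  have "Ad u c \<longleftrightarrow> Ad v c" if uv: "u < n" "v < n" "u \<in> X" "v \<in> X" "lab X g u = lab X g v" and c: "c < n" "c \<notin> X" for u v c
  proof -
    obtain J where J: "J \<subseteq> {..<m}" "\<forall>u<n. u \<in> X \<longrightarrow> (Ad u c \<longleftrightarrow> odd (card {j \<in> J. bit X g u j}))"
      using g(2)[OF c] by (elim exE conjE)
    have "{j \<in> J. bit X g u j} = {j \<in> J. bit X g v j}" using lab_eqD[OF uv(5)] J(1) by auto
    then show ?thesis using J(2)[rule_format, OF uv(1,3)] J(2)[rule_format, OF uv(2,4)] by simp
  qed
  then show ?thesis using g(1) unfolding good_code_def by blast
qed

text \<open>Vertices of a half with equal old labels have the same neighbours outside of this half.
  So the new label, which counts neighbours outside of \<open>X\<close> only, and the adjacency to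
  the other half are functions of old labels; they can be read off a representative, and the list of
  merges contains every such triple.\<close>

lemma cons_exists:
  assumes X: "X = X1 \<union> X2" "X1 \<inter> X2 = {}" and l1: "labelled X1 Lb" and l2: "labelled X2 Lb"
  shows "\<exists>q<NP. cons_code X X1 X2 g q Lb"
proof -
  define pick where "pick Y l = (SOME u. u \<in> Y \<and> Lb u = l)" for Y l
  have pick: "pick Y (Lb u) \<in> Y \<and> Lb (pick Y (Lb u)) = Lb u" if "u \<in> Y" for Y u
    unfolding pick_def by (rule someI[of "\<lambda>v. v \<in> Y \<and> Lb v = Lb u" u]) (use that in simp)
  have lab_pick: "lab X g (pick Y (Lb u)) = lab X g u" if Y: "labelled Y Lb" "Y \<subseteq> X" and u: "u \<in> Y" for Y u
  proof -
    have p: "pick Y (Lb u) \<in> Y" "Lb (pick Y (Lb u)) = Lb u" using pick[OF u] by auto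
    have "bit X g (pick Y (Lb u)) j \<longleftrightarrow> bit X g u j" for j
    proof (cases "dig g j < n \<and> dig g j \<notin> X")
      case True
      then have "dig g j \<notin> Y" using Y(2) by auto
      with True have "Ad (pick Y (Lb u)) (dig g j) \<longleftrightarrow> Ad u (dig g j)"
        by (intro labelledD[OF Y(1) p(1) u p(2)]) simp_all
      then show ?thesis using True by (simp add: bit_def)
    qed (auto simp: bit_def)
    then show ?thesis by (simp add: lab_def)
  qed
  let ?f = "\<lambda>l. lab X g (pick X1 l)" and ?g = "\<lambda>l. lab X g (pick X2 l)"
    and ?J = "\<lambda>l l'. \<exists>u\<in>X1. \<exists>v\<in>X2. Lb u = l \<and> Lb v = l' \<and> Ad u v"
  obtain q where q: "q < NP" "\<forall>a<L. fst (ms ! q) a = ?f a \<and> fst (snd (ms ! q)) a = ?g a"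
    "\<forall>a<L. \<forall>b<L. snd (snd (ms ! q)) a b \<longleftrightarrow> ?J a b"
    using ms_all[of ?f ?g ?J] lab_less by blast
  have Lb: "u \<in> X1 \<Longrightarrow> Lb u < L" "u \<in> X2 \<Longrightarrow> Lb u < L" for u using l1 l2 by (auto simp: labelled_def)
  have sub: "u \<in> X1 \<Longrightarrow> u < n" "u \<in> X2 \<Longrightarrow> u < n" for u using l1 l2 by (auto simp: labelled_def)
  have "rho1 q (Lb u) = lab X g u" if "u \<in> X1" for u
    using lab_pick[OF l1 _ that] X Lb(1)[OF that] q(1,2) by (simp add: rho1_def)
  moreover have "rho2 q (Lb u) = lab X g u" if "u \<in> X2" for u
    using lab_pick[OF l2 _ that] X Lb(2)[OF that] q(1,2) by (simp add: rho2_def)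
  moreover have "Ad u v \<longleftrightarrow> joinl q (Lb u) (Lb v)" if uv: "u \<in> X1" "v \<in> X2" for u v
  proof -
    have "joinl q (Lb u) (Lb v) \<longleftrightarrow> ?J (Lb u) (Lb v)"
      using q(1,3) Lb(1)[OF uv(1)] Lb(2)[OF uv(2)] by (simp add: joinl_def)
    also have "\<dots> \<longleftrightarrow> Ad u v"
    proof
      assume "?J (Lb u) (Lb v)"
      then obtain u' v' where u': "u' \<in> X1" "v' \<in> X2" "Lb u' = Lb u" "Lb v' = Lb v" "Ad u' v'" by (elim bexE conjE)
      \<comment> \<open>The endpoints of the edge are exchanged one at a time, each time for a
        vertex with the same label in the same half while the other endpoint lies outside of this
        half.\<close>
      have "v' \<notin> X1" "u \<notin> X2" using X(2) u' uv by auto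
      then have "Ad u v'" using labelledD[OF l1 u'(1) uv(1) u'(3) sub(2)[OF u'(2)]] u'(5) by simp
      then have "Ad v' u" using sym[OF sub(1)[OF uv(1)] sub(2)[OF u'(2)]] by simp
      then have "Ad v u" using labelledD[OF l2 u'(2) uv(2) u'(4) sub(1)[OF uv(1)] \<open>u \<notin> X2\<close>] by simp
      then show "Ad u v" using sym[OF sub(1)[OF uv(1)] sub(2)[OF uv(2)]] by simp
    qed (use uv in blast)
    finally show ?thesis by simp
  qed
  ultimately have "cons_code X X1 X2 g q Lb" unfolding cons_code_def by simp
  then show ?thesis using q(1) by blast
qed

lemma piece_cong:
  assumes "piece X Lb x" "\<And>u. u \<in> X \<Longrightarrow> Lb u = Lb' u"
  shows "piece X Lb' x"
proof -
  have "st A r Lb X (\<lambda>_. {}) f = st A r Lb' X (\<lambda>_. {}) f" for r by (rule st_cong_lab) (rule assms(2))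
  moreover have "labelled X Lb'" unfolding labelled_def
  proof (intro conjI ballI allI impI)
    have l: "labelled X Lb" using assms(1) by (simp add: piece_def)
    then show "X \<subseteq> {..<n}" by (simp add: labelled_def)
    show "Lb' u < L" if "u \<in> X" for u using l that unfolding labelled_def assms(2)[OF that, symmetric] by blast
    show "Ad u c \<longleftrightarrow> Ad v c" if "u \<in> X" "v \<in> X" "Lb' u = Lb' v" "c < n" "c \<notin> X" for u v c
      using labelledD[OF l that(1,2) _ that(4,5)] that(3) assms(2)[OF that(1)] assms(2)[OF that(2)] by simp
  qed
  ultimately show ?thesis using assms(1) unfolding piece_def by simp
qed

text \<open>The order on \<open>X\<close> puts all of \<open>X1\<close> before all of
  \<open>X2\<close>. With it the merge is an admissible one for the composition theorem.\<close>

lemma piece_merge: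
  assumes X: "X = X1 \<union> X2" "X1 \<inter> X2 = {}" and p1: "piece X1 Lb x" and p2: "piece X2 Lb y"
    and g: "good_code X g" and q: "q < NP" "cons_code X X1 X2 g q Lb"
  shows "piece X (lab X g) (OPv M q x y)"
proof -
  obtain r1 r2 where r: "r1 \<subseteq> X1 \<times> X1" "strict_linear_order_on X1 r1" "x = st A r1 Lb X1 (\<lambda>_. {}) f"
    "r2 \<subseteq> X2 \<times> X2" "strict_linear_order_on X2 r2" "y = st A r2 Lb X2 (\<lambda>_. {}) f"
    and xy: "x \<in> vs L f" "y \<in> vs L f" and l: "labelled X1 Lb" "labelled X2 Lb"
    using p1 p2 unfolding piece_def by blast
  have sub: "X1 \<subseteq> {..<n}" "X2 \<subseteq> {..<n}" using l by (auto simp: labelled_def)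
  have Lb: "u \<in> X1 \<Longrightarrow> Lb u < L" "u \<in> X2 \<Longrightarrow> Lb u < L" for u using l by (auto simp: labelled_def)
  obtain fm1 fm2 J where mq: "ms ! q = (fm1, fm2, J)" "\<forall>a<L. fm1 a < L \<and> fm2 a < L"
    using ms_ok[OF nth_mem, of q] q(1) unfolding NP_def by blast
  define r where "r = r1 \<union> r2 \<union> X1 \<times> X2"
  have "merge_ok A r r1 r2 (lab X g) Lb Lb X1 X2 (fm1, fm2, J)"
    unfolding merge_ok_def prod.case
  proof (intro conjI ballI allI)
    show "finite X1" "finite X2" using sub finite_subset by blast+
    show "A u v \<longleftrightarrow> A v u" for u v by (rule ig.A_sym)
    show "X1 \<inter> X2 = {}" by (rule X(2))
    show "lab X g u = fm1 (Lb u)" if "u \<in> X1" for u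
      using q(2) sub(1) that Lb(1)[OF that] mq(1) q(1) unfolding cons_code_def rho1_def by auto
    show "lab X g u = fm2 (Lb u)" if "u \<in> X2" for u
      using q(2) sub(2) that Lb(2)[OF that] mq(1) q(1) unfolding cons_code_def rho2_def by auto
    show "A u v \<longleftrightarrow> J (Lb u) (Lb v)" if "u \<in> X1" "v \<in> X2" for u v
    proof -
      have "u < n" "v < n" using that sub by auto
      then have "Ad u v \<longleftrightarrow> joinl q (Lb u) (Lb v)" using q(2) that unfolding cons_code_def by simp
      then show ?thesis using \<open>u < n\<close> \<open>v < n\<close> Lb(1)[OF that(1)] Lb(2)[OF that(2)] mq(1) q(1) by (simp add: joinl_def A_Ad)
    qed
  qed (use X(2) r(1,4) in \<open>auto simp: r_def\<close>)
  from opn_st[OF this, of "\<lambda>_. {}" f] have "st A r (lab X g) X (\<lambda>_. {}) f = OPv M q x y"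
    using op[OF q(1) xy] by (simp add: X(1) r(3,6) mq(1))
  moreover have "OPv M q x y \<in> vs L f"
    unfolding op[OF q(1) xy] using mq(2) by (intro opn_vs[OF mq(1) _ _ xy]) auto
  moreover have "strict_linear_order_on X r" unfolding X(1) r_def by (rule strict_linear_Un) (use r X(2) in auto)
  moreover have "r \<subseteq> X \<times> X" using r(1,4) by (auto simp: r_def X(1))
  moreover have "labelled X (lab X g)"
  proof -
    have XV: "X \<subseteq> {..<n}" using sub by (simp add: X(1))
    have "Ad u c \<longleftrightarrow> Ad v c" if "u \<in> X" "v \<in> X" "lab X g u = lab X g v" "c < n" "c \<notin> X" for u v c
      using g that XV unfolding good_code_def by (metis lessThan_iff subsetD)
    then show ?thesis using XV lab_less unfolding labelled_def by blast
  qed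
  ultimately show ?thesis unfolding piece_def by (intro conjI exI[of _ r]) simp_all
qed

lemma piece_leaf:
  assumes "u < n" "Lb u = 0"
  shows "piece {u} Lb (OPv M NP 0 0)"
proof -
  have L1: "1 \<le> L" by (simp add: L)
  have "st A {} Lb {u} (\<lambda>_. {}) f = leafn {X. u \<in> {}} f"
    by (rule leafn_st) (use assms irr in \<open>auto simp: A_def\<close>)
  moreover have "strict_linear_order_on {u} {}" by (simp add: strict_linear_order_on_def trans_def irrefl_def)
  moreover have "labelled {u} Lb" using assms L1 by (simp add: labelled_def)
  ultimately show ?thesis using leafn_vs[OF L1, of "{}" f] leaf
    unfolding piece_def by (intro conjI exI[of _ "{}"]) simp_all
qed

definition pieces :: "nat \<Rightarrow> bool" where
  "pieces i \<longleftrightarrow> (\<forall>b\<le>n - 1 - i. piece (blk (P (n - 1 - i)) b) (row M 18 i) (row M 19 i b))"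

lemma pieces_0: "pieces 0"
  unfolding pieces_def
proof (intro allI impI)
  fix b assume b: "b \<le> n - 1 - 0"
  let ?Q = "P (n - 1)"
  have ok: "part_ok (n - 1)" by (simp add: part_ok)
  \<comment> \<open>There are \<open>n\<close> nonempty blocks on \<open>n\<close> vertices, so the
    map from vertices to blocks is surjective and therefore injective.\<close>
  have "{..n - 1} \<subseteq> ?Q ` {..<n}"
  proof
    fix b assume "b \<in> {..n - 1}"
    then have "blk ?Q b \<noteq> {}" using ok by (simp add: part_ok_def)
    then show "b \<in> ?Q ` {..<n}" by (auto simp: blk_def)
  qed
  then have "card {..n - 1} \<le> card (?Q ` {..<n})" by (intro card_mono) auto
  then have "card {..<n} \<le> card (?Q ` {..<n})" using n1 by simp
  then have "card (?Q ` {..<n}) = card {..<n}" using card_image_le[of "{..<n}" ?Q] by simp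
  then have inj: "inj_on ?Q {..<n}" by (intro eq_card_imp_inj_on) auto
  have "blk ?Q b \<noteq> {}" using ok b by (simp add: part_ok_def)
  then obtain u where u: "u < n" "?Q u = b" by (auto simp: blk_def)
  have "blk ?Q b = {u}" using u inj_onD[OF inj] by (auto simp: blk_def)
  then show "piece (blk (P (n - 1 - 0)) b) (row M 18 0) (row M 19 0 b)"
    using piece_leaf[OF u(1), of "row M 18 0"] L0[THEN fun_cong] T0[of b] b n1 unfolding diff_zero by simp
qed

lemma pieces_Suc:
  assumes i: "i < n - 1" and pi: "pieces i"
  shows "pieces (Suc i)"
proof -
  define s where "s = n - 1 - i"
  define s' where "s' = n - 1 - Suc i"
  have s: "s = Suc s'" "s' < n - 1" "s' \<le> n - 1" using i by (auto simp: s_def s'_def)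
  define b where "b = M 16 s - 1"
  define X where "X = blk (P s') b"
  define X1 where "X1 = blk (P s) b"
  define X2 where "X2 = blk (P s) s"
  define Lb where "Lb = row M 18 i"
  define g where "g = M 20 (Suc i)"
  define p where "p = M 21 (Suc i)"
  have ok: "part_ok s'" by (rule part_ok[OF s(3)])
  note sp = split_step[OF ok s(2), folded s(1), folded b_def]
  have eq: "g = first NT (\<lambda>g. \<exists>q<NP. good_code X g \<and> cons_code X X1 X2 g q Lb)"
    "p = first NP (\<lambda>q. good_code X (g - 1) \<and> cons_code X X1 X2 (g - 1) q Lb)"
    "\<And>v. v < n \<Longrightarrow> row M 18 (Suc i) v = (if v \<in> X then lab X (g - 1) v else Lb v)"
    "\<And>v. v < n \<Longrightarrow> row M 19 (Suc i) v = (if v = b then OPv M (p - 1) (row M 19 i b) (row M 19 i s) else row M 19 i v)"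
    using mg_eq[OF i] unfolding merge_eq_def Let_def s_def[symmetric] b_def[symmetric] g_def[symmetric] p_def[symmetric] Lb_def[symmetric]
    unfolding X_def P_def X1_def X2_def s(1) by auto
  have pc: "piece (blk (P s) b') Lb (row M 19 i b')" if "b' \<le> s" for b'
    using pi that unfolding pieces_def s_def[symmetric] Lb_def by blast
  have bs: "b \<le> s'" by (rule sp(2))
  have p1: "piece X1 Lb (row M 19 i b)" unfolding X1_def by (rule pc) (use bs s in simp)
  have p2: "piece X2 Lb (row M 19 i s)" unfolding X2_def by (rule pc) simp
  have XX: "X = X1 \<union> X2" unfolding X_def X1_def X2_def by (rule sp(3)[folded s(1)])
  have dj: "X1 \<inter> X2 = {}" unfolding X1_def X2_def using bs s(1) by (auto simp: blk_def)
  have XV: "X \<subseteq> {..<n}" unfolding X_def by (rule blk_sub)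
  have "rk X" using ok bs by (simp add: part_ok_def X_def)
  from code_exists[OF XV this] obtain g0 where g0: "g0 < NT" "good_code X g0" by blast
  obtain q0 where q0: "q0 < NP" "cons_code X X1 X2 g0 q0 Lb"
    using cons_exists[OF XX dj, of Lb g0] p1 p2 unfolding piece_def by blast
  have ex: "\<exists>q<NP. good_code X (g - 1) \<and> cons_code X X1 X2 (g - 1) q Lb"
    using g0 q0 eq(1) by (cases rule: first_cases[of NT "\<lambda>g. \<exists>q<NP. good_code X g \<and> cons_code X X1 X2 g q Lb"]) auto
  have gp: "p - 1 < NP" "good_code X (g - 1)" "cons_code X X1 X2 (g - 1) (p - 1) Lb"
    using ex eq(2) by (cases rule: first_cases[of NP "\<lambda>q. good_code X (g - 1) \<and> cons_code X X1 X2 (g - 1) q Lb"]; auto)+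
  have new: "piece X (lab X (g - 1)) (OPv M (p - 1) (row M 19 i b) (row M 19 i s))"
    by (rule piece_merge[OF XX dj p1 p2 gp(2,1,3)])
  show ?thesis
    unfolding pieces_def s'_def[symmetric]
  proof (intro allI impI)
    fix b' assume b': "b' \<le> s'"
    then have b'n: "b' < n" using s(2) by simp
    show "piece (blk (P s') b') (row M 18 (Suc i)) (row M 19 (Suc i) b')"
    proof (cases "b' = b")
      case True
      have "piece X (row M 18 (Suc i)) (OPv M (p - 1) (row M 19 i b) (row M 19 i s))"
      proof (rule piece_cong[OF new])
        fix u assume u: "u \<in> X"
        then have "u < n" using XV by auto
        then show "lab X (g - 1) u = row M 18 (Suc i) u" using eq(3) u by simp
      qed
      then show ?thesis using True eq(4)[OF b'n] by (simp add: X_def)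
    next
      case False
      have Y: "blk (P s') b' = blk (P s) b'" by (rule sp(4)[folded s(1), OF b' False, symmetric])
      have "piece (blk (P s) b') (row M 18 (Suc i)) (row M 19 i b')"
      proof (rule piece_cong[OF pc])
        show "b' \<le> s" using b' s(1) by simp
        fix u assume u: "u \<in> blk (P s) b'"
        then have "u < n" "u \<notin> X" unfolding Y[symmetric] X_def using False by (auto simp: blk_def)
        then show "Lb u = row M 18 (Suc i) u" using eq(3) by simp
      qed
      then show ?thesis using False eq(4)[OF b'n] by (simp add: Y)
    qed
  qed
qed

theorem root_piece: "\<exists>r. r \<subseteq> {..<n} \<times> {..<n} \<and> strict_linear_order_on {..<n} r \<and> row M 19 (n - 1) 0 \<in> vs L f
    \<and> (accn f (row M 19 (n - 1) 0) \<longleftrightarrow> satf {..<n} A r (\<lambda>_. {}) f)"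
proof -
  have "i \<le> n - 1 \<Longrightarrow> pieces i" for i
    by (induction i) (use pieces_0 pieces_Suc in auto)
  then have "pieces (n - 1)" by simp
  moreover have "blk (P 0) 0 = {..<n}" using P0 by (auto simp: blk_def P_def)
  ultimately have "piece {..<n} (row M 18 (n - 1)) (row M 19 (n - 1) 0)" by (auto simp: pieces_def)
  then obtain r where r: "r \<subseteq> {..<n} \<times> {..<n}" "strict_linear_order_on {..<n} r" "row M 19 (n - 1) 0 \<in> vs L f"
    "row M 19 (n - 1) 0 = st A r (row M 18 (n - 1)) {..<n} (\<lambda>_. {}) f"
    unfolding piece_def by blast
  then show ?thesis using accn_st[of "{..<n}" "\<lambda>_. {}" f A r "row M 18 (n - 1)"] by (intro exI[of _ r]) auto
qed

end

section \<open>The whole program\<close>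

lemma run_iter:
  assumes "eval w n r s = N"
    and "\<And>t j. (\<And>b. b \<noteq> a \<Longrightarrow> t b = s b) \<Longrightarrow> eval w e (r(x := j)) t = h (t a 0)"
  shows "run w (For x n (Asg a (Lit 0) e)) r s = s(a := (s a)(0 := (h ^^ N) (s a 0)))"
proof -
  define f where "f k = fold (\<lambda>j s. run w (Asg a (Lit 0) e) (r(x := j)) s) [0..<k] s" for k
  have "f k = s(a := (s a)(0 := (h ^^ k) (s a 0)))" for k
  proof (induction k)
    case (Suc k)
    have "f (Suc k) = run w (Asg a (Lit 0) e) (r(x := k)) (f k)" by (simp add: f_def)
    also have "\<dots> = (f k)(a := (f k a)(0 := h (f k a 0)))" using assms(2)[of "f k" k] Suc by simp
    finally show ?case using Suc by (simp add: fun_eq_iff)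
  qed (simp add: f_def)
  then show ?thesis using assms(1) by (simp add: f_def)
qed

lemma run_step_fill:
  assumes "eval w n r s = N"
    and "\<And>t j. (\<And>b. b \<noteq> a \<Longrightarrow> t b = s b) \<Longrightarrow> eval w e (r(x := j)) t = h (t a j)"
  defines "s' \<equiv> run w (For x n (Asg a (Plus (Var x) (Lit 1)) e)) r s"
  shows "(\<forall>b. b \<noteq> a \<longrightarrow> s' b = s b) \<and> (\<forall>j\<le>N. s' a j = (h ^^ j) (s a 0))"
proof -
  define f where "f k = fold (\<lambda>j s. run w (Asg a (Plus (Var x) (Lit 1)) e) (r(x := j)) s) [0..<k] s" for k
  have "(\<forall>b. b \<noteq> a \<longrightarrow> f k b = s b) \<and> (\<forall>j\<le>k. f k a j = (h ^^ j) (s a 0))" for k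
  proof (induction k)
    case (Suc k)
    have "f (Suc k) = run w (Asg a (Plus (Var x) (Lit 1)) e) (r(x := k)) (f k)" by (simp add: f_def)
    also have "\<dots> = (f k)(a := (f k a)(Suc k := h (f k a k)))" using assms(2)[of "f k" k] Suc by simp
    finally have S: "f (Suc k) = (f k)(a := (f k a)(Suc k := h (f k a k)))" .
    show ?case unfolding S using Suc by (auto simp: le_Suc_eq)
  qed (simp add: f_def)
  from this[of N] show ?thesis using assms(1) by (simp add: s'_def f_def)
qed

definition mulE :: "exp \<Rightarrow> exp \<Rightarrow> exp" where
  "mulE e f = Fold 0 1 e (Lit 0) (Plus (Var 1) f)"

lemma eval_mulE:
  assumes "\<And>j a. eval w f (r(0 := j, 1 := a)) s = c"
  shows "eval w (mulE e f) r s = eval w e r s * c"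
proof -
  have "fold (\<lambda>j acc. eval w (Plus (Var 1) f) (r(0 := j, 1 := acc)) s) [0..<k] 0 = k * c" for k
    using assms by (induction k) (simp_all add: algebra_simps)
  then show ?thesis by (simp add: mulE_def)
qed

text \<open>The number of multiplications is a constant, and each of them loops only over the length
  of the input. Thus the power is available as a loop bound without having been one.\<close>

definition powcom :: "nat \<Rightarrow> nat \<Rightarrow> com" where
  "powcom a E = Seq (Asg a (Lit 0) (Lit 1)) (For 20 (Lit E) (Asg a (Lit 0) (mulE lenE (Arr a (Lit 0)))))"

lemma run_powcom: "a \<noteq> 0 \<Longrightarrow> run w (powcom a E) r s = s(a := (s a)(0 := s 0 0 ^ E))"
proof -
  assume a: "a \<noteq> 0"
  let ?s = "s(a := (s a)(0 := 1))"
  have "run w (For 20 (Lit E) (Asg a (Lit 0) (mulE lenE (Arr a (Lit 0))))) r ?s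
      = ?s(a := (?s a)(0 := ((\<lambda>x. s 0 0 * x) ^^ E) (?s a 0)))"
    by (rule run_iter) (use a in \<open>simp_all add: eval_mulE\<close>)
  moreover have "((\<lambda>x. s 0 0 * x) ^^ E) 1 = s 0 0 ^ E" by (induction E) auto
  ultimately show ?thesis by (simp add: powcom_def)
qed

lemma bexp_derived [simp]:
  "bexp A (notE e) = bexp A e" "bexp A (andE e f) = (bexp A e \<and> bexp A f)" "bexp A (orE e f) = (bexp A e \<and> bexp A f)"
  "bexp A (eqE e f) = (bexp A e \<and> bexp A f)" "bexp A (ltE e f) = (bexp A e \<and> bexp A f)" "bexp A (neE e) = bexp A e"
  "bexp A (exE x e f) = (bd A e \<and> bexp A e \<and> bexp A f)" "bexp A (allE' x e f) = (bd A e \<and> bexp A e \<and> bexp A f)"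
  "bexp A (selE x e f) = (bd A e \<and> bexp A e \<and> bexp A f)" "bexp A (letE x e f) = (bexp A e \<and> bexp A f)"
  "bexp A (prG e f) = (bexp A e \<and> bexp A f)" "bexp A (prJ e f) = (bexp A e \<and> bexp A f)"
  "bexp A (adjE e f) = (bexp A e \<and> bexp A f)" "bexp A (mulE e f) = (bd A e \<and> bexp A e \<and> bexp A f)"
  by (auto simp: notE_def andE_def orE_def eqE_def ltE_def neE_def exE_def allE'_def selE_def letE_def prG_def prJ_def adjE_def mulE_def)

lemma bexp_sndsE [simp]: "bexp A (sndsE j e) = bexp A e"
  by (induction j) auto

lemma bexp_digE [simp]: "bexp A (digE j e) = bexp A e"
  by (simp add: digE_def)

lemma bexp_orL [simp]: "bexp A (orL es) \<longleftrightarrow> (\<forall>e\<in>set es. bexp A e)"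
  by (induction es) (auto simp: orL_def)

lemma bexp_xorL [simp]: "bexp A (xorL es) \<longleftrightarrow> (\<forall>e\<in>set es. bexp A e)"
  by (induction es) (auto simp: xorL_def)

lemma bexp_tabE: "bexp A e \<Longrightarrow> (\<And>i. bexp A (F i)) \<Longrightarrow> bexp A (tabE F n e)"
  by (induction n) auto

section \<open>Parsing the input and filling the tables\<close>

context graph_prog
begin

text \<open>Codes of tuples of at most \<open>a1 + a2 + 1\<close> vertices are at most the length of
  the input to the power \<open>kk (a1 + a2 + 1)\<close>; the additional 1 makes the bound
  strict.\<close>

definition PE :: nat where "PE = kk (a1 + a2 + 1) + 1"

abbreviation "FLE \<equiv> Arr 10 nE"

text \<open>The row after the last one would start where the formula starts, which explains
  \<open>FLE\<close>. The exponent \<open>4 * PE + 16\<close> comes from \<open>PE + 1\<close> by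
  two pairings, each of which turns an exponent \<open>e\<close> into
  \<open>2 * e + 4\<close>.\<close>

definition parse_com :: com where
  "parse_com = Seq (Asg 6 (Lit 0) (Minus (selE 20 lenE (notE (Inp (Var 20)))) (Lit 1)))
    (Seq (Asg 10 (Lit 0) (Plus nE (Lit 1)))
    (Seq (For 20 lenE (Asg 10 i1E (Plus (Arr 10 (Var 20)) nE)))
    (Seq (Asg 1 (Lit 0) (Minus lenE FLE))
    (Seq (For 20 lenE (Asg 2 (Var 20) (Inp (Plus FLE (Var 20)))))
    (Seq (powcom 7 PE) (powcom 8 (4 * PE + 16)))))))"

text \<open>For a formula of length \<open>l\<close> this computes \<open>bnd (L + l) l\<close>.
  Increasing \<open>L\<close> by \<open>l\<close> at the start makes the result exceed the codes of
  sets of variables as well as the types.\<close>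

definition T_com :: com where
  "T_com = Seq (Asg 3 (Lit 0) (powE (Plus (Lit (2 + 2 * L)) (Plus LFE LFE)))) (For 20 LFE (Asg 3 (Lit 0) (powE (prE TE TE))))"

definition tri5_com :: com where
  "tri5_com = For 20 (prE (Lit (NP + 5)) (prE TE TE)) (Asg 5 (Var 20) (triE (Var 20)))"

definition table_com :: com where
  "table_com = Seq T_com (Seq tri5_com fill_tab)"

lemma bcom_parse: "bcom {0} parse_com"
  by (simp add: parse_com_def powcom_def)

lemma bexp_locals:
  assumes "{6, 7, 8} \<subseteq> A"
  shows "bexp A (partE e f) = (bexp A e \<and> bexp A f)" "bexp A (mXE b f) = bexp A f" "bexp A (mE f) = bexp A f"
    "bexp A (m1E f) = bexp A f" "bexp A (m2E f) = bexp A f" "bexp A (LBE f) = bexp A f"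
    "(\<And>e. bexp A e \<Longrightarrow> bexp A (X e)) \<Longrightarrow> bexp A g \<Longrightarrow> bexp A u \<Longrightarrow> bexp A (bitE X g u j)"
    "bexp A e \<Longrightarrow> bexp A (sbE e)"
  by (auto simp: partE_def mXE_def mE_def m1E_def m2E_def LBE_def bitE_def sbE_def)

lemma bexp_labE: "{6, 7, 8} \<subseteq> A \<Longrightarrow> bexp A u \<Longrightarrow> bexp A (labE u)"
proof -
  assume a: "{6, 7, 8} \<subseteq> A" "bexp A u"
  then have "bexp A (foldr (\<lambda>j acc. Plus (Ite (bitE mE (Var 24) u j) (Lit (2 ^ j)) (Lit 0)) acc) js (Lit 0))" for js
    by (induction js) (auto simp: bexp_locals)
  then show ?thesis by (simp add: labE_def)
qed

lemma bexp_merge: "{6, 7, 8} \<subseteq> A \<Longrightarrow> bexp A goodE" "{6, 7, 8} \<subseteq> A \<Longrightarrow> bexp A consE" "{6, 7, 8} \<subseteq> A \<Longrightarrow> bexp A chkE"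
  by (simp_all add: goodE_def consE_def chkE_def rkE_def rho1E_def rho2E_def joinE_def bexp_locals bexp_labE bexp_tabE)

lemma bcom_graph: "bcom {6, 7, 8} graph_com"
  by (simp add: graph_com_def tri_com_def fs_com_def zc0_def zcS_def badE_def split_com_def split_body_def merge_com_def
      merge_body_def bexp_locals bexp_labE bexp_merge)

lemma bexp_ansE: "bexp A ansE"
  by (simp add: ansE_def)

lemma run_parse:
  assumes n: "n < length w" "\<And>i. i < n \<Longrightarrow> w ! i \<noteq> 0" "w ! n = 0"
  defines "s \<equiv> run w parse_com (\<lambda>_. 0) (\<lambda>a i. if a = 0 \<and> i = 0 then length w else 0)" and "h \<equiv> n + 1 + n * n"
  shows "s 1 = (\<lambda>_. 0)(0 := length w - h)" "s 2 = (\<lambda>i. if h + i < length w then w ! (h + i) else 0)"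
    "s 6 0 = n" "s 7 0 = length w ^ PE" "s 8 0 = length w ^ (4 * PE + 16)" "\<And>u. u < n \<Longrightarrow> s 10 u = n + 1 + u * n"
    "\<And>a. a \<notin> {0, 1, 2, 6, 7, 8, 10} \<Longrightarrow> s a = (\<lambda>_. 0)"
proof -
  let ?r = "\<lambda>_ :: nat. 0 :: nat"
  define l where "l = length w"
  define z where "z = (\<lambda>_ :: nat. 0 :: nat)"
  define s0 where "s0 = (\<lambda>a i :: nat. if a = (0 :: nat) \<and> i = 0 then l else (0 :: nat))"
  have f: "first l (\<lambda>i. i < l \<longrightarrow> w ! i = 0) = Suc n"
  proof -
    have "(LEAST i. i < l \<longrightarrow> w ! i = 0) = n"
    proof (rule Least_equality)
      show "n < l \<longrightarrow> w ! n = 0" using n by simp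
      fix y assume "y < l \<longrightarrow> w ! y = 0"
      then show "n \<le> y" using n(2)[of y] n(1) unfolding l_def[symmetric] by (cases "y < l") (auto intro: leI)
    qed
    moreover have "\<exists>i<l. i < l \<longrightarrow> w ! i = 0" using n l_def by auto
    ultimately show ?thesis by (simp add: first_def)
  qed
  define s1 where "s1 = s0(6 := z(0 := n))"
  have 1: "run w (Asg 6 (Lit 0) (Minus (selE 20 lenE (notE (Inp (Var 20)))) (Lit 1))) ?r s0 = s1"
    using f by (simp add: s1_def s0_def z_def l_def[symmetric] fun_eq_iff)
  define s2 where "s2 = s1(10 := z(0 := n + 1))"
  have 2: "run w (Asg 10 (Lit 0) (Plus nE (Lit 1))) ?r s1 = s2"
    by (simp add: s2_def s1_def s0_def z_def fun_eq_iff)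
  define s3 where "s3 = run w (For 20 lenE (Asg 10 i1E (Plus (Arr 10 (Var 20)) nE))) ?r s2"
  have "(\<forall>b. b \<noteq> 10 \<longrightarrow> s3 b = s2 b) \<and> (\<forall>j\<le>l. s3 10 j = ((\<lambda>x. x + n) ^^ j) (s2 10 0))"
    unfolding s3_def by (rule run_step_fill) (simp_all add: s2_def s1_def s0_def z_def)
  moreover have "((\<lambda>x. x + n) ^^ j) c = c + j * n" for j c by (induction j) auto
  ultimately have 3: "\<And>b. b \<noteq> 10 \<Longrightarrow> s3 b = s2 b" "\<And>j. j \<le> l \<Longrightarrow> s3 10 j = n + 1 + j * n"
    by (auto simp: s2_def)
  have s3: "s3 6 0 = n" "s3 10 n = h" "s3 0 0 = l" "s3 1 = z" "s3 2 = z"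
    using 3(1)[of 6] 3(1)[of 0] 3(1)[of 1] 3(1)[of 2] 3(2)[of n] n l_def by (auto simp: s2_def s1_def h_def s0_def z_def)
  define s4 where "s4 = s3(1 := z(0 := l - h))"
  have 4: "run w (Asg 1 (Lit 0) (Minus lenE FLE)) ?r s3 = s4" using s3 by (simp add: s4_def)
  define s5 where "s5 = run w (For 20 lenE (Asg 2 (Var 20) (Inp (Plus FLE (Var 20))))) ?r s4"
  have "(\<forall>v<l. s5 2 (id v) = (if h + v < l then w ! (h + v) else 0)) \<and> (\<forall>z. z \<notin> id ` {..<l} \<longrightarrow> s5 2 z = s4 2 z) \<and> (\<forall>b. b \<noteq> 2 \<longrightarrow> s5 b = s4 b)"
    unfolding s5_def by (rule run_fill) (use s3 in \<open>auto simp: s4_def l_def\<close>)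
  then have 5: "s5 2 = (\<lambda>i. if h + i < l then w ! (h + i) else 0)" "\<And>b. b \<noteq> 2 \<Longrightarrow> s5 b = s4 b"
    using s3 by (auto simp: fun_eq_iff s4_def z_def)
  have l5: "s5 0 0 = l" using 5(2)[of 0] s3 by (simp add: s4_def)
  define s6 where "s6 = s5(7 := (s5 7)(0 := l ^ PE))"
  have 6: "run w (powcom 7 PE) ?r s5 = s6" using l5 by (simp add: s6_def run_powcom)
  have s: "s = s6(8 := (s6 8)(0 := l ^ (4 * PE + 16)))"
    unfolding s_def parse_com_def run.simps(2) l_def[symmetric] s0_def[symmetric] 1 2 s3_def[symmetric] 4 s5_def[symmetric] 6
    using l5 by (simp add: run_powcom s6_def)
  have s': "s b = s2 b" if "b \<notin> {1, 2, 7, 8, 10}" for b using that s 5(2)[of b] 3(1)[of b] by (simp add: s6_def s4_def)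
  show "s 1 = (\<lambda>_. 0)(0 := length w - h)" using s 5(2)[of 1] by (simp add: s6_def s4_def z_def l_def)
  show "s 2 = (\<lambda>i. if h + i < length w then w ! (h + i) else 0)" using s 5(1) by (simp add: s6_def l_def)
  show "s 7 0 = length w ^ PE" "s 8 0 = length w ^ (4 * PE + 16)" using s by (simp_all add: s6_def l_def)
  show "s 6 0 = n" using s'[of 6] by (simp add: s2_def s1_def)
  show "s 10 u = n + 1 + u * n" if "u < n" for u
    using s 5(2)[of 10] 3(2)[of u] that n(1) by (simp add: s6_def s4_def l_def)
  show "s a = (\<lambda>_. 0)" if "a \<notin> {0, 1, 2, 6, 7, 8, 10}" for a
    using s'[of a] that by (auto simp: s2_def s1_def s0_def)
qed

end

lemma bnd_mono_L: "L \<le> L' \<Longrightarrow> bnd L i \<le> bnd L' i"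
proof (induction i)
  case (Suc i)
  then have "prod_encode (bnd L i, bnd L i) \<le> prod_encode (bnd L' i, bnd L' i)"
    by (simp add: prod_encode_def add_mono triangle_mono)
  then show ?case by simp
qed simp

text \<open>The arrays 1 to 5 are those of the formula and its tables; code that is confined to them
  does not see the graph.\<close>

definition closedE :: "exp \<Rightarrow> bool" where
  "closedE e \<longleftrightarrow> inp_free e \<and> arrs e \<subseteq> {1..5}"

lemma closedE_basic [simp]:
  "closedE (Lit n)" "closedE (Var x)" "closedE (Arr a e) \<longleftrightarrow> a \<in> {1..5} \<and> closedE e" "closedE (Plus e f) \<longleftrightarrow> closedE e \<and> closedE f"
  "closedE (Minus e f) \<longleftrightarrow> closedE e \<and> closedE f" "closedE (Ite e f g) \<longleftrightarrow> closedE e \<and> closedE f \<and> closedE g"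
  "closedE (Fold x y e i b) \<longleftrightarrow> closedE e \<and> closedE i \<and> closedE b"
  by (auto simp: closedE_def)

lemma closedE_derived [simp]:
  "closedE (notE e) = closedE e" "closedE (andE e f) = (closedE e \<and> closedE f)" "closedE (orE e f) = (closedE e \<and> closedE f)"
  "closedE (eqE e f) = (closedE e \<and> closedE f)" "closedE (ltE e f) = (closedE e \<and> closedE f)"
  "closedE (exE x e f) = (closedE e \<and> closedE f)" "closedE (allE' x e f) = (closedE e \<and> closedE f)"
  "closedE (selE x e f) = (closedE e \<and> closedE f)" "closedE (sumE x e f) = (closedE e \<and> closedE f)"
  "closedE (powE e) = closedE e" "closedE (triE e) = closedE e" "closedE (prE e f) = (closedE e \<and> closedE f)"
  "closedE (memE e f) = (closedE e \<and> closedE f)" "closedE (pfstE j)" "closedE (psndE j)"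
  by (auto simp: notE_def andE_def orE_def eqE_def ltE_def exE_def allE'_def selE_def sumE_def powE_def triE_def prE_def memE_def
      oddE_def halfE_def pfstE_def psndE_def)

lemma closedE_pE [simp]: "closedE pE"
  by (simp add: pE_def)

lemma closedE_rdE [simp]: "closedE (rdE a b c d) = (closedE a \<and> closedE b \<and> closedE c \<and> closedE d)"
  by (auto simp: rdE_def)

lemma closedE_tabE: "closedE e \<Longrightarrow> (\<And>i. closedE (F i)) \<Longrightarrow> closedE (tabE F n e)"
  by (induction n) auto

context graph_prog
begin

lemma closedE_allkE: "closedE allkE"
  by (simp add: allkE_def opE_def leafE_def accE_def ue'E_def uv'E_def en'E_def byc_def combE_def v1E_def v2E_def vqE_def
      ueE_def uvE_def enE_def Let_def closedE_tabE)

lemma table_com_closed: "cinp_free table_com" "carrs table_com \<subseteq> {1..5}"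
proof -
  have "closedE e \<Longrightarrow> inp_free e" "closedE e \<Longrightarrow> arrs e \<subseteq> {1..5}" for e by (auto simp: closedE_def)
  then show "cinp_free table_com" "carrs table_com \<subseteq> {1..5}"
    using closedE_allkE by (simp_all add: table_com_def T_com_def tri5_com_def fill_tab_def fill_p_def)
qed

lemma run_table:
  fixes s :: mem and w :: "nat list" and r :: env
  assumes s: "s 1 0 = l"
  defines "M \<equiv> run w table_com r s" and "T \<equiv> bnd (L + l) l"
  shows "\<And>a. a \<notin> {3, 4, 5} \<Longrightarrow> M a = s a" "M 3 0 = T"
    "\<And>i. i < prod_encode (NP + 5, prod_encode (T, T)) \<Longrightarrow> M 5 i = triangle i"
    "\<And>p k x y. p < l \<Longrightarrow> k < NP + 5 \<Longrightarrow> x < T \<Longrightarrow> y < T \<Longrightarrow> M 4 (cell p k x y) = eval w allkE (env r (l - 1 - p) k x y) M"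
proof -
  define s1 where "s1 = s(3 := (s 3)(0 := 2 ^ (2 + 2 * L + (l + l))))"
  have 1: "run w (Asg 3 (Lit 0) (powE (Plus (Lit (2 + 2 * L)) (Plus LFE LFE)))) r s = s1" using s by (simp add: s1_def)
  have 2: "run w (For 20 LFE (Asg 3 (Lit 0) (powE (prE TE TE)))) r s1
      = s1(3 := (s1 3)(0 := ((\<lambda>x. 2 ^ prod_encode (x, x)) ^^ l) (s1 3 0)))"
    by (rule run_iter) (use s in \<open>simp_all add: s1_def\<close>)
  have "((\<lambda>x. 2 ^ prod_encode (x, x)) ^^ j) (s1 3 0) = bnd (L + l) j" for j
    by (induction j) (simp_all add: s1_def algebra_simps)
  with 1 2 have 3: "run w T_com r s = s1(3 := (s1 3)(0 := T))" by (simp add: T_com_def T_def)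
  define s2 where "s2 = s1(3 := (s1 3)(0 := T))"
  define s3 where "s3 = run w tri5_com r s2"
  have "(\<forall>v<prod_encode (NP + 5, prod_encode (T, T)). s3 5 (id v) = triangle v)
     \<and> (\<forall>z. z \<notin> id ` {..<prod_encode (NP + 5, prod_encode (T, T))} \<longrightarrow> s3 5 z = s2 5 z) \<and> (\<forall>b. b \<noteq> 5 \<longrightarrow> s3 b = s2 b)"
    unfolding s3_def tri5_com_def by (rule run_fill) (simp_all add: s2_def)
  then have 4: "\<And>v. v < prod_encode (NP + 5, prod_encode (T, T)) \<Longrightarrow> s3 5 v = triangle v" "\<And>b. b \<noteq> 5 \<Longrightarrow> s3 b = s2 b" by auto
  have M: "M = run w fill_tab r s3" by (simp add: M_def table_com_def 3 s3_def s2_def)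
  note ft = run_fill_tab[of w r s3, folded M]
  have M4: "\<And>a. a \<noteq> 4 \<Longrightarrow> M a = s3 a" using ft by blast
  show "M a = s a" if "a \<notin> {3, 4, 5}" for a using that M4[of a] 4(2)[of a] by (simp add: s2_def s1_def)
  have e: "s3 3 0 = T" "s3 1 0 = l" using 4(2)[of 3] 4(2)[of 1] s by (simp_all add: s2_def s1_def)
  show "M 3 0 = T" using M4[of 3] e by simp
  show "M 5 i = triangle i" if "i < prod_encode (NP + 5, prod_encode (T, T))" for i using that M4[of 5] 4(1) by simp
  show "M 4 (cell p k x y) = eval w allkE (env r (l - 1 - p) k x y) M" if "p < l" "k < NP + 5" "x < T" "y < T" for p k x y
    using ft that unfolding e by blast
qed

end

context graph_sem
begin

lemma OPv_cell:
  assumes "\<And>i. i < prod_encode (NP + 5, prod_encode (T, T)) \<Longrightarrow> M 5 i = triangle i" "i < NP + 5" "x < T" "y < T"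
  shows "OPv M i x y = M 4 (cell 0 i x y)"
proof -
  have pe: "prod_encode (a, b) = triangle (a + b) + a" for a b by (simp add: prod_encode_def)
  have xy: "prod_encode (x, y) < prod_encode (T, T)" using assms by (intro prod_encode_less) auto
  have "prod_encode (i, prod_encode (x, y)) < prod_encode (NP + 5, prod_encode (T, T))"
    using assms xy triangle_mono[of "i + prod_encode (x, y)" "NP + 5 + prod_encode (T, T)"] by (simp add: pe[of i] pe[of "NP + 5"])
  moreover have "x + y \<le> prod_encode (x, y)" "i + prod_encode (x, y) \<le> prod_encode (i, prod_encode (x, y))"
    using le_triangle by (simp_all add: prod_encode_def trans_le_add1)
  moreover have "prod_encode (x, y) \<le> prod_encode (i, prod_encode (x, y))" by (rule le_prod_encode_2)
  ultimately have "M 5 (x + y) = triangle (x + y)" "M 5 (i + prod_encode (x, y)) = triangle (i + prod_encode (x, y))"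
    "M 5 (prod_encode (i, prod_encode (x, y))) = triangle (prod_encode (i, prod_encode (x, y)))"
    by (auto intro!: assms(1))
  then show ?thesis by (simp add: OPv_def prJ_def prod_encode_def add.commute)
qed

end

section \<open>Inputs\<close>

lemma concat_rows:
  assumes "\<And>x. x \<in> set xs \<Longrightarrow> length (f x) = n"
  shows "length (concat (map f xs)) = length xs * n"
    "u < length xs \<Longrightarrow> v < n \<Longrightarrow> concat (map f xs) ! (u * n + v) = f (xs ! u) ! v"
proof -
  show "length (concat (map f xs)) = length xs * n"
    using assms by (induction xs) auto
  show "u < length xs \<Longrightarrow> v < n \<Longrightarrow> concat (map f xs) ! (u * n + v) = f (xs ! u) ! v"
    using assms
  proof (induction xs arbitrary: u)
    case (Cons x xs)
    then show ?case by (cases u) (auto simp: nth_append)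
  qed simp
qed

lemma graph_word_nth:
  fixes G vs
  defines "n \<equiv> length vs"
  shows "length (graph_word G vs) = n + 1 + n * n" "i < n \<Longrightarrow> graph_word G vs ! i = 1" "graph_word G vs ! n = 0"
    "u < n \<Longrightarrow> v < n \<Longrightarrow> graph_word G vs ! (n + 1 + u * n + v) = of_bool ((vs ! u, vs ! v) \<in> parcs G)"
proof -
  let ?f = "\<lambda>u. map (\<lambda>v. if (u, v) \<in> parcs G then 1 else 0 :: nat) vs"
  have g: "graph_word G vs = (replicate n 1 @ [0]) @ concat (map ?f vs)" by (simp add: graph_word_def unary_def n_def)
  have c: "length (concat (map ?f vs)) = n * n" unfolding n_def by (rule concat_rows(1)) simp
  have c2: "concat (map ?f vs) ! (u * n + v) = ?f (vs ! u) ! v" if "u < n" "v < n"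
    unfolding n_def by (rule concat_rows(2)) (use that n_def in auto)
  show "length (graph_word G vs) = n + 1 + n * n" using c by (simp add: g)
  show "i < n \<Longrightarrow> graph_word G vs ! i = 1" "graph_word G vs ! n = 0" by (simp_all add: g nth_append)
  have "graph_word G vs ! (n + 1 + u * n + v) = concat (map ?f vs) ! (u * n + v)" by (simp add: g nth_append)
  then show "u < n \<Longrightarrow> v < n \<Longrightarrow> graph_word G vs ! (n + 1 + u * n + v) = of_bool ((vs ! u, vs ! v) \<in> parcs G)"
    using c2 by (simp add: n_def)
qed

lemma occ_nth: "(\<And>i. i < length xs \<Longrightarrow> F (p + i) = xs ! i) \<Longrightarrow> occ F p xs"
proof (induction xs arbitrary: p)
  case (Cons x xs)
  have "F p = x" using Cons.prems[of 0] by simp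
  moreover have "occ F (Suc p) xs" using Cons.prems[of "Suc _"] by (intro Cons.IH) simp
  ultimately show ?case by simp
qed simp

lemma satf_image:
  assumes "inj_on h V" "\<And>u v. u \<in> V \<Longrightarrow> v \<in> V \<Longrightarrow> A' (h u) (h v) \<longleftrightarrow> A u v"
    "\<And>u v. u \<in> V \<Longrightarrow> v \<in> V \<Longrightarrow> (h u, h v) \<in> r' \<longleftrightarrow> (u, v) \<in> r" "\<And>X. \<sigma> X \<subseteq> V"
  shows "satf (h ` V) A' r' (\<lambda>X. h ` \<sigma> X) p \<longleftrightarrow> satf V A r \<sigma> p"
  using assms(4)
proof (induction p arbitrary: \<sigma>)
  case (Atm c X Y)
  have "rel A' r' c (h u) (h v) \<longleftrightarrow> rel A r c u v" if "u \<in> \<sigma> X" "v \<in> \<sigma> Y" for u v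
  proof -
    have "u \<in> V" "v \<in> V" using that Atm.prems by auto
    then show ?thesis using assms(1-3) by (simp add: rel_def inj_on_eq_iff)
  qed
  then show ?case by simp
next
  case (Qn c v p)
  have S: "satf (h ` V) A' r' ((\<lambda>X. h ` \<sigma> X)(v := h ` S)) p \<longleftrightarrow> satf V A r (\<sigma>(v := S)) p" "card (h ` S) = card S" if "S \<subseteq> V" for S
  proof -
    have "(\<lambda>X. h ` \<sigma> X)(v := h ` S) = (\<lambda>X. h ` (\<sigma>(v := S)) X)" by (simp add: fun_eq_iff)
    moreover have "satf (h ` V) A' r' (\<lambda>X. h ` (\<sigma>(v := S)) X) p \<longleftrightarrow> satf V A r (\<sigma>(v := S)) p"
      using Qn.prems that by (intro Qn.IH) auto
    ultimately show "satf (h ` V) A' r' ((\<lambda>X. h ` \<sigma> X)(v := h ` S)) p \<longleftrightarrow> satf V A r (\<sigma>(v := S)) p" by simp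
    show "card (h ` S) = card S" using inj_on_subset[OF assms(1) that] by (rule card_image)
  qed
  have all: "(\<forall>S\<subseteq>h ` V. P S) \<longleftrightarrow> (\<forall>S\<subseteq>V. P (h ` S))" for P by (metis image_mono subset_imageE)
  have ex: "(\<exists>S\<subseteq>h ` V. P S) \<longleftrightarrow> (\<exists>S\<subseteq>V. P (h ` S))" for P by (metis image_mono subset_imageE)
  show ?case using S unfolding satf.simps all ex by (simp cong: conj_cong)
qed auto

lemma all_merges:
  "\<exists>ms :: merge list. (\<forall>p\<in>set ms. \<exists>f g J. p = (f, g, J) \<and> (\<forall>a<L. f a < L \<and> g a < L))
    \<and> (\<forall>f g J. (\<forall>a<L. f a < L \<and> g a < L) \<longrightarrow> (\<exists>i<length ms. (\<forall>a<L. fst (ms ! i) a = f a \<and> fst (snd (ms ! i)) a = g a)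
        \<and> (\<forall>a<L. \<forall>b<L. snd (snd (ms ! i)) a b \<longleftrightarrow> J a b)))"
proof -
  \<comment> \<open>Merges matter only by their values on labels below \<open>L\<close>. Fixing the
    values elsewhere leaves finitely many, which can be listed.\<close>
  define FF where "FF = {f :: nat \<Rightarrow> nat. \<forall>a. (a \<in> {..<L} \<longrightarrow> f a \<in> {..<L}) \<and> (a \<notin> {..<L} \<longrightarrow> f a = 0)}"
  define JJ where "JJ = (\<lambda>R a b. (a, b) \<in> R) ` Pow ({..<L} \<times> {..<L})"
  have "finite (FF \<times> FF \<times> JJ)"
    unfolding FF_def JJ_def by (intro finite_cartesian_product finite_set_of_finite_funs finite_imageI) auto
  then obtain ms where ms: "set ms = FF \<times> FF \<times> JJ" using finite_list by blast
  have "\<exists>i<length ms. (\<forall>a<L. fst (ms ! i) a = f a \<and> fst (snd (ms ! i)) a = g a) \<and> (\<forall>a<L. \<forall>b<L. snd (snd (ms ! i)) a b \<longleftrightarrow> J a b)"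
    if "\<forall>a<L. f a < L \<and> g a < L" for f g J
  proof -
    let ?c = "\<lambda>f a. if a < L then f a else (0 :: nat)" and ?J = "\<lambda>a b. (a, b) \<in> {(a, b). a < L \<and> b < L \<and> J a b}"
    have "?J \<in> JJ" unfolding JJ_def by (rule image_eqI[of _ _ "{(a, b). a < L \<and> b < L \<and> J a b}"]) auto
    then have "(?c f, ?c g, ?J) \<in> set ms" unfolding ms using that by (simp add: FF_def)
    then obtain i where "i < length ms" "ms ! i = (?c f, ?c g, ?J)" by (auto simp only: in_set_conv_nth)
    then show ?thesis by (intro exI[of _ i]) simp
  qed
  moreover have "\<exists>f g J. p = (f, g, J) \<and> (\<forall>a<L. f a < L \<and> g a < L)" if p: "p \<in> set ms" for p
  proof -
    have "fst p \<in> FF" "fst (snd p) \<in> FF" using p by (auto simp: ms)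
    then show ?thesis by (intro exI[of _ "fst p"] exI[of _ "fst (snd p)"] exI[of _ "snd (snd p)"]) (auto simp: FF_def)
  qed
  ultimately show ?thesis by (intro exI[of _ ms] conjI ballI allI impI) simp_all
qed

lemma clique_width_leD:
  assumes "clique_width G \<le> enat k"
  shows "\<exists>k'\<le>k. \<exists>c. cw_built k' G c"
proof -
  let ?S = "{enat k | k. \<exists>c. cw_built k G c}"
  have "?S \<noteq> {}"
  proof
    assume "?S = {}"
    then show False using assms unfolding clique_width_def by (simp add: Inf_enat_def del: Collect_empty_eq)
  qed
  then have "Inf ?S \<in> ?S" unfolding Inf_enat_def by (metis (mono_tags, lifting) LeastI ex_in_conv)
  then obtain k' c where "Inf ?S = enat k'" "cw_built k' G c" by blast
  then show ?thesis using assms by (auto simp: clique_width_def)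
qed

lemma cw_built_nonempty: "cw_built k G c \<Longrightarrow> pverts G \<noteq> {}"
  by (induction rule: cw_built.induct) auto

text \<open>The program knows vertices as positions in the list of the input. The measure is
  transported to the vertices along \<open>idx\<close>, and the resulting set is brought back to
  positions.\<close>

lemma balanced_listed:
  fixes vs :: "'v list"
  assumes G: "pverts G = set vs" "distinct vs" and cw: "cw_built k' G c" "k' \<le> k"
    and A: "\<And>u v. u < length vs \<Longrightarrow> v < length vs \<Longrightarrow> A u v \<longleftrightarrow> (vs ! u, vs ! v) \<in> parcs G"
    and ig: "igraph {..<length vs} A"
  shows "igraph.balanced {..<length vs} A k"
  unfolding igraph.balanced_def[OF ig]
proof (intro allI impI)
  fix f :: "nat set \<Rightarrow> nat" and th :: nat
  assume th: "2 \<le> th" and fUn: "\<forall>X Y. f (X \<union> Y) \<le> f X * f Y" and f1: "\<forall>v. f {v} \<le> 2" and fV: "th \<le> f {..<length vs}"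
  define idx where "idx = inv_into {..<length vs} ((!) vs)"
  have inj: "inj_on ((!) vs) {..<length vs}" using G(2) by (simp add: inj_on_nth)
  have im: "(!) vs ` {..<length vs} = pverts G" unfolding G(1) set_conv_nth by (auto simp: image_def)
  have idx: "idx (vs ! i) = i" if "i < length vs" for i using inj that by (simp add: idx_def)
  have vs_idx: "vs ! idx v = v" "idx v < length vs" if "v \<in> pverts G" for v
    using that f_inv_into_f[of v "(!) vs" "{..<length vs}"] inv_into_into[of v "(!) vs" "{..<length vs}"] im by (auto simp: idx_def)
  have "idx ` pverts G = {..<length vs}"
  proof
    show "{..<length vs} \<subseteq> idx ` pverts G" unfolding im[symmetric] using idx by (force simp: image_iff)
  qed (use vs_idx in auto)
  then have "th \<le> f (idx ` pverts G)" using fV by simp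
  moreover have "f (idx ` (X \<union> Y)) \<le> f (idx ` X) * f (idx ` Y)" for X Y using fUn by (simp add: image_Un)
  moreover have "f (idx ` {v}) \<le> 2" for v using f1 by simp
  \<comment> \<open>\<open>D\<close> is empty at the root: no operation is applied above the whole
    expression.\<close>
  ultimately have "\<exists>W\<subseteq>pverts G. th \<le> f (idx ` W) \<and> f (idx ` W) \<le> th\<^sup>2 \<and> (\<exists>col. (\<forall>u\<in>W. col u \<in> {1..k'}) \<and>
     (\<forall>u\<in>W. \<forall>u'\<in>W. col u = col u' \<longrightarrow> (\<forall>v\<in>pverts G - W. (u, v) \<in> parcs G \<longleftrightarrow> (u', v) \<in> parcs G)))"
    by (intro cw_built_balanced[where f = "\<lambda>X. f (idx ` X)" and D = "\<lambda>_ _. False", OF cw(1) th]) auto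
  then obtain W col where W: "W \<subseteq> pverts G" "th \<le> f (idx ` W)" "f (idx ` W) \<le> th\<^sup>2" "\<And>u. u \<in> W \<Longrightarrow> col u \<in> {1..k'}"
    "\<And>u u' v. u \<in> W \<Longrightarrow> u' \<in> W \<Longrightarrow> col u = col u' \<Longrightarrow> v \<in> pverts G - W \<Longrightarrow> (u, v) \<in> parcs G \<longleftrightarrow> (u', v) \<in> parcs G"
    by (elim exE conjE) (rule that, assumption, assumption, assumption, blast, blast)
  have iW: "vs ! i \<in> W \<and> i < length vs" if "i \<in> idx ` W" for i
    using that vs_idx W(1) by auto
  have "igraph.classes {..<length vs} A k (idx ` W)"
    unfolding igraph.classes_def[OF ig]
  proof (intro exI[of _ "\<lambda>i. col (vs ! i)"] conjI ballI impI)
    fix u assume "u \<in> idx ` W"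
    then have "col (vs ! u) \<in> {1..k'}" using iW W(4) by blast
    then show "col (vs ! u) \<in> {1..k}" using cw(2) by simp
  next
    fix u u' v assume u: "u \<in> idx ` W" "u' \<in> idx ` W" and e: "col (vs ! u) = col (vs ! u')" and v: "v \<in> {..<length vs} - idx ` W"
    have u': "vs ! u \<in> W" "vs ! u' \<in> W" "u < length vs" "u' < length vs" using iW[OF u(1)] iW[OF u(2)] by auto
    have "vs ! v \<notin> W" using v idx[of v] by (metis DiffE imageI lessThan_iff)
    then have "vs ! v \<in> pverts G - W" using v im by auto
    from W(5)[OF u'(1,2) e this] show "A u v \<longleftrightarrow> A u' v" using A u'(3,4) v by simp
  qed
  moreover have "idx ` W \<subseteq> {..<length vs}" using iW by auto
  ultimately show "\<exists>W\<subseteq>{..<length vs}. th \<le> f W \<and> f W \<le> th\<^sup>2 \<and> igraph.classes {..<length vs} A k W"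
    using W(2,3) by blast
qed

section \<open>The algorithm\<close>

locale mso_prog = graph_prog +
  fixes k :: nat
  assumes k1: "1 \<le> k" and mk: "m = 6 * k + 1" and L: "L = 2 ^ m" and a1: "k + 2 ^ (2 * k) \<le> a1"
    and a2: "k * k + 1 \<le> a2" "m \<le> a2"
    and ms_ok: "\<And>p. p \<in> set ms \<Longrightarrow> \<exists>f g J. p = (f, g, J) \<and> (\<forall>a<L. f a < L \<and> g a < L)"
    and ms_all: "\<And>f g J. (\<forall>a<L. f a < L \<and> g a < L) \<Longrightarrow> \<exists>i<NP. (\<forall>a<L. fst (ms ! i) a = f a \<and> fst (snd (ms ! i)) a = g a)
        \<and> (\<forall>a<L. \<forall>b<L. snd (snd (ms ! i)) a b \<longleftrightarrow> J a b)"
begin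

definition prog :: com where
  "prog = Seq parse_com (Seq table_com graph_com)"

text \<open>The tables of types only depend on the formula, and therefore so does their cost.\<close>

definition table_cost :: "nat \<Rightarrow> nat list \<Rightarrow> nat" where
  "table_cost K xs = ccost K [] table_com (\<lambda>_. 0) ((\<lambda>_ _. 0)(1 := (\<lambda>_. 0)(0 := length xs),
     2 := \<lambda>i. if i < length xs then xs ! i else 0))"

end

locale mso_input = mso_prog +
  fixes G :: "nat pair_pre_digraph" and \<phi> :: mso and xs :: "nat list" and k' :: nat and c :: "nat \<Rightarrow> nat option"
  assumes G: "pair_graph G" and cw: "cw_built k' G c" "k' \<le> k"
    and \<phi>: "sentence \<phi>" "order_invariant \<phi>" and xs: "distinct xs" "set xs = pverts G"
begin

definition w :: "nat list" where "w = graph_word G xs @ formula_word \<phi>"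
definition n :: nat where "n = length xs"
definition l :: nat where "l = length (formula_word \<phi>)"
definition T :: nat where "T = bnd (L + l) l"
definition s0 :: mem where "s0 = (\<lambda>a i. if a = 0 \<and> i = 0 then length w else 0)"
definition s1 :: mem where "s1 = run w parse_com (\<lambda>_. 0) s0"
definition s2 :: mem where "s2 = run w table_com (\<lambda>_. 0) s1"
definition s3 :: mem where "s3 = run w graph_com (\<lambda>_. 0) s2"

lemma n1: "1 \<le> n"
proof -
  have "xs \<noteq> []" using cw_built_nonempty[OF cw(1)] xs(2) by auto
  then show ?thesis unfolding n_def by (simp add: Suc_le_eq)
qed

lemma length_w: "length w = n + 1 + n * n + l"
  by (simp add: w_def graph_word_nth(1) n_def l_def)

lemma w_nth: "i < n \<Longrightarrow> w ! i = 1" "w ! n = 0"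
    "u < n \<Longrightarrow> v < n \<Longrightarrow> w ! (n + 1 + u * n + v) = of_bool ((xs ! u, xs ! v) \<in> parcs G)"
    "i < l \<Longrightarrow> w ! (n + 1 + n * n + i) = formula_word \<phi> ! i"
proof -
  have g: "w ! j = graph_word G xs ! j" if "j < n + 1 + n * n" for j
    using that by (simp add: w_def nth_append graph_word_nth(1) n_def)
  show "i < n \<Longrightarrow> w ! i = 1" "w ! n = 0" using g[of i] g[of n] graph_word_nth(2,3)[where vs = xs and G = G] by (simp_all add: n_def)
  show "w ! (n + 1 + u * n + v) = of_bool ((xs ! u, xs ! v) \<in> parcs G)" if "u < n" "v < n"
  proof -
    have "Suc u * n \<le> n * n" using that by (intro mult_right_mono) auto
    then have "n + 1 + u * n + v < n + 1 + n * n" using that by simp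
    from g[OF this] show ?thesis using that graph_word_nth(4)[of u xs v G] by (simp add: n_def)
  qed
  show "i < l \<Longrightarrow> w ! (n + 1 + n * n + i) = formula_word \<phi> ! i"
    by (simp add: w_def nth_append graph_word_nth(1) n_def[symmetric] l_def)
qed

lemma run1: "s1 1 = (\<lambda>_. 0)(0 := l)" "s1 2 = (\<lambda>i. if i < l then formula_word \<phi> ! i else 0)"
    "s1 6 0 = n" "s1 7 0 = length w ^ PE" "s1 8 0 = length w ^ (4 * PE + 16)" "\<And>u. u < n \<Longrightarrow> s1 10 u = n + 1 + u * n"
    "\<And>a. a \<notin> {0, 1, 2, 6, 7, 8, 10} \<Longrightarrow> s1 a = (\<lambda>_. 0)"
proof -
  have n: "n < length w" "\<And>i. i < n \<Longrightarrow> w ! i \<noteq> 0" "w ! n = 0" using w_nth by (simp_all add: length_w)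
  note r = run_parse[OF n, folded s0_def, folded s1_def]
  show "s1 1 = (\<lambda>_. 0)(0 := l)" using r(1) by (simp add: length_w)
  show "s1 2 = (\<lambda>i. if i < l then formula_word \<phi> ! i else 0)" using r(2) w_nth(4) by (auto simp: length_w)
  show "s1 6 0 = n" "s1 7 0 = length w ^ PE" "s1 8 0 = length w ^ (4 * PE + 16)" "\<And>u. u < n \<Longrightarrow> s1 10 u = n + 1 + u * n"
    "\<And>a. a \<notin> {0, 1, 2, 6, 7, 8, 10} \<Longrightarrow> s1 a = (\<lambda>_. 0)"
    using r(3-) by blast+
qed

lemma run2: "\<And>a. a \<notin> {3, 4, 5} \<Longrightarrow> s2 a = s1 a" "s2 3 0 = T"
    "\<And>i. i < prod_encode (NP + 5, prod_encode (T, T)) \<Longrightarrow> s2 5 i = triangle i"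
    "\<And>p k x y. p < l \<Longrightarrow> k < NP + 5 \<Longrightarrow> x < T \<Longrightarrow> y < T \<Longrightarrow> s2 4 (cell p k x y) = eval w allkE (env (\<lambda>_. 0) (l - 1 - p) k x y) s2"
proof -
  have e: "s1 1 0 = l" using run1(1) by simp
  note r = run_table[where s = s1 and l = l and w = w and r = "\<lambda>_. 0", OF e, folded s2_def T_def]
  show "\<And>a. a \<notin> {3, 4, 5} \<Longrightarrow> s2 a = s1 a" "s2 3 0 = T"
    "\<And>i. i < prod_encode (NP + 5, prod_encode (T, T)) \<Longrightarrow> s2 5 i = triangle i"
    "\<And>p k x y. p < l \<Longrightarrow> k < NP + 5 \<Longrightarrow> x < T \<Longrightarrow> y < T \<Longrightarrow> s2 4 (cell p k x y) = eval w allkE (env (\<lambda>_. 0) (l - 1 - p) k x y) s2"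
    by (rule r; assumption)+
qed

sublocale ts: tables_sem L ms s2 w "\<lambda>_. 0" l T
proof unfold_locales
  show "s2 1 0 = l" using run2(1)[of 1] run1(1) by simp
  show "1 \<le> L" by (simp add: L)
  show "bnd L l \<le> T" unfolding T_def by (rule bnd_mono_L) simp
  have "bnd (L + l) 0 \<le> bnd (L + l) l" by (rule bnd_mono) simp
  moreover have "(2 :: nat) ^ (2 * l + 2) \<le> bnd (L + l) 0" unfolding bnd.simps by (rule power_increasing) auto
  ultimately show "2 ^ (2 * l + 2) \<le> T" unfolding T_def by (rule order_trans[rotated])
qed (fact run2(2), fact ms_ok, fact run2(4))

lemma pos: "pos l (s2 2) 0 (conv \<phi>) l"
proof -
  have "occ (s2 2) 0 (formula_word \<phi>)" by (rule occ_nth) (simp add: run2(1)[of 2] run1(2) l_def)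
  from occ_pos[OF this, of l] show ?thesis by (simp add: l_def)
qed

definition NT :: nat where "NT = length w ^ PE"
definition NB :: nat where "NB = length w ^ (4 * PE + 16)"

lemma w2: "2 \<le> length w" "n \<le> length w"
  using n1 by (simp_all add: length_w)

lemma PE2: "2 \<le> PE"
  using kk_pos[of "a1 + a2 + 1"] by (simp add: PE_def)

sublocale gs: graph_sem L ms m a1 a2 w n NT NB "fsf NT" "snf NT"
proof unfold_locales
  have "length w ^ 1 \<le> length w ^ PE" using w2 PE2 by (intro power_increasing) auto
  then show "n \<le> NT" using w2 by (simp add: NT_def)
  have "NT + 1 \<le> 2 * NT" using w2 by (simp add: NT_def)
  also have "\<dots> \<le> length w * NT" using w2 by (intro mult_right_mono) auto
  finally have 1: "NT + 1 \<le> length w ^ (PE + 1)" by (simp add: NT_def)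
  then have 2: "prod_encode (NT + 1, NT + 1) \<le> length w ^ (2 * (PE + 1) + 4)" by (intro prod_encode_le_power[OF w2(1)])
  have "length w ^ (PE + 1) \<le> length w ^ (2 * (PE + 1) + 4)" using w2 by (intro power_increasing) auto
  with 1 have "NT + 1 \<le> length w ^ (2 * (PE + 1) + 4)" by (rule le_trans)
  from prod_encode_le_power[OF w2(1) this 2]
  show "prod_encode (NT + 1, prod_encode (NT + 1, NT + 1)) \<le> NB" by (simp add: NB_def algebra_simps)
qed (use n1 L in \<open>auto simp: fsf_def snf_def\<close>)

lemma Ad_iff: "u < n \<Longrightarrow> v < n \<Longrightarrow> gs.Ad u v \<longleftrightarrow> (xs ! u, xs ! v) \<in> parcs G"
proof -
  assume uv: "u < n" "v < n"
  then have "Suc u * n \<le> n * n" by (intro mult_right_mono) auto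
  then have "n + 1 + u * n + v < length w" using uv by (simp add: length_w)
  then show ?thesis using uv w_nth(3)[OF uv] by (simp add: gs.Ad_def)
qed

lemma parcs_sym: "(u, v) \<in> parcs G \<longleftrightarrow> (v, u) \<in> parcs G" and parcs_irrefl: "(u, u) \<notin> parcs G"
proof -
  interpret pair_graph G by (rule G)
  show "(u, v) \<in> parcs G \<longleftrightarrow> (v, u) \<in> parcs G" using pair_sym_arcs by (auto simp: symmetric_def sym_def)
  show "(u, u) \<notin> parcs G" using pair_no_loops[of "(u, u)"] by auto
qed

lemma run3: "gs.zc_eqs s3" "\<And>i. i < n - 1 \<Longrightarrow> gs.split_eq i s3" "\<And>i. i < n - 1 \<Longrightarrow> gs.merge_eq i s3"
    "gs.row s3 15 0 = (\<lambda>_. 0)" "gs.row s3 18 0 = (\<lambda>_. 0)" "\<And>b. b < n \<Longrightarrow> gs.row s3 19 0 b = gs.OPv s3 NP 0 0"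
    "s3 4 = s2 4" "s3 5 = s2 5"
    "eval w ansE r s3 = gs.OPv s3 (NP + 1) (gs.row s3 19 (n - 1) 0) 0"
proof -
  have s: "s2 6 0 = n" "s2 7 0 = NT" "s2 8 0 = NB" "\<And>u. u < n \<Longrightarrow> s2 10 u = n + 1 + u * n"
    and z: "\<And>a. a \<in> {9, 12, 13, 14, 15, 16, 17, 18, 19, 20, 21} \<Longrightarrow> s2 a = (\<lambda>_. 0)"
    using run2(1) run1(3-7) by (auto simp: NT_def NB_def)
  note r = gs.run_graph[OF refl refl s z, where ?r = "\<lambda>_. 0", folded s3_def]
  show "gs.zc_eqs s3" "\<And>i. i < n - 1 \<Longrightarrow> gs.split_eq i s3" "\<And>i. i < n - 1 \<Longrightarrow> gs.merge_eq i s3"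
    "gs.row s3 15 0 = (\<lambda>_. 0)" "gs.row s3 18 0 = (\<lambda>_. 0)" "\<And>b. b < n \<Longrightarrow> gs.row s3 19 0 b = gs.OPv s3 NP 0 0"
    "s3 4 = s2 4" "s3 5 = s2 5"
    "eval w ansE r s3 = gs.OPv s3 (NP + 1) (gs.row s3 19 (n - 1) 0) 0"
    by (rule r; assumption?)+
qed

lemma OPv_s3: "i < NP + 5 \<Longrightarrow> x < T \<Longrightarrow> y < T \<Longrightarrow> gs.OPv s3 i x y = s2 4 (cell 0 i x y)"
  using gs.OPv_cell[of T s3 i x y] run2(3) by (simp add: run3(7,8))

sublocale mc: mc_run L ms m a1 a2 w n NT NB "fsf NT" "snf NT" k "conv \<phi>" s3
proof unfold_locales
  show "gs.Ad u v \<longleftrightarrow> gs.Ad v u" if "u < n" "v < n" for u v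
    using Ad_iff[OF that] Ad_iff[OF that(2,1)] parcs_sym[of "xs ! u" "xs ! v"] by simp
  show "\<not> gs.Ad u u" if "u < n" for u using Ad_iff that parcs_irrefl by simp
  have "igraph {..<n} (\<lambda>u v. u < n \<and> v < n \<and> gs.Ad u v)"
  proof unfold_locales
    fix u v
    show "(u < n \<and> v < n \<and> gs.Ad u v) \<longleftrightarrow> (v < n \<and> u < n \<and> gs.Ad v u)"
      using Ad_iff[of u v] Ad_iff[of v u] parcs_sym[of "xs ! u" "xs ! v"] by (cases "u < n \<and> v < n") auto
  qed simp
  then show "igraph.balanced {..<n} (\<lambda>u v. u < n \<and> v < n \<and> gs.Ad u v) k"
    unfolding n_def using xs cw Ad_iff by (intro balanced_listed[of G xs k' c k]) (auto simp: n_def)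
  show "tcd ds < NT" if ds: "length ds \<le> a1 + a2 + 1" "set ds \<subseteq> {..<n}" for ds
  proof -
    have "kk j \<le> kk (Suc j)" for j by simp
    from lift_Suc_mono_le[of kk, OF this ds(1)] have "length w ^ kk (length ds) \<le> length w ^ kk (a1 + a2 + 1)"
      using w2 by (intro power_increasing) auto
    moreover have "tcd ds \<le> length w ^ kk (length ds)"
    proof (rule tcd_le[OF w2(1)])
      fix d assume "d \<in> set ds"
      then have "d < n" using ds(2) by auto
      then show "d \<le> length w" using w2(2) by simp
    qed
    moreover have "length w ^ kk (a1 + a2 + 1) < NT" unfolding NT_def PE_def using w2 by (intro power_strict_increasing) auto
    ultimately show ?thesis by linarith
  qed
  have "n * n \<le> length w ^ 2" using w2 by (simp add: power2_eq_square mult_mono)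
  also have "\<dots> \<le> NT" unfolding NT_def using w2 PE2 by (intro power_increasing) auto
  finally show "n * n \<le> NT" .
  show "gs.OPv s3 i x y = opn (ms ! i) (conv \<phi>) x y" if "i < NP" "x \<in> vs L (conv \<phi>)" "y \<in> vs L (conv \<phi>)" for i x y
    using OPv_s3[of i x y] that ts.vs_T[OF pos] ts.G_op[OF pos that] by simp
  show "gs.OPv s3 NP 0 0 = leafn {} (conv \<phi>)"
    using OPv_s3[of NP 0 0] ts.T0 ts.G_leaf[OF pos, of "{}"] by simp
qed (fact k1 mk a1 a2 refl run3 ms_ok ms_all)+

theorem prog_correct: "eval w ansE r s3 \<noteq> 0 \<longleftrightarrow> models_ord_inv G \<phi>"
proof -
  define x where "x = gs.row s3 19 (n - 1) 0"
  obtain q where q: "q \<subseteq> {..<n} \<times> {..<n}" "strict_linear_order_on {..<n} q" "x \<in> vs L (conv \<phi>)"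
    "accn (conv \<phi>) x \<longleftrightarrow> satf {..<n} mc.A q (\<lambda>_. {}) (conv \<phi>)"
    using mc.root_piece unfolding x_def by blast
  have "eval w ansE r s3 = s2 4 (cell 0 (NP + 1) x 0)"
    using run3(9) OPv_s3[of "NP + 1" x 0] ts.vs_T[OF pos q(3)] ts.T0 by (simp add: x_def)
  then have 1: "eval w ansE r s3 \<noteq> 0 \<longleftrightarrow> satf {..<n} mc.A q (\<lambda>_. {}) (conv \<phi>)"
    using ts.G_acc[OF pos q(3)] q(4) by simp
  let ?h = "(!) xs"
  have inj: "inj_on ?h {..<n}" using xs(1) by (simp add: inj_on_nth n_def)
  have im: "?h ` {..<n} = pverts G" unfolding xs(2)[symmetric] n_def set_conv_nth by (auto simp: image_def)
  define q' where "q' = map_prod ?h ?h ` q"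
  have qq: "(?h u, ?h v) \<in> q' \<longleftrightarrow> (u, v) \<in> q" if "u < n" "v < n" for u v
  proof
    assume "(?h u, ?h v) \<in> q'"
    then obtain a b where ab: "(a, b) \<in> q" "?h u = ?h a" "?h v = ?h b" by (auto simp: q'_def)
    then have "a < n" "b < n" using q(1) by auto
    then have "u = a" "v = b" using inj_onD[OF inj ab(2)] inj_onD[OF inj ab(3)] that by simp_all
    then show "(u, v) \<in> q" using ab(1) by simp
  qed (force simp: q'_def)
  have "satf (?h ` {..<n}) (\<lambda>u v. (u, v) \<in> parcs G) q' (\<lambda>X. ?h ` {}) (conv \<phi>) \<longleftrightarrow> satf {..<n} mc.A q (\<lambda>_. {}) (conv \<phi>)"
    by (rule satf_image[OF inj]) (use qq Ad_iff in \<open>auto simp: mc.A_def\<close>)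
  then have 2: "satf (pverts G) (\<lambda>u v. (u, v) \<in> parcs G) q' (\<lambda>X. {}) (conv \<phi>) \<longleftrightarrow> satf {..<n} mc.A q (\<lambda>_. {}) (conv \<phi>)"
    by (simp add: im)
  have 3: "models G q' \<phi> \<longleftrightarrow> satf (pverts G) (\<lambda>u v. (u, v) \<in> parcs G) q' (\<lambda>X. {}) (conv \<phi>)"
    unfolding models_def by (rule sat_satf) (use \<phi>(1) in \<open>auto simp: sentence_def\<close>)
  have sub: "q' \<subseteq> pverts G \<times> pverts G" using q(1) im by (auto simp: q'_def)
  have vn: "\<exists>i<n. v = xs ! i" if "v \<in> pverts G" for v using that im by auto
  have "trans q'" unfolding trans_def
  proof (intro allI impI)
    fix a b d assume "(a, b) \<in> q'" "(b, d) \<in> q'"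
    then obtain i j i' where ij: "i < n" "j < n" "i' < n" "a = xs ! i" "b = xs ! j" "d = xs ! i'"
      using sub vn by (metis mem_Sigma_iff subsetD)
    then have "(i, j) \<in> q" "(j, i') \<in> q" using qq \<open>(a, b) \<in> q'\<close> \<open>(b, d) \<in> q'\<close> by simp_all
    then have "(i, i') \<in> q" using q(2) by (auto simp: strict_linear_order_on_def dest: transD)
    then show "(a, d) \<in> q'" using qq ij by simp
  qed
  moreover have "irrefl q'" unfolding irrefl_def
  proof (intro allI notI)
    fix a assume a: "(a, a) \<in> q'"
    then obtain i where "i < n" "a = xs ! i" using sub vn by (metis mem_Sigma_iff subsetD)
    then have "(i, i) \<in> q" using qq a by simp
    then show False using q(2) by (simp add: strict_linear_order_on_def irrefl_def)
  qed
  moreover have "total_on (pverts G) q'" unfolding total_on_def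
  proof (intro ballI impI)
    fix a b assume ab: "a \<in> pverts G" "b \<in> pverts G" "a \<noteq> b"
    then obtain i j where ij: "i < n" "j < n" "a = xs ! i" "b = xs ! j" using vn by metis
    then have "(i, j) \<in> q \<or> (j, i) \<in> q" using q(2) ij ab(3) unfolding strict_linear_order_on_def total_on_def by (metis lessThan_iff)
    then show "(a, b) \<in> q' \<or> (b, a) \<in> q'" using qq ij by auto
  qed
  ultimately have lin: "linear_order_of G q'" using sub by (simp add: linear_order_of_def strict_linear_order_on_def)
  \<comment> \<open>Order invariance enters here: the sentence has been evaluated for the order
    implicit in the merges, and its truth for any order of \<open>G\<close> is equivalent to
    that.\<close>
  have "models_ord_inv G \<phi> \<longleftrightarrow> models G q' \<phi>"
    unfolding models_ord_inv_def using lin G \<phi>(2) unfolding order_invariant_def by blast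
  with 1 2 3 show ?thesis by simp
qed

lemma cost_table: "ccost K w table_com (\<lambda>_. 0) s1 = table_cost K (formula_word \<phi>)"
  unfolding table_cost_def
proof (rule cinp_free_run(2)[OF table_com_closed])
  fix a :: nat assume "a \<in> {1..5}"
  then consider "a = 1" | "a = 2" | "a \<in> {3, 4, 5}" by fastforce
  then show "s1 a = ((\<lambda>_ _. 0)(1 := (\<lambda>_. 0)(0 := length (formula_word \<phi>)),
     2 := \<lambda>i. if i < length (formula_word \<phi>) then formula_word \<phi> ! i else 0)) a"
  proof cases
    case 3
    then show ?thesis using run1(7)[of a] by auto
  qed (simp_all add: run1(1)[unfolded One_nat_def] run1(2) l_def)
qed

text \<open>After parsing, all scalars that bound loops are at most
  \<open>length w ^ (4 * PE + 16)\<close>, so polynomials in them are polynomials in the length of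
  the input. The tables contribute a separate summand that depends on the formula word only.\<close>

lemma cost_prog:
  assumes c1: "\<And>w r s M. scalars_le {0} M s \<Longrightarrow> ccost K w parse_com r s \<le> C1 * M ^ d1"
    and c2: "\<And>w r s M. scalars_le {6, 7, 8} M s \<Longrightarrow> ccost K w graph_com r s \<le> C2 * M ^ d2"
    and c3: "\<And>w r s M. scalars_le {6, 7, 8} M s \<Longrightarrow> cost K w ansE r s \<le> C3 * M ^ d3"
  shows "Suc (ccost K w prog (\<lambda>_. 0) s0) + cost K w ansE (\<lambda>_. 0) s3
    \<le> table_cost K (formula_word \<phi>) + (1 + C1 + C2 + C3) * length w ^ (d1 + (4 * PE + 16) * (d2 + d3))"
proof -
  let ?n = "length w" and ?E = "4 * PE + 16"
  let ?D = "d1 + ?E * (d2 + d3)"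
  have 1: "1 \<le> ?n" using w2 by simp
  have pw: "?n ^ d \<le> ?n ^ ?D" if "d \<le> ?D" for d using 1 that by (rule power_increasing[rotated])
  have "scalars_le {0} ?n s0" using 1 by (simp add: scalars_le_def s0_def)
  then have "ccost K w parse_com (\<lambda>_. 0) s0 \<le> C1 * ?n ^ d1" by (rule c1)
  also have "\<dots> \<le> C1 * ?n ^ ?D" by (intro mult_left_mono pw) auto
  finally have i1: "ccost K w parse_com (\<lambda>_. 0) s0 \<le> C1 * ?n ^ ?D" .
  have "scalars_le {6, 7, 8} (?n ^ ?E) s2"
  proof -
    have "?n ^ 1 \<le> ?n ^ ?E" "?n ^ PE \<le> ?n ^ ?E" "1 \<le> ?n ^ ?E"
      by (rule power_increasing[OF _ 1], simp)+ (use 1 in simp)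
    then show ?thesis using run2(1)[of 6] run2(1)[of 7] run2(1)[of 8] run1(3-5) w2(2) by (simp add: scalars_le_def)
  qed
  moreover from this have "scalars_le {6, 7, 8} (?n ^ ?E) s3" unfolding s3_def by (rule scalars_le_run[OF bcom_graph])
  ultimately have "ccost K w graph_com (\<lambda>_. 0) s2 \<le> C2 * (?n ^ ?E) ^ d2" "cost K w ansE (\<lambda>_. 0) s3 \<le> C3 * (?n ^ ?E) ^ d3"
    by (simp_all only: c2 c3)
  moreover have "(?n ^ ?E) ^ d2 \<le> ?n ^ ?D" "(?n ^ ?E) ^ d3 \<le> ?n ^ ?D"
    unfolding power_mult[symmetric] by (intro pw; simp add: algebra_simps)+
  ultimately have "ccost K w graph_com (\<lambda>_. 0) s2 \<le> C2 * ?n ^ ?D" "cost K w ansE (\<lambda>_. 0) s3 \<le> C3 * ?n ^ ?D"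
    by (meson le_trans mult_left_mono zero_le)+
  moreover have "1 \<le> ?n ^ ?D" using 1 by simp
  moreover have "ccost K w prog (\<lambda>_. 0) s0 = ccost K w parse_com (\<lambda>_. 0) s0 + (table_cost K (formula_word \<phi>) + ccost K w graph_com (\<lambda>_. 0) s2)"
    using cost_table by (simp add: prog_def s1_def[symmetric] s2_def[symmetric])
  ultimately show ?thesis using i1 by (simp add: add_mult_distrib)
qed

end

text \<open>A finite alphabet leaves finitely many words of a given length, so that the parameter
  function may add up the costs of their tables.\<close>

lemma set_formula_word: "set (formula_word \<phi>) \<subseteq> {..12}"
  by (induction \<phi>) (auto simp: unary_def)

theorem theorem4p2:
  fixes C :: "nat pair_pre_digraph set"
  assumes "\<And>G. G \<in> C \<Longrightarrow> pair_graph G"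
    and "bounded_clique_width C"
  shows "fpt (MC_mso1_ord_inv C)"
proof -
  obtain k0 :: nat where k0: "\<And>G. G \<in> C \<Longrightarrow> clique_width G \<le> enat k0"
    using assms(2) by (auto simp: bounded_clique_width_def)
  \<comment> \<open>The bound on the clique-width is raised by 1 so that \<open>k\<close> is
    positive.\<close>
  define k where "k = k0 + 1"
  define m where "m = 6 * k + 1"
  define L where "L = (2 :: nat) ^ m"
  define a1 where "a1 = k + 2 ^ (2 * k)"
  \<comment> \<open>Up to \<open>k * k + 1\<close> entries are test vertices; the summand
    \<open>m\<close> makes the codes long enough for tuples that certify ranks.\<close>
  define a2 where "a2 = k * k + 1 + m"
  obtain ms :: "merge list" where ms: "\<forall>p\<in>set ms. \<exists>f g J. p = (f, g, J) \<and> (\<forall>a<L. f a < L \<and> g a < L)"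
    "\<forall>f g J. (\<forall>a<L. f a < L \<and> g a < L) \<longrightarrow> (\<exists>i<length ms. (\<forall>a<L. fst (ms ! i) a = f a \<and> fst (snd (ms ! i)) a = g a)
        \<and> (\<forall>a<L. \<forall>b<L. snd (snd (ms ! i)) a b \<longleftrightarrow> J a b))"
    using all_merges[of L] by blast
  interpret mso_prog L ms m a1 a2 k
  proof unfold_locales
    show "\<exists>f g J. p = (f, g, J) \<and> (\<forall>a<L. f a < L \<and> g a < L)" if "p \<in> set ms" for p using ms(1) that by blast
    show "\<exists>i<tables.NP ms. (\<forall>a<L. fst (ms ! i) a = f a \<and> fst (snd (ms ! i)) a = g a)
        \<and> (\<forall>a<L. \<forall>b<L. snd (snd (ms ! i)) a b \<longleftrightarrow> J a b)" if "\<forall>a<L. f a < L \<and> g a < L" for f g J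
      unfolding tables.NP_def by (rule ms(2)[rule_format]) (use that in blast)
  qed (simp_all add: k_def m_def L_def a1_def a2_def)
  define K where "K = stride prog ansE"
  obtain C1 d1 where c1: "\<And>w r s M. scalars_le {0} M s \<Longrightarrow> ccost K w parse_com r s \<le> C1 * M ^ d1"
    using polyb_ccost[OF bcom_parse, of K] unfolding polyb_def by blast
  obtain C2 d2 where c2: "\<And>w r s M. scalars_le {6, 7, 8} M s \<Longrightarrow> ccost K w graph_com r s \<le> C2 * M ^ d2"
    using polyb_ccost[OF bcom_graph, of K] unfolding polyb_def by blast
  obtain C3 d3 where c3: "\<And>w r s M. scalars_le {6, 7, 8} M s \<Longrightarrow> cost K w ansE r s \<le> C3 * M ^ d3"
    using polyb_cost[OF bexp_ansE, of _ K] unfolding polyb_def by blast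
  define c where "c = 1 + C1 + C2 + C3"
  define D where "D = d1 + (4 * PE + 16) * (d2 + d3)"
  \<comment> \<open>The parameter is only the length of the formula, hence the sum over all words of
    this length. For a graph of size \<open>g\<close> the input has length at most
    \<open>(3 + l) * (g * g)\<close>: the three parts of the graph word and the formula are each
    absorbed by \<open>g * g\<close>. This also explains the exponent \<open>2 * D\<close>
    below.\<close>
  define f where "f l = (\<Sum>xs | set xs \<subseteq> {..12} \<and> length xs = l. table_cost K xs) + c * (3 + l) ^ D" for l
  obtain P where P: "\<And>w t. let s = run w prog (\<lambda>_. 0) (\<lambda>a i. if a = 0 \<and> i = 0 then length w else 0) in
     Suc (ccost K w prog (\<lambda>_. 0) (\<lambda>a i. if a = 0 \<and> i = 0 then length w else 0)) + cost K w ansE (\<lambda>_. 0) s \<le> t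
     \<longrightarrow> halts_within P w t \<and> (accepts_within P w t \<longleftrightarrow> eval w ansE (\<lambda>_. 0) s \<noteq> 0)"
    using program_correct[of prog ansE] unfolding K_def by blast
  have main: "halts_within P w t \<and> (accepts_within P w t \<longleftrightarrow> models_ord_inv G \<phi>)"
    if G: "G \<in> C" and \<phi>: "sentence \<phi>" "order_invariant \<phi>" and xs: "distinct xs" "set xs = pverts G"
      and w: "w = graph_word G xs @ formula_word \<phi>" and t: "t = f (formula_size \<phi>) * graph_size G ^ (2 * D)"
    for G \<phi> xs w t
  proof -
    obtain k' cc where k': "k' \<le> k0" "cw_built k' G cc" using clique_width_leD[OF k0[OF G]] by blast
    interpret I: mso_input L ms m a1 a2 k G \<phi> xs k' cc
    proof (intro mso_input.intro mso_input_axioms.intro mso_prog_axioms)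
      show "k' \<le> k" using k'(1) by (simp add: k_def)
    qed (fact assms(1)[OF G] k'(2) \<phi> xs mso_prog_axioms)+
    have w: "w = I.w" by (simp add: w I.w_def)
    have s3: "run w prog (\<lambda>_. 0) (\<lambda>a i. if a = 0 \<and> i = 0 then length w else 0) = I.s3"
      by (simp only: prog_def run.simps w I.s3_def I.s2_def I.s1_def I.s0_def)
    let ?g = "graph_size G" and ?l = "formula_size \<phi>"
    have l: "I.l = ?l" by (simp add: I.l_def formula_size_def)
    have "I.n = card (pverts G)" using xs by (simp add: I.n_def distinct_card[symmetric])
    then have ng: "I.n \<le> ?g" by (simp add: graph_size_def)
    then have g1: "1 \<le> ?g" using I.n1 by simp
    have "I.n * I.n \<le> ?g * ?g" using ng by (intro mult_mono) auto
    moreover have "?g \<le> ?g * ?g" "1 \<le> ?g * ?g" "?l \<le> ?l * (?g * ?g)" using g1 by simp_all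
    ultimately have "length w \<le> (3 + ?l) * (?g * ?g)" using ng unfolding w I.length_w l add_mult_distrib by linarith
    then have "length w ^ D \<le> ((3 + ?l) * (?g * ?g)) ^ D" by (rule power_mono) simp
    also have "\<dots> = (3 + ?l) ^ D * ?g ^ (2 * D)" by (simp only: power_mult_distrib power_mult power2_eq_square)
    finally have "c * length w ^ D \<le> c * (3 + ?l) ^ D * ?g ^ (2 * D)" by (simp only: mult.assoc mult_left_mono zero_le)
    moreover have "table_cost K (formula_word \<phi>) \<le> (\<Sum>xs | set xs \<subseteq> {..12} \<and> length xs = ?l. table_cost K xs) * ?g ^ (2 * D)"
    proof -
      have "table_cost K (formula_word \<phi>) \<le> (\<Sum>xs | set xs \<subseteq> {..12} \<and> length xs = ?l. table_cost K xs)"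
        by (rule member_le_sum) (use set_formula_word in \<open>auto simp: formula_size_def finite_lists_length_eq\<close>)
      also have "\<dots> \<le> (\<Sum>xs | set xs \<subseteq> {..12} \<and> length xs = ?l. table_cost K xs) * ?g ^ (2 * D)" using g1 by simp
      finally show ?thesis .
    qed
    ultimately have "table_cost K (formula_word \<phi>) + c * length w ^ D \<le> t"
      unfolding t f_def add_mult_distrib by linarith
    then have "Suc (ccost K w prog (\<lambda>_. 0) I.s0) + cost K w ansE (\<lambda>_. 0) I.s3 \<le> t"
      using I.cost_prog[OF c1 c2 c3] unfolding w c_def D_def by linarith
    then show ?thesis using P[of w t] I.prog_correct[of "\<lambda>_. 0"] unfolding Let_def s3 unfolding w I.s0_def by blast
  qed
  show ?thesis
    unfolding fpt_def
  proof (intro exI[of _ P] exI[of _ f] exI[of _ "2 * D"] ballI)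
    fix x w assume x: "x \<in> instances (MC_mso1_ord_inv C)" and w: "w \<in> encodings (MC_mso1_ord_inv C) x"
    obtain G \<phi> where [simp]: "x = (G, \<phi>)" by (cases x)
    obtain xs where "distinct xs" "set xs = pverts G" "w = graph_word G xs @ formula_word \<phi>"
      using w by (auto simp: MC_mso1_ord_inv_def)
    moreover have "G \<in> C" "sentence \<phi>" "order_invariant \<phi>" using x by (auto simp: MC_mso1_ord_inv_def)
    ultimately show "let t = f (parameter (MC_mso1_ord_inv C) x) * input_size (MC_mso1_ord_inv C) x ^ (2 * D)
      in halts_within P w t \<and> (accepts_within P w t \<longleftrightarrow> yes (MC_mso1_ord_inv C) x)"
      using main[of G \<phi> xs w] by (simp add: MC_mso1_ord_inv_def)
  qed
qed

end
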